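(* Let $H$ be a Hopf algebra over a field $k$. (i) For any right $H^{par}$-comodule $(M,\hat\rho)$, the pair $(M,\rho)$ with $\rho=(I\otimes p)\circ\hat\rho$ is a partial right $H$-comodule. This construction yields a fully faithful functor $\Gamma:\mathrm{Mod}^{H^{par}}\to \mathrm{Mod}^H_{par}$. (ii) The functor $\Gamma$ restricts to an isomorphism of categories $\Gamma_f:\mathrm{Mod}^{H^{par}}_f\to \mathrm{Mod}^H_{par,f}$ between the categories of firmly projective $H^{par}$-comodules and firmly projective partial $H$-comodules. (iii) In particular, $\Gamma$ restricts to an isomorphism of categories $\Gamma_{fd}:\mathrm{Mod}^{H^{par}}_{fd}\to \mathrm{Mod}^H_{par,fd}$ between the categories of finite dimensional $H^{par}$-comodules and finite dimensional partial $H$-comodules. Hence $H^{par}$ is the coalgebra that can be reconstructed from the forgetful (fibre) functor $U:\mathrm{Mod}^H_{par,fd}\to \mathrm{Vect}_k$ by means of the Tannakian formalism.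
   Context: Unadorned tensor products are over $k$; $I$ denotes an identity map; $\Delta,\epsilon,\mu,S$ are the comultiplication, counit, multiplication and antipode of $H$; Sweedler notation is used. Partial comodule: a partial right $H$-comodule is a $k$-module $M$ with a $k$-linear map $\rho:M\to M\otimes H$, $\rho(m)=m^{[0]}\otimes m^{[1]}$, such that for all $m\in M$: (PCM1) $m^{[0]}\epsilon(m^{[1]})=m$; (PCM2) $m^{[0][0]}\otimes {m^{[0][1]}}_{(1)}\otimes {m^{[0][1]}}_{(2)}S(m^{[1]})=m^{[0][0][0]}\otimes m^{[0][0][1]}\otimes m^{[0][1]}S(m^{[1]})$; (PCM3) $m^{[0][0]}\otimes m^{[0][1]}S({m^{[1]}}_{(1)})\otimes {m^{[1]}}_{(2)}=m^{[0][0][0]}\otimes m^{[0][0][1]}S(m^{[0][1]})\otimes m^{[1]}$. Morphisms $(M,\rho)\to(N,\sigma)$ are linear maps $f$ with $\sigma\circ f=(f\otimes I)\circ\rho$. The category is $\mathrm{Mod}^H_{par}$; $\mathrm{Mod}^{D}$ denotes right comodules over a coalgebra $D$. Partial corepresentation: for a coalgebra $D$, a linear map $\omega:D\to H$ such that for all $c\in D$: (PC1) $\epsilon_H(\omega(c))=\epsilon_D(c)$; (PC2) $\omega(c_{(1)})_{(1)}\otimes\omega(c_{(1)})_{(2)}S(\omega(c_{(2)}))=\omega(c_{(1)})\otimes\omega(c_{(2)})S(\omega(c_{(3)}))$; (PC3) $\omega(c_{(1)})S(\omega(c_{(2)})_{(1)})\otimes\omega(c_{(2)})_{(2)}=\omega(c_{(1)})S(\omega(c_{(2)}))\otimes\omega(c_{(3)})$.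 Universal coalgebra: let $(C(H),p)$ be the cofree coalgebra over the vector space $H$, $p:C(H)\to H$ (every linear map from a coalgebra to $H$ factors uniquely through $p$ by a coalgebra map to $C(H)$). $H^{par}$ is the sum of all subcoalgebras $X\subseteq C(H)$ such that $p|_X$ is a partial corepresentation; it is the largest such subcoalgebra. The restriction of $p$ to $H^{par}$ is again denoted $p$. Firm projectivity: a (possibly non-unital) ring $R$ is firm if multiplication induces an isomorphism $R\otimes_R R\to R$; a left $R$-module $M$ is firm if the action induces an isomorphism $R\otimes_R M\to M$. A $k$-module $M$ is $R$-firmly projective if $R$ is a firm ring and there is a ring morphism $R\to M\otimes M^*$, $r\mapsto e_r\otimes f_r$ (summation understood; the product on $M\otimes M^*$ is $(m\otimes f)(n\otimes g)=m f(n)\otimes g$) such that $M$ is a firm left $R$-module under $r\cdot m=e_rf_r(m)$. A partial $H$-comodule (resp. an $H^{par}$-comodule) $M$ is firmly projective if it is $R$-firmly projective as a $k$-module for some firm ring $R$ contained in its endomorphism ring as a partial $H$-comodule (resp. as an $H^{par}$-comodule). The subscripts $f$ and $fd$ denote the full subcategories of firmly projective, resp. finite dimensional, objects. *)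

theory Defs
  imports "HOL-Algebra.Module" "HOL-Algebra.Coset" "HOL-Algebra.Generated_Groups"
    "HOL-Algebra.Free_Abelian_Groups"
begin

section \<open>Linear maps and tensor products\<close>

text \<open>
  Vector spaces are modules of \<^theory>\<open>HOL-Algebra.Module\<close> over a field record \<open>K\<close>. An algebra uses
  the fields \<open>mult\<close> and \<open>one\<close> of the module record; for plain vector spaces these two
  fields carry no information.
\<close>

definition is_linear ::
  "('k,'z) ring_scheme \<Rightarrow> ('k,'a,'x) module_scheme \<Rightarrow> ('k,'b,'y) module_scheme \<Rightarrow> ('a \<Rightarrow> 'b) \<Rightarrow> bool"
  where "is_linear K V W f \<longleftrightarrow>
    f \<in> hom (add_monoid V) (add_monoid W) \<and>
    (\<forall>c\<in>carrier K. \<forall>x\<in>carrier V. f (c \<odot>\<^bsub>V\<^esub> x) = c \<odot>\<^bsub>W\<^esub> f x)"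

text \<open>Extensionality makes equality of functions mean equality of maps with domain \<open>V\<close>.\<close>

definition lin ::
  "('k,'z) ring_scheme \<Rightarrow> ('k,'a,'x) module_scheme \<Rightarrow> ('k,'b,'y) module_scheme \<Rightarrow> ('a \<Rightarrow> 'b) set"
  where "lin K V W = {f \<in> extensional (carrier V). is_linear K V W f}"

definition self_module :: "('k,'z) ring_scheme \<Rightarrow> ('k,'k) module"
  where "self_module K = \<lparr>carrier = carrier K, monoid.mult = monoid.mult K, one = one K,
    ring.zero = ring.zero K, ring.add = ring.add K, smult = monoid.mult K\<rparr>"

definition span_of :: "('k,'z) ring_scheme \<Rightarrow> ('k,'a,'x) module_scheme \<Rightarrow> 'a set \<Rightarrow> 'a set"
  where "span_of K M B = \<Inter>{W. submodule W K M \<and> B \<subseteq> W}"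

definition finite_dim :: "('k,'z) ring_scheme \<Rightarrow> ('k,'a,'x) module_scheme \<Rightarrow> bool"
  where "finite_dim K M \<longleftrightarrow> (\<exists>B. finite B \<and> B \<subseteq> carrier M \<and> span_of K M B = carrier M)"

type_synonym ('a, 'b) tensor = "(('a \<times> 'b) \<Rightarrow>\<^sub>0 int) set"

text \<open>
  The balanced tensor product of a right module \<open>A\<close> (action \<open>ra\<close>) and a left module \<open>B\<close>
  (action \<open>lb\<close>) over a set \<open>R\<close> of operators: the quotient of the free abelian group on
  \<open>A \<times> B\<close> by the subgroup generated by the usual relations.
\<close>

definition bal_relations ::
  "'r set \<Rightarrow> ('a,'x) ring_scheme \<Rightarrow> ('b,'y) ring_scheme \<Rightarrow> ('a \<Rightarrow> 'r \<Rightarrow> 'a) \<Rightarrow> ('r \<Rightarrow> 'b \<Rightarrow> 'b) \<Rightarrow>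
   (('a \<times> 'b) \<Rightarrow>\<^sub>0 int) set"
  where "bal_relations R A B ra lb =
    {frag_of (a \<oplus>\<^bsub>A\<^esub> a', b) - frag_of (a, b) - frag_of (a', b) | a a' b.
       a \<in> carrier A \<and> a' \<in> carrier A \<and> b \<in> carrier B} \<union>
    {frag_of (a, b \<oplus>\<^bsub>B\<^esub> b') - frag_of (a, b) - frag_of (a, b') | a b b'.
       a \<in> carrier A \<and> b \<in> carrier B \<and> b' \<in> carrier B} \<union>
    {frag_of (ra a r, b) - frag_of (a, lb r b) | a r b.
       a \<in> carrier A \<and> r \<in> R \<and> b \<in> carrier B}"

definition bal_kernel ::
  "'r set \<Rightarrow> ('a,'x) ring_scheme \<Rightarrow> ('b,'y) ring_scheme \<Rightarrow> ('a \<Rightarrow> 'r \<Rightarrow> 'a) \<Rightarrow> ('r \<Rightarrow> 'b \<Rightarrow> 'b) \<Rightarrow>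
   (('a \<times> 'b) \<Rightarrow>\<^sub>0 int) set"
  where "bal_kernel R A B ra lb =
    generate (free_Abelian_group (carrier A \<times> carrier B)) (bal_relations R A B ra lb)"

definition bal_tensor ::
  "'r set \<Rightarrow> ('a,'x) ring_scheme \<Rightarrow> ('b,'y) ring_scheme \<Rightarrow> ('a \<Rightarrow> 'r \<Rightarrow> 'a) \<Rightarrow> ('r \<Rightarrow> 'b \<Rightarrow> 'b) \<Rightarrow>
   ('a,'b) tensor monoid"
  where "bal_tensor R A B ra lb =
    free_Abelian_group (carrier A \<times> carrier B) Mod bal_kernel R A B ra lb"

definition bal_coset ::
  "'r set \<Rightarrow> ('a,'x) ring_scheme \<Rightarrow> ('b,'y) ring_scheme \<Rightarrow> ('a \<Rightarrow> 'r \<Rightarrow> 'a) \<Rightarrow> ('r \<Rightarrow> 'b \<Rightarrow> 'b) \<Rightarrow>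
   (('a \<times> 'b) \<Rightarrow>\<^sub>0 int) \<Rightarrow> ('a,'b) tensor"
  where "bal_coset R A B ra lb x =
    bal_kernel R A B ra lb #>\<^bsub>free_Abelian_group (carrier A \<times> carrier B)\<^esub> x"

definition tens_coset ::
  "('k,'z) ring_scheme \<Rightarrow> ('k,'a,'x) module_scheme \<Rightarrow> ('k,'b,'y) module_scheme \<Rightarrow>
   (('a \<times> 'b) \<Rightarrow>\<^sub>0 int) \<Rightarrow> ('a,'b) tensor"
  where "tens_coset K A B = bal_coset (carrier K) A B (\<lambda>a c. c \<odot>\<^bsub>A\<^esub> a) (\<lambda>c b. c \<odot>\<^bsub>B\<^esub> b)"

text \<open>
  The tensor product over \<open>K\<close> as a \<open>K\<close>-module. In the clause for \<open>smult\<close>, all representatives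
  \<open>x\<close> of \<open>t\<close> yield the same coset; the union serves to name it.
\<close>

definition tens ::
  "('k,'z) ring_scheme \<Rightarrow> ('k,'a,'x) module_scheme \<Rightarrow> ('k,'b,'y) module_scheme \<Rightarrow>
   ('k, ('a,'b) tensor) module"
  where "tens K A B =
    (let T = bal_tensor (carrier K) A B (\<lambda>a c. c \<odot>\<^bsub>A\<^esub> a) (\<lambda>c b. c \<odot>\<^bsub>B\<^esub> b) in
     \<lparr>carrier = carrier T, monoid.mult = undefined, one = undefined, ring.zero = one T, ring.add = monoid.mult T,
      smult = (\<lambda>c t. \<Union>x\<in>t. tens_coset K A B (frag_extend (\<lambda>(a, b). frag_of (c \<odot>\<^bsub>A\<^esub> a, b)) x))\<rparr>)"

definition pure ::
  "('k,'z) ring_scheme \<Rightarrow> ('k,'a,'x) module_scheme \<Rightarrow> ('k,'b,'y) module_scheme \<Rightarrow>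
   'a \<Rightarrow> 'b \<Rightarrow> ('a,'b) tensor"
  where "pure K A B a b = tens_coset K A B (frag_of (a, b))"

text \<open>
  For a \<open>K\<close>-bilinear \<open>\<beta>\<close>, the linear map \<open>A \<otimes> B \<rightarrow> W\<close> sending \<open>a \<otimes> b\<close> to \<open>\<beta> a b\<close>;
  it exists and is unique by the universal property of the tensor product.
\<close>

definition tlift ::
  "('k,'z) ring_scheme \<Rightarrow> ('k,'a,'x) module_scheme \<Rightarrow> ('k,'b,'y) module_scheme \<Rightarrow>
   ('k,'w,'v) module_scheme \<Rightarrow> ('a \<Rightarrow> 'b \<Rightarrow> 'w) \<Rightarrow> ('a,'b) tensor \<Rightarrow> 'w"
  where "tlift K A B W \<beta> = (THE f. f \<in> lin K (tens K A B) W \<and>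
    (\<forall>a\<in>carrier A. \<forall>b\<in>carrier B. f (pure K A B a b) = \<beta> a b))"

definition tmap ::
  "('k,'z) ring_scheme \<Rightarrow> ('k,'a,'x) module_scheme \<Rightarrow> ('k,'b,'y) module_scheme \<Rightarrow>
   ('k,'c,'v) module_scheme \<Rightarrow> ('k,'d,'w) module_scheme \<Rightarrow>
   ('a \<Rightarrow> 'c) \<Rightarrow> ('b \<Rightarrow> 'd) \<Rightarrow> ('a,'b) tensor \<Rightarrow> ('c,'d) tensor"
  where "tmap K A B C D f g = tlift K A B (tens K C D) (\<lambda>a b. pure K C D (f a) (g b))"

definition tassoc ::
  "('k,'z) ring_scheme \<Rightarrow> ('k,'a,'x) module_scheme \<Rightarrow> ('k,'b,'y) module_scheme \<Rightarrow>
   ('k,'c,'v) module_scheme \<Rightarrow> (('a,'b) tensor, 'c) tensor \<Rightarrow> ('a, ('b,'c) tensor) tensor"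
  where "tassoc K A B C = tlift K (tens K A B) C (tens K A (tens K B C))
    (\<lambda>t c. tlift K A B (tens K A (tens K B C)) (\<lambda>a b. pure K A (tens K B C) a (pure K B C b c)) t)"


section \<open>Coalgebras and Hopf algebras\<close>

record ('k, 'a) coalgebra = "('k, 'a) module" +
  comult :: "'a \<Rightarrow> ('a, 'a) tensor"
  counit :: "'a \<Rightarrow> 'k"

record ('k, 'a) hopf = "('k, 'a) coalgebra" +
  antipode :: "'a \<Rightarrow> 'a"

definition is_coalgebra :: "('k,'z) ring_scheme \<Rightarrow> ('k,'a,'x) coalgebra_scheme \<Rightarrow> bool"
  where "is_coalgebra K C \<longleftrightarrow>
    module K C \<and>
    is_linear K C (tens K C C) (comult C) \<and>
    is_linear K C (self_module K) (counit C) \<and>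
    (\<forall>c\<in>carrier C.
       tassoc K C C C (tmap K C C (tens K C C) C (comult C) (\<lambda>x. x) (comult C c)) =
       tmap K C C C (tens K C C) (\<lambda>x. x) (comult C) (comult C c)) \<and>
    (\<forall>c\<in>carrier C. tlift K C C C (\<lambda>a b. counit C a \<odot>\<^bsub>C\<^esub> b) (comult C c) = c) \<and>
    (\<forall>c\<in>carrier C. tlift K C C C (\<lambda>a b. counit C b \<odot>\<^bsub>C\<^esub> a) (comult C c) = c)"

definition coalgebra_hom ::
  "('k,'z) ring_scheme \<Rightarrow> ('k,'a,'x) coalgebra_scheme \<Rightarrow> ('k,'b,'y) coalgebra_scheme \<Rightarrow> ('a \<Rightarrow> 'b) set"
  where "coalgebra_hom K C D = {f \<in> lin K C D.
    (\<forall>c\<in>carrier C. tmap K C C D D f f (comult C c) = comult D (f c)) \<and>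
    (\<forall>c\<in>carrier C. counit D (f c) = counit C c)}"

definition is_unital_algebra :: "('k,'z) ring_scheme \<Rightarrow> ('k,'a,'x) module_scheme \<Rightarrow> bool"
  where "is_unital_algebra K A \<longleftrightarrow>
    module K A \<and> ring A \<and>
    (\<forall>c\<in>carrier K. \<forall>x\<in>carrier A. \<forall>y\<in>carrier A.
       (c \<odot>\<^bsub>A\<^esub> x) \<otimes>\<^bsub>A\<^esub> y = c \<odot>\<^bsub>A\<^esub> (x \<otimes>\<^bsub>A\<^esub> y) \<and>
       x \<otimes>\<^bsub>A\<^esub> (c \<odot>\<^bsub>A\<^esub> y) = c \<odot>\<^bsub>A\<^esub> (x \<otimes>\<^bsub>A\<^esub> y))"

text \<open>The product \<open>(a \<otimes> b)(c \<otimes> d) = ac \<otimes> bd\<close> of \<open>A \<otimes> A\<close>.\<close>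

definition tens_mult ::
  "('k,'z) ring_scheme \<Rightarrow> ('k,'a,'x) module_scheme \<Rightarrow> ('a,'a) tensor \<Rightarrow> ('a,'a) tensor \<Rightarrow> ('a,'a) tensor"
  where "tens_mult K A s t = tlift K A A (tens K A A)
    (\<lambda>a b. tmap K A A A A (\<lambda>c. a \<otimes>\<^bsub>A\<^esub> c) (\<lambda>d. b \<otimes>\<^bsub>A\<^esub> d) t) s"

definition is_hopf_algebra :: "('k,'z) ring_scheme \<Rightarrow> ('k,'h,'x) hopf_scheme \<Rightarrow> bool"
  where "is_hopf_algebra K H \<longleftrightarrow>
    is_unital_algebra K H \<and> is_coalgebra K H \<and>
    (\<forall>x\<in>carrier H. \<forall>y\<in>carrier H.
       comult H (x \<otimes>\<^bsub>H\<^esub> y) = tens_mult K H (comult H x) (comult H y) \<and>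
       counit H (x \<otimes>\<^bsub>H\<^esub> y) = counit H x \<otimes>\<^bsub>K\<^esub> counit H y) \<and>
    comult H \<one>\<^bsub>H\<^esub> = pure K H H \<one>\<^bsub>H\<^esub> \<one>\<^bsub>H\<^esub> \<and>
    counit H \<one>\<^bsub>H\<^esub> = \<one>\<^bsub>K\<^esub> \<and>
    is_linear K H H (antipode H) \<and>
    (\<forall>h\<in>carrier H.
       tlift K H H H (\<lambda>x y. antipode H x \<otimes>\<^bsub>H\<^esub> y) (comult H h) = counit H h \<odot>\<^bsub>H\<^esub> \<one>\<^bsub>H\<^esub> \<and>
       tlift K H H H (\<lambda>x y. x \<otimes>\<^bsub>H\<^esub> antipode H y) (comult H h) = counit H h \<odot>\<^bsub>H\<^esub> \<one>\<^bsub>H\<^esub>)"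

text \<open>The maps \<open>H \<otimes> H \<rightarrow> H\<close> and \<open>H \<otimes> H \<rightarrow> H \<otimes> H\<close> given by
  \<open>x \<otimes> y \<mapsto> x S(y)\<close>,
  \<open>x \<otimes> y \<mapsto> x\<^sub>(\<^sub>1\<^sub>) \<otimes> x\<^sub>(\<^sub>2\<^sub>) S(y)\<close> and
  \<open>x \<otimes> y \<mapsto> x S(y\<^sub>(\<^sub>1\<^sub>)) \<otimes> y\<^sub>(\<^sub>2\<^sub>)\<close>.\<close>

definition mult_S ::
  "('k,'z) ring_scheme \<Rightarrow> ('k,'h,'x) hopf_scheme \<Rightarrow> ('h,'h) tensor \<Rightarrow> 'h"
  where "mult_S K H = tlift K H H H (\<lambda>x y. x \<otimes>\<^bsub>H\<^esub> antipode H y)"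

definition split_left_S ::
  "('k,'z) ring_scheme \<Rightarrow> ('k,'h,'x) hopf_scheme \<Rightarrow> ('h,'h) tensor \<Rightarrow> ('h,'h) tensor"
  where "split_left_S K H = tlift K H H (tens K H H)
    (\<lambda>x y. tmap K H H H H (\<lambda>u. u) (\<lambda>v. v \<otimes>\<^bsub>H\<^esub> antipode H y) (comult H x))"

definition split_right_S ::
  "('k,'z) ring_scheme \<Rightarrow> ('k,'h,'x) hopf_scheme \<Rightarrow> ('h,'h) tensor \<Rightarrow> ('h,'h) tensor"
  where "split_right_S K H = tlift K H H (tens K H H)
    (\<lambda>x y. tmap K H H H H (\<lambda>u. x \<otimes>\<^bsub>H\<^esub> antipode H u) (\<lambda>v. v) (comult H y))"


section \<open>Comodules and partial comodules\<close>

text \<open>A (partial) comodule is a pair of a vector space and a coaction on it.\<close>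

type_synonym ('k, 'm, 'h) comod = "('k, 'm) module \<times> ('m \<Rightarrow> ('m, 'h) tensor)"

definition is_comodule ::
  "('k,'z) ring_scheme \<Rightarrow> ('k,'d,'x) coalgebra_scheme \<Rightarrow> ('k,'m,'d) comod \<Rightarrow> bool"
  where "is_comodule K D = (\<lambda>(M, \<rho>).
    module K M \<and> \<rho> \<in> lin K M (tens K M D) \<and>
    (\<forall>m\<in>carrier M.
       tassoc K M D D (tmap K M D (tens K M D) D \<rho> (\<lambda>d. d) (\<rho> m)) =
       tmap K M D M (tens K D D) (\<lambda>m. m) (comult D) (\<rho> m)) \<and>
    (\<forall>m\<in>carrier M. tlift K M D M (\<lambda>x d. counit D d \<odot>\<^bsub>M\<^esub> x) (\<rho> m) = m))"

text \<open>\<open>coact2\<close> is \<open>m \<mapsto> m\<^sup>[\<^sup>0\<^sup>]\<^sup>[\<^sup>0\<^sup>] \<otimes> (m\<^sup>[\<^sup>0\<^sup>]\<^sup>[\<^sup>1\<^sup>] \<otimes> m\<^sup>[\<^sup>1\<^sup>])\<close> and \<open>coact_S\<close> is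
  \<open>m \<mapsto> m\<^sup>[\<^sup>0\<^sup>]\<^sup>[\<^sup>0\<^sup>] \<otimes> m\<^sup>[\<^sup>0\<^sup>]\<^sup>[\<^sup>1\<^sup>] S(m\<^sup>[\<^sup>1\<^sup>])\<close>.\<close>

definition coact2 ::
  "('k,'z) ring_scheme \<Rightarrow> ('k,'h,'x) hopf_scheme \<Rightarrow> ('k,'m,'h) comod \<Rightarrow> 'm \<Rightarrow> ('m, ('h,'h) tensor) tensor"
  where "coact2 K H = (\<lambda>(M, \<rho>) m.
    tassoc K M H H (tmap K M H (tens K M H) H \<rho> (\<lambda>h. h) (\<rho> m)))"

definition coact_S ::
  "('k,'z) ring_scheme \<Rightarrow> ('k,'h,'x) hopf_scheme \<Rightarrow> ('k,'m,'h) comod \<Rightarrow> 'm \<Rightarrow> ('m, 'h) tensor"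
  where "coact_S K H = (\<lambda>(M, \<rho>) m.
    tmap K M (tens K H H) M H (\<lambda>m. m) (mult_S K H) (coact2 K H (M, \<rho>) m))"

text \<open>With triple tensors bracketed to the right, the last two conjuncts read
  \<open>m\<^sup>[\<^sup>0\<^sup>]\<^sup>[\<^sup>0\<^sup>] \<otimes> m\<^sup>[\<^sup>0\<^sup>]\<^sup>[\<^sup>1\<^sup>]\<^sub>(\<^sub>1\<^sub>) \<otimes> m\<^sup>[\<^sup>0\<^sup>]\<^sup>[\<^sup>1\<^sup>]\<^sub>(\<^sub>2\<^sub>) S(m\<^sup>[\<^sup>1\<^sup>]) = m\<^sup>[\<^sup>0\<^sup>]\<^sup>[\<^sup>0\<^sup>]\<^sup>[\<^sup>0\<^sup>] \<otimes> m\<^sup>[\<^sup>0\<^sup>]\<^sup>[\<^sup>0\<^sup>]\<^sup>[\<^sup>1\<^sup>] \<otimes> m\<^sup>[\<^sup>0\<^sup>]\<^sup>[\<^sup>1\<^sup>] S(m\<^sup>[\<^sup>1\<^sup>])\<close> and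
  \<open>m\<^sup>[\<^sup>0\<^sup>]\<^sup>[\<^sup>0\<^sup>] \<otimes> m\<^sup>[\<^sup>0\<^sup>]\<^sup>[\<^sup>1\<^sup>] S(m\<^sup>[\<^sup>1\<^sup>]\<^sub>(\<^sub>1\<^sub>)) \<otimes> m\<^sup>[\<^sup>1\<^sup>]\<^sub>(\<^sub>2\<^sub>) = m\<^sup>[\<^sup>0\<^sup>]\<^sup>[\<^sup>0\<^sup>]\<^sup>[\<^sup>0\<^sup>] \<otimes> m\<^sup>[\<^sup>0\<^sup>]\<^sup>[\<^sup>0\<^sup>]\<^sup>[\<^sup>1\<^sup>] S(m\<^sup>[\<^sup>0\<^sup>]\<^sup>[\<^sup>1\<^sup>]) \<otimes> m\<^sup>[\<^sup>1\<^sup>]\<close>.\<close>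

definition is_partial_comodule ::
  "('k,'z) ring_scheme \<Rightarrow> ('k,'h,'x) hopf_scheme \<Rightarrow> ('k,'m,'h) comod \<Rightarrow> bool"
  where "is_partial_comodule K H = (\<lambda>(M, \<rho>).
    module K M \<and> \<rho> \<in> lin K M (tens K M H) \<and>
    (\<forall>m\<in>carrier M. tlift K M H M (\<lambda>x h. counit H h \<odot>\<^bsub>M\<^esub> x) (\<rho> m) = m) \<and>
    (\<forall>m\<in>carrier M.
       tmap K M (tens K H H) M (tens K H H) (\<lambda>m. m) (split_left_S K H) (coact2 K H (M, \<rho>) m) =
       tassoc K M H H (tmap K M H (tens K M H) H \<rho> (\<lambda>h. h) (coact_S K H (M, \<rho>) m))) \<and>
    (\<forall>m\<in>carrier M.
       tmap K M (tens K H H) M (tens K H H) (\<lambda>m. m) (split_right_S K H) (coact2 K H (M, \<rho>) m) =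
       tassoc K M H H (tmap K M H (tens K M H) H (coact_S K H (M, \<rho>)) (\<lambda>h. h) (\<rho> m))))"

text \<open>Maps compatible with coactions; here \<open>E\<close> is the vector space in which the coactions
  take their second tensor factor.\<close>

definition comodule_hom ::
  "('k,'z) ring_scheme \<Rightarrow> ('k,'h,'x) module_scheme \<Rightarrow> ('k,'m,'h) comod \<Rightarrow> ('k,'n,'h) comod \<Rightarrow> ('m \<Rightarrow> 'n) set"
  where "comodule_hom K E = (\<lambda>(M, \<rho>) (N, \<sigma>). {f \<in> lin K M N.
    \<forall>m\<in>carrier M. \<sigma> (f m) = tmap K M E N E f (\<lambda>h. h) (\<rho> m)})"


section \<open>Partial corepresentations and the universal coalgebra\<close>

text \<open>The last two conjuncts read
  \<open>\<omega>(c\<^sub>(\<^sub>1\<^sub>))\<^sub>(\<^sub>1\<^sub>) \<otimes> \<omega>(c\<^sub>(\<^sub>1\<^sub>))\<^sub>(\<^sub>2\<^sub>) S(\<omega>(c\<^sub>(\<^sub>2\<^sub>))) = \<omega>(c\<^sub>(\<^sub>1\<^sub>)) \<otimes> \<omega>(c\<^sub>(\<^sub>2\<^sub>)) S(\<omega>(c\<^sub>(\<^sub>3\<^sub>)))\<close> and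
  \<open>\<omega>(c\<^sub>(\<^sub>1\<^sub>)) S(\<omega>(c\<^sub>(\<^sub>2\<^sub>))\<^sub>(\<^sub>1\<^sub>)) \<otimes> \<omega>(c\<^sub>(\<^sub>2\<^sub>))\<^sub>(\<^sub>2\<^sub>) = \<omega>(c\<^sub>(\<^sub>1\<^sub>)) S(\<omega>(c\<^sub>(\<^sub>2\<^sub>))) \<otimes> \<omega>(c\<^sub>(\<^sub>3\<^sub>))\<close>.\<close>

definition is_partial_corep ::
  "('k,'z) ring_scheme \<Rightarrow> ('k,'d,'x) coalgebra_scheme \<Rightarrow> ('k,'h,'y) hopf_scheme \<Rightarrow> ('d \<Rightarrow> 'h) \<Rightarrow> bool"
  where "is_partial_corep K D H \<omega> \<longleftrightarrow>
    is_linear K D H \<omega> \<and>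
    (\<forall>c\<in>carrier D. counit H (\<omega> c) = counit D c) \<and>
    (\<forall>c\<in>carrier D.
       split_left_S K H (tmap K D D H H \<omega> \<omega> (comult D c)) =
       tmap K D D H H \<omega> (\<lambda>d. mult_S K H (tmap K D D H H \<omega> \<omega> (comult D d))) (comult D c)) \<and>
    (\<forall>c\<in>carrier D.
       split_right_S K H (tmap K D D H H \<omega> \<omega> (comult D c)) =
       tmap K D D H H (\<lambda>d. mult_S K H (tmap K D D H H \<omega> \<omega> (comult D d))) \<omega> (comult D c))"

text \<open>
  The universal property of \<open>p : C \<rightarrow> V\<close> is tested on the coalgebras whose underlying set lies
  in the type \<open>'u\<close>, which plays the role of a universe.
\<close>

definition is_cofree_coalgebra ::
  "'u itself \<Rightarrow> ('k,'z) ring_scheme \<Rightarrow> ('k,'h,'x) module_scheme \<Rightarrow> ('k,'c) coalgebra \<Rightarrow> ('c \<Rightarrow> 'h) \<Rightarrow> bool"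
  where "is_cofree_coalgebra _ K V C p \<longleftrightarrow>
    is_coalgebra K C \<and> is_linear K C V p \<and>
    (\<forall>D :: ('k,'u) coalgebra. is_coalgebra K D \<longrightarrow>
       (\<forall>f\<in>lin K D V. \<exists>!g. g \<in> coalgebra_hom K D C \<and> (\<forall>d\<in>carrier D. p (g d) = f d)))"

definition submod :: "('k,'a,'x) module_scheme \<Rightarrow> 'a set \<Rightarrow> ('k,'a,'x) module_scheme"
  where "submod M X = M\<lparr>carrier := X\<rparr>"

definition is_subcoalgebra :: "('k,'z) ring_scheme \<Rightarrow> ('k,'c) coalgebra \<Rightarrow> 'c set \<Rightarrow> bool"
  where "is_subcoalgebra K C X \<longleftrightarrow> submodule X K C \<and>
    comult C ` X \<subseteq>
      tmap K (submod C X) (submod C X) C C (\<lambda>x. x) (\<lambda>x. x) ` carrier (tens K (submod C X) (submod C X))"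

text \<open>
  A subcoalgebra \<open>X\<close> as a coalgebra of its own. The tensor products \<open>X \<otimes> X\<close> and \<open>C \<otimes> C\<close>
  consist of different cosets; over a field the canonical map \<open>X \<otimes> X \<rightarrow> C \<otimes> C\<close> is injective.
\<close>

definition subcoalgebra :: "('k,'z) ring_scheme \<Rightarrow> ('k,'c) coalgebra \<Rightarrow> 'c set \<Rightarrow> ('k,'c) coalgebra"
  where "subcoalgebra K C X = (submod C X)
    \<lparr>comult := (\<lambda>x\<in>X. THE t. t \<in> carrier (tens K (submod C X) (submod C X)) \<and>
       tmap K (submod C X) (submod C X) C C (\<lambda>x. x) (\<lambda>x. x) t = comult C x)\<rparr>"

definition Hpar ::
  "('k,'z) ring_scheme \<Rightarrow> ('k,'h,'x) hopf_scheme \<Rightarrow> ('k,'c) coalgebra \<Rightarrow> ('c \<Rightarrow> 'h) \<Rightarrow> ('k,'c) coalgebra"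
  where "Hpar K H C p = subcoalgebra K C
    (span_of K C (\<Union>{X. is_subcoalgebra K C X \<and> is_partial_corep K (subcoalgebra K C X) H p}))"


section \<open>Firm projectivity\<close>

definition is_nonunital_ring :: "('r,'x) ring_scheme \<Rightarrow> bool"
  where "is_nonunital_ring R \<longleftrightarrow> abelian_group R \<and>
    (\<forall>a\<in>carrier R. \<forall>b\<in>carrier R. a \<otimes>\<^bsub>R\<^esub> b \<in> carrier R) \<and>
    (\<forall>a\<in>carrier R. \<forall>b\<in>carrier R. \<forall>c\<in>carrier R.
       (a \<otimes>\<^bsub>R\<^esub> b) \<otimes>\<^bsub>R\<^esub> c = a \<otimes>\<^bsub>R\<^esub> (b \<otimes>\<^bsub>R\<^esub> c) \<and>
       (a \<oplus>\<^bsub>R\<^esub> b) \<otimes>\<^bsub>R\<^esub> c = a \<otimes>\<^bsub>R\<^esub> c \<oplus>\<^bsub>R\<^esub> b \<otimes>\<^bsub>R\<^esub> c \<and>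
       a \<otimes>\<^bsub>R\<^esub> (b \<oplus>\<^bsub>R\<^esub> c) = a \<otimes>\<^bsub>R\<^esub> b \<oplus>\<^bsub>R\<^esub> a \<otimes>\<^bsub>R\<^esub> c)"

definition is_left_module :: "('r,'x) ring_scheme \<Rightarrow> ('m,'y) ring_scheme \<Rightarrow> ('r \<Rightarrow> 'm \<Rightarrow> 'm) \<Rightarrow> bool"
  where "is_left_module R M act \<longleftrightarrow> abelian_group M \<and>
    (\<forall>r\<in>carrier R. \<forall>m\<in>carrier M. act r m \<in> carrier M) \<and>
    (\<forall>r\<in>carrier R. \<forall>s\<in>carrier R. \<forall>m\<in>carrier M.
       act (r \<oplus>\<^bsub>R\<^esub> s) m = act r m \<oplus>\<^bsub>M\<^esub> act s m \<and>
       act (r \<otimes>\<^bsub>R\<^esub> s) m = act r (act s m)) \<and>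
    (\<forall>r\<in>carrier R. \<forall>m\<in>carrier M. \<forall>n\<in>carrier M.
       act r (m \<oplus>\<^bsub>M\<^esub> n) = act r m \<oplus>\<^bsub>M\<^esub> act r n)"

definition is_firm_module :: "('r,'x) ring_scheme \<Rightarrow> ('m,'y) ring_scheme \<Rightarrow> ('r \<Rightarrow> 'm \<Rightarrow> 'm) \<Rightarrow> bool"
  where "is_firm_module R M act \<longleftrightarrow> is_left_module R M act \<and>
    (\<exists>h \<in> iso (bal_tensor (carrier R) R M (monoid.mult R) act) (add_monoid M).
       \<forall>r\<in>carrier R. \<forall>m\<in>carrier M.
         h (bal_coset (carrier R) R M (monoid.mult R) act (frag_of (r, m))) = act r m)"

definition is_firm_ring :: "('r,'x) ring_scheme \<Rightarrow> bool"
  where "is_firm_ring R \<longleftrightarrow> is_nonunital_ring R \<and> is_firm_module R R (monoid.mult R)"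

definition dual :: "('k,'z) ring_scheme \<Rightarrow> ('k,'m,'x) module_scheme \<Rightarrow> ('k, 'm \<Rightarrow> 'k) module"
  where "dual K M = \<lparr>carrier = lin K M (self_module K), monoid.mult = undefined, one = undefined,
    ring.zero = (\<lambda>x\<in>carrier M. \<zero>\<^bsub>K\<^esub>), ring.add = (\<lambda>f g. \<lambda>x\<in>carrier M. f x \<oplus>\<^bsub>K\<^esub> g x),
    smult = (\<lambda>c f. \<lambda>x\<in>carrier M. c \<otimes>\<^bsub>K\<^esub> f x)\<rparr>"

text \<open>The product \<open>(m \<otimes> f)(n \<otimes> g) = m f(n) \<otimes> g\<close> on \<open>M \<otimes> M\<^sup>*\<close>.\<close>

definition elem_mult ::
  "('k,'z) ring_scheme \<Rightarrow> ('k,'m,'x) module_scheme \<Rightarrow> ('m, 'm \<Rightarrow> 'k) tensor \<Rightarrow> ('m, 'm \<Rightarrow> 'k) tensor \<Rightarrow>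
   ('m, 'm \<Rightarrow> 'k) tensor"
  where "elem_mult K M s t = tlift K M (dual K M) (tens K M (dual K M))
    (\<lambda>m f. tlift K M (dual K M) (tens K M (dual K M))
       (\<lambda>n g. pure K M (dual K M) (f n \<odot>\<^bsub>M\<^esub> m) g) t) s"

text \<open>The action \<open>(e \<otimes> f) \<cdot> m = e f(m)\<close>.\<close>

definition elem_act ::
  "('k,'z) ring_scheme \<Rightarrow> ('k,'m,'x) module_scheme \<Rightarrow> ('m, 'm \<Rightarrow> 'k) tensor \<Rightarrow> 'm \<Rightarrow> 'm"
  where "elem_act K M t m = tlift K M (dual K M) M (\<lambda>e f. f m \<odot>\<^bsub>M\<^esub> e) t"

text \<open>\<open>M\<close> is \<open>R\<close>-firmly projective by means of the ring morphism \<open>\<phi> : R \<rightarrow> M \<otimes> M\<^sup>*\<close>.\<close>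

definition is_firmly_projective_via ::
  "('k,'z) ring_scheme \<Rightarrow> ('r,'x) ring_scheme \<Rightarrow> ('k,'m,'y) module_scheme \<Rightarrow>
   ('r \<Rightarrow> ('m, 'm \<Rightarrow> 'k) tensor) \<Rightarrow> bool"
  where "is_firmly_projective_via K R M \<phi> \<longleftrightarrow>
    module K M \<and> is_firm_ring R \<and>
    \<phi> \<in> hom (add_monoid R) (add_monoid (tens K M (dual K M))) \<and>
    (\<forall>r\<in>carrier R. \<forall>s\<in>carrier R. \<phi> (r \<otimes>\<^bsub>R\<^esub> s) = elem_mult K M (\<phi> r) (\<phi> s)) \<and>
    is_firm_module R M (\<lambda>r. elem_act K M (\<phi> r))"

definition endo_ring :: "('k,'m,'x) module_scheme \<Rightarrow> ('m \<Rightarrow> 'm) set \<Rightarrow> ('m \<Rightarrow> 'm) ring"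
  where "endo_ring M E = \<lparr>carrier = E, monoid.mult = compose (carrier M), one = (\<lambda>x\<in>carrier M. x),
    ring.zero = (\<lambda>x\<in>carrier M. \<zero>\<^bsub>M\<^esub>), ring.add = (\<lambda>f g. \<lambda>x\<in>carrier M. f x \<oplus>\<^bsub>M\<^esub> g x)\<rparr>"

text \<open>
  \<open>E\<close> is the endomorphism ring of a (partial) comodule with underlying vector space \<open>M\<close>.
  The ring \<open>R\<close> is a subring of \<open>E\<close>, not necessarily unital, and its action on \<open>M\<close> through
  \<open>M \<otimes> M\<^sup>*\<close> is the one it has as a set of endomorphisms of \<open>M\<close>.
\<close>

definition is_firmly_projective ::
  "('k,'z) ring_scheme \<Rightarrow> ('k,'m,'x) module_scheme \<Rightarrow> ('m \<Rightarrow> 'm) set \<Rightarrow> bool"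
  where "is_firmly_projective K M E \<longleftrightarrow> (\<exists>R\<subseteq>E. \<exists>\<phi>.
    is_firmly_projective_via K (endo_ring M R) M \<phi> \<and>
    (\<forall>r\<in>R. \<forall>m\<in>carrier M. elem_act K M (\<phi> r) m = r m))"


section \<open>Categories\<close>

text \<open>Hom-sets need not be disjoint, so identities, composition and the arrow part of a functor
  take the objects as arguments; \<open>Cmp X Y Z g f\<close> is \<open>g \<circ> f\<close> for \<open>f : X \<rightarrow> Y\<close>, \<open>g : Y \<rightarrow> Z\<close>.\<close>

record ('o, 'a) cat =
  Ob :: "'o set"
  Hom :: "'o \<Rightarrow> 'o \<Rightarrow> 'a set"
  Idn :: "'o \<Rightarrow> 'a"
  Cmp :: "'o \<Rightarrow> 'o \<Rightarrow> 'o \<Rightarrow> 'a \<Rightarrow> 'a \<Rightarrow> 'a"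

definition is_category :: "('o,'a) cat \<Rightarrow> bool"
  where "is_category C \<longleftrightarrow>
    (\<forall>X\<in>Ob C. Idn C X \<in> Hom C X X) \<and>
    (\<forall>X\<in>Ob C. \<forall>Y\<in>Ob C. \<forall>Z\<in>Ob C. \<forall>f\<in>Hom C X Y. \<forall>g\<in>Hom C Y Z. Cmp C X Y Z g f \<in> Hom C X Z) \<and>
    (\<forall>X\<in>Ob C. \<forall>Y\<in>Ob C. \<forall>f\<in>Hom C X Y. Cmp C X X Y f (Idn C X) = f \<and> Cmp C X Y Y (Idn C Y) f = f) \<and>
    (\<forall>W\<in>Ob C. \<forall>X\<in>Ob C. \<forall>Y\<in>Ob C. \<forall>Z\<in>Ob C. \<forall>f\<in>Hom C W X. \<forall>g\<in>Hom C X Y. \<forall>h\<in>Hom C Y Z.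
       Cmp C W Y Z h (Cmp C W X Y g f) = Cmp C W X Z (Cmp C X Y Z h g) f)"

definition full_subcat :: "('o,'a) cat \<Rightarrow> ('o \<Rightarrow> bool) \<Rightarrow> ('o,'a) cat"
  where "full_subcat C P = C\<lparr>Ob := {X \<in> Ob C. P X}\<rparr>"

record ('o, 'a, 'p, 'b) funct =
  fob :: "'o \<Rightarrow> 'p"
  farr :: "'o \<Rightarrow> 'o \<Rightarrow> 'a \<Rightarrow> 'b"

definition is_functor :: "('o,'a) cat \<Rightarrow> ('p,'b) cat \<Rightarrow> ('o,'a,'p,'b) funct \<Rightarrow> bool"
  where "is_functor C D F \<longleftrightarrow> is_category C \<and> is_category D \<and>
    (\<forall>X\<in>Ob C. fob F X \<in> Ob D) \<and>
    (\<forall>X\<in>Ob C. \<forall>Y\<in>Ob C. \<forall>f\<in>Hom C X Y. farr F X Y f \<in> Hom D (fob F X) (fob F Y)) \<and>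
    (\<forall>X\<in>Ob C. farr F X X (Idn C X) = Idn D (fob F X)) \<and>
    (\<forall>X\<in>Ob C. \<forall>Y\<in>Ob C. \<forall>Z\<in>Ob C. \<forall>f\<in>Hom C X Y. \<forall>g\<in>Hom C Y Z.
       farr F X Z (Cmp C X Y Z g f) =
       Cmp D (fob F X) (fob F Y) (fob F Z) (farr F Y Z g) (farr F X Y f))"

definition is_fully_faithful :: "('o,'a) cat \<Rightarrow> ('p,'b) cat \<Rightarrow> ('o,'a,'p,'b) funct \<Rightarrow> bool"
  where "is_fully_faithful C D F \<longleftrightarrow>
    (\<forall>X\<in>Ob C. \<forall>Y\<in>Ob C. bij_betw (farr F X Y) (Hom C X Y) (Hom D (fob F X) (fob F Y)))"

definition is_cat_iso :: "('o,'a) cat \<Rightarrow> ('p,'b) cat \<Rightarrow> ('o,'a,'p,'b) funct \<Rightarrow> bool"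
  where "is_cat_iso C D F \<longleftrightarrow> is_functor C D F \<and>
    (\<exists>G. is_functor D C G \<and>
       (\<forall>X\<in>Ob C. fob G (fob F X) = X) \<and>
       (\<forall>X\<in>Ob D. fob F (fob G X) = X) \<and>
       (\<forall>X\<in>Ob C. \<forall>Y\<in>Ob C. \<forall>f\<in>Hom C X Y. farr G (fob F X) (fob F Y) (farr F X Y f) = f) \<and>
       (\<forall>X\<in>Ob D. \<forall>Y\<in>Ob D. \<forall>f\<in>Hom D X Y. farr F (fob G X) (fob G Y) (farr G X Y f) = f))"

definition vect_cat :: "('k,'z) ring_scheme \<Rightarrow> (('k,'u) module, 'u \<Rightarrow> 'u) cat"
  where "vect_cat K = \<lparr>Ob = {V. module K V}, Hom = (\<lambda>V W. lin K V W),
    Idn = (\<lambda>V. \<lambda>x\<in>carrier V. x), Cmp = (\<lambda>U V W g f. compose (carrier U) g f)\<rparr>"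

definition comod_cat ::
  "('k,'z) ring_scheme \<Rightarrow> ('k,'d,'x) coalgebra_scheme \<Rightarrow> (('k,'u,'d) comod, 'u \<Rightarrow> 'u) cat"
  where "comod_cat K D = \<lparr>Ob = {X. is_comodule K D X}, Hom = comodule_hom K D,
    Idn = (\<lambda>X. \<lambda>x\<in>carrier (fst X). x), Cmp = (\<lambda>X Y Z g f. compose (carrier (fst X)) g f)\<rparr>"

definition par_comod_cat ::
  "('k,'z) ring_scheme \<Rightarrow> ('k,'h,'x) hopf_scheme \<Rightarrow> (('k,'u,'h) comod, 'u \<Rightarrow> 'u) cat"
  where "par_comod_cat K H = \<lparr>Ob = {X. is_partial_comodule K H X}, Hom = comodule_hom K H,
    Idn = (\<lambda>X. \<lambda>x\<in>carrier (fst X). x), Cmp = (\<lambda>X Y Z g f. compose (carrier (fst X)) g f)\<rparr>"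

definition comod_cat_f ::
  "('k,'z) ring_scheme \<Rightarrow> ('k,'d,'x) coalgebra_scheme \<Rightarrow> (('k,'u,'d) comod, 'u \<Rightarrow> 'u) cat"
  where "comod_cat_f K D =
    full_subcat (comod_cat K D) (\<lambda>X. is_firmly_projective K (fst X) (comodule_hom K D X X))"

definition par_comod_cat_f ::
  "('k,'z) ring_scheme \<Rightarrow> ('k,'h,'x) hopf_scheme \<Rightarrow> (('k,'u,'h) comod, 'u \<Rightarrow> 'u) cat"
  where "par_comod_cat_f K H =
    full_subcat (par_comod_cat K H) (\<lambda>X. is_firmly_projective K (fst X) (comodule_hom K H X X))"

definition comod_cat_fd ::
  "('k,'z) ring_scheme \<Rightarrow> ('k,'d,'x) coalgebra_scheme \<Rightarrow> (('k,'u,'d) comod, 'u \<Rightarrow> 'u) cat"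
  where "comod_cat_fd K D = full_subcat (comod_cat K D) (\<lambda>X. finite_dim K (fst X))"

definition par_comod_cat_fd ::
  "('k,'z) ring_scheme \<Rightarrow> ('k,'h,'x) hopf_scheme \<Rightarrow> (('k,'u,'h) comod, 'u \<Rightarrow> 'u) cat"
  where "par_comod_cat_fd K H = full_subcat (par_comod_cat K H) (\<lambda>X. finite_dim K (fst X))"

definition forget :: "(('k,'u,'h) comod, 'u \<Rightarrow> 'u, ('k,'u) module, 'u \<Rightarrow> 'u) funct"
  where "forget = \<lparr>fob = fst, farr = (\<lambda>X Y f. f)\<rparr>"

text \<open>\<open>\<Gamma>(M, \<rho>) = (M, (I \<otimes> p) \<circ> \<rho>)\<close>, identical on morphisms.\<close>

definition Gamma ::
  "('k,'z) ring_scheme \<Rightarrow> ('k,'h,'y) hopf_scheme \<Rightarrow> ('k,'c) coalgebra \<Rightarrow> ('c \<Rightarrow> 'h) \<Rightarrow>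
   (('k,'u,'c) comod, 'u \<Rightarrow> 'u, ('k,'u,'h) comod, 'u \<Rightarrow> 'u) funct"
  where "Gamma K H C p =
    \<lparr>fob = (\<lambda>(M, \<rho>). (M, \<lambda>m\<in>carrier M. tmap K M (Hpar K H C p) M H (\<lambda>m. m) p (\<rho> m))),
     farr = (\<lambda>X Y f. f)\<rparr>"


section \<open>Tannaka reconstruction\<close>

text \<open>Natural transformations \<open>U \<Rightarrow> U \<otimes> W\<close>, for a functor \<open>U\<close> to vector spaces.\<close>

definition is_nat_tensor ::
  "('k,'z) ring_scheme \<Rightarrow> ('o,'a) cat \<Rightarrow> ('o,'a,('k,'u) module,'u \<Rightarrow> 'u) funct \<Rightarrow>
   ('k,'w,'x) module_scheme \<Rightarrow> ('o \<Rightarrow> 'u \<Rightarrow> ('u,'w) tensor) \<Rightarrow> bool"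
  where "is_nat_tensor K \<C> U W \<alpha> \<longleftrightarrow>
    (\<forall>X\<in>Ob \<C>. \<alpha> X \<in> lin K (fob U X) (tens K (fob U X) W)) \<and>
    (\<forall>X\<in>Ob \<C>. \<forall>Y\<in>Ob \<C>. \<forall>f\<in>Hom \<C> X Y. \<forall>x\<in>carrier (fob U X).
       \<alpha> Y (farr U X Y f x) = tmap K (fob U X) W (fob U Y) W (farr U X Y f) (\<lambda>w. w) (\<alpha> X x))"

text \<open>
  The coalgebra reconstructed from \<open>U\<close> is its coend coalgebra \<open>L\<close>: the vector space \<open>L\<close> represents
  \<open>W \<mapsto> Nat(U, U \<otimes> W)\<close>, with universal element \<open>\<delta>\<close>, and its coalgebra structure is the one
  (determined by universality) for which every \<open>\<delta> X\<close> is a coaction on \<open>U X\<close>.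
\<close>

definition is_tannaka_coalgebra ::
  "'w itself \<Rightarrow> ('k,'z) ring_scheme \<Rightarrow> ('o,'a) cat \<Rightarrow> ('o,'a,('k,'u) module,'u \<Rightarrow> 'u) funct \<Rightarrow>
   ('k,'l,'x) coalgebra_scheme \<Rightarrow> ('o \<Rightarrow> 'u \<Rightarrow> ('u,'l) tensor) \<Rightarrow> bool"
  where "is_tannaka_coalgebra _ K \<C> U L \<delta> \<longleftrightarrow>
    is_functor \<C> (vect_cat K) U \<and> is_coalgebra K L \<and>
    is_nat_tensor K \<C> U L \<delta> \<and>
    (\<forall>X\<in>Ob \<C>. is_comodule K L (fob U X, \<delta> X)) \<and>
    (\<forall>W :: ('k,'w) module. module K W \<longrightarrow> (\<forall>\<alpha>. is_nat_tensor K \<C> U W \<alpha> \<longrightarrow>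
       (\<exists>!g. g \<in> lin K L W \<and>
          (\<forall>X\<in>Ob \<C>. \<forall>x\<in>carrier (fob U X).
             \<alpha> X x = tmap K (fob U X) L (fob U X) W (\<lambda>x. x) g (\<delta> X x)))))"

end

theory Submission
  imports Defs
begin

text \<open>
  Any \<open>p\<close>-preimages of matrix entries in \<open>H\<close> assemble into a comatrix of \<open>C(H)\<close>: this is cofreeness, applied to
  comatrix coalgebras. Uniqueness in the same universal property, applied to block triangular comatrices, shows
  that \<open>p\<close> cogenerates: an element of \<open>H\<^sup>p\<^sup>a\<^sup>r\<close> is determined by the values of the counit on its iterated
  slices along the functionals \<open>\<phi> \<circ> p\<close>. Hence a coaction of \<open>H\<^sup>p\<^sup>a\<^sup>r\<close> and its morphisms can be read off from the
  induced partial coaction, so that \<open>\<Gamma>\<close> is full and injective on objects.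

  Conversely, a partial coaction that is locally finite, that is, whose elements lie in finite-dimensional stable
  subspaces, lifts: the matrix of the coaction on such a subspace lifts to a comatrix of \<open>C(H)\<close>, and the axioms
  (PCM1)-(PCM3) say that \<open>p\<close> is a partial corepresentation on the subcoalgebra spanned by it, which therefore lies in
  \<open>H\<^sup>p\<^sup>a\<^sup>r\<close>. Firmly projective partial comodules are locally finite.

  For the reconstruction, every finite subset of a coalgebra lies in a finite-dimensional subcomodule of the regular
  comodule, so that a natural transformation \<open>U \<Rightarrow> U \<otimes> W\<close> amounts to a linear map on the span of all coefficients,
  which is the whole coalgebra.
\<close>

text \<open>The universal property of the cofree coalgebra can be tested only on coalgebras carried
  by the type \<open>'u\<close>, while \<open>C\<close> and \<open>H\<close> have types of their
  own; hence no piece of \<open>C\<close> can serve as a test object directly. The arguments are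
  pushed down to finite matrices instead: a comatrix of size \<open>n\<close> is the image of a
  coalgebra whose elements are lists of scalars, and \<open>\<iota>\<close> places such lists inside
  \<open>'u\<close>. Tensor products are sets of cosets without normal forms. Over a field
  functionals separate points, so equations between tensors are verified on slices, that is, after
  contracting one factor with a functional. Finite dimensionality is expressed in the same language,
  by finite biorthogonal systems or by finitely many functionals that separate the points of a
  subspace. The delicate point is that a partial coaction sees only the slices along functionals
  \<open>\<phi> \<circ> p\<close>, which need not exhaust the dual of the coalgebra; the block
  triangular argument is what makes these slices suffice.\<close>

locale base_field = field K for K :: "('k, 'z) ring_scheme" (structure)
begin

section \<open>Closure rules for modules over the base field\<close>

lemma module_abelian_group: "module K A \<Longrightarrow> abelian_group A"
  by (simp add: module_def)

lemma module_abelian_monoid: "module K A \<Longrightarrow> abelian_monoid A"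
  by (simp add: module_def abelian_group_def)

lemma module_comm_group: "module K A \<Longrightarrow> comm_group (add_monoid A)"
  by (meson abelian_group.a_comm_group module_abelian_group)

lemma module_add_closed [simp]:
  "module K A \<Longrightarrow> x \<in> carrier A \<Longrightarrow> y \<in> carrier A \<Longrightarrow> x \<oplus>\<^bsub>A\<^esub> y \<in> carrier A"
  by (simp add: abelian_monoid.a_closed module_abelian_monoid)

lemma module_zero_closed [simp]: "module K A \<Longrightarrow> \<zero>\<^bsub>A\<^esub> \<in> carrier A"
  by (simp add: abelian_monoid.zero_closed module_abelian_monoid)

lemma module_minus_closed [simp]: "module K A \<Longrightarrow> x \<in> carrier A \<Longrightarrow> \<ominus>\<^bsub>A\<^esub> x \<in> carrier A"
  by (simp add: abelian_group.a_inv_closed module_abelian_group)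

lemma module_minus_zero [simp]: "module K A \<Longrightarrow> \<ominus>\<^bsub>A\<^esub> \<zero>\<^bsub>A\<^esub> = \<zero>\<^bsub>A\<^esub>"
  by (rule abelian_group.minus_equality[OF module_abelian_group])
    (simp_all add: abelian_monoid.l_zero[OF module_abelian_monoid])

lemma module_diff_closed [simp]:
  "module K A \<Longrightarrow> x \<in> carrier A \<Longrightarrow> y \<in> carrier A \<Longrightarrow> x \<ominus>\<^bsub>A\<^esub> y \<in> carrier A"
  by (simp add: a_minus_def)

lemma module_diff_eq_zero:
  assumes "module K A" "x \<in> carrier A" "y \<in> carrier A"
  shows "x \<ominus>\<^bsub>A\<^esub> y = \<zero>\<^bsub>A\<^esub> \<longleftrightarrow> x = y"
proof -
  interpret A: abelian_group A using assms module_abelian_group by blast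
  show ?thesis
    using assms by (metis A.minus_equality A.minus_minus A.a_inv_closed a_minus_def A.r_neg)
qed

lemma module_smult_closed [simp]:
  "module K A \<Longrightarrow> c \<in> carrier K \<Longrightarrow> x \<in> carrier A \<Longrightarrow> c \<odot>\<^bsub>A\<^esub> x \<in> carrier A"
  by (simp add: module.smult_closed)

lemma module_finsum_closed [simp]:
  "module K A \<Longrightarrow> (\<And>i. i \<in> I \<Longrightarrow> f i \<in> carrier A) \<Longrightarrow> finsum A f I \<in> carrier A"
  by (simp add: abelian_monoid.finsum_closed module_abelian_monoid)


subsection \<open>Linear maps\<close>

lemma is_linearI:
  assumes "\<And>x. x \<in> carrier V \<Longrightarrow> f x \<in> carrier W"
    and "\<And>x y. x \<in> carrier V \<Longrightarrow> y \<in> carrier V \<Longrightarrow> f (x \<oplus>\<^bsub>V\<^esub> y) = f x \<oplus>\<^bsub>W\<^esub> f y"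
    and "\<And>c x. c \<in> carrier K \<Longrightarrow> x \<in> carrier V \<Longrightarrow> f (c \<odot>\<^bsub>V\<^esub> x) = c \<odot>\<^bsub>W\<^esub> f x"
  shows "is_linear K V W f"
  using assms by (auto simp: is_linear_def hom_def)

lemma linear_closed: "is_linear K V W f \<Longrightarrow> x \<in> carrier V \<Longrightarrow> f x \<in> carrier W"
  by (auto simp: is_linear_def hom_def)

lemma linear_add:
  "is_linear K V W f \<Longrightarrow> x \<in> carrier V \<Longrightarrow> y \<in> carrier V \<Longrightarrow> f (x \<oplus>\<^bsub>V\<^esub> y) = f x \<oplus>\<^bsub>W\<^esub> f y"
  by (auto simp: is_linear_def hom_def)

lemma linear_smult:
  "is_linear K V W f \<Longrightarrow> c \<in> carrier K \<Longrightarrow> x \<in> carrier V \<Longrightarrow> f (c \<odot>\<^bsub>V\<^esub> x) = c \<odot>\<^bsub>W\<^esub> f x"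
  by (auto simp: is_linear_def)

lemma linear_zero:
  assumes "is_linear K V W f" "module K V" "module K W" shows "f \<zero>\<^bsub>V\<^esub> = \<zero>\<^bsub>W\<^esub>"
proof -
  have "\<zero>\<^bsub>K\<^esub> \<in> carrier K"
    by simp
  then have "f (\<zero>\<^bsub>K\<^esub> \<odot>\<^bsub>V\<^esub> \<zero>\<^bsub>V\<^esub>) = \<zero>\<^bsub>K\<^esub> \<odot>\<^bsub>W\<^esub> f \<zero>\<^bsub>V\<^esub>"
    using assms by (simp add: linear_smult)
  then show ?thesis
    using assms by (simp add: module.smult_l_null linear_closed[OF assms(1)])
qed

lemma linear_minus:
  assumes "is_linear K V W f" "module K V" "module K W" "x \<in> carrier V"
  shows "f (\<ominus>\<^bsub>V\<^esub> x) = \<ominus>\<^bsub>W\<^esub> f x"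
proof -
  interpret V: abelian_group V using assms module_abelian_group by blast
  interpret W: abelian_group W using assms module_abelian_group by blast
  have "f (\<ominus>\<^bsub>V\<^esub> x) \<oplus>\<^bsub>W\<^esub> f x = \<zero>\<^bsub>W\<^esub>"
    using linear_add[OF assms(1), of "\<ominus>\<^bsub>V\<^esub> x" x] linear_zero[OF assms(1-3)] assms(4)
    by (simp add: V.l_neg)
  then show ?thesis
    using linear_closed[OF assms(1)] assms(4) by (metis V.a_inv_closed W.minus_equality)
qed

lemma linear_diff:
  assumes "is_linear K V W f" "module K V" "module K W" "x \<in> carrier V" "y \<in> carrier V"
  shows "f (x \<ominus>\<^bsub>V\<^esub> y) = f x \<ominus>\<^bsub>W\<^esub> f y"
  using assms by (simp add: a_minus_def linear_add linear_minus)

lemma linear_finsum: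
  assumes "is_linear K V W f" "module K V" "module K W" "finite I"
    "\<And>i. i \<in> I \<Longrightarrow> g i \<in> carrier V"
  shows "f (\<Oplus>\<^bsub>V\<^esub>i\<in>I. g i) = (\<Oplus>\<^bsub>W\<^esub>i\<in>I. f (g i))"
proof -
  interpret V: abelian_monoid V using assms module_abelian_monoid by blast
  interpret W: abelian_monoid W using assms module_abelian_monoid by blast
  show ?thesis
    using assms(4,5)
  proof (induction I)
    case empty
    then show ?case using linear_zero[OF assms(1-3)] by simp
  next
    case (insert i I)
    then have "g \<in> I \<rightarrow> carrier V" "(\<lambda>i. f (g i)) \<in> I \<rightarrow> carrier W"
      using linear_closed[OF assms(1)] by auto
    then show ?case
      using insert linear_add[OF assms(1)] linear_closed[OF assms(1)] by simp
  qed
qed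

lemma linear_cong:
  assumes "is_linear K V W f" "module K V" "\<And>x. x \<in> carrier V \<Longrightarrow> g x = f x"
  shows "is_linear K V W g"
proof (rule is_linearI)
  note [simp] = assms(2,3) linear_closed[OF assms(1)]
  show "g x \<in> carrier W" if "x \<in> carrier V" for x using that by simp
  show "g (x \<oplus>\<^bsub>V\<^esub> y) = g x \<oplus>\<^bsub>W\<^esub> g y" if "x \<in> carrier V" "y \<in> carrier V" for x y
    using that by (simp add: linear_add[OF assms(1)])
  show "g (c \<odot>\<^bsub>V\<^esub> x) = c \<odot>\<^bsub>W\<^esub> g x" if "c \<in> carrier K" "x \<in> carrier V" for c x
    using that by (simp add: linear_smult[OF assms(1)])
qed

lemma linear_restrict:
  "is_linear K V W f \<Longrightarrow> module K V \<Longrightarrow> restrict f (carrier V) \<in> lin K V W"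
  by (simp add: lin_def linear_cong)

lemma linear_comp:
  "is_linear K V W g \<Longrightarrow> is_linear K U V f \<Longrightarrow> is_linear K U W (\<lambda>x. g (f x))"
  by (rule is_linearI) (auto simp: linear_closed linear_add linear_smult)

lemma linear_ident [simp]: "is_linear K V V (\<lambda>x. x)"
  by (rule is_linearI) auto

lemma linear_zero_map: "module K W \<Longrightarrow> is_linear K V W (\<lambda>x. \<zero>\<^bsub>W\<^esub>)"
  by (rule is_linearI)
    (auto simp: module.smult_r_null abelian_monoid.l_zero module_abelian_monoid)

lemma linear_plus:
  assumes "module K W" "is_linear K V W f" "is_linear K V W g"
  shows "is_linear K V W (\<lambda>x. f x \<oplus>\<^bsub>W\<^esub> g x)"
proof (rule is_linearI)
  interpret W: abelian_group W using assms module_abelian_group by blast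
  note [simp] = linear_closed[OF assms(2)] linear_closed[OF assms(3)]
    linear_add[OF assms(2)] linear_add[OF assms(3)]
    linear_smult[OF assms(2)] linear_smult[OF assms(3)]
  show "f x \<oplus>\<^bsub>W\<^esub> g x \<in> carrier W" if "x \<in> carrier V" for x using that by simp
  show "f (x \<oplus>\<^bsub>V\<^esub> y) \<oplus>\<^bsub>W\<^esub> g (x \<oplus>\<^bsub>V\<^esub> y) = f x \<oplus>\<^bsub>W\<^esub> g x \<oplus>\<^bsub>W\<^esub> (f y \<oplus>\<^bsub>W\<^esub> g y)"
    if "x \<in> carrier V" "y \<in> carrier V" for x y
    using that by (simp add: W.a_ac)
  show "f (c \<odot>\<^bsub>V\<^esub> x) \<oplus>\<^bsub>W\<^esub> g (c \<odot>\<^bsub>V\<^esub> x) = c \<odot>\<^bsub>W\<^esub> (f x \<oplus>\<^bsub>W\<^esub> g x)"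
    if "c \<in> carrier K" "x \<in> carrier V" for c x
    using that assms(1) by (simp add: module.smult_r_distr)
qed

lemma linear_scale:
  assumes "module K W" "is_linear K V W f" "c \<in> carrier K"
  shows "is_linear K V W (\<lambda>x. c \<odot>\<^bsub>W\<^esub> f x)"
proof (rule is_linearI)
  interpret W: module K W by fact
  note [simp] = linear_closed[OF assms(2)] linear_add[OF assms(2)] linear_smult[OF assms(2)]
  show "c \<odot>\<^bsub>W\<^esub> f x \<in> carrier W" if "x \<in> carrier V" for x using that assms by simp
  show "c \<odot>\<^bsub>W\<^esub> f (x \<oplus>\<^bsub>V\<^esub> y) = c \<odot>\<^bsub>W\<^esub> f x \<oplus>\<^bsub>W\<^esub> c \<odot>\<^bsub>W\<^esub> f y"
    if "x \<in> carrier V" "y \<in> carrier V" for x y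
    using that assms by (simp add: W.smult_r_distr)
  show "c \<odot>\<^bsub>W\<^esub> f (d \<odot>\<^bsub>V\<^esub> x) = d \<odot>\<^bsub>W\<^esub> (c \<odot>\<^bsub>W\<^esub> f x)"
    if "d \<in> carrier K" "x \<in> carrier V" for d x
    using that assms by (simp add: m_comm flip: W.smult_assoc1)
qed

lemma linear_diff_map:
  assumes "module K V" "module K W" "is_linear K V W f" "is_linear K V W g"
  shows "is_linear K V W (\<lambda>x. f x \<ominus>\<^bsub>W\<^esub> g x)"
proof -
  interpret W: module K W by fact
  have eq: "\<ominus>\<^bsub>W\<^esub> y = (\<ominus>\<^bsub>K\<^esub> \<one>\<^bsub>K\<^esub>) \<odot>\<^bsub>W\<^esub> y" if "y \<in> carrier W" for y
    using that by (simp add: W.smult_l_minus)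
  have "is_linear K V W (\<lambda>x. f x \<oplus>\<^bsub>W\<^esub> (\<ominus>\<^bsub>K\<^esub> \<one>\<^bsub>K\<^esub>) \<odot>\<^bsub>W\<^esub> g x)"
    by (intro linear_plus linear_scale assms) simp
  then show ?thesis
  proof (rule linear_cong[OF _ assms(1)])
    show "f x \<ominus>\<^bsub>W\<^esub> g x = f x \<oplus>\<^bsub>W\<^esub> (\<ominus>\<^bsub>K\<^esub> \<one>\<^bsub>K\<^esub>) \<odot>\<^bsub>W\<^esub> g x" if "x \<in> carrier V" for x
      using eq[OF linear_closed[OF assms(4) that]] by (simp add: a_minus_def)
  qed
qed

lemma linear_finsum_map:
  assumes "module K V" "module K W" "finite I" "\<And>i. i \<in> I \<Longrightarrow> is_linear K V W (f i)"
  shows "is_linear K V W (\<lambda>x. \<Oplus>\<^bsub>W\<^esub>i\<in>I. f i x)"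
  using assms(3,4)
proof (induction I)
  case empty
  show ?case
    by (simp add: linear_zero_map[OF assms(2)]
        abelian_monoid.finsum_empty[OF module_abelian_monoid[OF assms(2)]])
next
  case (insert i I)
  interpret W: abelian_monoid W using assms module_abelian_monoid by blast
  have "is_linear K V W (\<lambda>x. f i x \<oplus>\<^bsub>W\<^esub> (\<Oplus>\<^bsub>W\<^esub>i\<in>I. f i x))"
    using insert assms by (intro linear_plus) auto
  then show ?case
  proof (rule linear_cong[OF _ assms(1)])
    show "(\<Oplus>\<^bsub>W\<^esub>i\<in>insert i I. f i x) = f i x \<oplus>\<^bsub>W\<^esub> (\<Oplus>\<^bsub>W\<^esub>i\<in>I. f i x)"
      if "x \<in> carrier V" for x
      using insert that by (intro W.finsum_insert) (auto intro: linear_closed)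
  qed
qed

end

subsection \<open>Balanced tensor products\<close>

text \<open>Closure of both carriers under addition and under the operators, which puts the
  generating relations into the free abelian group. The operators form a bare set, so the same
  lemmas serve tensor products over \<open>K\<close> and over the non-unital rings of firm
  modules.\<close>

definition bal_ok ::
  "'r set \<Rightarrow> ('a,'x) ring_scheme \<Rightarrow> ('b,'y) ring_scheme \<Rightarrow> ('a \<Rightarrow> 'r \<Rightarrow> 'a) \<Rightarrow> ('r \<Rightarrow> 'b \<Rightarrow> 'b) \<Rightarrow> bool"
  where "bal_ok R A B ra lb \<longleftrightarrow>
    (\<forall>a\<in>carrier A. \<forall>a'\<in>carrier A. a \<oplus>\<^bsub>A\<^esub> a' \<in> carrier A) \<and>
    (\<forall>b\<in>carrier B. \<forall>b'\<in>carrier B. b \<oplus>\<^bsub>B\<^esub> b' \<in> carrier B) \<and>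
    (\<forall>a\<in>carrier A. \<forall>r\<in>R. ra a r \<in> carrier A) \<and>
    (\<forall>b\<in>carrier B. \<forall>r\<in>R. lb r b \<in> carrier B)"

lemma keys_diff_subset: "Poly_Mapping.keys x \<subseteq> S \<Longrightarrow> Poly_Mapping.keys y \<subseteq> S \<Longrightarrow>
   Poly_Mapping.keys (x - y :: 'a \<Rightarrow>\<^sub>0 int) \<subseteq> S"
  using keys_diff[of x y] by blast

lemma keys_add_subset: "Poly_Mapping.keys x \<subseteq> S \<Longrightarrow> Poly_Mapping.keys y \<subseteq> S \<Longrightarrow>
   Poly_Mapping.keys (x + y :: 'a \<Rightarrow>\<^sub>0 int) \<subseteq> S"
  using keys_add[of x y] by blast

lemma bal_relations_subset:
  assumes "bal_ok R A B ra lb"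
  shows "bal_relations R A B ra lb \<subseteq> carrier (free_Abelian_group (carrier A \<times> carrier B))"
proof
  fix x assume "x \<in> bal_relations R A B ra lb"
  then consider
      a a' b where "x = frag_of (a \<oplus>\<^bsub>A\<^esub> a', b) - frag_of (a, b) - frag_of (a', b)"
        "a \<in> carrier A" "a' \<in> carrier A" "b \<in> carrier B"
    | a b b' where "x = frag_of (a, b \<oplus>\<^bsub>B\<^esub> b') - frag_of (a, b) - frag_of (a, b')"
        "a \<in> carrier A" "b \<in> carrier B" "b' \<in> carrier B"
    | a r b where "x = frag_of (ra a r, b) - frag_of (a, lb r b)"
        "a \<in> carrier A" "r \<in> R" "b \<in> carrier B"
    unfolding bal_relations_def by blast
  then have "Poly_Mapping.keys x \<subseteq> carrier A \<times> carrier B"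
  proof cases
    case 1
    then show ?thesis unfolding 1(1)
      by (intro keys_diff_subset) (use assms in \<open>simp_all add: bal_ok_def\<close>)
  next
    case 2
    then show ?thesis unfolding 2(1)
      by (intro keys_diff_subset) (use assms in \<open>simp_all add: bal_ok_def\<close>)
  next
    case 3
    then show ?thesis unfolding 3(1)
      by (intro keys_diff_subset) (use assms in \<open>simp_all add: bal_ok_def\<close>)
  qed
  then show "x \<in> carrier (free_Abelian_group (carrier A \<times> carrier B))" by simp
qed

lemma bal_kernel_normal:
  assumes "bal_ok R A B ra lb"
  shows "bal_kernel R A B ra lb \<lhd> free_Abelian_group (carrier A \<times> carrier B)"
  unfolding bal_kernel_def
  by (intro comm_group.subgroup_imp_normal abelian_free_Abelian_group
      group.generate_is_subgroup group_free_Abelian_group bal_relations_subset assms)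

lemma bal_tensor_comm_group:
  assumes "bal_ok R A B ra lb"
  shows "comm_group (bal_tensor R A B ra lb)"
proof -
  have "subgroup (bal_kernel R A B ra lb) (free_Abelian_group (carrier A \<times> carrier B))"
    using bal_kernel_normal[OF assms] normal_imp_subgroup by blast
  then show ?thesis
    unfolding bal_tensor_def
    using comm_group.abelian_FactGroup abelian_free_Abelian_group by blast
qed

lemma bal_coset_hom:
  assumes "bal_ok R A B ra lb"
  shows "bal_coset R A B ra lb \<in>
    hom (free_Abelian_group (carrier A \<times> carrier B)) (bal_tensor R A B ra lb)"
proof -
  have "bal_coset R A B ra lb =
      (\<lambda>x. bal_kernel R A B ra lb #>\<^bsub>free_Abelian_group (carrier A \<times> carrier B)\<^esub> x)"
    by (simp add: bal_coset_def fun_eq_iff)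
  then show ?thesis
    using normal.r_coset_hom_Mod[OF bal_kernel_normal[OF assms]] by (simp add: bal_tensor_def)
qed

lemma bal_coset_surj:
  "carrier (bal_tensor R A B ra lb) =
    bal_coset R A B ra lb ` carrier (free_Abelian_group (carrier A \<times> carrier B))"
  by (auto simp: bal_tensor_def FactGroup_def RCOSETS_def bal_coset_def)

lemma bal_coset_add:
  assumes "bal_ok R A B ra lb"
    "Poly_Mapping.keys x \<subseteq> carrier A \<times> carrier B" "Poly_Mapping.keys y \<subseteq> carrier A \<times> carrier B"
  shows "bal_coset R A B ra lb (x + y) =
    bal_coset R A B ra lb x \<otimes>\<^bsub>bal_tensor R A B ra lb\<^esub> bal_coset R A B ra lb y"
  using hom_mult[OF bal_coset_hom[OF assms(1)], of x y] assms(2,3) by simp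

lemma bal_coset_eq_iff:
  assumes "bal_ok R A B ra lb"
    "Poly_Mapping.keys x \<subseteq> carrier A \<times> carrier B" "Poly_Mapping.keys y \<subseteq> carrier A \<times> carrier B"
  shows "bal_coset R A B ra lb x = bal_coset R A B ra lb y \<longleftrightarrow> x - y \<in> bal_kernel R A B ra lb"
proof -
  let ?G = "free_Abelian_group (carrier A \<times> carrier B)"
  interpret N: normal "bal_kernel R A B ra lb" ?G
    by (rule bal_kernel_normal[OF assms(1)])
  have "x \<in> carrier ?G" "y \<in> carrier ?G" "x \<otimes>\<^bsub>?G\<^esub> inv\<^bsub>?G\<^esub> y = x - y"
    using assms(2,3) by auto
  moreover have "bal_kernel R A B ra lb #>\<^bsub>?G\<^esub> x = bal_kernel R A B ra lb #>\<^bsub>?G\<^esub> y \<longleftrightarrow>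
      x \<in> bal_kernel R A B ra lb #>\<^bsub>?G\<^esub> y" if "x \<in> carrier ?G" "y \<in> carrier ?G"
    using that N.rcos_self N.repr_independence N.subgroup_axioms by blast
  ultimately show ?thesis
    using N.rcos_module[of y x] by (simp add: bal_coset_def)
qed

lemma bal_coset_addl:
  assumes ok: "bal_ok R A B ra lb" and ab: "a \<in> carrier A" "a' \<in> carrier A" "b \<in> carrier B"
  shows "bal_coset R A B ra lb (frag_of (a \<oplus>\<^bsub>A\<^esub> a', b)) =
    bal_coset R A B ra lb (frag_of (a, b)) \<otimes>\<^bsub>bal_tensor R A B ra lb\<^esub> bal_coset R A B ra lb (frag_of (a', b))"
proof -
  let ?x = "frag_of (a \<oplus>\<^bsub>A\<^esub> a', b)" and ?y = "frag_of (a, b)" and ?z = "frag_of (a', b)"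
  have keys: "Poly_Mapping.keys ?x \<subseteq> carrier A \<times> carrier B" "Poly_Mapping.keys ?y \<subseteq> carrier A \<times> carrier B"
    "Poly_Mapping.keys ?z \<subseteq> carrier A \<times> carrier B"
    using ok ab by (auto simp: bal_ok_def)
  have "?x - ?y - ?z \<in> bal_relations R A B ra lb"
    unfolding bal_relations_def using ab by blast
  then have "?x - (?y + ?z) \<in> bal_kernel R A B ra lb"
    unfolding bal_kernel_def by (simp add: diff_diff_eq generate.incl)
  then have "bal_coset R A B ra lb ?x = bal_coset R A B ra lb (?y + ?z)"
    using bal_coset_eq_iff[OF ok keys(1) keys_add_subset[OF keys(2,3)]] by simp
  then show ?thesis using bal_coset_add[OF ok keys(2,3)] by simp
qed

lemma bal_coset_addr:
  assumes ok: "bal_ok R A B ra lb" and ab: "a \<in> carrier A" "b \<in> carrier B" "b' \<in> carrier B"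
  shows "bal_coset R A B ra lb (frag_of (a, b \<oplus>\<^bsub>B\<^esub> b')) =
    bal_coset R A B ra lb (frag_of (a, b)) \<otimes>\<^bsub>bal_tensor R A B ra lb\<^esub> bal_coset R A B ra lb (frag_of (a, b'))"
proof -
  let ?x = "frag_of (a, b \<oplus>\<^bsub>B\<^esub> b')" and ?y = "frag_of (a, b)" and ?z = "frag_of (a, b')"
  have keys: "Poly_Mapping.keys ?x \<subseteq> carrier A \<times> carrier B" "Poly_Mapping.keys ?y \<subseteq> carrier A \<times> carrier B"
    "Poly_Mapping.keys ?z \<subseteq> carrier A \<times> carrier B"
    using ok ab by (auto simp: bal_ok_def)
  have "?x - ?y - ?z \<in> bal_relations R A B ra lb"
    unfolding bal_relations_def using ab by blast
  then have "?x - (?y + ?z) \<in> bal_kernel R A B ra lb"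
    unfolding bal_kernel_def by (simp add: diff_diff_eq generate.incl)
  then have "bal_coset R A B ra lb ?x = bal_coset R A B ra lb (?y + ?z)"
    using bal_coset_eq_iff[OF ok keys(1) keys_add_subset[OF keys(2,3)]] by simp
  then show ?thesis using bal_coset_add[OF ok keys(2,3)] by simp
qed

lemma bal_coset_balanced:
  assumes ok: "bal_ok R A B ra lb" and ab: "a \<in> carrier A" "r \<in> R" "b \<in> carrier B"
  shows "bal_coset R A B ra lb (frag_of (ra a r, b)) = bal_coset R A B ra lb (frag_of (a, lb r b))"
proof -
  have "frag_of (ra a r, b) - frag_of (a, lb r b) \<in> bal_relations R A B ra lb"
    unfolding bal_relations_def using ab by blast
  then show ?thesis
    using bal_coset_eq_iff[OF ok, of "frag_of (ra a r, b)" "frag_of (a, lb r b)"] ok ab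
    by (auto simp: bal_ok_def bal_kernel_def intro: generate.incl)
qed

lemma bal_coset_closed:
  assumes "a \<in> carrier A" "b \<in> carrier B"
  shows "bal_coset R A B ra lb (frag_of (a, b)) \<in> carrier (bal_tensor R A B ra lb)"
  using assms by (auto simp: bal_coset_surj)

text \<open>The step goes through differences, following the induction rule for free abelian groups,
  whose elements have integer coefficients of either sign.\<close>

lemma bal_tensor_induct:
  assumes ok: "bal_ok R A B ra lb" and t: "t \<in> carrier (bal_tensor R A B ra lb)"
    and zero: "P \<one>\<^bsub>bal_tensor R A B ra lb\<^esub>"
    and frag: "\<And>a b. a \<in> carrier A \<Longrightarrow> b \<in> carrier B \<Longrightarrow> P (bal_coset R A B ra lb (frag_of (a, b)))"
    and diff: "\<And>s t. s \<in> carrier (bal_tensor R A B ra lb) \<Longrightarrow> t \<in> carrier (bal_tensor R A B ra lb) \<Longrightarrow>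
      P s \<Longrightarrow> P t \<Longrightarrow> P (s \<otimes>\<^bsub>bal_tensor R A B ra lb\<^esub> inv\<^bsub>bal_tensor R A B ra lb\<^esub> t)"
  shows "P t"
proof -
  let ?G = "free_Abelian_group (carrier A \<times> carrier B)" and ?c = "bal_coset R A B ra lb"
    and ?T = "bal_tensor R A B ra lb"
  interpret h: group_hom ?G ?T ?c
    using bal_coset_hom[OF ok] bal_tensor_comm_group[OF ok]
    by (simp add: group_hom_def group_hom_axioms_def comm_group.axioms)
  obtain x where x: "Poly_Mapping.keys x \<subseteq> carrier A \<times> carrier B" "t = ?c x"
    using t by (auto simp: bal_coset_surj)
  have "P (?c x)"
    using x(1)
  proof (rule free_Abelian_group_induct)
    show "P (?c 0)" using zero h.hom_one by simp
  next
    fix x y assume xy: "Poly_Mapping.keys x \<subseteq> carrier A \<times> carrier B"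
      "Poly_Mapping.keys y \<subseteq> carrier A \<times> carrier B" "P (?c x)" "P (?c y)"
    then have c: "x \<in> carrier ?G" "y \<in> carrier ?G" by auto
    have "?c (x - y) = ?c (x \<otimes>\<^bsub>?G\<^esub> inv\<^bsub>?G\<^esub> y)" using xy by simp
    also have "\<dots> = ?c x \<otimes>\<^bsub>?T\<^esub> inv\<^bsub>?T\<^esub> ?c y"
      using c by (simp only: h.hom_mult h.inv_closed h.hom_inv h.G.inv_closed)
    finally show "P (?c (x - y))" using diff[of "?c x" "?c y"] c xy h.hom_closed by metis
  qed (use frag in auto)
  then show ?thesis using x by simp
qed

text \<open>The map that \<open>\<beta>\<close> induces on the free abelian group kills the
  generating relations, hence the subgroup they generate, and so descends to the quotient.\<close>

lemma bal_tensor_lift: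
  assumes ok: "bal_ok R A B ra lb" and W: "comm_group W"
    and closed: "\<And>a b. a \<in> carrier A \<Longrightarrow> b \<in> carrier B \<Longrightarrow> \<beta> a b \<in> carrier W"
    and addl: "\<And>a a' b. a \<in> carrier A \<Longrightarrow> a' \<in> carrier A \<Longrightarrow> b \<in> carrier B \<Longrightarrow>
       \<beta> (a \<oplus>\<^bsub>A\<^esub> a') b = \<beta> a b \<otimes>\<^bsub>W\<^esub> \<beta> a' b"
    and addr: "\<And>a b b'. a \<in> carrier A \<Longrightarrow> b \<in> carrier B \<Longrightarrow> b' \<in> carrier B \<Longrightarrow>
       \<beta> a (b \<oplus>\<^bsub>B\<^esub> b') = \<beta> a b \<otimes>\<^bsub>W\<^esub> \<beta> a b'"
    and bal: "\<And>a r b. a \<in> carrier A \<Longrightarrow> r \<in> R \<Longrightarrow> b \<in> carrier B \<Longrightarrow> \<beta> (ra a r) b = \<beta> a (lb r b)"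
  obtains h where "h \<in> hom (bal_tensor R A B ra lb) W"
    "\<And>a b. a \<in> carrier A \<Longrightarrow> b \<in> carrier B \<Longrightarrow> h (bal_coset R A B ra lb (frag_of (a, b))) = \<beta> a b"
proof -
  let ?G = "free_Abelian_group (carrier A \<times> carrier B)" and ?c = "bal_coset R A B ra lb"
    and ?N = "bal_kernel R A B ra lb"
  interpret W: comm_group W by fact
  obtain g where g: "g \<in> hom ?G W" "\<And>x. x \<in> carrier A \<times> carrier B \<Longrightarrow> g (frag_of x) = case_prod \<beta> x"
    using W.free_Abelian_group_universal[of "case_prod \<beta>" "carrier A \<times> carrier B"] closed
    by (metis (no_types, lifting) SigmaE case_prod_conv image_subsetI)
  interpret g: group_hom ?G W g
    using g W.is_group by (simp add: group_hom_def group_hom_axioms_def)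
  have gdiff: "g (x - y) = g x \<otimes>\<^bsub>W\<^esub> inv\<^bsub>W\<^esub> g y"
    if "Poly_Mapping.keys x \<subseteq> carrier A \<times> carrier B" "Poly_Mapping.keys y \<subseteq> carrier A \<times> carrier B" for x y
    using g.hom_mult[of x "inv\<^bsub>?G\<^esub> y"] g.hom_inv[of y] that g.G.inv_closed[of y] by auto
  have rel: "x \<in> kernel ?G W g" if "x \<in> bal_relations R A B ra lb" for x
  proof -
    have ok': "\<And>a a'. a \<in> carrier A \<Longrightarrow> a' \<in> carrier A \<Longrightarrow> a \<oplus>\<^bsub>A\<^esub> a' \<in> carrier A"
      "\<And>a a'. a \<in> carrier B \<Longrightarrow> a' \<in> carrier B \<Longrightarrow> a \<oplus>\<^bsub>B\<^esub> a' \<in> carrier B"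
      "\<And>a r. a \<in> carrier A \<Longrightarrow> r \<in> R \<Longrightarrow> ra a r \<in> carrier A"
      "\<And>b r. b \<in> carrier B \<Longrightarrow> r \<in> R \<Longrightarrow> lb r b \<in> carrier B"
      using ok by (auto simp: bal_ok_def)
    \<comment> \<open>The shape that an additivity relation takes under \<open>g\<close>.\<close>
    have 1: "u \<otimes>\<^bsub>W\<^esub> v \<otimes>\<^bsub>W\<^esub> inv\<^bsub>W\<^esub> u \<otimes>\<^bsub>W\<^esub> inv\<^bsub>W\<^esub> v = \<one>\<^bsub>W\<^esub>" if "u \<in> carrier W" "v \<in> carrier W" for u v
    proof -
      have "u \<otimes>\<^bsub>W\<^esub> v \<otimes>\<^bsub>W\<^esub> inv\<^bsub>W\<^esub> u \<otimes>\<^bsub>W\<^esub> inv\<^bsub>W\<^esub> v = (u \<otimes>\<^bsub>W\<^esub> v) \<otimes>\<^bsub>W\<^esub> inv\<^bsub>W\<^esub> (u \<otimes>\<^bsub>W\<^esub> v)"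
        using that by (simp add: W.inv_mult W.m_assoc del: W.r_inv)
      then show ?thesis using that by simp
    qed
    have "x \<in> carrier ?G" using bal_relations_subset[OF ok] that by blast
    moreover have "g x = \<one>\<^bsub>W\<^esub>"
      using that unfolding bal_relations_def
      by (auto simp: gdiff g(2) ok' closed addl addr bal 1 keys_diff_subset)
    ultimately show ?thesis by (simp add: kernel_def)
  qed
  have "?N \<subseteq> kernel ?G W g"
    unfolding bal_kernel_def
    by (intro g.G.generate_subgroup_incl g.subgroup_kernel) (use rel in auto)
  then obtain h where h: "h \<in> hom (?G Mod ?N) W" "\<And>x. x \<in> carrier ?G \<Longrightarrow> h (?N #>\<^bsub>?G\<^esub> x) = g x"
    using g.FactGroup_universal_kernel[OF bal_kernel_normal[OF ok]] by metis
  show thesis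
  proof (rule that)
    show "h \<in> hom (bal_tensor R A B ra lb) W" using h by (simp add: bal_tensor_def)
    show "h (?c (frag_of (a, b))) = \<beta> a b" if "a \<in> carrier A" "b \<in> carrier B" for a b
      using h(2)[of "frag_of (a, b)"] g(2) that by (simp add: bal_coset_def)
  qed
qed

subsection \<open>Tensor products over the base field\<close>

definition bilinear ::
  "('k,'z) ring_scheme \<Rightarrow> ('k,'a,'x) module_scheme \<Rightarrow> ('k,'b,'y) module_scheme \<Rightarrow>
   ('k,'w,'v) module_scheme \<Rightarrow> ('a \<Rightarrow> 'b \<Rightarrow> 'w) \<Rightarrow> bool"
  where "bilinear K A B W \<beta> \<longleftrightarrow>
    (\<forall>a\<in>carrier A. is_linear K B W (\<beta> a)) \<and> (\<forall>b\<in>carrier B. is_linear K A W (\<lambda>a. \<beta> a b))"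

context base_field
begin

lemma tens_ok:
  "module K A \<Longrightarrow> module K B \<Longrightarrow>
   bal_ok (carrier K) A B (\<lambda>a c. c \<odot>\<^bsub>A\<^esub> a) (\<lambda>c b. c \<odot>\<^bsub>B\<^esub> b)"
  by (simp add: bal_ok_def)

abbreviation (input) "tgrp A B \<equiv> bal_tensor (carrier K) A B (\<lambda>a c. c \<odot>\<^bsub>A\<^esub> a) (\<lambda>c b. c \<odot>\<^bsub>B\<^esub> b)"

lemma tens_simps:
  "carrier (tens K A B) = carrier (tgrp A B)"
  "\<zero>\<^bsub>tens K A B\<^esub> = \<one>\<^bsub>tgrp A B\<^esub>"
  "s \<oplus>\<^bsub>tens K A B\<^esub> t = s \<otimes>\<^bsub>tgrp A B\<^esub> t"
  by (simp_all add: tens_def Let_def)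

lemma tens_abelian_group:
  assumes "module K A" "module K B"
  shows "abelian_group (tens K A B)"
proof -
  interpret T: comm_group "tgrp A B"
    by (rule bal_tensor_comm_group[OF tens_ok[OF assms]])
  show ?thesis
  proof (rule abelian_groupI)
    show "\<exists>y\<in>carrier (tens K A B). y \<oplus>\<^bsub>tens K A B\<^esub> x = \<zero>\<^bsub>tens K A B\<^esub>" if "x \<in> carrier (tens K A B)" for x
      using that by (metis T.inv_closed T.l_inv tens_simps)
  qed (simp_all add: tens_simps T.m_ac)
qed

lemma tens_inv:
  assumes "module K A" "module K B" "t \<in> carrier (tens K A B)"
  shows "\<ominus>\<^bsub>tens K A B\<^esub> t = inv\<^bsub>tgrp A B\<^esub> t"
proof -
  interpret T: comm_group "tgrp A B"
    by (rule bal_tensor_comm_group[OF tens_ok[OF assms(1,2)]])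
  interpret A: abelian_group "tens K A B" using tens_abelian_group assms by blast
  show ?thesis
    using assms(3) A.minus_equality[of "inv\<^bsub>tgrp A B\<^esub> t" t] by (simp add: tens_simps)
qed

text \<open>The expression \<open>c \<odot> a \<otimes> b\<close> is biadditive in \<open>a\<close>
  and \<open>b\<close>, and balanced because \<open>K\<close> is commutative; so scaling
  representatives respects cosets. This is needed because \<open>smult\<close> of
  \<open>tens\<close> is defined through representatives.\<close>

lemma frag_of_scale:
  assumes "module K A" "module K B" "c \<in> carrier K"
  obtains h where "h \<in> hom (tgrp A B) (tgrp A B)"
    "\<And>x. Poly_Mapping.keys x \<subseteq> carrier A \<times> carrier B \<Longrightarrow>
      h (tens_coset K A B x) = tens_coset K A B (frag_extend (\<lambda>(a, b). frag_of (c \<odot>\<^bsub>A\<^esub> a, b)) x)"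
    "\<And>x. Poly_Mapping.keys x \<subseteq> carrier A \<times> carrier B \<Longrightarrow>
      Poly_Mapping.keys (frag_extend (\<lambda>(a, b). frag_of (c \<odot>\<^bsub>A\<^esub> a, b)) x) \<subseteq> carrier A \<times> carrier B"
proof -
  let ?G = "free_Abelian_group (carrier A \<times> carrier B)" and ?c = "tens_coset K A B"
  let ?e = "frag_extend (\<lambda>(a, b). frag_of (c \<odot>\<^bsub>A\<^esub> a, b))"
  let ?T = "tgrp A B"
  note ok = tens_ok[OF assms(1,2)]
  interpret T: comm_group ?T by (rule bal_tensor_comm_group[OF ok])
  interpret A: module K A by fact
  interpret B: module K B by fact
  have hc: "?c \<in> hom ?G ?T"
    using bal_coset_hom[OF ok] by (simp add: tens_coset_def[abs_def])
  interpret c: group_hom ?G ?T ?c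
    using hc T.is_group by (simp add: group_hom_def group_hom_axioms_def)
  have cdiff: "?c (x - y) = ?c x \<otimes>\<^bsub>?T\<^esub> inv\<^bsub>?T\<^esub> ?c y"
    if "Poly_Mapping.keys x \<subseteq> carrier A \<times> carrier B" "Poly_Mapping.keys y \<subseteq> carrier A \<times> carrier B" for x y
    using c.hom_mult[of x "inv\<^bsub>?G\<^esub> y"] c.hom_inv[of y] that c.G.inv_closed[of y] by auto
  have cadd: "?c (x + y) = ?c x \<otimes>\<^bsub>?T\<^esub> ?c y"
    if "Poly_Mapping.keys x \<subseteq> carrier A \<times> carrier B" "Poly_Mapping.keys y \<subseteq> carrier A \<times> carrier B" for x y
    using c.hom_mult[of x y] that by auto
  define \<beta> where "\<beta> = (\<lambda>a b. ?c (frag_of (c \<odot>\<^bsub>A\<^esub> a, b)))"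
  obtain h where h: "h \<in> hom ?T ?T"
    "\<And>a b. a \<in> carrier A \<Longrightarrow> b \<in> carrier B \<Longrightarrow> h (?c (frag_of (a, b))) = ?c (frag_of (c \<odot>\<^bsub>A\<^esub> a, b))"
  proof (rule bal_tensor_lift[OF ok T.comm_group_axioms, of \<beta>])
    show "\<beta> a b \<in> carrier ?T" if "a \<in> carrier A" "b \<in> carrier B" for a b
      using c.hom_closed[of "frag_of (c \<odot>\<^bsub>A\<^esub> a, b)"] that assms(3) by (simp add: \<beta>_def)
    show "\<beta> (a \<oplus>\<^bsub>A\<^esub> a') b = \<beta> a b \<otimes>\<^bsub>?T\<^esub> \<beta> a' b" if "a \<in> carrier A" "a' \<in> carrier A" "b \<in> carrier B" for a a' b
      using bal_coset_addl[OF ok, of "c \<odot>\<^bsub>A\<^esub> a" "c \<odot>\<^bsub>A\<^esub> a'" b] that assms(3)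
      by (simp add: \<beta>_def A.smult_r_distr tens_coset_def)
    show "\<beta> a (b \<oplus>\<^bsub>B\<^esub> b') = \<beta> a b \<otimes>\<^bsub>?T\<^esub> \<beta> a b'" if "a \<in> carrier A" "b \<in> carrier B" "b' \<in> carrier B" for a b b'
      using bal_coset_addr[OF ok, of "c \<odot>\<^bsub>A\<^esub> a" b b'] that assms(3)
      by (simp add: \<beta>_def tens_coset_def)
    show "\<beta> (r \<odot>\<^bsub>A\<^esub> a) b = \<beta> a (r \<odot>\<^bsub>B\<^esub> b)" if "a \<in> carrier A" "r \<in> carrier K" "b \<in> carrier B" for a r b
    proof -
      have "c \<odot>\<^bsub>A\<^esub> (r \<odot>\<^bsub>A\<^esub> a) = r \<odot>\<^bsub>A\<^esub> (c \<odot>\<^bsub>A\<^esub> a)"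
        using that assms(3) by (simp add: m_comm flip: A.smult_assoc1)
      moreover have "?c (frag_of (r \<odot>\<^bsub>A\<^esub> (c \<odot>\<^bsub>A\<^esub> a), b)) = ?c (frag_of (c \<odot>\<^bsub>A\<^esub> a, r \<odot>\<^bsub>B\<^esub> b))"
        using bal_coset_balanced[OF ok, of "c \<odot>\<^bsub>A\<^esub> a" r b] that assms(3)
        by (simp add: tens_coset_def)
      ultimately show ?thesis by (simp add: \<beta>_def)
    qed
  qed (auto simp: \<beta>_def tens_coset_def)
  have e: "Poly_Mapping.keys (?e x) \<subseteq> carrier A \<times> carrier B \<and> h (?c x) = ?c (?e x)"
    if "Poly_Mapping.keys x \<subseteq> carrier A \<times> carrier B" for x
    using that
  proof (rule free_Abelian_group_induct)
    have "?c 0 = \<one>\<^bsub>?T\<^esub>" using c.hom_one by simp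
    then show "Poly_Mapping.keys (?e 0) \<subseteq> carrier A \<times> carrier B \<and> h (?c 0) = ?c (?e 0)"
      using hom_one[OF h(1) T.is_group T.is_group] by simp
  next
    fix x y
    assume xy: "Poly_Mapping.keys x \<subseteq> carrier A \<times> carrier B" "Poly_Mapping.keys y \<subseteq> carrier A \<times> carrier B"
      "Poly_Mapping.keys (?e x) \<subseteq> carrier A \<times> carrier B \<and> h (?c x) = ?c (?e x)"
      "Poly_Mapping.keys (?e y) \<subseteq> carrier A \<times> carrier B \<and> h (?c y) = ?c (?e y)"
    interpret hh: group_hom ?T ?T h
      using h T.is_group by (simp add: group_hom_def group_hom_axioms_def)
    have cc: "?c x \<in> carrier ?T" "?c y \<in> carrier ?T" using xy c.hom_closed by auto
    have "h (?c (x - y)) = ?c (?e x) \<otimes>\<^bsub>?T\<^esub> inv\<^bsub>?T\<^esub> ?c (?e y)"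
      using xy cc by (simp add: cdiff)
    then show "Poly_Mapping.keys (?e (x - y)) \<subseteq> carrier A \<times> carrier B \<and> h (?c (x - y)) = ?c (?e (x - y))"
      using xy by (simp add: frag_extend_diff cdiff keys_diff_subset)
  next
    show "Poly_Mapping.keys (?e (frag_of a)) \<subseteq> carrier A \<times> carrier B \<and>
      h (?c (frag_of a)) = ?c (?e (frag_of a))" if "a \<in> carrier A \<times> carrier B" for a
      using that h(2) assms(3) by auto
  qed
  show thesis using that[OF h(1)] e by blast
qed

lemma tens_scale:
  assumes "module K A" "module K B" "c \<in> carrier K"
  shows "(\<lambda>t. c \<odot>\<^bsub>tens K A B\<^esub> t) \<in> hom (tgrp A B) (tgrp A B)"
    and "\<And>a b. a \<in> carrier A \<Longrightarrow> b \<in> carrier B \<Longrightarrow> c \<odot>\<^bsub>tens K A B\<^esub> pure K A B a b = pure K A B (c \<odot>\<^bsub>A\<^esub> a) b"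
proof -
  let ?e = "frag_extend (\<lambda>(a, b). frag_of (c \<odot>\<^bsub>A\<^esub> a, b))" and ?T = "tgrp A B"
  let ?G = "free_Abelian_group (carrier A \<times> carrier B)"
  note ok = tens_ok[OF assms(1,2)]
  interpret N: normal "bal_kernel (carrier K) A B (\<lambda>a c. c \<odot>\<^bsub>A\<^esub> a) (\<lambda>c b. c \<odot>\<^bsub>B\<^esub> b)" ?G
    by (rule bal_kernel_normal[OF ok])
  obtain h where h: "h \<in> hom ?T ?T"
    "\<And>x. Poly_Mapping.keys x \<subseteq> carrier A \<times> carrier B \<Longrightarrow> h (tens_coset K A B x) = tens_coset K A B (?e x)"
    using frag_of_scale[OF assms] by metis
  have eq: "c \<odot>\<^bsub>tens K A B\<^esub> tens_coset K A B x = h (tens_coset K A B x)"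
    if x: "Poly_Mapping.keys x \<subseteq> carrier A \<times> carrier B" for x
  proof -
    have self: "x \<in> tens_coset K A B x"
      using N.rcos_self[of x] N.subgroup_axioms x by (simp add: tens_coset_def bal_coset_def)
    \<comment> \<open>Every representative scales into the same coset, so the union in the
      definition of \<open>smult\<close> collapses to a single set.\<close>
    have "tens_coset K A B (?e y) = h (tens_coset K A B x)" if "y \<in> tens_coset K A B x" for y
    proof -
      have "y \<in> carrier ?G"
      proof -
        have "tens_coset K A B x \<subseteq> carrier ?G"
          unfolding tens_coset_def bal_coset_def
          by (rule monoid.r_coset_subset_G[OF group.is_monoid[OF group_free_Abelian_group] N.subset])
            (use x in simp)
        then show ?thesis using that by blast
      qed
      moreover have "tens_coset K A B y = tens_coset K A B x"
        using that x N.repr_independence[where x = x and y = y] N.subgroup_axioms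
        by (simp add: tens_coset_def bal_coset_def)
      ultimately show ?thesis using h(2)[of y] by simp
    qed
    then have "(\<Union>y\<in>tens_coset K A B x. tens_coset K A B (?e y)) = h (tens_coset K A B x)"
      using self by auto
    then show ?thesis by (simp add: tens_def Let_def)
  qed
  have eq': "c \<odot>\<^bsub>tens K A B\<^esub> t = h t" if "t \<in> carrier ?T" for t
    using that eq by (auto simp: bal_coset_surj tens_coset_def)
  then show "(\<lambda>t. c \<odot>\<^bsub>tens K A B\<^esub> t) \<in> hom ?T ?T"
    using h(1) bal_tensor_comm_group[OF ok] by (auto simp: hom_def comm_group_def comm_monoid_def monoid.m_closed Pi_iff)
  show "c \<odot>\<^bsub>tens K A B\<^esub> pure K A B a b = pure K A B (c \<odot>\<^bsub>A\<^esub> a) b" if "a \<in> carrier A" "b \<in> carrier B" for a b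
    using eq[of "frag_of (a, b)"] h(2)[of "frag_of (a, b)"] that by (simp add: pure_def)
qed

lemma tens_module [simp]:
  assumes "module K A" "module K B"
  shows "module K (tens K A B)"
proof -
  let ?T = "tgrp A B"
  note ok = tens_ok[OF assms]
  interpret T: comm_group ?T by (rule bal_tensor_comm_group[OF ok])
  interpret A: module K A by fact
  interpret B: module K B by fact
  have closed: "c \<odot>\<^bsub>tens K A B\<^esub> t \<in> carrier ?T" if "c \<in> carrier K" "t \<in> carrier ?T" for c t
    using tens_scale(1)[OF assms that(1)] that(2) by (auto simp: hom_def)
  have hom: "group_hom ?T ?T (\<lambda>t. c \<odot>\<^bsub>tens K A B\<^esub> t)" if "c \<in> carrier K" for c
    using tens_scale(1)[OF assms that] T.is_group by (simp add: group_hom_def group_hom_axioms_def)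
  have pure: "pure K A B a b = bal_coset (carrier K) A B (\<lambda>a c. c \<odot>\<^bsub>A\<^esub> a) (\<lambda>c b. c \<odot>\<^bsub>B\<^esub> b) (frag_of (a, b))" for a b
    by (simp add: pure_def tens_coset_def)
  have pureT: "pure K A B a b \<in> carrier ?T" if "a \<in> carrier A" "b \<in> carrier B" for a b
    unfolding pure using that by (rule bal_coset_closed)
  \<comment> \<open>Module axioms that compare two endomorphisms of the tensor group are thereby
    reduced to pure tensors.\<close>
  have eq: "g t = h t" if g: "group_hom ?T ?T g" and h: "group_hom ?T ?T h" and t: "t \<in> carrier ?T"
    and gh: "\<And>a b. a \<in> carrier A \<Longrightarrow> b \<in> carrier B \<Longrightarrow> g (pure K A B a b) = h (pure K A B a b)" for g h t
  proof (rule bal_tensor_induct[OF ok t])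
    interpret g: group_hom ?T ?T g by fact
    interpret h: group_hom ?T ?T h by fact
    show "g \<one>\<^bsub>?T\<^esub> = h \<one>\<^bsub>?T\<^esub>" by simp
    show "g (s \<otimes>\<^bsub>?T\<^esub> inv\<^bsub>?T\<^esub> t) = h (s \<otimes>\<^bsub>?T\<^esub> inv\<^bsub>?T\<^esub> t)"
      if "s \<in> carrier ?T" "t \<in> carrier ?T" "g s = h s" "g t = h t" for s t
      using that by simp
  qed (use gh in \<open>simp add: pure\<close>)
  have mhom: "group_hom ?T ?T (\<lambda>t. f t \<otimes>\<^bsub>?T\<^esub> g t)" if "group_hom ?T ?T f" "group_hom ?T ?T g" for f g
  proof -
    interpret f: group_hom ?T ?T f by fact
    interpret g: group_hom ?T ?T g by fact
    show ?thesis by unfold_locales (auto simp: hom_def T.m_ac)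
  qed
  have chom: "group_hom ?T ?T (\<lambda>t. f (g t))" if "group_hom ?T ?T f" "group_hom ?T ?T g" for f g
  proof -
    interpret f: group_hom ?T ?T f by fact
    interpret g: group_hom ?T ?T g by fact
    show ?thesis by unfold_locales (auto simp: hom_def)
  qed
  have ihom: "group_hom ?T ?T (\<lambda>t. t)" by unfold_locales (auto simp: hom_def)
  show ?thesis
  proof (rule moduleI)
    show "cring K" by (rule is_cring)
    show "abelian_group (tens K A B)" by (rule tens_abelian_group[OF assms])
    show "c \<odot>\<^bsub>tens K A B\<^esub> t \<in> carrier (tens K A B)" if "c \<in> carrier K" "t \<in> carrier (tens K A B)" for c t
      using closed that by (simp add: tens_simps)
    show "(c \<oplus> d) \<odot>\<^bsub>tens K A B\<^esub> t = c \<odot>\<^bsub>tens K A B\<^esub> t \<oplus>\<^bsub>tens K A B\<^esub> d \<odot>\<^bsub>tens K A B\<^esub> t"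
      if "c \<in> carrier K" "d \<in> carrier K" "t \<in> carrier (tens K A B)" for c d t
      unfolding tens_simps
    proof (rule eq[OF hom mhom[OF hom hom]])
      show "(c \<oplus> d) \<odot>\<^bsub>tens K A B\<^esub> pure K A B a b =
          (c \<odot>\<^bsub>tens K A B\<^esub> pure K A B a b) \<otimes>\<^bsub>?T\<^esub> (d \<odot>\<^bsub>tens K A B\<^esub> pure K A B a b)"
        if "a \<in> carrier A" "b \<in> carrier B" for a b
        using that \<open>c \<in> carrier K\<close> \<open>d \<in> carrier K\<close>
          bal_coset_addl[OF ok, of "c \<odot>\<^bsub>A\<^esub> a" "d \<odot>\<^bsub>A\<^esub> a" b]
        by (simp add: tens_scale(2)[OF assms] A.smult_l_distr flip: pure)
    qed (use that in \<open>simp_all add: tens_simps\<close>)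
    show "c \<odot>\<^bsub>tens K A B\<^esub> (s \<oplus>\<^bsub>tens K A B\<^esub> t) = c \<odot>\<^bsub>tens K A B\<^esub> s \<oplus>\<^bsub>tens K A B\<^esub> c \<odot>\<^bsub>tens K A B\<^esub> t"
      if "c \<in> carrier K" "s \<in> carrier (tens K A B)" "t \<in> carrier (tens K A B)" for c s t
      using that group_hom.hom_mult[OF hom, of c s t] by (simp add: tens_simps)
    show "(c \<otimes> d) \<odot>\<^bsub>tens K A B\<^esub> t = c \<odot>\<^bsub>tens K A B\<^esub> (d \<odot>\<^bsub>tens K A B\<^esub> t)"
      if "c \<in> carrier K" "d \<in> carrier K" "t \<in> carrier (tens K A B)" for c d t
    proof (rule eq[OF hom chom[OF hom hom]])
      show "(c \<otimes> d) \<odot>\<^bsub>tens K A B\<^esub> pure K A B a b = c \<odot>\<^bsub>tens K A B\<^esub> (d \<odot>\<^bsub>tens K A B\<^esub> pure K A B a b)"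
        if "a \<in> carrier A" "b \<in> carrier B" for a b
        using that \<open>c \<in> carrier K\<close> \<open>d \<in> carrier K\<close>
        by (simp add: tens_scale(2)[OF assms] A.smult_assoc1)
    qed (use that in \<open>simp_all add: tens_simps\<close>)
    show "\<one> \<odot>\<^bsub>tens K A B\<^esub> t = t" if "t \<in> carrier (tens K A B)" for t
    proof (rule eq[OF hom ihom])
      show "\<one> \<odot>\<^bsub>tens K A B\<^esub> pure K A B a b = pure K A B a b"
        if "a \<in> carrier A" "b \<in> carrier B" for a b
        using that by (simp add: tens_scale(2)[OF assms])
    qed (use that in \<open>simp_all add: tens_simps\<close>)
  qed
qed

lemma pure_closed [simp]:
  "a \<in> carrier A \<Longrightarrow> b \<in> carrier B \<Longrightarrow> pure K A B a b \<in> carrier (tens K A B)"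
  by (simp add: pure_def tens_coset_def tens_simps bal_coset_closed)

lemma bilinear_pure: "module K A \<Longrightarrow> module K B \<Longrightarrow> bilinear K A B (tens K A B) (pure K A B)"
  unfolding bilinear_def
  by (intro conjI ballI is_linearI)
    (simp_all add: tens_scale(2), simp_all add: pure_def tens_coset_def tens_simps
      bal_coset_addl[OF tens_ok] bal_coset_addr[OF tens_ok] bal_coset_balanced[OF tens_ok, symmetric])

text \<open>Since \<open>- (a \<otimes> b) = (- a) \<otimes> b\<close>, signs are absorbed into pure
  tensors and their sums exhaust the tensor product.\<close>

lemma tens_induct [consumes 3, case_names pure add]:
  assumes "module K A" "module K B" "t \<in> carrier (tens K A B)"
    and pure: "\<And>a b. a \<in> carrier A \<Longrightarrow> b \<in> carrier B \<Longrightarrow> P (pure K A B a b)"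
    and add: "\<And>s t. s \<in> carrier (tens K A B) \<Longrightarrow> t \<in> carrier (tens K A B) \<Longrightarrow> P s \<Longrightarrow> P t \<Longrightarrow>
      P (s \<oplus>\<^bsub>tens K A B\<^esub> t)"
  shows "P t"
proof -
  interpret T: module K "tens K A B" using assms by simp
  note bil = bilinear_pure[OF assms(1,2), unfolded bilinear_def]
  have neg: "\<ominus>\<^bsub>tens K A B\<^esub> pure K A B a b = pure K A B (\<ominus>\<^bsub>A\<^esub> a) b"
    if "a \<in> carrier A" "b \<in> carrier B" for a b
    using linear_minus[of A "tens K A B" "\<lambda>a. pure K A B a b"] bil assms that by simp
  have zero: "\<zero>\<^bsub>tens K A B\<^esub> = pure K A B \<zero>\<^bsub>A\<^esub> \<zero>\<^bsub>B\<^esub>"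
    using linear_zero[of A "tens K A B" "\<lambda>a. pure K A B a \<zero>\<^bsub>B\<^esub>"] bil assms by simp
  \<comment> \<open>Proved for \<open>t\<close> and its negative together, since the underlying rule
    \<open>bal_tensor_induct\<close> passes through differences.\<close>
  have "P t \<and> P (\<ominus>\<^bsub>tens K A B\<^esub> t)"
  proof (rule bal_tensor_induct[OF tens_ok[OF assms(1,2)],
        where P = "\<lambda>t. P t \<and> P (\<ominus>\<^bsub>tens K A B\<^esub> t)" and t = t])
    show "t \<in> carrier (tgrp A B)" using assms by (simp add: tens_simps)
    show "P \<one>\<^bsub>tgrp A B\<^esub> \<and> P (\<ominus>\<^bsub>tens K A B\<^esub> \<one>\<^bsub>tgrp A B\<^esub>)"
    proof -
      have "\<ominus>\<^bsub>tens K A B\<^esub> \<zero>\<^bsub>tens K A B\<^esub> = \<zero>\<^bsub>tens K A B\<^esub>"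
        by (rule T.minus_equality) simp_all
      then show ?thesis
        using pure[of "\<zero>\<^bsub>A\<^esub>" "\<zero>\<^bsub>B\<^esub>"] assms(1,2)
        unfolding tens_simps(2)[symmetric] by (metis zero module_zero_closed)
    qed
    show "P (bal_coset (carrier K) A B (\<lambda>a c. c \<odot>\<^bsub>A\<^esub> a) (\<odot>\<^bsub>B\<^esub>) (frag_of (a, b))) \<and>
      P (\<ominus>\<^bsub>tens K A B\<^esub> bal_coset (carrier K) A B (\<lambda>a c. c \<odot>\<^bsub>A\<^esub> a) (\<odot>\<^bsub>B\<^esub>) (frag_of (a, b)))"
      if "a \<in> carrier A" "b \<in> carrier B" for a b
      using pure[of a b] pure[of "\<ominus>\<^bsub>A\<^esub> a" b] neg[of a b] that assms by (simp add: pure_def tens_coset_def)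
  next
    fix s t assume st: "s \<in> carrier (tgrp A B)" "t \<in> carrier (tgrp A B)"
      "P s \<and> P (\<ominus>\<^bsub>tens K A B\<^esub> s)" "P t \<and> P (\<ominus>\<^bsub>tens K A B\<^esub> t)"
    then have c: "s \<in> carrier (tens K A B)" "t \<in> carrier (tens K A B)" by (simp_all add: tens_simps)
    have eq: "s \<otimes>\<^bsub>tgrp A B\<^esub> inv\<^bsub>tgrp A B\<^esub> t = s \<oplus>\<^bsub>tens K A B\<^esub> \<ominus>\<^bsub>tens K A B\<^esub> t"
      using tens_inv[OF assms(1,2) c(2)] by (simp add: tens_simps)
    have "\<ominus>\<^bsub>tens K A B\<^esub> (s \<oplus>\<^bsub>tens K A B\<^esub> \<ominus>\<^bsub>tens K A B\<^esub> t) = \<ominus>\<^bsub>tens K A B\<^esub> s \<oplus>\<^bsub>tens K A B\<^esub> t"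
      using c by (simp add: T.minus_add)
    then show "P (s \<otimes>\<^bsub>tgrp A B\<^esub> inv\<^bsub>tgrp A B\<^esub> t) \<and>
        P (\<ominus>\<^bsub>tens K A B\<^esub> (s \<otimes>\<^bsub>tgrp A B\<^esub> inv\<^bsub>tgrp A B\<^esub> t))"
      unfolding eq using add c st by simp
  qed
  then show ?thesis ..
qed

lemma tens_linear_eq:
  assumes "module K A" "module K B" "is_linear K (tens K A B) W f" "is_linear K (tens K A B) W g"
    "\<And>a b. a \<in> carrier A \<Longrightarrow> b \<in> carrier B \<Longrightarrow> f (pure K A B a b) = g (pure K A B a b)"
    "t \<in> carrier (tens K A B)"
  shows "f t = g t"
  using assms(1,2,6)
proof (induction rule: tens_induct)
  case (add s t)
  then show ?case using linear_add[OF assms(3)] linear_add[OF assms(4)] by simp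
qed (use assms in auto)

text \<open>The unique existence behind the description in \<open>tlift\<close>: balancedness gives
  an additive map, which is homogeneous because it is so on pure tensors, and linear maps that agree
  on pure tensors coincide.\<close>

lemma tlift:
  assumes "module K A" "module K B" "module K W" "bilinear K A B W \<beta>"
  shows tlift_in_lin: "tlift K A B W \<beta> \<in> lin K (tens K A B) W"
    and tlift_pure: "\<And>a b. a \<in> carrier A \<Longrightarrow> b \<in> carrier B \<Longrightarrow> tlift K A B W \<beta> (pure K A B a b) = \<beta> a b"
proof -
  interpret A: module K A by fact
  interpret B: module K B by fact
  interpret W: module K W by fact
  let ?T = "tgrp A B"
  note lin = assms(4)[unfolded bilinear_def]
  obtain h where h: "h \<in> hom ?T (add_monoid W)"
    "\<And>a b. a \<in> carrier A \<Longrightarrow> b \<in> carrier B \<Longrightarrow> h (pure K A B a b) = \<beta> a b"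
  proof (rule bal_tensor_lift[OF tens_ok[OF assms(1,2)] module_comm_group[OF assms(3)], of \<beta>])
    show "\<beta> a b \<in> carrier (add_monoid W)" if "a \<in> carrier A" "b \<in> carrier B" for a b
      using that lin linear_closed[of B W "\<beta> a" b] by simp
    show "\<beta> (a \<oplus>\<^bsub>A\<^esub> a') b = \<beta> a b \<otimes>\<^bsub>add_monoid W\<^esub> \<beta> a' b"
      if "a \<in> carrier A" "a' \<in> carrier A" "b \<in> carrier B" for a a' b
      using that lin linear_add[of A W "\<lambda>a. \<beta> a b"] by simp
    show "\<beta> a (b \<oplus>\<^bsub>B\<^esub> b') = \<beta> a b \<otimes>\<^bsub>add_monoid W\<^esub> \<beta> a b'"
      if "a \<in> carrier A" "b \<in> carrier B" "b' \<in> carrier B" for a b b'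
      using that lin linear_add[of B W "\<beta> a"] by simp
    show "\<beta> (r \<odot>\<^bsub>A\<^esub> a) b = \<beta> a (r \<odot>\<^bsub>B\<^esub> b)" if "a \<in> carrier A" "r \<in> carrier K" "b \<in> carrier B" for a r b
      using that lin linear_smult[of A W "\<lambda>a. \<beta> a b"] linear_smult[of B W "\<beta> a"] by simp
  qed (auto simp: pure_def tens_coset_def)
  have hadd: "h (s \<oplus>\<^bsub>tens K A B\<^esub> t) = h s \<oplus>\<^bsub>W\<^esub> h t"
    if "s \<in> carrier (tens K A B)" "t \<in> carrier (tens K A B)" for s t
    using h(1) that by (auto simp: hom_def tens_simps)
  have hcl: "h s \<in> carrier W" if "s \<in> carrier (tens K A B)" for s
    using h(1) that by (auto simp: hom_def tens_simps)
  have hs: "h (c \<odot>\<^bsub>tens K A B\<^esub> t) = c \<odot>\<^bsub>W\<^esub> h t" if "t \<in> carrier (tens K A B)" "c \<in> carrier K" for c t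
    using assms(1,2) that(1)
  proof (induction rule: tens_induct)
    case (pure a b)
    then show ?case
      using h(2)[of a b] h(2)[of "c \<odot>\<^bsub>A\<^esub> a" b] lin linear_smult[of A W "\<lambda>a. \<beta> a b"] that(2) assms
      by (simp add: tens_scale(2))
  next
    case (add s t)
    interpret T: module K "tens K A B" using assms by simp
    show ?case
      using add that(2) by (simp add: T.smult_r_distr hadd W.smult_r_distr hcl)
  qed
  have hlin: "is_linear K (tens K A B) W h"
    by (rule is_linearI) (simp_all add: hadd hcl hs)
  let ?P = "\<lambda>f. f \<in> lin K (tens K A B) W \<and>
    (\<forall>a\<in>carrier A. \<forall>b\<in>carrier B. f (pure K A B a b) = \<beta> a b)"
  have "?P (restrict h (carrier (tens K A B)))"
    using linear_restrict[OF hlin] h(2) assms by simp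
  moreover have "f = g" if "?P f" "?P g" for f g
  proof
    fix t show "f t = g t"
      using that tens_linear_eq[OF assms(1,2), of W f g t] 
      by (cases "t \<in> carrier (tens K A B)") (auto simp: lin_def extensional_def)
  qed
  ultimately have "\<exists>!f. ?P f" by blast
  then have "?P (tlift K A B W \<beta>)"
    unfolding tlift_def by (rule theI')
  then show "tlift K A B W \<beta> \<in> lin K (tens K A B) W"
    "\<And>a b. a \<in> carrier A \<Longrightarrow> b \<in> carrier B \<Longrightarrow> tlift K A B W \<beta> (pure K A B a b) = \<beta> a b"
    by auto
qed

lemma tlift_linear [simp]:
  "module K A \<Longrightarrow> module K B \<Longrightarrow> module K W \<Longrightarrow> bilinear K A B W \<beta> \<Longrightarrow>
   is_linear K (tens K A B) W (tlift K A B W \<beta>)"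
  using tlift_in_lin by (auto simp: lin_def)


section \<open>Tensor products of linear maps and associativity\<close>

lemma bilinearI:
  assumes "\<And>a. a \<in> carrier A \<Longrightarrow> is_linear K B W (\<beta> a)"
    and "\<And>b. b \<in> carrier B \<Longrightarrow> is_linear K A W (\<lambda>a. \<beta> a b)"
  shows "bilinear K A B W \<beta>"
  using assms by (simp add: bilinear_def)

lemma linear_pure_left: "module K A \<Longrightarrow> module K B \<Longrightarrow> b \<in> carrier B \<Longrightarrow>
    is_linear K A (tens K A B) (\<lambda>a. pure K A B a b)"
  and linear_pure_right: "module K A \<Longrightarrow> module K B \<Longrightarrow> a \<in> carrier A \<Longrightarrow>
    is_linear K B (tens K A B) (\<lambda>b. pure K A B a b)"
  using bilinear_pure by (auto simp: bilinear_def)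

lemma tlift_cong:
  assumes "\<And>a b. a \<in> carrier A \<Longrightarrow> b \<in> carrier B \<Longrightarrow> \<beta> a b = \<gamma> a b"
  shows "tlift K A B W \<beta> = tlift K A B W \<gamma>"
  using assms by (simp add: tlift_def)

lemma tmap_cong:
  assumes "\<And>a. a \<in> carrier A \<Longrightarrow> f a = f' a" "\<And>b. b \<in> carrier B \<Longrightarrow> g b = g' b"
  shows "tmap K A B C D f g = tmap K A B C D f' g'"
  unfolding tmap_def by (rule tlift_cong) (use assms in simp)

lemma bilinear_pure_map:
  assumes "module K A" "module K B" "module K C" "module K D" "is_linear K A C f" "is_linear K B D g"
  shows "bilinear K A B (tens K C D) (\<lambda>a b. pure K C D (f a) (g b))"
proof (rule bilinearI)
  show "is_linear K B (tens K C D) (\<lambda>b. pure K C D (f a) (g b))" if "a \<in> carrier A" for a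
    by (rule linear_comp[OF linear_pure_right[OF assms(3,4) linear_closed[OF assms(5) that]] assms(6)])
  show "is_linear K A (tens K C D) (\<lambda>a. pure K C D (f a) (g b))" if "b \<in> carrier B" for b
    by (rule linear_comp[OF linear_pure_left[OF assms(3,4) linear_closed[OF assms(6) that]] assms(5)])
qed

lemma tmap_linear [simp]:
  assumes "module K A" "module K B" "module K C" "module K D" "is_linear K A C f" "is_linear K B D g"
  shows "is_linear K (tens K A B) (tens K C D) (tmap K A B C D f g)"
  unfolding tmap_def by (intro tlift_linear tens_module bilinear_pure_map assms)

lemma tmap_closed [simp]:
  assumes "module K A" "module K B" "module K C" "module K D" "is_linear K A C f" "is_linear K B D g"
    "t \<in> carrier (tens K A B)"
  shows "tmap K A B C D f g t \<in> carrier (tens K C D)"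
  using linear_closed[OF tmap_linear[OF assms(1-6)] assms(7)] .

lemma tmap_pure [simp]:
  assumes "module K A" "module K B" "module K C" "module K D" "is_linear K A C f" "is_linear K B D g"
    "a \<in> carrier A" "b \<in> carrier B"
  shows "tmap K A B C D f g (pure K A B a b) = pure K C D (f a) (g b)"
  unfolding tmap_def
  by (rule tlift_pure[OF assms(1,2) tens_module[OF assms(3,4)] bilinear_pure_map[OF assms(1-6)] assms(7,8)])

lemma tmap_comp:
  assumes "module K A" "module K B" "module K C" "module K D" "module K E" "module K F"
    "is_linear K A C f" "is_linear K B D g" "is_linear K C E f'" "is_linear K D F g'"
    "t \<in> carrier (tens K A B)"
  shows "tmap K C D E F f' g' (tmap K A B C D f g t) = tmap K A B E F (\<lambda>a. f' (f a)) (\<lambda>b. g' (g b)) t"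
  using assms(1,2) _ _ _ assms(11)
proof (rule tens_linear_eq)
  show "is_linear K (tens K A B) (tens K E F) (\<lambda>t. tmap K C D E F f' g' (tmap K A B C D f g t))"
    by (rule linear_comp[OF tmap_linear tmap_linear]) (use assms in auto)
  show "is_linear K (tens K A B) (tens K E F) (tmap K A B E F (\<lambda>a. f' (f a)) (\<lambda>b. g' (g b)))"
    using assms by (intro tmap_linear linear_comp[OF assms(9,7)] linear_comp[OF assms(10,8)])
  show "tmap K C D E F f' g' (tmap K A B C D f g (pure K A B a b)) =
      tmap K A B E F (\<lambda>a. f' (f a)) (\<lambda>b. g' (g b)) (pure K A B a b)"
    if "a \<in> carrier A" "b \<in> carrier B" for a b
    using that assms linear_comp[OF assms(9,7)] linear_comp[OF assms(10,8)]
    by (simp add: linear_closed[OF assms(7)] linear_closed[OF assms(8)])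
qed

lemma tmap_ident [simp]:
  assumes "module K A" "module K B" "t \<in> carrier (tens K A B)"
  shows "tmap K A B A B (\<lambda>x. x) (\<lambda>x. x) t = t"
  by (rule tens_linear_eq[where W = "tens K A B" and g = "\<lambda>x. x", OF assms(1,2) _ _ _ assms(3)])
    (use assms in auto)

text \<open>The bilinearity required by the two levels of the nested \<open>tlift\<close> in
  \<open>tassoc\<close>.\<close>

lemma tassoc_aux:
  assumes "module K A" "module K B" "module K C"
  shows "c \<in> carrier C \<Longrightarrow>
      bilinear K A B (tens K A (tens K B C)) (\<lambda>a b. pure K A (tens K B C) a (pure K B C b c))"
    and "bilinear K (tens K A B) C (tens K A (tens K B C))
      (\<lambda>t c. tlift K A B (tens K A (tens K B C)) (\<lambda>a b. pure K A (tens K B C) a (pure K B C b c)) t)"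
proof -
  let ?\<beta> = "\<lambda>c a b. pure K A (tens K B C) a (pure K B C b c)" and ?W = "tens K A (tens K B C)"
  have 1: "bilinear K A B ?W (?\<beta> c)" if "c \<in> carrier C" for c
    using assms that linear_comp[OF linear_pure_right linear_pure_left, of A B C _ c]
    by (intro bilinearI linear_pure_left) (auto intro: linear_comp[OF linear_pure_right linear_pure_left])
  show "bilinear K A B ?W (?\<beta> c)" if "c \<in> carrier C" using 1 that .
  have pl: "is_linear K C ?W (\<lambda>c. ?\<beta> c a b)" if "a \<in> carrier A" "b \<in> carrier B" for a b
    using that assms by (intro linear_comp[OF linear_pure_right linear_pure_right]) auto
  show "bilinear K (tens K A B) C ?W (\<lambda>t c. tlift K A B ?W (?\<beta> c) t)"
  proof (rule bilinearI)
    show "is_linear K (tens K A B) ?W (\<lambda>t. tlift K A B ?W (?\<beta> c) t)" if "c \<in> carrier C" for c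
      using 1 that assms by simp
    \<comment> \<open>Here the variable sits in the bilinear map that is being lifted, so linearity
      is obtained by induction on the tensor \<open>t\<close>.\<close>
    show "is_linear K C ?W (\<lambda>c. tlift K A B ?W (?\<beta> c) t)" if "t \<in> carrier (tens K A B)" for t
      using assms(1,2) that
    proof (induction rule: tens_induct)
      case (pure a b)
      show ?case
        by (rule linear_cong[OF pl[OF pure]]) (use pure assms 1 in \<open>auto simp: tlift_pure\<close>)
    next
      case (add s t)
      have "is_linear K C ?W (\<lambda>c. tlift K A B ?W (?\<beta> c) s \<oplus>\<^bsub>?W\<^esub> tlift K A B ?W (?\<beta> c) t)"
        by (rule linear_plus[OF _ add(3,4)]) (use assms in simp)
      then show ?case
      proof (rule linear_cong[OF _ assms(3)])
        show "tlift K A B ?W (?\<beta> c) (s \<oplus>\<^bsub>tens K A B\<^esub> t) =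
            tlift K A B ?W (?\<beta> c) s \<oplus>\<^bsub>?W\<^esub> tlift K A B ?W (?\<beta> c) t" if "c \<in> carrier C" for c
          by (rule linear_add[OF tlift_linear[OF assms(1,2) _ 1[OF that]] add(1,2)]) (use assms in simp)
      qed
    qed
  qed
qed

lemma tassoc_linear [simp]:
  assumes "module K A" "module K B" "module K C"
  shows "is_linear K (tens K (tens K A B) C) (tens K A (tens K B C)) (tassoc K A B C)"
  unfolding tassoc_def by (intro tlift_linear tens_module tassoc_aux(2) assms)

lemma tassoc_closed [simp]:
  assumes "module K A" "module K B" "module K C" "t \<in> carrier (tens K (tens K A B) C)"
  shows "tassoc K A B C t \<in> carrier (tens K A (tens K B C))"
  using linear_closed[OF tassoc_linear[OF assms(1-3)] assms(4)] .

lemma tassoc_pure [simp]: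
  assumes "module K A" "module K B" "module K C" "a \<in> carrier A" "b \<in> carrier B" "c \<in> carrier C"
  shows "tassoc K A B C (pure K (tens K A B) C (pure K A B a b) c) = pure K A (tens K B C) a (pure K B C b c)"
proof -
  have "tassoc K A B C (pure K (tens K A B) C (pure K A B a b) c) =
      tlift K A B (tens K A (tens K B C)) (\<lambda>a b. pure K A (tens K B C) a (pure K B C b c)) (pure K A B a b)"
    unfolding tassoc_def
    by (rule tlift_pure[OF _ _ _ tassoc_aux(2)[OF assms(1-3)]]) (use assms in auto)
  also have "\<dots> = pure K A (tens K B C) a (pure K B C b c)"
    by (rule tlift_pure[OF _ _ _ tassoc_aux(1)[OF assms(1-3,6)]]) (use assms in auto)
  finally show ?thesis .
qed

lemma tens3_linear_eq:
  assumes mods: "module K A" "module K B" "module K C" "module K W"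
    and f: "is_linear K (tens K (tens K A B) C) W f" and g: "is_linear K (tens K (tens K A B) C) W g"
    and eq: "\<And>a b c. a \<in> carrier A \<Longrightarrow> b \<in> carrier B \<Longrightarrow> c \<in> carrier C \<Longrightarrow>
      f (pure K (tens K A B) C (pure K A B a b) c) = g (pure K (tens K A B) C (pure K A B a b) c)"
    and t: "t \<in> carrier (tens K (tens K A B) C)"
  shows "f t = g t"
proof (rule tens_linear_eq[OF _ _ f g _ t])
  show "f (pure K (tens K A B) C s c) = g (pure K (tens K A B) C s c)"
    if s: "s \<in> carrier (tens K A B)" and c: "c \<in> carrier C" for s c
    by (rule tens_linear_eq[OF mods(1,2) linear_comp[OF f linear_pure_left]
          linear_comp[OF g linear_pure_left] _ s]) (use mods c eq in auto)
qed (use mods in auto)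

lemma tassoc_nat:
  assumes "module K A" "module K B" "module K C" "module K A'" "module K B'" "module K C'"
    and lin: "is_linear K A A' f" "is_linear K B B' g" "is_linear K C C' h"
    and t: "t \<in> carrier (tens K (tens K A B) C)"
  shows "tassoc K A' B' C' (tmap K (tens K A B) C (tens K A' B') C' (tmap K A B A' B' f g) h t) =
    tmap K A (tens K B C) A' (tens K B' C') f (tmap K B C B' C' g h) (tassoc K A B C t)"
proof (rule tens3_linear_eq[OF _ _ _ _ _ _ _ t])
  show "is_linear K (tens K (tens K A B) C) (tens K A' (tens K B' C'))
     (\<lambda>t. tassoc K A' B' C' (tmap K (tens K A B) C (tens K A' B') C' (tmap K A B A' B' f g) h t))"
    by (rule linear_comp[OF tassoc_linear]) (use assms in auto)
  show "is_linear K (tens K (tens K A B) C) (tens K A' (tens K B' C'))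
     (\<lambda>t. tmap K A (tens K B C) A' (tens K B' C') f (tmap K B C B' C' g h) (tassoc K A B C t))"
    by (rule linear_comp[OF tmap_linear tassoc_linear]) (use assms in auto)
qed (use assms linear_closed[OF lin(1)] linear_closed[OF lin(2)] linear_closed[OF lin(3)] in auto)


subsection \<open>Functionals and slices\<close>

lemma self_module_simps [simp]:
  "carrier (self_module K) = carrier K" "x \<oplus>\<^bsub>self_module K\<^esub> y = x \<oplus> y" "\<zero>\<^bsub>self_module K\<^esub> = \<zero>"
  "c \<odot>\<^bsub>self_module K\<^esub> x = c \<otimes> x"
  by (simp_all add: self_module_def)

lemma self_module [simp]: "module K (self_module K)"
proof (rule moduleI)
  show "abelian_group (self_module K)"
  proof (rule abelian_groupI)
    show "\<exists>y\<in>carrier (self_module K). y \<oplus>\<^bsub>self_module K\<^esub> x = \<zero>\<^bsub>self_module K\<^esub>"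
      if "x \<in> carrier (self_module K)" for x
      using that by (intro bexI[of _ "\<ominus> x"]) (auto simp: l_neg)
  qed (auto simp: a_ac)
qed (auto simp: is_cring l_distr r_distr m_assoc)

lemma self_module_minus [simp]: "x \<in> carrier K \<Longrightarrow> \<ominus>\<^bsub>self_module K\<^esub> x = \<ominus> x"
  by (rule abelian_group.minus_equality[OF module_abelian_group[OF self_module]]) (simp_all add: l_neg)

text \<open>Extensionality is left to the elements of \<open>dual\<close>, so that composites of
  functionals with linear maps are functionals as they stand.\<close>

definition functional :: "('k, 'a, 'x) module_scheme \<Rightarrow> ('a \<Rightarrow> 'k) \<Rightarrow> bool"
  where "functional V \<psi> \<longleftrightarrow> is_linear K V (self_module K) \<psi>"

lemma functional_closed: "functional V \<psi> \<Longrightarrow> x \<in> carrier V \<Longrightarrow> \<psi> x \<in> carrier K"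
  using linear_closed[of V "self_module K"] by (auto simp: functional_def)

lemma functional_add: "functional V \<psi> \<Longrightarrow> x \<in> carrier V \<Longrightarrow> y \<in> carrier V \<Longrightarrow>
    \<psi> (x \<oplus>\<^bsub>V\<^esub> y) = \<psi> x \<oplus> \<psi> y"
  using linear_add[of V "self_module K"] by (auto simp: functional_def)

lemma functional_smult: "functional V \<psi> \<Longrightarrow> c \<in> carrier K \<Longrightarrow> x \<in> carrier V \<Longrightarrow>
    \<psi> (c \<odot>\<^bsub>V\<^esub> x) = c \<otimes> \<psi> x"
  using linear_smult[of V "self_module K"] by (auto simp: functional_def)

lemma functional_zero: "functional V \<psi> \<Longrightarrow> module K V \<Longrightarrow> \<psi> \<zero>\<^bsub>V\<^esub> = \<zero>"
  using linear_zero[of V "self_module K"] by (auto simp: functional_def)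

lemma functional_diff:
  assumes "functional V \<psi>" "module K V" "x \<in> carrier V" "y \<in> carrier V"
  shows "\<psi> (x \<ominus>\<^bsub>V\<^esub> y) = \<psi> x \<ominus> \<psi> y"
proof -
  have "\<psi> (x \<ominus>\<^bsub>V\<^esub> y) = \<psi> x \<ominus>\<^bsub>self_module K\<^esub> \<psi> y"
    using assms by (intro linear_diff) (auto simp: functional_def)
  then show ?thesis using functional_closed[OF assms(1,4)] by (simp add: a_minus_def)
qed

lemma functional_comp: "functional W \<psi> \<Longrightarrow> is_linear K V W f \<Longrightarrow> functional V (\<lambda>x. \<psi> (f x))"
  unfolding functional_def by (rule linear_comp)


lemma linear_functional_scale:
  assumes "module K W" "functional V \<psi>" "w \<in> carrier W"
  shows "is_linear K V W (\<lambda>x. \<psi> x \<odot>\<^bsub>W\<^esub> w)"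
  by (rule is_linearI)
    (use assms in \<open>auto simp: functional_closed[OF assms(2)] functional_add[OF assms(2)] functional_smult[OF assms(2)] module.smult_l_distr module.smult_assoc1\<close>)

text \<open>The contraction \<open>I \<otimes> \<psi>\<close> of the right factor. Slicing a
  coaction by \<open>\<psi>\<close> is the action of \<open>\<psi>\<close>, as an element of the
  dual algebra, on the comodule.\<close>

definition rslice :: "('k, 'a, 'x) module_scheme \<Rightarrow> ('k, 'b, 'y) module_scheme \<Rightarrow> ('b \<Rightarrow> 'k) \<Rightarrow>
   ('a, 'b) tensor \<Rightarrow> 'a"
  where "rslice A B \<psi> = tlift K A B A (\<lambda>a b. \<psi> b \<odot>\<^bsub>A\<^esub> a)"

definition lslice :: "('k, 'a, 'x) module_scheme \<Rightarrow> ('k, 'b, 'y) module_scheme \<Rightarrow> ('a \<Rightarrow> 'k) \<Rightarrow>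
   ('a, 'b) tensor \<Rightarrow> 'b"
  where "lslice A B \<psi> = tlift K A B B (\<lambda>a b. \<psi> a \<odot>\<^bsub>B\<^esub> b)"

lemma rslice_bilinear: "module K A \<Longrightarrow> module K B \<Longrightarrow> functional B \<psi> \<Longrightarrow>
    bilinear K A B A (\<lambda>a b. \<psi> b \<odot>\<^bsub>A\<^esub> a)"
  and lslice_bilinear: "module K A \<Longrightarrow> module K B \<Longrightarrow> functional A \<phi> \<Longrightarrow>
    bilinear K A B B (\<lambda>a b. \<phi> a \<odot>\<^bsub>B\<^esub> b)"
  by (auto intro!: bilinearI linear_functional_scale linear_scale linear_ident elim: functional_closed)

lemma rslice_linear [simp]: "module K A \<Longrightarrow> module K B \<Longrightarrow> functional B \<psi> \<Longrightarrow>
    is_linear K (tens K A B) A (rslice A B \<psi>)"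
  and lslice_linear [simp]: "module K A \<Longrightarrow> module K B \<Longrightarrow> functional A \<phi> \<Longrightarrow>
    is_linear K (tens K A B) B (lslice A B \<phi>)"
  by (simp_all add: rslice_def lslice_def rslice_bilinear lslice_bilinear)

lemma rslice_closed [simp]: "module K A \<Longrightarrow> module K B \<Longrightarrow> functional B \<psi> \<Longrightarrow>
    t \<in> carrier (tens K A B) \<Longrightarrow> rslice A B \<psi> t \<in> carrier A"
  and lslice_closed [simp]: "module K A \<Longrightarrow> module K B \<Longrightarrow> functional A \<phi> \<Longrightarrow>
    t \<in> carrier (tens K A B) \<Longrightarrow> lslice A B \<phi> t \<in> carrier B"
  using linear_closed[OF rslice_linear] linear_closed[OF lslice_linear] by blast+

lemma rslice_pure [simp]: "module K A \<Longrightarrow> module K B \<Longrightarrow> functional B \<psi> \<Longrightarrow>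
    a \<in> carrier A \<Longrightarrow> b \<in> carrier B \<Longrightarrow> rslice A B \<psi> (pure K A B a b) = \<psi> b \<odot>\<^bsub>A\<^esub> a"
  and lslice_pure [simp]: "module K A \<Longrightarrow> module K B \<Longrightarrow> functional A \<phi> \<Longrightarrow>
    a \<in> carrier A \<Longrightarrow> b \<in> carrier B \<Longrightarrow> lslice A B \<phi> (pure K A B a b) = \<phi> a \<odot>\<^bsub>B\<^esub> b"
  by (simp_all add: rslice_def lslice_def tlift_pure rslice_bilinear lslice_bilinear)

lemma rslice_tmap:
  assumes "module K A" "module K B" "module K C" "module K D" "is_linear K A C f" "is_linear K B D g"
    "functional D \<psi>" "t \<in> carrier (tens K A B)"
  shows "rslice C D \<psi> (tmap K A B C D f g t) = f (rslice A B (\<lambda>b. \<psi> (g b)) t)"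
proof (rule tens_linear_eq[OF assms(1,2) linear_comp[OF rslice_linear tmap_linear]
      linear_comp[OF assms(5) rslice_linear] _ assms(8)])
  note fn = functional_comp[OF assms(7,6)]
  show "functional B (\<lambda>b. \<psi> (g b))" by fact
  show "rslice C D \<psi> (tmap K A B C D f g (pure K A B a b)) = f (rslice A B (\<lambda>b. \<psi> (g b)) (pure K A B a b))"
    if "a \<in> carrier A" "b \<in> carrier B" for a b
    using that assms fn functional_closed[OF fn] linear_closed[OF assms(5)] linear_closed[OF assms(6)]
    by (simp add: linear_smult[OF assms(5)])
qed (use assms in auto)

lemma lslice_tmap:
  assumes "module K A" "module K B" "module K C" "module K D" "is_linear K A C f" "is_linear K B D g"
    "functional C \<psi>" "t \<in> carrier (tens K A B)"
  shows "lslice C D \<psi> (tmap K A B C D f g t) = g (lslice A B (\<lambda>a. \<psi> (f a)) t)"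
proof (rule tens_linear_eq[OF assms(1,2) linear_comp[OF lslice_linear tmap_linear]
      linear_comp[OF assms(6) lslice_linear] _ assms(8)])
  note fn = functional_comp[OF assms(7,5)]
  show "functional A (\<lambda>b. \<psi> (f b))" by fact
  show "lslice C D \<psi> (tmap K A B C D f g (pure K A B a b)) = g (lslice A B (\<lambda>b. \<psi> (f b)) (pure K A B a b))"
    if "a \<in> carrier A" "b \<in> carrier B" for a b
    using that assms fn functional_closed[OF fn] linear_closed[OF assms(5)] linear_closed[OF assms(6)]
    by (simp add: linear_smult[OF assms(6)])
qed (use assms in auto)

lemma lslice_tassoc:
  assumes "module K A" "module K B" "module K C" "functional A \<psi>" "t \<in> carrier (tens K (tens K A B) C)"
  shows "lslice A (tens K B C) \<psi> (tassoc K A B C t) = tmap K (tens K A B) C B C (lslice A B \<psi>) (\<lambda>x. x) t"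
proof (rule tens3_linear_eq[OF _ _ _ _ linear_comp[OF lslice_linear tassoc_linear] tmap_linear _ assms(5)])
  show "lslice A (tens K B C) \<psi> (tassoc K A B C (pure K (tens K A B) C (pure K A B a b) c)) =
      tmap K (tens K A B) C B C (lslice A B \<psi>) (\<lambda>x. x) (pure K (tens K A B) C (pure K A B a b) c)"
    if "a \<in> carrier A" "b \<in> carrier B" "c \<in> carrier C" for a b c
    using that assms functional_closed[OF assms(4)] linear_smult[OF linear_pure_left[of B C c], of "\<psi> a" b] by simp
qed (use assms in auto)

lemma rslice_tassoc:
  assumes "module K A" "module K B" "module K C" "functional C \<psi>" "t \<in> carrier (tens K (tens K A B) C)"
  shows "tmap K A (tens K B C) A B (\<lambda>x. x) (rslice B C \<psi>) (tassoc K A B C t) = rslice (tens K A B) C \<psi> t"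
proof (rule tens3_linear_eq[OF _ _ _ _ linear_comp[OF tmap_linear tassoc_linear] rslice_linear _ assms(5)])
  show "tmap K A (tens K B C) A B (\<lambda>x. x) (rslice B C \<psi>) (tassoc K A B C (pure K (tens K A B) C (pure K A B a b) c)) =
      rslice (tens K A B) C \<psi> (pure K (tens K A B) C (pure K A B a b) c)"
    if "a \<in> carrier A" "b \<in> carrier B" "c \<in> carrier C" for a b c
    using that assms functional_closed[OF assms(4)] linear_smult[OF linear_pure_right[of A B a], of "\<psi> c" b] by simp
qed (use assms in auto)


subsection \<open>Submodules and separation by functionals\<close>

lemma submoduleI':
  assumes "module K V" "U \<subseteq> carrier V" "\<zero>\<^bsub>V\<^esub> \<in> U"
    and "\<And>x y. x \<in> U \<Longrightarrow> y \<in> U \<Longrightarrow> x \<oplus>\<^bsub>V\<^esub> y \<in> U"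
    and "\<And>c x. c \<in> carrier K \<Longrightarrow> x \<in> U \<Longrightarrow> c \<odot>\<^bsub>V\<^esub> x \<in> U"
  shows "submodule U K V"
proof -
  interpret V: module K V by fact
  show ?thesis
  proof (rule V.submoduleI)
    show "\<ominus>\<^bsub>V\<^esub> a \<in> U" if "a \<in> U" for a
    proof -
      have "\<ominus>\<^bsub>V\<^esub> a = (\<ominus> \<one>) \<odot>\<^bsub>V\<^esub> a" using that assms(2) by (auto simp: V.smult_l_minus)
      then show ?thesis using assms(5)[of "\<ominus> \<one>" a] that by simp
    qed
  qed (use assms in auto)
qed

lemma submodule_props:
  assumes "submodule U K V" "module K V"
  shows submodule_subset: "U \<subseteq> carrier V"
    and submodule_zero: "\<zero>\<^bsub>V\<^esub> \<in> U"
    and submodule_add: "\<And>x y. x \<in> U \<Longrightarrow> y \<in> U \<Longrightarrow> x \<oplus>\<^bsub>V\<^esub> y \<in> U"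
    and submodule_smult: "\<And>c x. c \<in> carrier K \<Longrightarrow> x \<in> U \<Longrightarrow> c \<odot>\<^bsub>V\<^esub> x \<in> U"
    and submodule_minus: "\<And>x. x \<in> U \<Longrightarrow> \<ominus>\<^bsub>V\<^esub> x \<in> U"
  using module.submoduleE[OF assms(2,1)] subgroup.one_closed[OF submodule.axioms(1)[OF assms(1)]] by auto

lemma submodule_diff:
  assumes "submodule U K V" "module K V" "x \<in> U" "y \<in> U"
  shows "x \<ominus>\<^bsub>V\<^esub> y \<in> U"
  using assms by (simp add: a_minus_def submodule_add submodule_minus)

lemma submodule_finsum:
  assumes U: "submodule U K V" "module K V" and "\<And>i. i \<in> I \<Longrightarrow> f i \<in> U"
  shows "finsum V f I \<in> U"
proof -
  interpret V: module K V by fact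
  have sub: "U \<subseteq> carrier V" using submodule_subset[OF U] .
  show ?thesis
    using assms(3)
  proof (induction I rule: infinite_finite_induct)
    \<comment> \<open>A sum over an infinite index set is \<open>\<zero>\<close> by convention and
      so lies in \<open>U\<close>.\<close>
    case (infinite I)
    then show ?case by (simp add: finsum_def finprod_def submodule_zero[OF U])
  next
    case (insert i I)
    have "finsum V f (insert i I) = f i \<oplus>\<^bsub>V\<^esub> finsum V f I"
      using insert sub by (intro V.finsum_insert) auto
    then show ?case using insert submodule_add[OF U] by simp
  qed (simp add: submodule_zero[OF U])
qed

lemma submod_simps [simp]:
  "carrier (submod V U) = U" "x \<oplus>\<^bsub>submod V U\<^esub> y = x \<oplus>\<^bsub>V\<^esub> y" "\<zero>\<^bsub>submod V U\<^esub> = \<zero>\<^bsub>V\<^esub>"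
  "c \<odot>\<^bsub>submod V U\<^esub> x = c \<odot>\<^bsub>V\<^esub> x"
  by (simp_all add: submod_def)

lemma submod_module [simp]: "submodule U K V \<Longrightarrow> module K V \<Longrightarrow> module K (submod V U)"
  unfolding submod_def by (rule submodule.submodule_is_module)

lemma submod_incl [simp]: "submodule U K V \<Longrightarrow> module K V \<Longrightarrow> is_linear K (submod V U) V (\<lambda>x. x)"
  by (rule is_linearI) (auto dest: submodule_subset)

lemma submodule_kernel:
  assumes "module K V" "module K W" "is_linear K V W f"
  shows "submodule {x \<in> carrier V. f x = \<zero>\<^bsub>W\<^esub>} K V"
proof -
  interpret W: module K W by fact
  show ?thesis
    by (rule submoduleI')
      (use assms in \<open>auto simp: linear_zero linear_add linear_smult\<close>)
qed

lemma submodule_equalizer: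
  assumes "module K V" "module K W" "is_linear K V W f" "is_linear K V W g"
  shows "submodule {x \<in> carrier V. f x = g x} K V"
proof -
  interpret W: module K W by fact
  show ?thesis
    by (rule submoduleI')
      (use assms in \<open>auto simp: linear_zero linear_add[OF assms(3)] linear_add[OF assms(4)]
        linear_smult[OF assms(3)] linear_smult[OF assms(4)]\<close>)
qed

lemma submodule_preimage:
  assumes "module K V" "module K W" "is_linear K V W f" "submodule U K W"
  shows "submodule {x \<in> carrier V. f x \<in> U} K V"
  by (rule submoduleI')
    (use assms in \<open>auto simp: linear_zero linear_add linear_smult submodule_zero submodule_add submodule_smult\<close>)

lemma submodule_image:
  assumes "module K V" "module K W" "is_linear K V W f" "submodule U K V"
  shows "submodule (f ` U) K W"
proof (rule submoduleI')
  have sub: "U \<subseteq> carrier V" using assms submodule_subset by blast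
  show "f ` U \<subseteq> carrier W" using sub linear_closed[OF assms(3)] by blast
  show "\<zero>\<^bsub>W\<^esub> \<in> f ` U" using linear_zero[OF assms(3,1,2)] submodule_zero[OF assms(4,1)] by (metis imageI)
  show "x \<oplus>\<^bsub>W\<^esub> y \<in> f ` U" if "x \<in> f ` U" "y \<in> f ` U" for x y
  proof -
    obtain a b where "a \<in> U" "b \<in> U" "x = f a" "y = f b" using \<open>x \<in> f ` U\<close> \<open>y \<in> f ` U\<close> by blast
    then show ?thesis
      using linear_add[OF assms(3), of a b] submodule_add[OF assms(4,1), of a b] sub by (metis imageI subsetD)
  qed
  show "c \<odot>\<^bsub>W\<^esub> x \<in> f ` U" if "c \<in> carrier K" "x \<in> f ` U" for c x
  proof -
    obtain a where "a \<in> U" "x = f a" using \<open>x \<in> f ` U\<close> by blast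
    then show ?thesis
      using linear_smult[OF assms(3), of c a] submodule_smult[OF assms(4,1), of c a] sub that(1)
      by (metis imageI subsetD)
  qed
qed (rule assms)

lemma submodule_inter:
  assumes "module K V" "submodule U K V" "submodule W K V"
  shows "submodule (U \<inter> W) K V"
  by (rule submoduleI')
    (use assms in \<open>auto simp: submodule_zero submodule_add submodule_smult dest: submodule_subset\<close>)

lemma submodule_span_of:
  assumes "module K V" "B \<subseteq> carrier V"
  shows "submodule (span_of K V B) K V"
proof -
  have c: "submodule (carrier V) K V" using assms module.carrier_is_submodule by blast
  show ?thesis
    by (rule submoduleI')
      (use assms c in \<open>auto simp: span_of_def submodule_zero submodule_add submodule_smult\<close>)
qed

lemma span_of_incl: "B \<subseteq> span_of K V B"
  by (auto simp: span_of_def)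

lemma span_of_least: "submodule U K V \<Longrightarrow> B \<subseteq> U \<Longrightarrow> span_of K V B \<subseteq> U"
  by (auto simp: span_of_def)

lemma submodule_Union_chain:
  assumes V: "module K V" and ne: "\<CC> \<noteq> {}" and ch: "subset.chain {U. submodule U K V} \<CC>"
  shows "submodule (\<Union>\<CC>) K V"
proof (rule submoduleI'[OF V])
  have sub: "\<And>U. U \<in> \<CC> \<Longrightarrow> submodule U K V" using ch by (auto simp: subset.chain_def)
  show "\<Union>\<CC> \<subseteq> carrier V" using sub submodule_subset V by blast
  show "\<zero>\<^bsub>V\<^esub> \<in> \<Union>\<CC>" using ne sub submodule_zero V by blast
  show "x \<oplus>\<^bsub>V\<^esub> y \<in> \<Union>\<CC>" if xy: "x \<in> \<Union>\<CC>" "y \<in> \<Union>\<CC>" for x y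
  proof -
    obtain A B where AB: "A \<in> \<CC>" "B \<in> \<CC>" "x \<in> A" "y \<in> B" using xy by blast
    then have "A \<subseteq> B \<or> B \<subseteq> A" using ch unfolding subset.chain_def by blast
    then show ?thesis using AB submodule_add[OF sub V] by blast
  qed
  show "c \<odot>\<^bsub>V\<^esub> x \<in> \<Union>\<CC>" if "c \<in> carrier K" "x \<in> \<Union>\<CC>" for c x
    using that submodule_smult[OF sub V] by blast
qed

text \<open>A subspace \<open>U\<close> maximal among those that avoid \<open>v\<close> is a
  complement of the line through \<open>v\<close>, and the functional reads off the coordinate along
  \<open>v\<close>. All later tests by functionals rest on this.\<close>

lemma separating_functional:
  assumes V: "module K V" and v: "v \<in> carrier V" "v \<noteq> \<zero>\<^bsub>V\<^esub>"
  obtains \<psi> where "functional V \<psi>" "\<psi> v = \<one>"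
proof -
  interpret V: module K V by fact
  let ?S = "{U. submodule U K V \<and> v \<notin> U}"
  have z: "{\<zero>\<^bsub>V\<^esub>} \<in> ?S" using v V by (auto intro!: submoduleI')
  have "\<exists>M\<in>?S. \<forall>X\<in>?S. M \<subseteq> X \<longrightarrow> X = M"
  proof (rule subset_Zorn_nonempty)
    show "?S \<noteq> {}" using z by blast
    show "\<Union>\<CC> \<in> ?S" if "\<CC> \<noteq> {}" "subset.chain ?S \<CC>" for \<CC>
    proof -
      have "subset.chain {U. submodule U K V} \<CC>" using that(2) by (auto simp: subset.chain_def)
      then show ?thesis using submodule_Union_chain[OF V that(1)] that(2) by (auto simp: subset.chain_def)
    qed
  qed
  then obtain U where U: "submodule U K V" "v \<notin> U"
    and max: "\<And>X. submodule X K V \<Longrightarrow> v \<notin> X \<Longrightarrow> U \<subseteq> X \<Longrightarrow> X = U" by blast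
  note Usub = submodule_subset[OF U(1) V]
  have Umem[simp]: "u \<in> carrier V" if "u \<in> U" for u using Usub that by blast
  have ex: "\<exists>c\<in>carrier K. x \<ominus>\<^bsub>V\<^esub> c \<odot>\<^bsub>V\<^esub> v \<in> U" if x: "x \<in> carrier V" for x
  proof (cases "x \<in> U")
    case True
    then show ?thesis using v by (intro bexI[of _ \<zero>]) (auto simp: V.minus_eq module_minus_zero[OF V])
  next
    case False
    \<comment> \<open>The sum of \<open>U\<close> and the line through \<open>x\<close>. By
      maximality it contains \<open>v\<close>, and solving that relation for \<open>x\<close> yields
      the coordinate.\<close>
    let ?X = "{u \<oplus>\<^bsub>V\<^esub> c \<odot>\<^bsub>V\<^esub> x | u c. u \<in> U \<and> c \<in> carrier K}"
    have X: "submodule ?X K V"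
    proof (rule submoduleI'[OF V])
      show "?X \<subseteq> carrier V" using x by auto
      have "\<zero>\<^bsub>V\<^esub> = \<zero>\<^bsub>V\<^esub> \<oplus>\<^bsub>V\<^esub> \<zero> \<odot>\<^bsub>V\<^esub> x" using x by simp
      then show "\<zero>\<^bsub>V\<^esub> \<in> ?X" using submodule_zero[OF U(1) V] by blast
      show "a \<oplus>\<^bsub>V\<^esub> b \<in> ?X" if "a \<in> ?X" "b \<in> ?X" for a b
      proof -
        obtain u c w d where *: "a = u \<oplus>\<^bsub>V\<^esub> c \<odot>\<^bsub>V\<^esub> x" "b = w \<oplus>\<^bsub>V\<^esub> d \<odot>\<^bsub>V\<^esub> x"
          "u \<in> U" "w \<in> U" "c \<in> carrier K" "d \<in> carrier K" using \<open>a \<in> ?X\<close> \<open>b \<in> ?X\<close> by blast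
        then have "a \<oplus>\<^bsub>V\<^esub> b = (u \<oplus>\<^bsub>V\<^esub> w) \<oplus>\<^bsub>V\<^esub> (c \<oplus> d) \<odot>\<^bsub>V\<^esub> x"
          using x by (simp add: V.smult_l_distr V.M.a_ac)
        then show ?thesis using * submodule_add[OF U(1) V] by blast
      qed
      show "c \<odot>\<^bsub>V\<^esub> a \<in> ?X" if "c \<in> carrier K" "a \<in> ?X" for c a
      proof -
        obtain u d where *: "a = u \<oplus>\<^bsub>V\<^esub> d \<odot>\<^bsub>V\<^esub> x" "u \<in> U" "d \<in> carrier K" using \<open>a \<in> ?X\<close> by blast
        then have "c \<odot>\<^bsub>V\<^esub> a = c \<odot>\<^bsub>V\<^esub> u \<oplus>\<^bsub>V\<^esub> (c \<otimes> d) \<odot>\<^bsub>V\<^esub> x"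
          using x that by (simp add: V.smult_r_distr V.smult_assoc1)
        then show ?thesis using * that submodule_smult[OF U(1) V] by blast
      qed
    qed
    have "U \<subseteq> ?X"
    proof
      fix u assume "u \<in> U"
      then have "u = u \<oplus>\<^bsub>V\<^esub> \<zero> \<odot>\<^bsub>V\<^esub> x" using x by simp
      then show "u \<in> ?X" using \<open>u \<in> U\<close> by blast
    qed
    moreover have "x \<in> ?X"
    proof -
      have "x = \<zero>\<^bsub>V\<^esub> \<oplus>\<^bsub>V\<^esub> \<one> \<odot>\<^bsub>V\<^esub> x" using x by simp
      then show ?thesis using submodule_zero[OF U(1) V] by blast
    qed
    ultimately have "v \<in> ?X" using max[OF X] False by blast
    then obtain u c where uc: "v = u \<oplus>\<^bsub>V\<^esub> c \<odot>\<^bsub>V\<^esub> x" "u \<in> U" "c \<in> carrier K" by blast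
    have c0: "c \<noteq> \<zero>" using uc U(2) x by auto
    have inv: "inv c \<in> carrier K" "inv c \<otimes> c = \<one>" using c0 uc(3) field_Units by auto
    have "inv c \<odot>\<^bsub>V\<^esub> v = inv c \<odot>\<^bsub>V\<^esub> u \<oplus>\<^bsub>V\<^esub> x"
      using uc x inv by (simp add: V.smult_r_distr flip: V.smult_assoc1)
    then have "x \<ominus>\<^bsub>V\<^esub> inv c \<odot>\<^bsub>V\<^esub> v = \<ominus>\<^bsub>V\<^esub> (inv c \<odot>\<^bsub>V\<^esub> u)"
      using uc x inv by (simp add: V.minus_eq V.M.minus_add V.M.a_ac V.M.r_neg2 V.M.r_neg1 V.M.r_neg)
    then show ?thesis
      using inv uc submodule_minus[OF U(1) V] submodule_smult[OF U(1) V] by (metis)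
  qed
  have un: "c = d" if "x \<in> carrier V" "c \<in> carrier K" "d \<in> carrier K"
    "x \<ominus>\<^bsub>V\<^esub> c \<odot>\<^bsub>V\<^esub> v \<in> U" "x \<ominus>\<^bsub>V\<^esub> d \<odot>\<^bsub>V\<^esub> v \<in> U" for x c d
  proof (rule ccontr)
    assume ne: "c \<noteq> d"
    have "(x \<ominus>\<^bsub>V\<^esub> d \<odot>\<^bsub>V\<^esub> v) \<ominus>\<^bsub>V\<^esub> (x \<ominus>\<^bsub>V\<^esub> c \<odot>\<^bsub>V\<^esub> v) \<in> U"
      using submodule_diff[OF U(1) V] that by blast
    moreover have "(x \<ominus>\<^bsub>V\<^esub> d \<odot>\<^bsub>V\<^esub> v) \<ominus>\<^bsub>V\<^esub> (x \<ominus>\<^bsub>V\<^esub> c \<odot>\<^bsub>V\<^esub> v) = (c \<ominus> d) \<odot>\<^bsub>V\<^esub> v"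
      using that v by (simp add: V.minus_eq V.M.minus_add V.smult_l_distr V.smult_l_minus minus_eq
          V.M.minus_minus V.M.a_ac V.M.r_neg1 V.M.r_neg2)
    ultimately have cd: "(c \<ominus> d) \<odot>\<^bsub>V\<^esub> v \<in> U" by simp
    have "c \<ominus> d \<noteq> \<zero>"
      using ne that module_diff_eq_zero[OF self_module, of c d] by (simp add: a_minus_def)
    then have "inv (c \<ominus> d) \<in> carrier K" "inv (c \<ominus> d) \<otimes> (c \<ominus> d) = \<one>"
      using that field_Units by auto
    then have "inv (c \<ominus> d) \<odot>\<^bsub>V\<^esub> ((c \<ominus> d) \<odot>\<^bsub>V\<^esub> v) = v"
      using that v by (simp flip: V.smult_assoc1)
    then show False
      using submodule_smult[OF U(1) V \<open>inv (c \<ominus> d) \<in> carrier K\<close> cd] U(2) by simp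
  qed
  define \<psi> where "\<psi> x = (SOME c. c \<in> carrier K \<and> x \<ominus>\<^bsub>V\<^esub> c \<odot>\<^bsub>V\<^esub> v \<in> U)" for x
  have \<psi>: "\<psi> x \<in> carrier K" "x \<ominus>\<^bsub>V\<^esub> \<psi> x \<odot>\<^bsub>V\<^esub> v \<in> U" if "x \<in> carrier V" for x
    using someI_ex[of "\<lambda>c. c \<in> carrier K \<and> x \<ominus>\<^bsub>V\<^esub> c \<odot>\<^bsub>V\<^esub> v \<in> U"] ex[OF that]
    unfolding \<psi>_def by blast+
  have uniq: "\<psi> x = c" if "x \<in> carrier V" "c \<in> carrier K" "x \<ominus>\<^bsub>V\<^esub> c \<odot>\<^bsub>V\<^esub> v \<in> U" for x c
    using un[OF that(1) \<psi>(1)[OF that(1)] that(2) \<psi>(2)[OF that(1)] that(3)] .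
  have "functional V \<psi>"
    unfolding functional_def
  proof (rule is_linearI)
    show "\<psi> x \<in> carrier (self_module K)" if "x \<in> carrier V" for x using \<psi> that by simp
    show "\<psi> (x \<oplus>\<^bsub>V\<^esub> y) = \<psi> x \<oplus>\<^bsub>self_module K\<^esub> \<psi> y" if xy: "x \<in> carrier V" "y \<in> carrier V" for x y
    proof -
      have "(x \<oplus>\<^bsub>V\<^esub> y) \<ominus>\<^bsub>V\<^esub> (\<psi> x \<oplus> \<psi> y) \<odot>\<^bsub>V\<^esub> v = (x \<ominus>\<^bsub>V\<^esub> \<psi> x \<odot>\<^bsub>V\<^esub> v) \<oplus>\<^bsub>V\<^esub> (y \<ominus>\<^bsub>V\<^esub> \<psi> y \<odot>\<^bsub>V\<^esub> v)"
        using xy \<psi>(1) v by (simp add: V.minus_eq V.smult_l_distr V.M.minus_add V.M.a_ac)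
      then show ?thesis
        using uniq[of "x \<oplus>\<^bsub>V\<^esub> y" "\<psi> x \<oplus> \<psi> y"] submodule_add[OF U(1) V \<psi>(2)[OF xy(1)] \<psi>(2)[OF xy(2)]] xy \<psi>(1)
        by simp
    qed
    show "\<psi> (c \<odot>\<^bsub>V\<^esub> x) = c \<odot>\<^bsub>self_module K\<^esub> \<psi> x" if "c \<in> carrier K" "x \<in> carrier V" for c x
    proof -
      have "c \<odot>\<^bsub>V\<^esub> x \<ominus>\<^bsub>V\<^esub> (c \<otimes> \<psi> x) \<odot>\<^bsub>V\<^esub> v = c \<odot>\<^bsub>V\<^esub> (x \<ominus>\<^bsub>V\<^esub> \<psi> x \<odot>\<^bsub>V\<^esub> v)"
        using that \<psi>(1) v by (simp add: V.minus_eq V.smult_r_distr V.smult_assoc1 V.smult_r_minus)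
      then show ?thesis
        using uniq[of "c \<odot>\<^bsub>V\<^esub> x" "c \<otimes> \<psi> x"] submodule_smult[OF U(1) V that(1) \<psi>(2)[OF that(2)]] that \<psi>(1)
        by simp
    qed
  qed
  moreover have "\<psi> v = \<one>"
    using uniq[of v \<one>] v submodule_zero[OF U(1) V] by (simp add: V.minus_eq V.M.r_neg)
  ultimately show thesis by (rule that)
qed


subsection \<open>Finite frames\<close>

text \<open>For a frame this is the projection onto the span of the \<open>e i\<close> along the
  common kernel of the \<open>\<psi> i\<close>. Membership of \<open>x\<close> in that span is
  expressed by \<open>fproj V n e \<psi> x = x\<close>.\<close>

definition fproj :: "('k, 'a, 'x) module_scheme \<Rightarrow> nat \<Rightarrow> (nat \<Rightarrow> 'a) \<Rightarrow> (nat \<Rightarrow> 'a \<Rightarrow> 'k) \<Rightarrow> 'a \<Rightarrow> 'a"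
  where "fproj V n e \<psi> x = (\<Oplus>\<^bsub>V\<^esub>i\<in>{..<n}. \<psi> i x \<odot>\<^bsub>V\<^esub> e i)"

text \<open>A finite biorthogonal system. The dual functionals are defined on the whole of
  \<open>V\<close>, so the projection acts on \<open>V\<close> and on tensor products with
  it.\<close>

definition frame :: "('k, 'a, 'x) module_scheme \<Rightarrow> nat \<Rightarrow> (nat \<Rightarrow> 'a) \<Rightarrow> (nat \<Rightarrow> 'a \<Rightarrow> 'k) \<Rightarrow> bool"
  where "frame V n e \<psi> \<longleftrightarrow> (\<forall>i<n. e i \<in> carrier V) \<and> (\<forall>i<n. functional V (\<psi> i)) \<and>
    (\<forall>i<n. \<forall>j<n. \<psi> i (e j) = (if i = j then \<one> else \<zero>))"

lemma frame_props:
  assumes "frame V n e \<psi>"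
  shows "\<And>i. i < n \<Longrightarrow> e i \<in> carrier V" "\<And>i. i < n \<Longrightarrow> functional V (\<psi> i)"
    "\<And>i j. i < n \<Longrightarrow> j < n \<Longrightarrow> \<psi> i (e j) = (if i = j then \<one> else \<zero>)"
  using assms by (auto simp: frame_def)

lemma fproj_linear:
  assumes "module K V" "\<And>i. i < n \<Longrightarrow> e i \<in> carrier V" "\<And>i. i < n \<Longrightarrow> functional V (\<psi> i)"
  shows "is_linear K V V (fproj V n e \<psi>)"
  unfolding fproj_def[abs_def]
  using assms by (intro linear_finsum_map linear_functional_scale) auto

lemma finsum_delta:
  assumes "module K V" "j < (n::nat)" "f j \<in> carrier V" "\<And>i. i < n \<Longrightarrow> c i = (if i = j then \<one> else \<zero>)"
    "\<And>i. i < n \<Longrightarrow> f i \<in> carrier V"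
  shows "(\<Oplus>\<^bsub>V\<^esub>i\<in>{..<n}. c i \<odot>\<^bsub>V\<^esub> f i) = f j"
proof -
  interpret V: module K V by fact
  have "(\<Oplus>\<^bsub>V\<^esub>i\<in>{..<n}. c i \<odot>\<^bsub>V\<^esub> f i) = (\<Oplus>\<^bsub>V\<^esub>i\<in>{..<n}. if j = i then f i else \<zero>\<^bsub>V\<^esub>)"
    using assms by (intro V.finsum_cong') auto
  also have "\<dots> = f j"
    using assms by (intro V.add.finprod_singleton) auto
  finally show ?thesis .
qed

lemma fproj_frame:
  assumes "module K V" "frame V n e \<psi>" "j < n"
  shows "fproj V n e \<psi> (e j) = e j"
  unfolding fproj_def using assms by (intro finsum_delta) (auto simp: frame_def)

lemma functional_finsum:
  assumes "functional V \<psi>" "module K V" "finite I" "\<And>i. i \<in> I \<Longrightarrow> g i \<in> carrier V"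
  shows "\<psi> (\<Oplus>\<^bsub>V\<^esub>i\<in>I. g i) = (\<Oplus>i\<in>I. \<psi> (g i))"
proof -
  interpret V: module K V by fact
  show ?thesis
    using assms(3,4)
  proof (induction I)
    case empty
    then show ?case using functional_zero[OF assms(1,2)] by simp
  next
    case (insert i I)
    then have "g \<in> I \<rightarrow> carrier V" "(\<lambda>i. \<psi> (g i)) \<in> I \<rightarrow> carrier K"
      using functional_closed[OF assms(1)] by auto
    then show ?case
      using insert assms functional_closed[OF assms(1)] by (simp add: functional_add[OF assms(1)])
  qed
qed

lemma frame_coord_fproj:
  assumes "module K V" "frame V n e \<psi>" "x \<in> carrier V" "j < n"
  shows "\<psi> j (fproj V n e \<psi> x) = \<psi> j x"
proof -
  note fr = frame_props[OF assms(2)]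
  note [simp] = functional_closed[OF fr(2)] functional_smult[OF fr(2)]
  have "\<psi> j (fproj V n e \<psi> x) = (\<Oplus>i\<in>{..<n}. \<psi> i x \<otimes> (if j = i then \<one> else \<zero>))"
    unfolding fproj_def using assms fr
    by (subst functional_finsum[OF fr(2)]) (auto intro!: finsum_cong')
  also have "\<dots> = (\<Oplus>i\<in>{..<n}. if j = i then \<psi> i x else \<zero>)"
    using assms fr by (intro finsum_cong') auto
  also have "\<dots> = \<psi> j x"
    using assms fr by (intro add.finprod_singleton) auto
  finally show ?thesis .
qed

text \<open>A Gram-Schmidt step: the residue of \<open>s\<close> after projection becomes a new
  vector, and a functional with value \<open>\<one>\<close> on the residue is composed with
  \<open>I - P\<close> so that it vanishes on the old vectors.\<close>

lemma frame_extend_one: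
  assumes V: "module K V" and U: "submodule U K V" and fr: "frame V n e \<psi>"
    and eU: "\<And>i. i < n \<Longrightarrow> e i \<in> U" and s: "s \<in> U"
  obtains n' e' \<psi>' where "n \<le> n'" "frame V n' e' \<psi>'" "\<And>i. i < n \<Longrightarrow> e' i = e i \<and> \<psi>' i = \<psi> i"
    "\<And>i. i < n' \<Longrightarrow> e' i \<in> U" "fproj V n' e' \<psi>' s = s"
proof (cases "fproj V n e \<psi> s = s")
  case True
  then show thesis using that[of n e \<psi>] fr eU by blast
next
  case False
  interpret V: module K V by fact
  let ?P = "fproj V n e \<psi>"
  note p = frame_props[OF fr]
  note [simp] = functional_closed[OF p(2)]
  have P: "is_linear K V V ?P" by (rule fproj_linear[OF V p(1,2)])
  have sV: "s \<in> carrier V" using s submodule_subset[OF U V] by blast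
  note PsV = linear_closed[OF P sV]
  define s' where "s' = s \<ominus>\<^bsub>V\<^esub> ?P s"
  have PsU: "?P s \<in> U"
    unfolding fproj_def using p eU sV by (intro submodule_finsum[OF U V] submodule_smult[OF U V]) auto
  have s'U: "s' \<in> U" unfolding s'_def using submodule_diff[OF U V s PsU] .
  have s'V: "s' \<in> carrier V" using s'U submodule_subset[OF U V] by blast
  have s'0: "s' \<noteq> \<zero>\<^bsub>V\<^esub>" using False sV PsV V by (simp add: s'_def module_diff_eq_zero)
  obtain \<chi> where \<chi>: "functional V \<chi>" "\<chi> s' = \<one>" using separating_functional[OF V s'V s'0] .
  define \<psi>n where "\<psi>n = (\<lambda>x. \<chi> (x \<ominus>\<^bsub>V\<^esub> ?P x))"
  have lin: "is_linear K V V (\<lambda>x. x \<ominus>\<^bsub>V\<^esub> ?P x)" by (intro linear_diff_map V linear_ident P)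
  have \<psi>n: "functional V \<psi>n" unfolding \<psi>n_def by (rule functional_comp[OF \<chi>(1) lin])
  define e' where "e' = e(n := s')"
  define \<psi>' where "\<psi>' = \<psi>(n := \<psi>n)"
  have z1: "\<psi>n (e j) = \<zero>" if "j < n" for j
    using that fproj_frame[OF V fr that] p(1)[OF that] functional_zero[OF \<chi>(1) V]
    by (simp add: \<psi>n_def V.minus_eq V.M.r_neg)
  have z2: "\<psi> i s' = \<zero>" if "i < n" for i
  proof -
    have "\<psi> i s' = \<psi> i s \<ominus> \<psi> i (?P s)"
      unfolding s'_def by (rule functional_diff[OF p(2)[OF that] V sV PsV])
    also have "\<dots> = \<zero>"
      using frame_coord_fproj[OF V fr sV that] functional_closed[OF p(2)[OF that] sV] by (simp add: minus_eq r_neg)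
    finally show ?thesis .
  qed
  have Ps': "?P s' = \<zero>\<^bsub>V\<^esub>"
    unfolding fproj_def using z2 p by (intro V.add.finprod_one_eqI) auto
  have o: "\<psi>n s' = \<one>" using s'V \<chi>(2) Ps' V by (simp add: \<psi>n_def V.minus_eq)
  have fr': "frame V (Suc n) e' \<psi>'"
    unfolding frame_def using p s'V \<psi>n z1 z2 o by (auto simp: functional_closed[OF \<psi>n] e'_def \<psi>'_def less_Suc_eq)
  have "fproj V (Suc n) e' \<psi>' s = \<psi>n s \<odot>\<^bsub>V\<^esub> s' \<oplus>\<^bsub>V\<^esub> ?P s"
  proof -
    have "fproj V (Suc n) e' \<psi>' s = \<psi>n s \<odot>\<^bsub>V\<^esub> s' \<oplus>\<^bsub>V\<^esub> (\<Oplus>\<^bsub>V\<^esub>i\<in>{..<n}. \<psi>' i s \<odot>\<^bsub>V\<^esub> e' i)"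
      unfolding fproj_def lessThan_Suc using p s'V sV V functional_closed[OF \<psi>n]
      by (subst V.finsum_insert) (auto simp: e'_def \<psi>'_def)
    also have "(\<Oplus>\<^bsub>V\<^esub>i\<in>{..<n}. \<psi>' i s \<odot>\<^bsub>V\<^esub> e' i) = ?P s"
      unfolding fproj_def using p sV by (intro V.finsum_cong') (auto simp: e'_def \<psi>'_def)
    finally show ?thesis .
  qed
  also have "\<psi>n s = \<one>" using \<chi>(2) by (simp add: \<psi>n_def s'_def)
  also have "\<one> \<odot>\<^bsub>V\<^esub> s' \<oplus>\<^bsub>V\<^esub> ?P s = s"
    using sV PsV by (simp add: s'_def V.minus_eq V.M.a_assoc V.M.l_neg)
  finally have "fproj V (Suc n) e' \<psi>' s = s" .
  then show thesis
    by (intro that[of "Suc n" e' \<psi>'] fr') (use eU s'U in \<open>auto simp: e'_def \<psi>'_def less_Suc_eq\<close>)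
qed

text \<open>The larger projection fixes each \<open>e i\<close> with \<open>i < n\<close>, hence
  their whole span.\<close>

lemma fproj_fixed_mono:
  assumes V: "module K V" and fr: "frame V n e \<psi>" and fr': "frame V n' e' \<psi>'" and le: "n \<le> n'"
    and ee: "\<And>i. i < n \<Longrightarrow> e' i = e i" and x: "x \<in> carrier V" "fproj V n e \<psi> x = x"
  shows "fproj V n' e' \<psi>' x = x"
proof -
  note p = frame_props[OF fr]
  note [simp] = functional_closed[OF p(2)]
  have lin: "is_linear K V V (fproj V n' e' \<psi>')"
    by (rule fproj_linear[OF V frame_props(1,2)[OF fr']])
  have "fproj V n' e' \<psi>' (fproj V n e \<psi> x) = fproj V n e \<psi> x"
  proof -
    interpret V: module K V by fact
    note c = functional_closed[OF p(2) x(1)]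
    have e: "fproj V n' e' \<psi>' (e i) = e i" if "i < n" for i
      using fproj_frame[OF V fr', of i] ee[OF that] that le by simp
    have "fproj V n' e' \<psi>' (fproj V n e \<psi> x) = (\<Oplus>\<^bsub>V\<^esub>i\<in>{..<n}. fproj V n' e' \<psi>' (\<psi> i x \<odot>\<^bsub>V\<^esub> e i))"
      unfolding fproj_def[of V n] by (rule linear_finsum[OF lin V V]) (use c p in auto)
    also have "\<dots> = fproj V n e \<psi> x"
      unfolding fproj_def[of V n] by (rule V.finsum_cong') (use c p e in \<open>auto simp: linear_smult[OF lin]\<close>)
    finally show ?thesis .
  qed
  then show ?thesis using x by simp
qed

text \<open>The vectors and functionals already present are kept, which is what allows a basis
  adapted to two nested subspaces.\<close>

lemma frame_extend:
  assumes V: "module K V" and U: "submodule U K V" and fr: "frame V n e \<psi>"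
    and eU: "\<And>i. i < n \<Longrightarrow> e i \<in> U" and S: "finite S" "S \<subseteq> U"
  shows "\<exists>n' e' \<psi>'. n \<le> n' \<and> frame V n' e' \<psi>' \<and> (\<forall>i<n. e' i = e i \<and> \<psi>' i = \<psi> i) \<and>
    (\<forall>i<n'. e' i \<in> U) \<and> (\<forall>s\<in>S. fproj V n' e' \<psi>' s = s)"
  using S
proof (induction S)
  case empty
  then show ?case using fr eU by blast
next
  case (insert s S)
  then obtain m d \<chi> where m: "n \<le> m" "frame V m d \<chi>" "\<forall>i<n. d i = e i \<and> \<chi> i = \<psi> i"
    "\<forall>i<m. d i \<in> U" "\<forall>s\<in>S. fproj V m d \<chi> s = s" by blast
  obtain m' d' \<chi>' where m': "m \<le> m'" "frame V m' d' \<chi>'" "\<And>i. i < m \<Longrightarrow> d' i = d i \<and> \<chi>' i = \<chi> i"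
    "\<And>i. i < m' \<Longrightarrow> d' i \<in> U" "fproj V m' d' \<chi>' s = s"
    using frame_extend_one[OF V U m(2), of s] m(4) insert.prems by (metis insert_subset)
  have "fproj V m' d' \<chi>' x = x" if "x \<in> S" for x
    by (rule fproj_fixed_mono[OF V m(2) m'(2,1)])
      (use m m' that insert.prems submodule_subset[OF U V] in auto)
  then have 1: "\<forall>x\<in>insert s S. fproj V m' d' \<chi>' x = x" using m'(5) by blast
  have 2: "\<forall>i<n. d' i = e i \<and> \<chi>' i = \<psi> i" using m(1,3) m'(3) by simp
  show ?case
  proof (intro exI conjI)
    show "n \<le> m'" using m(1) m'(1) by simp
    show "\<forall>i<m'. d' i \<in> U" using m'(4) by simp
  qed (fact m'(2) 1 2)+
qed

lemma frame_exists:
  assumes V: "module K V" and U: "submodule U K V" and S: "finite S" "S \<subseteq> U"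
  obtains n e \<psi> where "frame V n e \<psi>" "\<forall>i<n. e i \<in> U" "\<forall>s\<in>S. fproj V n e \<psi> s = s"
proof -
  have "frame V 0 undefined undefined" by (simp add: frame_def)
  from frame_extend[OF V U this _ S]
  obtain n e \<psi> where *: "frame V n e \<psi>" "\<forall>i<n. e i \<in> U" "\<forall>s\<in>S. fproj V n e \<psi> s = s" by auto
  show thesis by (rule that[OF *(1)]) (use *(2,3) in auto)
qed

text \<open>Induction on the number of functionals: a frame of the part of \<open>U\<close> killed
  by \<open>\<phi> n\<close> has to be enlarged by at most one vector \<open>w\<close> outside that
  kernel.\<close>

lemma frame_of_separated:
  assumes V: "module K V" and U: "submodule U K V"
    and \<phi>: "\<And>i. i < n \<Longrightarrow> functional V (\<phi> i)"
    and sep: "\<And>x. x \<in> U \<Longrightarrow> (\<And>i. i < (n::nat) \<Longrightarrow> \<phi> i x = \<zero>) \<Longrightarrow> x = \<zero>\<^bsub>V\<^esub>"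
  shows "\<exists>m e \<psi>. frame V m e \<psi> \<and> (\<forall>i<m. e i \<in> U) \<and> (\<forall>x\<in>U. fproj V m e \<psi> x = x)"
  using assms
proof (induction n arbitrary: U)
  case 0
  interpret V: module K V by fact
  have "frame V 0 undefined undefined" by (simp add: frame_def)
  moreover have "fproj V 0 undefined undefined x = x" if "x \<in> U" for x
    using 0(4)[OF that] by (simp add: fproj_def)
  ultimately show ?case by blast
next
  case (Suc n)
  interpret V: module K V by fact
  note U = Suc.prems(2)
  let ?U = "{x \<in> U. \<phi> n x = \<zero>}"
  have sub: "U \<subseteq> carrier V" by (rule submodule_subset[OF U V.module_axioms])
  have "?U = U \<inter> {x \<in> carrier V. \<phi> n x = \<zero>\<^bsub>self_module K\<^esub>}" using sub by auto
  moreover have "submodule {x \<in> carrier V. \<phi> n x = \<zero>\<^bsub>self_module K\<^esub>} K V"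
    using Suc.prems(3)[of n] V.module_axioms by (intro submodule_kernel) (auto simp: functional_def)
  ultimately have U': "submodule ?U K V" using submodule_inter[OF V.module_axioms U] by simp
  have "\<exists>m e \<psi>. frame V m e \<psi> \<and> (\<forall>i<m. e i \<in> ?U) \<and> (\<forall>x\<in>?U. fproj V m e \<psi> x = x)"
  proof (rule Suc.IH[OF V.module_axioms U'])
    show "functional V (\<phi> i)" if "i < n" for i using Suc.prems(3) that by simp
    show "x = \<zero>\<^bsub>V\<^esub>" if "x \<in> ?U" "\<And>i. i < n \<Longrightarrow> \<phi> i x = \<zero>" for x
      by (rule Suc.prems(4)) (use that in \<open>auto simp: less_Suc_eq\<close>)
  qed
  then obtain m e \<psi> where m: "frame V m e \<psi>" "\<forall>i<m. e i \<in> ?U" "\<forall>x\<in>?U. fproj V m e \<psi> x = x"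
    by blast
  show ?case
  proof (cases "?U = U")
    case True
    then show ?thesis using m by metis
  next
    case False
    then obtain w where w: "w \<in> U" "\<phi> n w \<noteq> \<zero>" by blast
    have wV: "w \<in> carrier V" using w sub by blast
    have fn: "functional V (\<phi> n)" using Suc.prems(3) by simp
    obtain m' e' \<psi>' where m': "m \<le> m'" "frame V m' e' \<psi>'" "\<And>i. i < m \<Longrightarrow> e' i = e i \<and> \<psi>' i = \<psi> i"
      "\<And>i. i < m' \<Longrightarrow> e' i \<in> U" "fproj V m' e' \<psi>' w = w"
      using frame_extend_one[OF V.module_axioms U m(1), of w] m(2) w by (metis (no_types, lifting) mem_Collect_eq)
    have lin: "is_linear K V V (fproj V m' e' \<psi>')"
      by (rule fproj_linear[OF V.module_axioms frame_props(1,2)[OF m'(2)]])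
    have "fproj V m' e' \<psi>' x = x" if x: "x \<in> U" for x
    proof -
      have xV: "x \<in> carrier V" using x sub by blast
      note [simp] = functional_closed[OF fn] functional_add[OF fn] functional_smult[OF fn]
      have iv: "inv (\<phi> n w) \<in> carrier K" "inv (\<phi> n w) \<otimes> \<phi> n w = \<one>"
        using w(2) fn wV field_Units by auto
      \<comment> \<open>Chosen so that \<open>x\<close> minus \<open>c\<close> times
        \<open>w\<close> is killed by \<open>\<phi> n\<close>.\<close>
      define c where "c = \<phi> n x \<otimes> inv (\<phi> n w)"
      have c: "c \<in> carrier K" using iv fn xV by (simp add: c_def)
      have "c \<otimes> \<phi> n w = \<phi> n x" using iv fn xV wV by (simp add: c_def m_assoc)
      define y where "y = x \<ominus>\<^bsub>V\<^esub> c \<odot>\<^bsub>V\<^esub> w"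
      have yU: "y \<in> U"
        unfolding y_def using submodule_diff[OF U V.module_axioms x] submodule_smult[OF U V.module_axioms c w(1)] by blast
      have yV: "y \<in> carrier V" using yU sub by blast
      have xy: "x = y \<oplus>\<^bsub>V\<^esub> c \<odot>\<^bsub>V\<^esub> w"
        using xV wV c by (simp add: y_def V.minus_eq V.M.a_assoc V.M.l_neg)
      have "\<phi> n x = \<phi> n y \<oplus> c \<otimes> \<phi> n w"
        using fn yV wV c by (subst xy) (simp add: functional_add functional_smult)
      then have "\<phi> n y = \<zero>"
        using \<open>c \<otimes> \<phi> n w = \<phi> n x\<close> fn yV xV by (metis functional_closed add.r_cancel_one')
      then have "y \<in> ?U" using yU by simp
      then have "fproj V m' e' \<psi>' y = y"
        using fproj_fixed_mono[OF V.module_axioms m(1) m'(2,1)] m m' yV by simp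
      then show ?thesis
        using xy m'(5) yV wV c by (simp add: linear_add[OF lin] linear_smult[OF lin])
    qed
    then show ?thesis using m' by blast
  qed
qed


section \<open>Expanding and comparing tensors by slices\<close>

lemma finsum_swap:
  assumes V: "module K V" and I: "finite I" and J: "finite J"
    and f: "\<And>i j. i \<in> I \<Longrightarrow> j \<in> J \<Longrightarrow> f i j \<in> carrier V"
  shows "(\<Oplus>\<^bsub>V\<^esub>i\<in>I. \<Oplus>\<^bsub>V\<^esub>j\<in>J. f i j) = (\<Oplus>\<^bsub>V\<^esub>j\<in>J. \<Oplus>\<^bsub>V\<^esub>i\<in>I. f i j)"
  using I f
proof (induction I)
  case empty
  interpret V: module K V by fact
  show ?case by simp
next
  case (insert i I)
  interpret V: module K V by fact
  have "(\<Oplus>\<^bsub>V\<^esub>j\<in>J. \<Oplus>\<^bsub>V\<^esub>i\<in>insert i I. f i j) = (\<Oplus>\<^bsub>V\<^esub>j\<in>J. f i j \<oplus>\<^bsub>V\<^esub> (\<Oplus>\<^bsub>V\<^esub>i\<in>I. f i j))"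
    using insert V by (intro V.finsum_cong') auto
  also have "\<dots> = (\<Oplus>\<^bsub>V\<^esub>j\<in>J. f i j) \<oplus>\<^bsub>V\<^esub> (\<Oplus>\<^bsub>V\<^esub>j\<in>J. \<Oplus>\<^bsub>V\<^esub>i\<in>I. f i j)"
    using insert V by (intro V.finsum_addf) auto
  also have "\<dots> = (\<Oplus>\<^bsub>V\<^esub>j\<in>J. f i j) \<oplus>\<^bsub>V\<^esub> (\<Oplus>\<^bsub>V\<^esub>i\<in>I. \<Oplus>\<^bsub>V\<^esub>j\<in>J. f i j)"
    using insert by simp
  also have "\<dots> = (\<Oplus>\<^bsub>V\<^esub>i\<in>insert i I. \<Oplus>\<^bsub>V\<^esub>j\<in>J. f i j)"
    using insert V by (subst V.finsum_insert) auto
  finally show ?case by simp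
qed

lemma module_finsum_cong:
  assumes "module K V" "\<And>i. i \<in> I \<Longrightarrow> f i = g i" "\<And>i. i \<in> I \<Longrightarrow> g i \<in> carrier V"
  shows "finsum V f I = finsum V g I"
  using assms by (intro abelian_monoid.finsum_cong'[OF module_abelian_monoid[OF assms(1)]]) auto

text \<open>Both sides are the value of \<open>\<phi> \<otimes> \<psi>\<close> at
  \<open>t\<close>.\<close>

lemma slice_swap:
  assumes "module K A" "module K B" "functional A \<phi>" "functional B \<psi>" "t \<in> carrier (tens K A B)"
  shows "\<psi> (lslice A B \<phi> t) = \<phi> (rslice A B \<psi> t)"
proof (rule tens_linear_eq[where W = "self_module K", OF assms(1,2) _ _ _ assms(5)])
  have \<phi>: "is_linear K A (self_module K) \<phi>" and \<psi>: "is_linear K B (self_module K) \<psi>"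
    using assms by (auto simp: functional_def)
  show "is_linear K (tens K A B) (self_module K) (\<lambda>t. \<psi> (lslice A B \<phi> t))"
    by (rule linear_comp[OF \<psi> lslice_linear]) (use assms in auto)
  show "is_linear K (tens K A B) (self_module K) (\<lambda>t. \<phi> (rslice A B \<psi> t))"
    by (rule linear_comp[OF \<phi> rslice_linear]) (use assms in auto)
  show "\<psi> (lslice A B \<phi> (pure K A B a b)) = \<phi> (rslice A B \<psi> (pure K A B a b))"
    if "a \<in> carrier A" "b \<in> carrier B" for a b
    using that assms functional_closed[OF assms(3)] functional_closed[OF assms(4)]
    by (simp add: functional_smult[OF assms(3)] functional_smult[OF assms(4)] m_comm)
qed

text \<open>A tensor involves finitely many vectors of \<open>B\<close>. Phrasing this through the
  operators that fix them avoids choosing an expansion of \<open>t\<close> and is stable under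
  sums.\<close>

lemma tens_support_right:
  assumes "module K A" "module K B" "t \<in> carrier (tens K A B)"
  shows "\<exists>S. finite S \<and> S \<subseteq> carrier B \<and>
    (\<forall>P. is_linear K B B P \<longrightarrow> (\<forall>s\<in>S. P s = s) \<longrightarrow> tmap K A B A B (\<lambda>x. x) P t = t)"
  using assms
proof (induction rule: tens_induct)
  case (pure a b)
  then show ?case using assms by (intro exI[of _ "{b}"]) auto
next
  case (add s t)
  from add.IH(1) obtain S where S0: "finite S" "S \<subseteq> carrier B"
    and S: "\<forall>P. is_linear K B B P \<longrightarrow> (\<forall>s\<in>S. P s = s) \<longrightarrow> tmap K A B A B (\<lambda>x. x) P s = s"
    by (elim exE conjE)
  from add.IH(2) obtain T where T0: "finite T" "T \<subseteq> carrier B"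
    and T: "\<forall>P. is_linear K B B P \<longrightarrow> (\<forall>s\<in>T. P s = s) \<longrightarrow> tmap K A B A B (\<lambda>x. x) P t = t"
    by (elim exE conjE)
  have "tmap K A B A B (\<lambda>x. x) P (s \<oplus>\<^bsub>tens K A B\<^esub> t) = s \<oplus>\<^bsub>tens K A B\<^esub> t"
    if "is_linear K B B P" "\<forall>x\<in>S \<union> T. P x = x" for P
    using linear_add[OF tmap_linear[OF assms(1,2,1,2) linear_ident that(1)] add.hyps] S[rule_format, OF that(1)] T[rule_format, OF that(1)] that(2)
    by simp
  then show ?case using S0 T0 by (intro exI[of _ "S \<union> T"]) auto
qed

lemma tens_support_left:
  assumes "module K A" "module K B" "t \<in> carrier (tens K A B)"
  shows "\<exists>S. finite S \<and> S \<subseteq> carrier A \<and>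
    (\<forall>P. is_linear K A A P \<longrightarrow> (\<forall>s\<in>S. P s = s) \<longrightarrow> tmap K A B A B P (\<lambda>x. x) t = t)"
  using assms
proof (induction rule: tens_induct)
  case (pure a b)
  then show ?case using assms by (intro exI[of _ "{a}"]) auto
next
  case (add s t)
  from add.IH(1) obtain S where S0: "finite S" "S \<subseteq> carrier A"
    and S: "\<forall>P. is_linear K A A P \<longrightarrow> (\<forall>s\<in>S. P s = s) \<longrightarrow> tmap K A B A B P (\<lambda>x. x) s = s"
    by (elim exE conjE)
  from add.IH(2) obtain T where T0: "finite T" "T \<subseteq> carrier A"
    and T: "\<forall>P. is_linear K A A P \<longrightarrow> (\<forall>s\<in>T. P s = s) \<longrightarrow> tmap K A B A B P (\<lambda>x. x) t = t"
    by (elim exE conjE)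
  have "tmap K A B A B P (\<lambda>x. x) (s \<oplus>\<^bsub>tens K A B\<^esub> t) = s \<oplus>\<^bsub>tens K A B\<^esub> t"
    if "is_linear K A A P" "\<forall>x\<in>S \<union> T. P x = x" for P
    using linear_add[OF tmap_linear[OF assms(1,2,1,2) that(1) linear_ident] add.hyps] S[rule_format, OF that(1)] T[rule_format, OF that(1)] that(2)
    by simp
  then show ?case using S0 T0 by (intro exI[of _ "S \<union> T"]) auto
qed

lemma tmap_fproj_right:
  assumes A: "module K A" and B: "module K B" and fr: "frame B n e \<psi>" and t: "t \<in> carrier (tens K A B)"
  shows "tmap K A B A B (\<lambda>x. x) (fproj B n e \<psi>) t =
    (\<Oplus>\<^bsub>tens K A B\<^esub>i\<in>{..<n}. pure K A B (rslice A B (\<psi> i) t) (e i))"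
proof -
  note p = frame_props[OF fr]
  have P: "is_linear K B B (fproj B n e \<psi>)" using fproj_linear[OF B p(1,2)] .
  have r: "is_linear K (tens K A B) (tens K A B) (\<lambda>t. pure K A B (rslice A B (\<psi> i) t) (e i))" if "i < n" for i
    by (rule linear_comp[OF linear_pure_left[OF A B p(1)[OF that]] rslice_linear[OF A B p(2)[OF that]]])
  show ?thesis
  proof (rule tens_linear_eq[where W = "tens K A B", OF A B _ _ _ t])
    show "is_linear K (tens K A B) (tens K A B)
       (\<lambda>t. \<Oplus>\<^bsub>tens K A B\<^esub>i\<in>{..<n}. pure K A B (rslice A B (\<psi> i) t) (e i))"
      by (rule linear_finsum_map) (use A B r in auto)
    show "tmap K A B A B (\<lambda>x. x) (fproj B n e \<psi>) (pure K A B a b) =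
        (\<Oplus>\<^bsub>tens K A B\<^esub>i\<in>{..<n}. pure K A B (rslice A B (\<psi> i) (pure K A B a b)) (e i))"
      if ab: "a \<in> carrier A" "b \<in> carrier B" for a b
    proof -
      note c = functional_closed[OF p(2) ab(2)]
      have "tmap K A B A B (\<lambda>x. x) (fproj B n e \<psi>) (pure K A B a b) = pure K A B a (fproj B n e \<psi> b)"
        using A B P ab by simp
      also have "\<dots> = (\<Oplus>\<^bsub>tens K A B\<^esub>i\<in>{..<n}. pure K A B a (\<psi> i b \<odot>\<^bsub>B\<^esub> e i))"
        unfolding fproj_def
        by (rule linear_finsum[OF linear_pure_right[OF A B ab(1)]]) (use A B p c in auto)
      also have "\<dots> = (\<Oplus>\<^bsub>tens K A B\<^esub>i\<in>{..<n}. pure K A B (rslice A B (\<psi> i) (pure K A B a b)) (e i))"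
      proof (rule module_finsum_cong)
        fix i assume "i \<in> {..<n}"
        then show "pure K A B a (\<psi> i b \<odot>\<^bsub>B\<^esub> e i) = pure K A B (rslice A B (\<psi> i) (pure K A B a b)) (e i)"
          using A B p ab c linear_smult[OF linear_pure_right[OF A B ab(1)], of "\<psi> i b" "e i"]
            linear_smult[OF linear_pure_left[OF A B p(1)], of i "\<psi> i b" a] by simp
      qed (use A B p ab c in auto)
      finally show ?thesis .
    qed
  qed (use A B P in auto)
qed

lemma tmap_fproj_left:
  assumes A: "module K A" and B: "module K B" and fr: "frame A n e \<psi>" and t: "t \<in> carrier (tens K A B)"
  shows "tmap K A B A B (fproj A n e \<psi>) (\<lambda>x. x) t =
    (\<Oplus>\<^bsub>tens K A B\<^esub>i\<in>{..<n}. pure K A B (e i) (lslice A B (\<psi> i) t))"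
proof -
  note p = frame_props[OF fr]
  have P: "is_linear K A A (fproj A n e \<psi>)" using fproj_linear[OF A p(1,2)] .
  have r: "is_linear K (tens K A B) (tens K A B) (\<lambda>t. pure K A B (e i) (lslice A B (\<psi> i) t))" if "i < n" for i
    by (rule linear_comp[OF linear_pure_right[OF A B p(1)[OF that]] lslice_linear[OF A B p(2)[OF that]]])
  show ?thesis
  proof (rule tens_linear_eq[where W = "tens K A B", OF A B _ _ _ t])
    show "is_linear K (tens K A B) (tens K A B)
       (\<lambda>t. \<Oplus>\<^bsub>tens K A B\<^esub>i\<in>{..<n}. pure K A B (e i) (lslice A B (\<psi> i) t))"
      by (rule linear_finsum_map) (use A B r in auto)
    show "tmap K A B A B (fproj A n e \<psi>) (\<lambda>x. x) (pure K A B a b) =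
        (\<Oplus>\<^bsub>tens K A B\<^esub>i\<in>{..<n}. pure K A B (e i) (lslice A B (\<psi> i) (pure K A B a b)))"
      if ab: "a \<in> carrier A" "b \<in> carrier B" for a b
    proof -
      note c = functional_closed[OF p(2) ab(1)]
      have "tmap K A B A B (fproj A n e \<psi>) (\<lambda>x. x) (pure K A B a b) = pure K A B (fproj A n e \<psi> a) b"
        using A B P ab by simp
      also have "\<dots> = (\<Oplus>\<^bsub>tens K A B\<^esub>i\<in>{..<n}. pure K A B (\<psi> i a \<odot>\<^bsub>A\<^esub> e i) b)"
        unfolding fproj_def
        by (rule linear_finsum[OF linear_pure_left[OF A B ab(2)]]) (use A B p c in auto)
      also have "\<dots> = (\<Oplus>\<^bsub>tens K A B\<^esub>i\<in>{..<n}. pure K A B (e i) (lslice A B (\<psi> i) (pure K A B a b)))"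
      proof (rule module_finsum_cong)
        fix i assume "i \<in> {..<n}"
        then show "pure K A B (\<psi> i a \<odot>\<^bsub>A\<^esub> e i) b = pure K A B (e i) (lslice A B (\<psi> i) (pure K A B a b))"
          using A B p ab c linear_smult[OF linear_pure_left[OF A B ab(2)], of "\<psi> i a" "e i"]
            linear_smult[OF linear_pure_right[OF A B p(1)], of i "\<psi> i a" b] by simp
      qed (use A B p ab c in auto)
      finally show ?thesis .
    qed
  qed (use A B P in auto)
qed

lemma tens_expand_right:
  assumes A: "module K A" and B: "module K B" and t: "t \<in> carrier (tens K A B)"
  obtains n e \<psi> where "frame B n e \<psi>"
    "t = (\<Oplus>\<^bsub>tens K A B\<^esub>i\<in>{..<n}. pure K A B (rslice A B (\<psi> i) t) (e i))"
proof -
  from tens_support_right[OF A B t] obtain S where S: "finite S" "S \<subseteq> carrier B"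
    "\<forall>P. is_linear K B B P \<longrightarrow> (\<forall>s\<in>S. P s = s) \<longrightarrow> tmap K A B A B (\<lambda>x. x) P t = t"
    by (elim exE conjE)
  obtain n e \<psi> where *: "frame B n e \<psi>" "\<forall>i<n. e i \<in> carrier B" "\<forall>s\<in>S. fproj B n e \<psi> s = s"
    by (rule frame_exists[OF B module.carrier_is_submodule[OF B] S(1,2)])
  have "tmap K A B A B (\<lambda>x. x) (fproj B n e \<psi>) t = t"
    using S(3) fproj_linear[OF B frame_props(1,2)[OF *(1)]] *(3) by simp
  then show thesis using that[OF *(1)] tmap_fproj_right[OF A B *(1) t] by simp
qed

text \<open>The difference of the two tensors expands over a frame of \<open>B\<close> with its own
  slices as coefficients, and these vanish.\<close>

lemma tens_eqI_rslice:
  assumes A: "module K A" and B: "module K B" and s: "s \<in> carrier (tens K A B)" and t: "t \<in> carrier (tens K A B)"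
    and eq: "\<And>\<psi>. functional B \<psi> \<Longrightarrow> rslice A B \<psi> s = rslice A B \<psi> t"
  shows "s = t"
proof -
  interpret A: module K A by fact
  let ?d = "s \<ominus>\<^bsub>tens K A B\<^esub> t"
  have d: "?d \<in> carrier (tens K A B)" using A B s t by simp
  obtain n e \<psi> where *: "frame B n e \<psi>"
    "?d = (\<Oplus>\<^bsub>tens K A B\<^esub>i\<in>{..<n}. pure K A B (rslice A B (\<psi> i) ?d) (e i))"
    using tens_expand_right[OF A B d] .
  note p = frame_props[OF *(1)]
  have z: "rslice A B (\<psi> i) ?d = \<zero>\<^bsub>A\<^esub>" if "i < n" for i
    using linear_diff[OF rslice_linear[OF A B p(2)[OF that]] _ A s t] eq[OF p(2)[OF that]] A B p(2)[OF that] s t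
    by (simp add: module_diff_eq_zero)
  have pz: "pure K A B \<zero>\<^bsub>A\<^esub> (e i) = \<zero>\<^bsub>tens K A B\<^esub>" if "i < n" for i
    using linear_zero[OF linear_pure_left[OF A B p(1)[OF that]]] A B by simp
  have "(\<Oplus>\<^bsub>tens K A B\<^esub>i\<in>{..<n}. pure K A B (rslice A B (\<psi> i) ?d) (e i)) =
      (\<Oplus>\<^bsub>tens K A B\<^esub>i\<in>{..<n}. \<zero>\<^bsub>tens K A B\<^esub>)"
    using z pz A B by (intro module_finsum_cong) auto
  also have "\<dots> = \<zero>\<^bsub>tens K A B\<^esub>"
    using A B by (intro abelian_monoid.finsum_zero module_abelian_monoid) auto
  finally show ?thesis using *(2) A B s t by (simp add: module_diff_eq_zero)
qed

text \<open>A right slice is tested by a further functional on \<open>A\<close>, and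
  \<open>slice_swap\<close> exchanges the order of the two contractions; so
  \<open>tens_eqI_rslice\<close> applies.\<close>

lemma tens_eqI_lslice:
  assumes A: "module K A" and B: "module K B" and s: "s \<in> carrier (tens K A B)" and t: "t \<in> carrier (tens K A B)"
    and eq: "\<And>\<psi>. functional A \<psi> \<Longrightarrow> lslice A B \<psi> s = lslice A B \<psi> t"
  shows "s = t"
proof (rule tens_eqI_rslice[OF A B s t])
  fix \<psi> assume \<psi>: "functional B \<psi>"
  let ?r = "rslice A B \<psi>"
  show "?r s = ?r t"
  proof (rule ccontr)
    assume "?r s \<noteq> ?r t"
    then have "?r s \<ominus>\<^bsub>A\<^esub> ?r t \<noteq> \<zero>\<^bsub>A\<^esub>" using A B s t \<psi> by (simp add: module_diff_eq_zero)
    then obtain \<phi> where \<phi>: "functional A \<phi>" "\<phi> (?r s \<ominus>\<^bsub>A\<^esub> ?r t) = \<one>"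
      using separating_functional[OF A, of "?r s \<ominus>\<^bsub>A\<^esub> ?r t"] A B s t \<psi> by auto
    have "\<phi> (?r s) = \<phi> (?r t)"
      using slice_swap[OF A B \<phi>(1) \<psi> s] slice_swap[OF A B \<phi>(1) \<psi> t] eq[OF \<phi>(1)] by simp
    then have "\<phi> (?r s \<ominus>\<^bsub>A\<^esub> ?r t) = \<zero>"
      using functional_diff[OF \<phi>(1) A, of "?r s" "?r t"] functional_closed[OF \<phi>(1), of "?r t"] A B s t \<psi>
      by (simp add: minus_eq r_neg)
    then show False using \<phi>(2) by simp
  qed
qed

lemma eqI_functional:
  assumes A: "module K A" and "x \<in> carrier A" "y \<in> carrier A" "\<And>\<phi>. functional A \<phi> \<Longrightarrow> \<phi> x = \<phi> y"
  shows "x = y"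
proof (rule ccontr)
  assume "x \<noteq> y"
  then have "x \<ominus>\<^bsub>A\<^esub> y \<noteq> \<zero>\<^bsub>A\<^esub>" using assms by (simp add: module_diff_eq_zero)
  then obtain \<phi> where \<phi>: "functional A \<phi>" "\<phi> (x \<ominus>\<^bsub>A\<^esub> y) = \<one>"
    using separating_functional[OF A, of "x \<ominus>\<^bsub>A\<^esub> y"] assms by auto
  have "\<phi> (x \<ominus>\<^bsub>A\<^esub> y) = \<zero>"
    using functional_diff[OF \<phi>(1) A assms(2,3)] functional_closed[OF \<phi>(1) assms(3)] assms(4)[OF \<phi>(1)]
    by (simp add: minus_eq r_neg)
  then show False using \<phi>(2) by simp
qed

text \<open>Flatness over a field: the map factors as \<open>I \<otimes> g\<close> followed by
  \<open>f \<otimes> I\<close>, and slicing away the inert factor reduces each to the injectivity of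
  \<open>g\<close> or \<open>f\<close>.\<close>

lemma tmap_inj:
  assumes mods: "module K A" "module K B" "module K C" "module K D"
    and f: "is_linear K A C f" "inj_on f (carrier A)" and g: "is_linear K B D g" "inj_on g (carrier B)"
  shows "inj_on (tmap K A B C D f g) (carrier (tens K A B))"
proof (rule inj_onI)
  fix s t assume st: "s \<in> carrier (tens K A B)" "t \<in> carrier (tens K A B)"
    and eq: "tmap K A B C D f g s = tmap K A B C D f g t"
  have fac: "tmap K A B C D f g u = tmap K A D C D f (\<lambda>x. x) (tmap K A B A D (\<lambda>x. x) g u)"
    if "u \<in> carrier (tens K A B)" for u
    using tmap_comp[OF mods(1,2,1,4,3,4) linear_ident g(1) f(1) linear_ident that] by simp
  let ?g = "tmap K A B A D (\<lambda>x. x) g"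
  have cl: "?g s \<in> carrier (tens K A D)" "?g t \<in> carrier (tens K A D)" using mods st g by auto
  have "?g s = ?g t"
  proof (rule tens_eqI_rslice[OF mods(1,4) cl])
    fix \<psi> assume \<psi>: "functional D \<psi>"
    have "f (rslice A D \<psi> (?g u)) = rslice C D \<psi> (tmap K A B C D f g u)" if "u \<in> carrier (tens K A B)" for u
      unfolding fac[OF that] using rslice_tmap[OF mods(1,4,3,4) f(1) linear_ident \<psi>, of "?g u"] mods that g by simp
    then have "f (rslice A D \<psi> (?g s)) = f (rslice A D \<psi> (?g t))" using st eq by simp
    then show "rslice A D \<psi> (?g s) = rslice A D \<psi> (?g t)"
      using f(2) cl mods \<psi> by (auto dest!: inj_onD)
  qed
  show "s = t"
  proof (rule tens_eqI_lslice[OF mods(1,2) st])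
    fix \<psi> assume \<psi>: "functional A \<psi>"
    have "g (lslice A B \<psi> u) = lslice A D \<psi> (?g u)" if "u \<in> carrier (tens K A B)" for u
      using lslice_tmap[OF mods(1,2,1,4) linear_ident g(1) \<psi> that] by simp
    then have "g (lslice A B \<psi> s) = g (lslice A B \<psi> t)" using st \<open>?g s = ?g t\<close> by simp
    then show "lslice A B \<psi> s = lslice A B \<psi> t"
      using g(2) st mods \<psi> by (auto dest!: inj_onD)
  qed
qed

lemma tmap_fixed_left:
  assumes "module K A" "module K B" "is_linear K A A P" "t \<in> carrier (tens K A B)"
    "\<And>\<psi>. functional B \<psi> \<Longrightarrow> P (rslice A B \<psi> t) = rslice A B \<psi> t"
  shows "tmap K A B A B P (\<lambda>x. x) t = t"
  by (rule tens_eqI_rslice[OF assms(1,2)])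
    (use assms rslice_tmap[OF assms(1,2,1,2,3) linear_ident] in auto)


subsection \<open>Coactions\<close>

text \<open>The axioms of \<open>is_comodule\<close> without extensionality, so that a
  comultiplication counts as a coaction of the coalgebra on itself.\<close>

definition coaction :: "('k, 'd, 'x) coalgebra_scheme \<Rightarrow> ('k, 'm, 'y) module_scheme \<Rightarrow>
   ('m \<Rightarrow> ('m, 'd) tensor) \<Rightarrow> bool"
  where "coaction D M \<rho> \<longleftrightarrow> module K M \<and> is_linear K M (tens K M D) \<rho> \<and>
    (\<forall>m\<in>carrier M.
       tassoc K M D D (tmap K M D (tens K M D) D \<rho> (\<lambda>d. d) (\<rho> m)) =
       tmap K M D M (tens K D D) (\<lambda>m. m) (comult D) (\<rho> m)) \<and>
    (\<forall>m\<in>carrier M. rslice M D (counit D) (\<rho> m) = m)"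

lemma coalgebra_props:
  assumes "is_coalgebra K D"
  shows coalgebra_module: "module K D"
    and comult_linear: "is_linear K D (tens K D D) (comult D)"
    and counit_functional: "functional D (counit D)"
    and coalgebra_coaction: "coaction D D (comult D)"
    and counit_left: "\<And>c. c \<in> carrier D \<Longrightarrow> lslice D D (counit D) (comult D c) = c"
  using assms unfolding is_coalgebra_def coaction_def functional_def rslice_def lslice_def by auto

lemma is_comodule_iff: "is_comodule K D (M, \<rho>) \<longleftrightarrow> coaction D M \<rho> \<and> \<rho> \<in> extensional (carrier M)"
  unfolding is_comodule_def coaction_def lin_def rslice_def by auto

lemma coaction_props:
  assumes "coaction D M \<rho>"
  shows "module K M" "is_linear K M (tens K M D) \<rho>"
    "\<And>m. m \<in> carrier M \<Longrightarrow> tassoc K M D D (tmap K M D (tens K M D) D \<rho> (\<lambda>d. d) (\<rho> m)) =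
       tmap K M D M (tens K D D) (\<lambda>m. m) (comult D) (\<rho> m)"
    "\<And>m. m \<in> carrier M \<Longrightarrow> rslice M D (counit D) (\<rho> m) = m"
    "\<And>m. m \<in> carrier M \<Longrightarrow> \<rho> m \<in> carrier (tens K M D)"
proof -
  show "module K M" and lin: "is_linear K M (tens K M D) \<rho>"
    and "\<And>m. m \<in> carrier M \<Longrightarrow> tassoc K M D D (tmap K M D (tens K M D) D \<rho> (\<lambda>d. d) (\<rho> m)) =
       tmap K M D M (tens K D D) (\<lambda>m. m) (comult D) (\<rho> m)"
    and "\<And>m. m \<in> carrier M \<Longrightarrow> rslice M D (counit D) (\<rho> m) = m"
    using assms unfolding coaction_def by blast+
  show "\<rho> m \<in> carrier (tens K M D)" if "m \<in> carrier M" for m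
    using linear_closed[OF lin that] .
qed

text \<open>Coassociativity contracted with \<open>\<psi>\<close> in the last factor: an action of
  \<open>\<psi>\<close> on the comodule becomes an action on the coefficient side of
  \<open>\<rho>\<close>.\<close>

lemma coaction_slice:
  assumes D: "is_coalgebra K D" and M: "coaction D M \<rho>" and \<psi>: "functional D \<psi>" and m: "m \<in> carrier M"
  shows "\<rho> (rslice M D \<psi> (\<rho> m)) = tmap K M D M D (\<lambda>x. x) (\<lambda>d. rslice D D \<psi> (comult D d)) (\<rho> m)"
proof -
  note Dp = coalgebra_props[OF D] and Mp = coaction_props[OF M]
  note [simp] = Dp(1) Mp(1)
  have "\<rho> (rslice M D \<psi> (\<rho> m)) = rslice (tens K M D) D \<psi> (tmap K M D (tens K M D) D \<rho> (\<lambda>d. d) (\<rho> m))"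
    using rslice_tmap[OF _ _ _ _ Mp(2) linear_ident \<psi> Mp(5)[OF m]] by simp
  also have "\<dots> = tmap K M (tens K D D) M D (\<lambda>x. x) (rslice D D \<psi>)
      (tassoc K M D D (tmap K M D (tens K M D) D \<rho> (\<lambda>d. d) (\<rho> m)))"
    using Mp \<psi> m by (intro rslice_tassoc[symmetric]) auto
  also have "\<dots> = tmap K M (tens K D D) M D (\<lambda>x. x) (rslice D D \<psi>) (tmap K M D M (tens K D D) (\<lambda>m. m) (comult D) (\<rho> m))"
    using Mp(3)[OF m] by simp
  also have "\<dots> = tmap K M D M D (\<lambda>x. x) (\<lambda>d. rslice D D \<psi> (comult D d)) (\<rho> m)"
    using Dp Mp \<psi> m by (intro tmap_comp) auto
  finally show ?thesis .
qed

lemma coslice_linear: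
  assumes "is_coalgebra K D" "functional D \<psi>"
  shows "is_linear K D D (\<lambda>d. rslice D D \<psi> (comult D d))"
  using coalgebra_props[OF assms(1)] assms(2) by (intro linear_comp[OF rslice_linear]) auto

lemma coaction_slice_slice:
  assumes D: "is_coalgebra K D" and M: "coaction D M \<rho>" and \<psi>: "functional D \<psi>" "functional D \<chi>"
    and m: "m \<in> carrier M"
  shows "rslice M D \<chi> (\<rho> (rslice M D \<psi> (\<rho> m))) = rslice M D (\<lambda>d. \<chi> (rslice D D \<psi> (comult D d))) (\<rho> m)"
  unfolding coaction_slice[OF D M \<psi>(1) m]
  using rslice_tmap[OF _ _ _ _ linear_ident coslice_linear[OF D \<psi>(1)] \<psi>(2), of M "\<rho> m"]
    coaction_props[OF M] coalgebra_props[OF D] m by simp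

text \<open>The finiteness theorem for comodules. That \<open>U\<close> is finite dimensional is expressed by finitely many
  functionals separating its points.\<close>

lemma coaction_finite:
  assumes D: "is_coalgebra K D" and M: "coaction D M \<rho>" and S: "finite S" "S \<subseteq> carrier M"
  shows "\<exists>U n \<phi>. submodule U K M \<and> S \<subseteq> U \<and>
    (\<forall>x\<in>U. \<forall>\<psi>. functional D \<psi> \<longrightarrow> rslice M D \<psi> (\<rho> x) \<in> U) \<and>
    (\<forall>i<n::nat. functional M (\<phi> i)) \<and>
    (\<forall>x\<in>U. (\<forall>i<n. \<phi> i x = \<zero>) \<longrightarrow> x = \<zero>\<^bsub>M\<^esub>)"
proof -
  note Dp = coalgebra_props[OF D] and Mp = coaction_props[OF M]
  interpret M: module K M by (rule Mp(1))
  have "\<exists>T. finite T \<and> T \<subseteq> carrier M \<and> (\<forall>P. is_linear K M M P \<longrightarrow> (\<forall>s\<in>T. P s = s) \<longrightarrow>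
     tmap K M D M D P (\<lambda>x. x) (\<rho> m) = \<rho> m)" if "m \<in> S" for m
    by (rule tens_support_left) (use Mp Dp S that in auto)
  then have "\<forall>m\<in>S. \<exists>T. finite T \<and> T \<subseteq> carrier M \<and> (\<forall>P. is_linear K M M P \<longrightarrow> (\<forall>s\<in>T. P s = s) \<longrightarrow>
     tmap K M D M D P (\<lambda>x. x) (\<rho> m) = \<rho> m)" by blast
  from bchoice[OF this] obtain T where T: "\<forall>m\<in>S. finite (T m) \<and> T m \<subseteq> carrier M \<and>
     (\<forall>P. is_linear K M M P \<longrightarrow> (\<forall>s\<in>T m. P s = s) \<longrightarrow> tmap K M D M D P (\<lambda>x. x) (\<rho> m) = \<rho> m)" ..
  have fT: "finite (\<Union>m\<in>S. T m)" "(\<Union>m\<in>S. T m) \<subseteq> carrier M" using T S by auto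
  obtain n e \<phi> where fr: "frame M n e \<phi>" "\<forall>i<n. e i \<in> carrier M" "\<forall>s\<in>(\<Union>m\<in>S. T m). fproj M n e \<phi> s = s"
    by (rule frame_exists[OF Mp(1) M.carrier_is_submodule fT])
  note fp = frame_props[OF fr(1)]
  let ?P = "fproj M n e \<phi>"
  have P: "is_linear K M M ?P" using fproj_linear[OF Mp(1) fp(1,2)] .
  have PS: "tmap K M D M D ?P (\<lambda>x. x) (\<rho> m) = \<rho> m" if "m \<in> S" for m
    using T P fr(3) that by simp
  \<comment> \<open>The counit recovers \<open>S\<close> among these slices, and a slice of a slice
    is again a slice by coassociativity.\<close>
  let ?G = "{rslice M D \<psi> (\<rho> m) | \<psi> m. functional D \<psi> \<and> m \<in> S}"
  let ?U = "span_of K M ?G"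
  have G: "?G \<subseteq> carrier M" using Mp Dp S by auto
  have U: "submodule ?U K M" by (rule submodule_span_of[OF Mp(1) G])
  \<comment> \<open>The projection fixes the left factor of each \<open>\<rho> m\<close>, hence
    every slice of it; this bounds the dimension.\<close>
  have "?G \<subseteq> {x \<in> carrier M. ?P x = x}"
  proof safe
    fix \<psi> m assume \<psi>: "functional D \<psi>" and m: "m \<in> S"
    have mM: "m \<in> carrier M" using m S by blast
    show "rslice M D \<psi> (\<rho> m) \<in> carrier M" using \<psi> mM Mp Dp by auto
    show "?P (rslice M D \<psi> (\<rho> m)) = rslice M D \<psi> (\<rho> m)"
      using rslice_tmap[OF Mp(1) Dp(1) Mp(1) Dp(1) P linear_ident \<psi> Mp(5)[OF mM], unfolded PS[OF m]]
      by (rule sym)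
  qed
  then have UP: "?U \<subseteq> {x \<in> carrier M. ?P x = x}"
    by (rule span_of_least[OF submodule_equalizer[OF Mp(1) Mp(1) P linear_ident]])
  have "S \<subseteq> ?G"
  proof
    fix m assume "m \<in> S"
    then show "m \<in> ?G" using Mp(4)[of m] Dp(3) S by (intro CollectI exI[of _ "counit D"] exI[of _ m]) auto
  qed
  then have "S \<subseteq> ?U" using span_of_incl[of ?G M] by blast
  moreover have "rslice M D \<chi> (\<rho> x) \<in> ?U" if x: "x \<in> ?U" and \<chi>: "functional D \<chi>" for x \<chi>
  proof -
    have lin: "is_linear K M M (\<lambda>x. rslice M D \<chi> (\<rho> x))"
      using linear_comp[OF rslice_linear[OF Mp(1) Dp(1) \<chi>] Mp(2)] .
    have "?G \<subseteq> {x \<in> carrier M. rslice M D \<chi> (\<rho> x) \<in> ?U}"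
    proof safe
      fix \<psi> m assume \<psi>: "functional D \<psi>" and m: "m \<in> S"
      have mM: "m \<in> carrier M" using m S by blast
      show "rslice M D \<psi> (\<rho> m) \<in> carrier M" using \<psi> mM Mp Dp by auto
      have "functional D (\<lambda>d. \<chi> (rslice D D \<psi> (comult D d)))"
        by (rule functional_comp[OF \<chi> coslice_linear[OF D \<psi>]])
      then have "rslice M D \<chi> (\<rho> (rslice M D \<psi> (\<rho> m))) \<in> ?G"
        unfolding coaction_slice_slice[OF D M \<psi> \<chi> mM] using m by blast
      then show "rslice M D \<chi> (\<rho> (rslice M D \<psi> (\<rho> m))) \<in> ?U" using span_of_incl[of ?G M] by blast
    qed
    then have "?U \<subseteq> {x \<in> carrier M. rslice M D \<chi> (\<rho> x) \<in> ?U}"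
      by (rule span_of_least[OF submodule_preimage[OF Mp(1) Mp(1) lin U]])
    then show ?thesis using x by blast
  qed
  moreover have "x = \<zero>\<^bsub>M\<^esub>" if x: "x \<in> ?U" and z: "\<And>i. i < n \<Longrightarrow> \<phi> i x = \<zero>" for x
  proof -
    have "x = ?P x" using UP x by auto
    also have "\<dots> = \<zero>\<^bsub>M\<^esub>"
      unfolding fproj_def using z fp by (intro M.add.finprod_one_eqI) auto
    finally show ?thesis .
  qed
  ultimately show ?thesis
    using U fp(2) by (intro exI[of _ ?U] exI[of _ n] exI[of _ \<phi>] conjI) simp_all
qed

section \<open>Matrix coefficients of a coaction\<close>

text \<open>Such a family amounts to a coalgebra map from the \<open>n\<close> by \<open>n\<close>
  comatrix coalgebra, its entries being the images of the standard basis.\<close>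

definition comatrix :: "('k, 'd, 'x) coalgebra_scheme \<Rightarrow> nat \<Rightarrow> (nat \<Rightarrow> nat \<Rightarrow> 'd) \<Rightarrow> bool"
  where "comatrix D n c \<longleftrightarrow> (\<forall>i<n. \<forall>j<n. c i j \<in> carrier D \<and>
    comult D (c i j) = (\<Oplus>\<^bsub>tens K D D\<^esub>k\<in>{..<n}. pure K D D (c i k) (c k j)) \<and>
    counit D (c i j) = (if i = j then \<one> else \<zero>))"

text \<open>A frame whose span is stable under \<open>\<rho>\<close>; the left slices that occur are
  the matrix entries of \<open>\<rho>\<close> in it.\<close>

definition coframe :: "('k, 'h, 'x) module_scheme \<Rightarrow> ('k, 'm, 'y) module_scheme \<Rightarrow> ('m \<Rightarrow> ('m, 'h) tensor) \<Rightarrow>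
   nat \<Rightarrow> (nat \<Rightarrow> 'm) \<Rightarrow> (nat \<Rightarrow> 'm \<Rightarrow> 'k) \<Rightarrow> bool"
  where "coframe H M \<rho> n e \<psi> \<longleftrightarrow> frame M n e \<psi> \<and>
    (\<forall>j<n. \<rho> (e j) = (\<Oplus>\<^bsub>tens K M H\<^esub>i\<in>{..<n}. pure K M H (e i) (lslice M H (\<psi> i) (\<rho> (e j)))))"

text \<open>Stability of \<open>U\<close> under slices makes the projection fix the left factor of
  \<open>\<rho> (e j)\<close>, which therefore expands along the frame.\<close>

lemma coframeI:
  assumes mods: "module K M" "module K H" and \<rho>: "is_linear K M (tens K M H) \<rho>"
    and fr: "frame M n e \<psi>" and eU: "\<And>i. i < n \<Longrightarrow> e i \<in> U" and fxd: "\<And>x. x \<in> U \<Longrightarrow> fproj M n e \<psi> x = x"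
    and stab: "\<And>x \<chi>. x \<in> U \<Longrightarrow> functional H \<chi> \<Longrightarrow> rslice M H \<chi> (\<rho> x) \<in> U"
  shows "coframe H M \<rho> n e \<psi>"
  unfolding coframe_def
proof (intro conjI allI impI fr)
  fix j assume j: "j < n"
  note p = frame_props[OF fr]
  have P: "is_linear K M M (fproj M n e \<psi>)" using fproj_linear[OF mods(1) p(1,2)] .
  have c: "\<rho> (e j) \<in> carrier (tens K M H)" using linear_closed[OF \<rho> p(1)[OF j]] .
  have "tmap K M H M H (fproj M n e \<psi>) (\<lambda>x. x) (\<rho> (e j)) = \<rho> (e j)"
    by (rule tmap_fixed_left[OF mods P c]) (use fxd stab eU j in auto)
  then show "\<rho> (e j) = (\<Oplus>\<^bsub>tens K M H\<^esub>i\<in>{..<n}. pure K M H (e i) (lslice M H (\<psi> i) (\<rho> (e j))))"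
    using tmap_fproj_left[OF mods fr c] by simp
qed

text \<open>Coassociativity contracted with \<open>f\<close> in the first factor. It says that
  taking coefficients along \<open>f\<close> is a comodule morphism from \<open>M\<close> to the
  regular comodule \<open>D\<close>.\<close>

lemma comult_coefficient:
  assumes D: "is_coalgebra K D" and M: "coaction D M \<rho>" and f: "functional M f" and m: "m \<in> carrier M"
  shows "comult D (lslice M D f (\<rho> m)) = tmap K M D D D (\<lambda>x. lslice M D f (\<rho> x)) (\<lambda>x. x) (\<rho> m)"
proof -
  note Dp = coalgebra_props[OF D] and Mp = coaction_props[OF M]
  note [simp] = Dp(1) Mp(1)
  have "comult D (lslice M D f (\<rho> m)) = lslice M (tens K D D) f (tmap K M D M (tens K D D) (\<lambda>m. m) (comult D) (\<rho> m))"
    using lslice_tmap[OF _ _ _ _ linear_ident Dp(2) f, of "\<rho> m"] Mp(5)[OF m] by simp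
  also have "\<dots> = lslice M (tens K D D) f (tassoc K M D D (tmap K M D (tens K M D) D \<rho> (\<lambda>d. d) (\<rho> m)))"
    using Mp(3)[OF m] by simp
  also have "\<dots> = tmap K (tens K M D) D D D (lslice M D f) (\<lambda>x. x) (tmap K M D (tens K M D) D \<rho> (\<lambda>d. d) (\<rho> m))"
    using Mp(2) Mp(5)[OF m] f by (intro lslice_tassoc) auto
  also have "\<dots> = tmap K M D D D (\<lambda>m. lslice M D f (\<rho> m)) (\<lambda>x. x) (\<rho> m)"
    using Mp(2) Mp(5)[OF m] f by (intro tmap_comp) auto
  finally show ?thesis .
qed

lemma counit_coefficient:
  assumes D: "is_coalgebra K D" and M: "coaction D M \<rho>" and f: "functional M f" and m: "m \<in> carrier M"
  shows "counit D (lslice M D f (\<rho> m)) = f m"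
  using slice_swap[OF coaction_props(1)[OF M] coalgebra_module[OF D] f counit_functional[OF D] coaction_props(5)[OF M m]]
    coaction_props(4)[OF M m] by simp

lemma coefficient_linear:
  assumes D: "is_coalgebra K D" and M: "coaction D M \<rho>" and f: "functional M f"
  shows "is_linear K M D (\<lambda>m. lslice M D f (\<rho> m))"
  by (rule linear_comp[OF lslice_linear coaction_props(2)[OF M]])
    (use coaction_props(1)[OF M] coalgebra_module[OF D] f in auto)

lemma comatrix_of_coframe:
  assumes D: "is_coalgebra K D" and M: "coaction D M \<rho>" and fr: "coframe D M \<rho> n e \<psi>"
  shows "comatrix D n (\<lambda>i j. lslice M D (\<psi> i) (\<rho> (e j)))"
  unfolding comatrix_def
proof (intro allI impI conjI)
  fix i j assume ij: "i < n" "j < n"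
  note Dp = coalgebra_props[OF D] and Mp = coaction_props[OF M]
  note [simp] = Dp(1) Mp(1)
  have frM: "frame M n e \<psi>" using fr by (simp add: coframe_def)
  note p = frame_props[OF frM]
  note \<psi> = p(2)[OF ij(1)] and ej = p(1)[OF ij(2)]
  let ?c = "\<lambda>i j. lslice M D (\<psi> i) (\<rho> (e j))"
  show "?c i j \<in> carrier D" using Mp(5)[OF ej] \<psi> by simp
  note lin = coefficient_linear[OF D M \<psi>]
  have "comult D (?c i j) = tmap K M D D D (\<lambda>m. lslice M D (\<psi> i) (\<rho> m)) (\<lambda>x. x) (\<rho> (e j))"
    by (rule comult_coefficient[OF D M \<psi> ej])
  also have "\<dots> = tmap K M D D D (\<lambda>m. lslice M D (\<psi> i) (\<rho> m)) (\<lambda>x. x)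
      (\<Oplus>\<^bsub>tens K M D\<^esub>k\<in>{..<n}. pure K M D (e k) (?c k j))"
    by (rule arg_cong[where f = "tmap K M D D D (\<lambda>m. lslice M D (\<psi> i) (\<rho> m)) (\<lambda>x. x)"])
      (use fr ij(2) in \<open>unfold coframe_def, blast\<close>)
  also have "\<dots> = (\<Oplus>\<^bsub>tens K D D\<^esub>k\<in>{..<n}. tmap K M D D D (\<lambda>m. lslice M D (\<psi> i) (\<rho> m)) (\<lambda>x. x) (pure K M D (e k) (?c k j)))"
    using lin p Mp(5)[OF ej] by (intro linear_finsum[OF tmap_linear]) auto
  also have "\<dots> = (\<Oplus>\<^bsub>tens K D D\<^esub>k\<in>{..<n}. pure K D D (?c i k) (?c k j))"
    using lin p Mp(5) ej \<psi> by (intro module_finsum_cong) auto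
  finally show "comult D (?c i j) = (\<Oplus>\<^bsub>tens K D D\<^esub>k\<in>{..<n}. pure K D D (?c i k) (?c k j))" .
  show "counit D (?c i j) = (if i = j then \<one> else \<zero>)"
    using counit_coefficient[OF D M \<psi> ej] p(3)[OF ij] by simp
qed

end

subsection \<open>Finite-dimensional modules inside the universe type\<close>

context base_field
begin

lemma module_finsum_zero:
  assumes "module K V" "\<And>i. i \<in> I \<Longrightarrow> f i = \<zero>\<^bsub>V\<^esub>"
  shows "finsum V f I = \<zero>\<^bsub>V\<^esub>"
proof -
  interpret V: module K V by fact
  show ?thesis by (rule V.add.finprod_one_eqI) (use assms in auto)
qed

text \<open>The index set is arbitrary so that pairs \<open>(i, j)\<close> can index the basis of a
  comatrix coalgebra.\<close>

definition basis :: "('k, 'a, 'x) module_scheme \<Rightarrow> 'i set \<Rightarrow> ('i \<Rightarrow> 'a) \<Rightarrow> ('i \<Rightarrow> 'a \<Rightarrow> 'k) \<Rightarrow> bool"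
  where "basis V Q b \<chi> \<longleftrightarrow> module K V \<and> finite Q \<and> (\<forall>q\<in>Q. b q \<in> carrier V \<and> functional V (\<chi> q)) \<and>
    (\<forall>q\<in>Q. \<forall>r\<in>Q. \<chi> q (b r) = (if q = r then \<one> else \<zero>)) \<and>
    (\<forall>x\<in>carrier V. x = (\<Oplus>\<^bsub>V\<^esub>q\<in>Q. \<chi> q x \<odot>\<^bsub>V\<^esub> b q))"

lemma basis_props:
  assumes "basis V Q b \<chi>"
  shows "module K V" "finite Q" "\<And>q. q \<in> Q \<Longrightarrow> b q \<in> carrier V" "\<And>q. q \<in> Q \<Longrightarrow> functional V (\<chi> q)"
    "\<And>q r. q \<in> Q \<Longrightarrow> r \<in> Q \<Longrightarrow> \<chi> q (b r) = (if q = r then \<one> else \<zero>)"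
    "\<And>x. x \<in> carrier V \<Longrightarrow> x = (\<Oplus>\<^bsub>V\<^esub>q\<in>Q. \<chi> q x \<odot>\<^bsub>V\<^esub> b q)"
  using assms by (simp_all add: basis_def)

lemma basis_cong:
  assumes bas: "basis V Q b \<chi>" and eq: "\<And>q. q \<in> Q \<Longrightarrow> b' q = b q"
  shows "basis V Q b' \<chi>"
proof -
  note p = basis_props[OF bas]
  have "x = (\<Oplus>\<^bsub>V\<^esub>q\<in>Q. \<chi> q x \<odot>\<^bsub>V\<^esub> b' q)" if x: "x \<in> carrier V" for x
  proof -
    have "(\<Oplus>\<^bsub>V\<^esub>q\<in>Q. \<chi> q x \<odot>\<^bsub>V\<^esub> b' q) = (\<Oplus>\<^bsub>V\<^esub>q\<in>Q. \<chi> q x \<odot>\<^bsub>V\<^esub> b q)"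
      by (rule module_finsum_cong) (use p eq functional_closed[OF p(4) x] in auto)
    then show ?thesis using p(6)[OF x] by simp
  qed
  then show ?thesis using p eq by (simp add: basis_def)
qed

lemma basis_linear_eq:
  assumes bas: "basis V Q b \<chi>" and W: "module K W" and f: "is_linear K V W f" and g: "is_linear K V W g"
    and eq: "\<And>q. q \<in> Q \<Longrightarrow> f (b q) = g (b q)" and x: "x \<in> carrier V"
  shows "f x = g x"
proof -
  note p = basis_props[OF bas]
  note c = functional_closed[OF p(4) x]
  have h: "h x = (\<Oplus>\<^bsub>W\<^esub>q\<in>Q. \<chi> q x \<odot>\<^bsub>W\<^esub> h (b q))" if h: "is_linear K V W h" for h
  proof -
    have "h x = h (\<Oplus>\<^bsub>V\<^esub>q\<in>Q. \<chi> q x \<odot>\<^bsub>V\<^esub> b q)" using p(6)[OF x] by (rule arg_cong)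
    also have "\<dots> = (\<Oplus>\<^bsub>W\<^esub>q\<in>Q. h (\<chi> q x \<odot>\<^bsub>V\<^esub> b q))"
      by (rule linear_finsum[OF h p(1) W p(2)]) (use p c in auto)
    also have "\<dots> = (\<Oplus>\<^bsub>W\<^esub>q\<in>Q. \<chi> q x \<odot>\<^bsub>W\<^esub> h (b q))"
      by (rule module_finsum_cong[OF W]) (use p c W linear_closed[OF h] in \<open>auto simp: linear_smult[OF h]\<close>)
    finally show ?thesis .
  qed
  show ?thesis
    unfolding h[OF f] h[OF g]
    by (rule module_finsum_cong[OF W]) (use eq p(3) c W linear_closed[OF g] in auto)
qed

definition basis_map :: "('k, 'w, 'v) module_scheme \<Rightarrow> 'i set \<Rightarrow> ('i \<Rightarrow> 'a \<Rightarrow> 'k) \<Rightarrow> ('i \<Rightarrow> 'w) \<Rightarrow> 'a \<Rightarrow> 'w"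
  where "basis_map W Q \<chi> f x = (\<Oplus>\<^bsub>W\<^esub>q\<in>Q. \<chi> q x \<odot>\<^bsub>W\<^esub> f q)"

lemma basis_map:
  assumes bas: "basis V Q b \<chi>" and W: "module K W" and f: "\<And>q. q \<in> Q \<Longrightarrow> f q \<in> carrier W"
  shows basis_map_linear: "is_linear K V W (basis_map W Q \<chi> f)"
    and basis_map_basis: "\<And>q. q \<in> Q \<Longrightarrow> basis_map W Q \<chi> f (b q) = f q"
proof -
  note p = basis_props[OF bas]
  show "is_linear K V W (basis_map W Q \<chi> f)"
    unfolding basis_map_def[abs_def]
    by (intro linear_finsum_map linear_functional_scale) (use p W f in auto)
  show "basis_map W Q \<chi> f (b q) = f q" if q: "q \<in> Q" for q
  proof -
    interpret W: module K W by fact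
    have "basis_map W Q \<chi> f (b q) = (\<Oplus>\<^bsub>W\<^esub>r\<in>Q. if q = r then f r else \<zero>\<^bsub>W\<^esub>)"
      unfolding basis_map_def by (rule module_finsum_cong[OF W]) (use p(5) q f W in auto)
    also have "\<dots> = f q"
      by (rule W.add.finprod_singleton) (use q p f in auto)
    finally show ?thesis .
  qed
qed

lemma basis_reindex:
  assumes bas: "basis V R b \<chi>" and h: "bij_betw h Q R"
  shows "basis V Q (\<lambda>q. b (h q)) (\<lambda>q. \<chi> (h q))"
  unfolding basis_def
proof (intro conjI ballI)
  note p = basis_props[OF bas]
  have hQ: "h q \<in> R" if "q \<in> Q" for q using h that by (auto simp: bij_betw_def)
  have inj: "inj_on h Q" and im: "h ` Q = R" using h by (auto simp: bij_betw_def)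
  show "module K V" "finite Q" using p(1,2) h by (auto simp: bij_betw_finite)
  show "b (h q) \<in> carrier V" "functional V (\<chi> (h q))" if "q \<in> Q" for q using p hQ that by auto
  show "\<chi> (h q) (b (h r)) = (if q = r then \<one> else \<zero>)" if "q \<in> Q" "r \<in> Q" for q r
    using p(5)[OF hQ hQ] that inj by (auto dest: inj_onD)
  show "x = (\<Oplus>\<^bsub>V\<^esub>q\<in>Q. \<chi> (h q) x \<odot>\<^bsub>V\<^esub> b (h q))" if x: "x \<in> carrier V" for x
  proof -
    interpret V: module K V by (rule p(1))
    have "(\<Oplus>\<^bsub>V\<^esub>q\<in>h ` Q. \<chi> q x \<odot>\<^bsub>V\<^esub> b q) = (\<Oplus>\<^bsub>V\<^esub>q\<in>Q. \<chi> (h q) x \<odot>\<^bsub>V\<^esub> b (h q))"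
      by (rule V.add.finprod_reindex) (use inj im p functional_closed[OF p(4) x] in auto)
    then show ?thesis using p(6)[OF x] im by simp
  qed
qed

text \<open>The extension field \<open>m\<close> of the record lets the same space carry a coalgebra structure.\<close>

definition umod :: "('k list \<Rightarrow> 'u) \<Rightarrow> nat \<Rightarrow> 'x \<Rightarrow> ('k, 'u, 'x) module_scheme"
  where "umod \<iota> N m = (let dec = inv_into (lists (carrier K)) \<iota> in
    \<lparr>carrier = \<iota> ` {xs \<in> lists (carrier K). length xs = N}, monoid.mult = undefined, one = undefined,
     ring.zero = \<iota> (replicate N \<zero>), ring.add = (\<lambda>x y. \<iota> (map2 (\<oplus>) (dec x) (dec y))),
     smult = (\<lambda>c x. \<iota> (map ((\<otimes>) c) (dec x))), \<dots> = m\<rparr>)"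

lemma umod_basis:
  fixes \<iota> :: "'k list \<Rightarrow> 'u"
  assumes \<iota>: "inj_on \<iota> (lists (carrier K))"
  shows "basis (umod \<iota> N m) {..<N} (\<lambda>i. \<iota> ((replicate N \<zero>)[i := \<one>]))
    (\<lambda>i x. inv_into (lists (carrier K)) \<iota> x ! i)"
proof -
  let ?L = "{xs \<in> lists (carrier K). length xs = N}" and ?V = "umod \<iota> N m"
  let ?\<chi> = "\<lambda>i x. inv_into (lists (carrier K)) \<iota> x ! i"
  let ?b = "\<lambda>i. \<iota> ((replicate N \<zero>)[i := \<one>])"
  have dec: "inv_into (lists (carrier K)) \<iota> (\<iota> xs) = xs" if "xs \<in> lists (carrier K)" for xs
    using \<iota> that by (rule inv_into_f_f)
  have c: "carrier ?V = \<iota> ` ?L" "\<zero>\<^bsub>?V\<^esub> = \<iota> (replicate N \<zero>)" by (simp_all add: umod_def Let_def)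
  have nth: "xs ! i \<in> carrier K" if "xs \<in> ?L" "i < N" for xs i
    using that by (auto simp: in_lists_conv_set)
  have L2: "map2 (\<oplus>) xs ys \<in> lists (carrier K)" if "xs \<in> ?L" "ys \<in> ?L" for xs ys
    using nth[OF that(1)] nth[OF that(2)] that by (auto simp: in_lists_conv_set set_zip)
  have Lc: "map ((\<otimes>) a) xs \<in> lists (carrier K)" if "xs \<in> ?L" "a \<in> carrier K" for xs a
    using that by (auto simp: in_lists_conv_set)
  have Lz: "replicate N \<zero> \<in> ?L" by (auto simp: in_lists_conv_set)
  have Lb: "(replicate N \<zero>)[i := \<one>] \<in> ?L" for i
    by (auto simp: in_lists_conv_set dest!: subsetD[OF set_update_subset_insert])
  have add: "\<iota> xs \<oplus>\<^bsub>?V\<^esub> \<iota> ys = \<iota> (map2 (\<oplus>) xs ys)" if "xs \<in> ?L" "ys \<in> ?L" for xs ys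
    using that by (simp add: umod_def Let_def dec)
  have sm: "a \<odot>\<^bsub>?V\<^esub> \<iota> xs = \<iota> (map ((\<otimes>) a) xs)" if "xs \<in> ?L" for xs a
    using that by (simp add: umod_def Let_def dec)
  have eqI: "\<iota> xs = \<iota> ys" if "length xs = N" "length ys = N" "\<And>i. i < N \<Longrightarrow> xs ! i = ys ! i" for xs ys
    using that by (metis nth_equalityI)
  have mem: "\<iota> xs \<in> carrier ?V" if "xs \<in> ?L" for xs using that c by blast
  have V: "module K ?V"
  proof (rule moduleI)
    show "cring K" by (rule is_cring)
    show "abelian_group ?V"
    proof (rule abelian_groupI)
      show "x \<oplus>\<^bsub>?V\<^esub> y \<in> carrier ?V" if xyz: "x \<in> carrier ?V" "y \<in> carrier ?V" for x y
      proof -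
        obtain xs ys where xy: "x = \<iota> xs" "xs \<in> ?L" "y = \<iota> ys" "ys \<in> ?L" using xyz by (auto simp: c)
        then have "map2 (\<oplus>) xs ys \<in> ?L" using L2 by auto
        then show ?thesis using mem xy add by simp
      qed
      show "\<zero>\<^bsub>?V\<^esub> \<in> carrier ?V" using Lz by (auto simp: c)
      show "x \<oplus>\<^bsub>?V\<^esub> y \<oplus>\<^bsub>?V\<^esub> z = x \<oplus>\<^bsub>?V\<^esub> (y \<oplus>\<^bsub>?V\<^esub> z)"
        if xyz: "x \<in> carrier ?V" "y \<in> carrier ?V" "z \<in> carrier ?V" for x y z
      proof -
        obtain xs ys zs where "x = \<iota> xs" "xs \<in> ?L" "y = \<iota> ys" "ys \<in> ?L" "z = \<iota> zs" "zs \<in> ?L"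
          using xyz by (auto simp: c)
        then show ?thesis using L2 nth by (auto simp: add a_assoc intro!: eqI)
      qed
      show "x \<oplus>\<^bsub>?V\<^esub> y = y \<oplus>\<^bsub>?V\<^esub> x" if xyz: "x \<in> carrier ?V" "y \<in> carrier ?V" for x y
      proof -
        obtain xs ys where "x = \<iota> xs" "xs \<in> ?L" "y = \<iota> ys" "ys \<in> ?L" using xyz by (auto simp: c)
        then show ?thesis using nth by (auto simp: add a_comm intro!: eqI)
      qed
      show "\<zero>\<^bsub>?V\<^esub> \<oplus>\<^bsub>?V\<^esub> x = x" if xyz: "x \<in> carrier ?V" for x
      proof -
        obtain xs where "x = \<iota> xs" "xs \<in> ?L" using xyz by (auto simp: c)
        then show ?thesis using nth Lz by (auto simp: add c intro!: eqI)
      qed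
      show "\<exists>y\<in>carrier ?V. y \<oplus>\<^bsub>?V\<^esub> x = \<zero>\<^bsub>?V\<^esub>" if xyz: "x \<in> carrier ?V" for x
      proof -
        obtain xs where xs: "x = \<iota> xs" "xs \<in> ?L" using xyz by (auto simp: c)
        have l: "map (\<lambda>a. \<ominus> a) xs \<in> ?L" using xs(2) by (auto simp: in_lists_conv_set)
        have "\<iota> (map (\<lambda>a. \<ominus> a) xs) \<oplus>\<^bsub>?V\<^esub> x = \<zero>\<^bsub>?V\<^esub>"
          unfolding xs(1) add[OF l xs(2)] c(2) using nth[OF xs(2)] xs(2) by (auto simp: l_neg intro!: eqI)
        then show ?thesis using mem[OF l] by blast
      qed
    qed
    show "a \<odot>\<^bsub>?V\<^esub> x \<in> carrier ?V" if xyz: "a \<in> carrier K" "x \<in> carrier ?V" for a x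
    proof -
      obtain xs where xs: "x = \<iota> xs" "xs \<in> ?L" using xyz by (auto simp: c)
      then have "map ((\<otimes>) a) xs \<in> ?L" using Lc xyz by auto
      then show ?thesis using mem xs sm by simp
    qed
    show "(a \<oplus> d) \<odot>\<^bsub>?V\<^esub> x = a \<odot>\<^bsub>?V\<^esub> x \<oplus>\<^bsub>?V\<^esub> d \<odot>\<^bsub>?V\<^esub> x"
      if xyz: "a \<in> carrier K" "d \<in> carrier K" "x \<in> carrier ?V" for a d x
    proof -
      obtain xs where "x = \<iota> xs" "xs \<in> ?L" using xyz by (auto simp: c)
      then show ?thesis using nth Lc xyz by (auto simp: add sm l_distr intro!: eqI)
    qed
    show "a \<odot>\<^bsub>?V\<^esub> (x \<oplus>\<^bsub>?V\<^esub> y) = a \<odot>\<^bsub>?V\<^esub> x \<oplus>\<^bsub>?V\<^esub> a \<odot>\<^bsub>?V\<^esub> y"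
      if xyz: "a \<in> carrier K" "x \<in> carrier ?V" "y \<in> carrier ?V" for a x y
    proof -
      obtain xs ys where "x = \<iota> xs" "xs \<in> ?L" "y = \<iota> ys" "ys \<in> ?L" using xyz by (auto simp: c)
      then show ?thesis using nth Lc L2 xyz by (auto simp: add sm r_distr intro!: eqI)
    qed
    show "(a \<otimes> d) \<odot>\<^bsub>?V\<^esub> x = a \<odot>\<^bsub>?V\<^esub> (d \<odot>\<^bsub>?V\<^esub> x)"
      if xyz: "a \<in> carrier K" "d \<in> carrier K" "x \<in> carrier ?V" for a d x
    proof -
      obtain xs where "x = \<iota> xs" "xs \<in> ?L" using xyz by (auto simp: c)
      then show ?thesis using nth Lc xyz by (auto simp: sm m_assoc intro!: eqI)
    qed
    show "\<one> \<odot>\<^bsub>?V\<^esub> x = x" if xyz: "x \<in> carrier ?V" for x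
    proof -
      obtain xs where "x = \<iota> xs" "xs \<in> ?L" using xyz by (auto simp: c)
      then show ?thesis using nth by (auto simp: sm intro!: eqI)
    qed
  qed
  have \<chi>: "functional ?V (?\<chi> i)" if i: "i < N" for i
    unfolding functional_def
  proof (rule is_linearI)
    show "?\<chi> i x \<in> carrier (self_module K)" if xyz: "x \<in> carrier ?V" for x
    proof -
      obtain xs where "x = \<iota> xs" "xs \<in> ?L" using xyz by (auto simp: c)
      then show ?thesis using nth i by (simp add: dec)
    qed
    show "?\<chi> i (x \<oplus>\<^bsub>?V\<^esub> y) = ?\<chi> i x \<oplus>\<^bsub>self_module K\<^esub> ?\<chi> i y"
      if xyz: "x \<in> carrier ?V" "y \<in> carrier ?V" for x y
    proof -
      obtain xs ys where "x = \<iota> xs" "xs \<in> ?L" "y = \<iota> ys" "ys \<in> ?L" using xyz by (auto simp: c)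
      then show ?thesis using L2 i by (simp add: add dec)
    qed
    show "?\<chi> i (a \<odot>\<^bsub>?V\<^esub> x) = a \<odot>\<^bsub>self_module K\<^esub> ?\<chi> i x"
      if xyz: "a \<in> carrier K" "x \<in> carrier ?V" for a x
    proof -
      obtain xs where "x = \<iota> xs" "xs \<in> ?L" using xyz by (auto simp: c)
      then show ?thesis using Lc i xyz by (simp add: sm dec)
    qed
  qed
  have b: "?b i \<in> carrier ?V" for i using mem[OF Lb] .
  have \<chi>b: "?\<chi> i (?b j) = (if i = j then \<one> else \<zero>)" if "i < N" "j < N" for i j
    using that Lb[of j] by (simp add: dec nth_list_update)
  have exp: "x = (\<Oplus>\<^bsub>?V\<^esub>i\<in>{..<N}. ?\<chi> i x \<odot>\<^bsub>?V\<^esub> ?b i)" if x: "x \<in> carrier ?V" for x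
  proof -
    interpret V: module K ?V by (rule V)
    let ?s = "\<Oplus>\<^bsub>?V\<^esub>i\<in>{..<N}. ?\<chi> i x \<odot>\<^bsub>?V\<^esub> ?b i"
    have xc: "?\<chi> i x \<in> carrier K" if "i < N" for i using functional_closed[OF \<chi>[OF that] x] .
    have s: "?s \<in> carrier ?V" using xc b V by simp
    have "?\<chi> j ?s = ?\<chi> j x" if j: "j < N" for j
    proof -
      have "?\<chi> j ?s = (\<Oplus>i\<in>{..<N}. ?\<chi> j (?\<chi> i x \<odot>\<^bsub>?V\<^esub> ?b i))"
        by (rule functional_finsum[OF \<chi>[OF j] V]) (use xc b V in auto)
      also have "\<dots> = (\<Oplus>i\<in>{..<N}. if j = i then ?\<chi> i x else \<zero>)"
        using xc b j \<chi>b by (intro finsum_cong') (auto simp: functional_smult[OF \<chi>[OF j]])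
      also have "\<dots> = ?\<chi> j x" using xc j by (intro add.finprod_singleton) auto
      finally show ?thesis .
    qed
    moreover obtain xs ss where "x = \<iota> xs" "xs \<in> ?L" "?s = \<iota> ss" "ss \<in> ?L" using x s by (auto simp: c)
    ultimately show ?thesis by (simp add: dec) (auto intro!: eqI)
  qed
  show ?thesis
    unfolding basis_def using V b \<chi> \<chi>b exp by auto
qed

text \<open>One choice of \<open>N\<close>, \<open>b\<close> and \<open>\<chi>\<close> serves every
  extension field \<open>m\<close>. This breaks a circle: the comultiplication stored in
  \<open>m\<close> is defined by means of that basis.\<close>

lemma universe_basis:
  fixes \<iota> :: "'k list \<Rightarrow> 'u" and Q :: "'i set"
  assumes "inj_on \<iota> (lists (carrier K))" "finite Q"
  shows "\<exists>N b \<chi>. \<forall>m :: 'x. basis (umod \<iota> N m) Q b \<chi>"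
proof -
  obtain h where h: "bij_betw h Q {..<card Q}"
    using ex_bij_betw_finite_nat[OF assms(2)] by (metis atLeast0LessThan)
  show ?thesis using basis_reindex[OF umod_basis[OF assms(1)] h] by blast
qed

text \<open>The tensor product reads the module fields alone, so the target of a comultiplication
  can be formed before the record that contains it.\<close>

lemma umod_tens:
  "tens K (umod \<iota> N m) (umod \<iota> N m) = tens K (umod \<iota> N m') (umod \<iota> N m')"
  "pure K (umod \<iota> N m) (umod \<iota> N m) = pure K (umod \<iota> N m') (umod \<iota> N m')"
  by (simp_all add: tens_def pure_def[abs_def] tens_coset_def[abs_def] bal_tensor_def bal_coset_def[abs_def]
      bal_kernel_def bal_relations_def umod_def Let_def)


subsection \<open>Comatrices\<close>

lemma comatrixD:
  assumes "comatrix D n c" "i < n" "j < n"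
  shows "c i j \<in> carrier D" "comult D (c i j) = (\<Oplus>\<^bsub>tens K D D\<^esub>k\<in>{..<n}. pure K D D (c i k) (c k j))"
    "counit D (c i j) = (if i = j then \<one> else \<zero>)"
  using assms by (auto simp: comatrix_def)

text \<open>Both sides of coassociativity expand to the double sum of the tensors
  \<open>e i \<otimes> c i k \<otimes> c k j\<close>. \<open>D\<close> carries just linear maps
  \<open>comult\<close> and \<open>counit\<close> here, so that the coalgebra axioms can themselves
  be derived from this lemma.\<close>

lemma matrix_coaction:
  assumes M: "module K M" and D: "module K D" and \<rho>: "is_linear K M (tens K M D) \<rho>"
    and \<Delta>: "is_linear K D (tens K D D) (comult D)" and \<epsilon>: "functional D (counit D)"
    and c: "comatrix D n c" and e: "\<And>i. i < n \<Longrightarrow> e i \<in> carrier M"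
    and re: "\<And>j. j < n \<Longrightarrow> \<rho> (e j) = (\<Oplus>\<^bsub>tens K M D\<^esub>i\<in>{..<n}. pure K M D (e i) (c i j))"
    and j: "j < n"
  shows "tassoc K M D D (tmap K M D (tens K M D) D \<rho> (\<lambda>d. d) (\<rho> (e j))) =
      tmap K M D M (tens K D D) (\<lambda>m. m) (comult D) (\<rho> (e j))"
    and "rslice M D (counit D) (\<rho> (e j)) = e j"
proof -
  note cD = comatrixD[OF c]
  note [simp] = M D
  let ?MDD = "tens K M (tens K D D)" and ?F = "tmap K M D (tens K M D) D \<rho> (\<lambda>d. d)"
  let ?t = "\<lambda>i k. pure K M (tens K D D) (e i) (pure K D D (c i k) (c k j))"
  have t: "?t i k \<in> carrier ?MDD" if "i < n" "k < n" for i k using that cD e j by simp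
  have F: "is_linear K (tens K M D) (tens K (tens K M D) D) ?F" using \<rho> by simp
  have L: "is_linear K (tens K M D) ?MDD (\<lambda>t. tassoc K M D D (?F t))"
    by (rule linear_comp[OF tassoc_linear F]) auto
  have "tassoc K M D D (?F (\<rho> (e j))) = (\<Oplus>\<^bsub>?MDD\<^esub>k\<in>{..<n}. tassoc K M D D (?F (pure K M D (e k) (c k j))))"
    unfolding re[OF j] by (rule linear_finsum[OF L]) (use e cD j in auto)
  also have "\<dots> = (\<Oplus>\<^bsub>?MDD\<^esub>k\<in>{..<n}. \<Oplus>\<^bsub>?MDD\<^esub>i\<in>{..<n}. ?t i k)"
  proof (rule module_finsum_cong)
    fix k assume "k \<in> {..<n}"
    then have k: "k < n" by simp
    have L': "is_linear K (tens K M D) ?MDD (\<lambda>s. tassoc K M D D (pure K (tens K M D) D s (c k j)))"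
      by (rule linear_comp[OF tassoc_linear linear_pure_left]) (use cD k j in auto)
    have "tassoc K M D D (?F (pure K M D (e k) (c k j))) = tassoc K M D D (pure K (tens K M D) D (\<rho> (e k)) (c k j))"
      using \<rho> e cD k j by simp
    also have "\<dots> = (\<Oplus>\<^bsub>?MDD\<^esub>i\<in>{..<n}. tassoc K M D D (pure K (tens K M D) D (pure K M D (e i) (c i k)) (c k j)))"
      unfolding re[OF k] by (rule linear_finsum[OF L']) (use e cD k j in auto)
    also have "\<dots> = (\<Oplus>\<^bsub>?MDD\<^esub>i\<in>{..<n}. ?t i k)"
      by (rule module_finsum_cong) (use e cD k j in auto)
    finally show "tassoc K M D D (?F (pure K M D (e k) (c k j))) = (\<Oplus>\<^bsub>?MDD\<^esub>i\<in>{..<n}. ?t i k)" .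
    show "(\<Oplus>\<^bsub>?MDD\<^esub>i\<in>{..<n}. ?t i k) \<in> carrier ?MDD"
      by (rule module_finsum_closed) (use t k in auto)
  qed auto
  also have "\<dots> = (\<Oplus>\<^bsub>?MDD\<^esub>i\<in>{..<n}. \<Oplus>\<^bsub>?MDD\<^esub>k\<in>{..<n}. ?t i k)"
    by (rule finsum_swap) (use t in auto)
  also have "\<dots> = (\<Oplus>\<^bsub>?MDD\<^esub>i\<in>{..<n}. tmap K M D M (tens K D D) (\<lambda>m. m) (comult D) (pure K M D (e i) (c i j)))"
  proof (rule module_finsum_cong)
    fix i assume "i \<in> {..<n}"
    then have i: "i < n" by simp
    have "pure K M (tens K D D) (e i) (comult D (c i j)) = (\<Oplus>\<^bsub>?MDD\<^esub>k\<in>{..<n}. ?t i k)"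
      unfolding cD(2)[OF i j] by (rule linear_finsum[OF linear_pure_right]) (use e cD i j in auto)
    then show "(\<Oplus>\<^bsub>?MDD\<^esub>k\<in>{..<n}. ?t i k) = tmap K M D M (tens K D D) (\<lambda>m. m) (comult D) (pure K M D (e i) (c i j))"
      using \<Delta> e cD i j by simp
    show "tmap K M D M (tens K D D) (\<lambda>m. m) (comult D) (pure K M D (e i) (c i j)) \<in> carrier ?MDD"
      by (rule tmap_closed) (use \<Delta> e cD(1) i j in auto)
  qed simp
  also have "\<dots> = tmap K M D M (tens K D D) (\<lambda>m. m) (comult D) (\<rho> (e j))"
    unfolding re[OF j] by (rule linear_finsum[OF tmap_linear, symmetric]) (use \<Delta> e cD j in auto)
  finally show "tassoc K M D D (?F (\<rho> (e j))) = tmap K M D M (tens K D D) (\<lambda>m. m) (comult D) (\<rho> (e j))" .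
  have "rslice M D (counit D) (\<rho> (e j)) = (\<Oplus>\<^bsub>M\<^esub>i\<in>{..<n}. rslice M D (counit D) (pure K M D (e i) (c i j)))"
    unfolding re[OF j] by (rule linear_finsum[OF rslice_linear]) (use \<epsilon> e cD j in auto)
  also have "\<dots> = (\<Oplus>\<^bsub>M\<^esub>i\<in>{..<n}. counit D (c i j) \<odot>\<^bsub>M\<^esub> e i)"
    by (rule module_finsum_cong) (use \<epsilon> e cD j in auto)
  also have "\<dots> = e j"
    by (rule finsum_delta) (use e cD j in auto)
  finally show "rslice M D (counit D) (\<rho> (e j)) = e j" .
qed

text \<open>On a basis made of comatrix entries the coalgebra axioms are identities of matrix
  products.\<close>

lemma coalgebra_of_comatrix:
  assumes bas: "basis D Q b \<chi>" and \<Delta>: "is_linear K D (tens K D D) (comult D)" and \<epsilon>: "functional D (counit D)"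
    and c: "comatrix D n c" and Q: "\<And>q. q \<in> Q \<Longrightarrow> \<exists>i<n. \<exists>j<n. b q = c i j"
  shows "is_coalgebra K D"
proof -
  have D: "module K D" by (rule basis_props(1)[OF bas])
  note [simp] = D
  \<comment> \<open>The row \<open>c i\<close> takes the place of the vectors \<open>e\<close> in
    \<open>matrix_coaction\<close>, with \<open>D\<close> coacting on itself.\<close>
  have row: "tassoc K D D D (tmap K D D (tens K D D) D (comult D) (\<lambda>d. d) (comult D (c i j))) =
      tmap K D D D (tens K D D) (\<lambda>m. m) (comult D) (comult D (c i j))"
    "rslice D D (counit D) (comult D (c i j)) = c i j" if "i < n" "j < n" for i j
    using that comatrixD[OF c] by (intro matrix_coaction[OF D D \<Delta> \<Delta> \<epsilon> c, of "c i"]; simp)+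
  have left: "lslice D D (counit D) (comult D (c i j)) = c i j" if ij: "i < n" "j < n" for i j
  proof -
    note cD = comatrixD[OF c]
    have "lslice D D (counit D) (comult D (c i j)) = (\<Oplus>\<^bsub>D\<^esub>k\<in>{..<n}. lslice D D (counit D) (pure K D D (c i k) (c k j)))"
      unfolding cD(2)[OF ij] by (rule linear_finsum[OF lslice_linear]) (use \<epsilon> cD ij in auto)
    also have "\<dots> = (\<Oplus>\<^bsub>D\<^esub>k\<in>{..<n}. counit D (c i k) \<odot>\<^bsub>D\<^esub> c k j)"
      by (rule module_finsum_cong) (use \<epsilon> cD ij in auto)
    also have "\<dots> = c i j"
      by (rule finsum_delta) (use cD ij in auto)
    finally show ?thesis .
  qed
  have 1: "tassoc K D D D (tmap K D D (tens K D D) D (comult D) (\<lambda>d. d) (comult D x)) =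
      tmap K D D D (tens K D D) (\<lambda>m. m) (comult D) (comult D x)" if x: "x \<in> carrier D" for x
  proof (rule basis_linear_eq[where W = "tens K D (tens K D D)", OF bas _ _ _ _ x])
    show "is_linear K D (tens K D (tens K D D))
        (\<lambda>x. tassoc K D D D (tmap K D D (tens K D D) D (comult D) (\<lambda>d. d) (comult D x)))"
      by (intro linear_comp[OF tassoc_linear] linear_comp[OF tmap_linear \<Delta>]) (use \<Delta> in auto)
    show "is_linear K D (tens K D (tens K D D)) (\<lambda>x. tmap K D D D (tens K D D) (\<lambda>m. m) (comult D) (comult D x))"
      by (intro linear_comp[OF tmap_linear \<Delta>]) (use \<Delta> in auto)
    show "tassoc K D D D (tmap K D D (tens K D D) D (comult D) (\<lambda>d. d) (comult D (b q))) =
      tmap K D D D (tens K D D) (\<lambda>m. m) (comult D) (comult D (b q))" if "q \<in> Q" for q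
      using Q[OF that] row(1) by auto
  qed simp
  have 2: "lslice D D (counit D) (comult D x) = x" if x: "x \<in> carrier D" for x
  proof (rule basis_linear_eq[OF bas D linear_comp[OF lslice_linear \<Delta>] linear_ident _ x])
    show "lslice D D (counit D) (comult D (b q)) = b q" if "q \<in> Q" for q using Q[OF that] left by auto
  qed (use \<epsilon> in auto)
  have 3: "rslice D D (counit D) (comult D x) = x" if x: "x \<in> carrier D" for x
  proof (rule basis_linear_eq[OF bas D linear_comp[OF rslice_linear \<Delta>] linear_ident _ x])
    show "rslice D D (counit D) (comult D (b q)) = b q" if "q \<in> Q" for q using Q[OF that] row(2) by auto
  qed (use \<epsilon> in auto)
  show ?thesis
    unfolding is_coalgebra_def
    using D \<Delta> \<epsilon> 1 2 3 by (auto simp: functional_def rslice_def lslice_def)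
qed

text \<open>For the full relation \<open>P\<close> this is the comatrix coalgebra, dual to the \<open>n \<times> n\<close> matrices; in
  general it is an incidence coalgebra, dual to block triangular matrices.\<close>

lemma incidence_coalgebra:
  fixes \<iota> :: "'k list \<Rightarrow> 'u"
  assumes \<iota>: "inj_on \<iota> (lists (carrier K))" and refl: "\<And>i. i < n \<Longrightarrow> P i i"
    and trans: "\<And>i j k. i < n \<Longrightarrow> j < n \<Longrightarrow> k < n \<Longrightarrow> P i j \<Longrightarrow> P j k \<Longrightarrow> P i k"
  obtains D :: "('k, 'u) coalgebra" and c \<chi> where "is_coalgebra K D" "comatrix D n c"
    "basis D {(i, j). i < n \<and> j < n \<and> P i j} (\<lambda>(i, j). c i j) \<chi>"
    "\<forall>i<n. \<forall>j<n. \<not> P i j \<longrightarrow> c i j = \<zero>\<^bsub>D\<^esub>"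
proof -
  define Q where "Q = {(i, j). i < n \<and> j < n \<and> P i j}"
  have Q: "finite Q" by (rule finite_subset[of _ "{..<n} \<times> {..<n}"]) (auto simp: Q_def)
  obtain N b \<chi> where bas: "\<And>m :: ('k, 'u, unit) coalgebra_ext. basis (umod \<iota> N m) Q b \<chi>"
    using universe_basis[OF \<iota> Q] by blast
  \<comment> \<open>A placeholder record: its carrier and its tensor square agree with those of the
    coalgebra \<open>D\<close> defined below.\<close>
  let ?V = "umod \<iota> N undefined :: ('k, 'u) coalgebra"
  define c where "c = (\<lambda>i j. if P i j then b (i, j) else \<zero>\<^bsub>?V\<^esub>)"
  let ?T = "tens K ?V ?V"
  define \<Delta> where "\<Delta> = basis_map ?T Q \<chi> (\<lambda>(i, j). \<Oplus>\<^bsub>?T\<^esub>k\<in>{..<n}. pure K ?V ?V (c i k) (c k j))"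
  define \<epsilon> where "\<epsilon> = basis_map (self_module K) Q \<chi> (\<lambda>(i, j). if i = j then \<one> else \<zero>)"
  define D :: "('k, 'u) coalgebra" where "D = umod \<iota> N \<lparr>comult = \<Delta>, counit = \<epsilon>\<rparr>"
  have basD: "basis D Q b \<chi>" and basV: "basis ?V Q b \<chi>" unfolding D_def by (rule bas)+
  note p = basis_props[OF basD] and pV = basis_props[OF basV]
  have T: "tens K D D = ?T" "pure K D D = pure K ?V ?V" unfolding D_def by (rule umod_tens)+
  have DV: "carrier D = carrier ?V" "\<zero>\<^bsub>D\<^esub> = \<zero>\<^bsub>?V\<^esub>" by (simp_all add: D_def umod_def Let_def)
  have com: "comult D = \<Delta>" "counit D = \<epsilon>" by (simp_all add: D_def umod_def Let_def)
  have cV: "c i j \<in> carrier ?V" if "i < n" "j < n" for i j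
    using that pV by (auto simp: c_def Q_def)
  have fV: "(\<Oplus>\<^bsub>?T\<^esub>k\<in>{..<n}. pure K ?V ?V (c i k) (c k j)) \<in> carrier ?T" if "i < n" "j < n" for i j
    by (rule module_finsum_closed) (use that cV pV(1) in auto)
  have \<Delta>: "is_linear K D (tens K D D) (comult D)"
    unfolding com T \<Delta>_def by (rule basis_map_linear[OF basD]) (use pV fV in \<open>auto simp: Q_def\<close>)
  have \<epsilon>: "functional D (counit D)"
    unfolding com functional_def \<epsilon>_def by (rule basis_map_linear[OF basD]) (auto simp: Q_def)
  have mat: "comatrix D n c"
    unfolding comatrix_def
  proof (intro allI impI conjI)
    fix i j assume ij: "i < n" "j < n"
    show "c i j \<in> carrier D" using cV ij DV by simp
    show "comult D (c i j) = (\<Oplus>\<^bsub>tens K D D\<^esub>k\<in>{..<n}. pure K D D (c i k) (c k j))"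
    proof (cases "P i j")
      case True
      then have q: "(i, j) \<in> Q" using ij by (simp add: Q_def)
      have "comult D (b (i, j)) = (\<lambda>(i, j). \<Oplus>\<^bsub>?T\<^esub>k\<in>{..<n}. pure K ?V ?V (c i k) (c k j)) (i, j)"
        unfolding com \<Delta>_def by (rule basis_map_basis[OF basD _ _ q]) (use pV fV in \<open>auto simp: Q_def\<close>)
      then show ?thesis using True by (simp add: c_def T)
    next
      case False
      \<comment> \<open>By transitivity every term of the sum at a pair outside \<open>P\<close> has
        a vanishing factor.\<close>
      have "pure K D D (c i k) (c k j) = \<zero>\<^bsub>tens K D D\<^esub>" if k: "k < n" for k
      proof -
        have "\<not> P i k \<or> \<not> P k j" using trans[OF ij(1) k ij(2)] False by blast
        then have "c i k = \<zero>\<^bsub>D\<^esub> \<or> c k j = \<zero>\<^bsub>D\<^esub>" by (auto simp: c_def DV)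
        then show ?thesis
          using linear_zero[OF linear_pure_left[OF p(1) p(1)]] linear_zero[OF linear_pure_right[OF p(1) p(1)]]
            p(1) cV ij k DV by auto
      qed
      then have "(\<Oplus>\<^bsub>tens K D D\<^esub>k\<in>{..<n}. pure K D D (c i k) (c k j)) = \<zero>\<^bsub>tens K D D\<^esub>"
        using p(1) by (intro module_finsum_zero) auto
      then show ?thesis
        using linear_zero[OF \<Delta>] p(1) False by (simp add: c_def DV)
    qed
    show "counit D (c i j) = (if i = j then \<one> else \<zero>)"
    proof (cases "P i j")
      case True
      then have q: "(i, j) \<in> Q" using ij by (simp add: Q_def)
      have "counit D (b (i, j)) = (\<lambda>(i, j). if i = j then \<one> else \<zero>) (i, j)"
        unfolding com \<epsilon>_def by (rule basis_map_basis[OF basD _ _ q]) (auto simp: Q_def)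
      then show ?thesis using True by (simp add: c_def)
    next
      case False
      \<comment> \<open>Reflexivity keeps the diagonal, where the counit is \<open>\<one>\<close>,
        inside \<open>P\<close>.\<close>
      then have "i \<noteq> j" using refl ij by blast
      then show ?thesis using functional_zero[OF \<epsilon> p(1)] False by (simp add: c_def DV)
    qed
  qed
  have coalg: "is_coalgebra K D"
    by (rule coalgebra_of_comatrix[OF basD \<Delta> \<epsilon> mat]) (auto simp: Q_def c_def)
  have "basis D Q (\<lambda>(i, j). c i j) \<chi>"
    by (rule basis_cong[OF basD]) (auto simp: c_def Q_def)
  then show thesis
    using that[OF coalg mat] by (auto simp: Q_def c_def DV)
qed

end

subsection \<open>The cofree coalgebra\<close>

context base_field
begin

lemma cofree_props:
  assumes "is_cofree_coalgebra TYPE('u) K H C p"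
  shows "is_coalgebra K C" "is_linear K C H p"
    "\<And>(D :: ('k, 'u) coalgebra) f. is_coalgebra K D \<Longrightarrow> f \<in> lin K D H \<Longrightarrow>
       \<exists>!g. g \<in> coalgebra_hom K D C \<and> (\<forall>d\<in>carrier D. p (g d) = f d)"
  using assms by (auto simp: is_cofree_coalgebra_def)

lemma coalgebra_homD:
  assumes "g \<in> coalgebra_hom K D C"
  shows "is_linear K D C g" "\<And>c. c \<in> carrier D \<Longrightarrow> tmap K D D C C g g (comult D c) = comult C (g c)"
    "\<And>c. c \<in> carrier D \<Longrightarrow> counit C (g c) = counit D c"
  using assms by (auto simp: coalgebra_hom_def lin_def)

lemma comatrix_image:
  assumes D: "is_coalgebra K D" and C: "is_coalgebra K C" and g: "g \<in> coalgebra_hom K D C" and c: "comatrix D n c"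
  shows "comatrix C n (\<lambda>i j. g (c i j))"
  unfolding comatrix_def
proof (intro allI impI conjI)
  fix i j assume ij: "i < n" "j < n"
  note cD = comatrixD[OF c] and gD = coalgebra_homD[OF g]
  note [simp] = coalgebra_module[OF D] coalgebra_module[OF C]
  show "g (c i j) \<in> carrier C" using cD ij linear_closed[OF gD(1)] by simp
  show "counit C (g (c i j)) = (if i = j then \<one> else \<zero>)" using gD(3) cD ij by simp
  have "comult C (g (c i j)) = tmap K D D C C g g (\<Oplus>\<^bsub>tens K D D\<^esub>k\<in>{..<n}. pure K D D (c i k) (c k j))"
    using gD(2)[of "c i j"] cD(1,2)[OF ij] by simp
  also have "\<dots> = (\<Oplus>\<^bsub>tens K C C\<^esub>k\<in>{..<n}. tmap K D D C C g g (pure K D D (c i k) (c k j)))"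
    by (rule linear_finsum[OF tmap_linear]) (use gD(1) cD(1) ij in auto)
  also have "\<dots> = (\<Oplus>\<^bsub>tens K C C\<^esub>k\<in>{..<n}. pure K C C (g (c i k)) (g (c k j)))"
    by (rule module_finsum_cong) (use gD(1) cD(1) ij linear_closed[OF gD(1)] in auto)
  finally show "comult C (g (c i j)) = (\<Oplus>\<^bsub>tens K C C\<^esub>k\<in>{..<n}. pure K C C (g (c i k)) (g (c k j)))" .
qed

text \<open>The matrix \<open>h\<close> defines a linear map to \<open>H\<close> on the incidence
  coalgebra of \<open>P\<close>, and its lift to \<open>C\<close> carries comatrix to comatrix. The
  relation \<open>P\<close> transports a pattern of zeros: entries outside it are already zero in
  the incidence coalgebra.\<close>

lemma comatrix_lift:
  fixes \<iota> :: "'k list \<Rightarrow> 'u"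
  assumes \<iota>: "inj_on \<iota> (lists (carrier K))" and C: "is_cofree_coalgebra TYPE('u) K H C p" and H: "module K H"
    and refl: "\<And>i. i < n \<Longrightarrow> P i i"
    and trans: "\<And>i j k. i < n \<Longrightarrow> j < n \<Longrightarrow> k < n \<Longrightarrow> P i j \<Longrightarrow> P j k \<Longrightarrow> P i k"
    and h: "\<And>i j. i < n \<Longrightarrow> j < n \<Longrightarrow> h i j \<in> carrier H"
    and hP: "\<And>i j. i < n \<Longrightarrow> j < n \<Longrightarrow> \<not> P i j \<Longrightarrow> h i j = \<zero>\<^bsub>H\<^esub>"
  shows "\<exists>c. comatrix C n c \<and> (\<forall>i<n. \<forall>j<n. p (c i j) = h i j) \<and> (\<forall>i<n. \<forall>j<n. \<not> P i j \<longrightarrow> c i j = \<zero>\<^bsub>C\<^esub>)"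
proof -
  note Cp = cofree_props[OF C]
  have Cm: "module K C" using coalgebra_module[OF Cp(1)] .
  obtain D :: "('k, 'u) coalgebra" and d \<chi> where D: "is_coalgebra K D" and d: "comatrix D n d"
    and bas: "basis D {(i, j). i < n \<and> j < n \<and> P i j} (\<lambda>(i, j). d i j) \<chi>"
    and d0: "\<forall>i<n. \<forall>j<n. \<not> P i j \<longrightarrow> d i j = \<zero>\<^bsub>D\<^esub>"
    by (rule incidence_coalgebra[where P = P and n = n, OF \<iota> refl trans])
  note Dm = coalgebra_module[OF D] and dD = comatrixD[OF d]
  let ?Q = "{(i, j). i < n \<and> j < n \<and> P i j}"
  define f where "f = restrict (basis_map H ?Q \<chi> (\<lambda>(i, j). h i j)) (carrier D)"
  have lin: "is_linear K D H (basis_map H ?Q \<chi> (\<lambda>(i, j). h i j))"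
    by (rule basis_map_linear[OF bas H]) (use h in auto)
  have f: "f \<in> lin K D H" unfolding f_def by (rule linear_restrict[OF lin Dm])
  have fd: "f (d i j) = h i j" if ij: "i < n" "j < n" for i j
  proof (cases "P i j")
    case True
    then have "basis_map H ?Q \<chi> (\<lambda>(i, j). h i j) (case (i, j) of (i, j) \<Rightarrow> d i j) = (case (i, j) of (i, j) \<Rightarrow> h i j)"
      by (intro basis_map_basis[OF bas H]) (use h ij in auto)
    then show ?thesis using dD(1)[OF ij] by (simp add: f_def)
  next
    case False
    then show ?thesis using d0 hP ij linear_zero[OF lin Dm H] Dm by (simp add: f_def)
  qed
  obtain g where g: "g \<in> coalgebra_hom K D C" "\<forall>x\<in>carrier D. p (g x) = f x" using Cp(3)[OF D f] by blast
  have g0: "g (d i j) = \<zero>\<^bsub>C\<^esub>" if "i < n" "j < n" "\<not> P i j" for i j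
    using d0 that linear_zero[OF coalgebra_homD(1)[OF g(1)] Dm Cm] by simp
  show ?thesis
    using comatrix_image[OF D Cp(1) g(1) d] g(2) dD(1) fd g0
    by (intro exI[of _ "\<lambda>i j. g (d i j)"]) auto
qed

text \<open>Each comatrix of \<open>C\<close> comes from a coalgebra map defined on the full
  comatrix coalgebra in \<open>'u\<close>, and equal composites with \<open>p\<close> force the two
  maps to coincide.\<close>

lemma comatrix_unique:
  fixes \<iota> :: "'k list \<Rightarrow> 'u"
  assumes \<iota>: "inj_on \<iota> (lists (carrier K))" and C: "is_cofree_coalgebra TYPE('u) K H C p" and H: "module K H"
    and c: "comatrix C n c" and c': "comatrix C n c'"
    and eq: "\<And>i j. i < n \<Longrightarrow> j < n \<Longrightarrow> p (c i j) = p (c' i j)" and ij: "i < n" "j < n"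
  shows "c i j = c' i j"
proof -
  note Cp = cofree_props[OF C]
  have Cm: "module K C" using coalgebra_module[OF Cp(1)] .
  obtain D :: "('k, 'u) coalgebra" and d \<chi> where D: "is_coalgebra K D" and d: "comatrix D n d"
    and bas: "basis D {(i, j). i < n \<and> j < n \<and> True} (\<lambda>(i, j). d i j) \<chi>"
    by (rule incidence_coalgebra[where P = "\<lambda>_ _. True" and n = n, OF \<iota>]) auto
  note Dp = coalgebra_props[OF D] and dD = comatrixD[OF d]
  note Dm = Dp(1)
  note [simp] = Dm Cm
  let ?Q = "{(i, j). i < n \<and> j < n \<and> True}"
  define G where "G c = restrict (basis_map C ?Q \<chi> (\<lambda>(i, j). c i j)) (carrier D)" for c
  have G: "G c \<in> coalgebra_hom K D C" and Gd: "\<And>i j. i < n \<Longrightarrow> j < n \<Longrightarrow> G c (d i j) = c i j"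
    if c: "comatrix C n c" for c
  proof -
    note cD = comatrixD[OF c]
    have lin: "is_linear K D C (basis_map C ?Q \<chi> (\<lambda>(i, j). c i j))"
      by (rule basis_map_linear[OF bas Cm]) (use cD in auto)
    show Gd: "G c (d i j) = c i j" if ij: "i < n" "j < n" for i j
    proof -
      have "basis_map C ?Q \<chi> (\<lambda>(i, j). c i j) (case (i, j) of (i, j) \<Rightarrow> d i j) = (case (i, j) of (i, j) \<Rightarrow> c i j)"
        by (intro basis_map_basis[OF bas Cm]) (use cD ij in auto)
      then show ?thesis using dD(1)[OF ij] by (simp add: G_def)
    qed
    have Glin: "G c \<in> lin K D C" unfolding G_def by (rule linear_restrict[OF lin Dm])
    then have GL: "is_linear K D C (G c)" by (simp add: lin_def)
    have 1: "tmap K D D C C (G c) (G c) (comult D x) = comult C (G c x)" if x: "x \<in> carrier D" for x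
    proof (rule basis_linear_eq[where W = "tens K C C", OF bas _ _ _ _ x])
      show "is_linear K D (tens K C C) (\<lambda>x. tmap K D D C C (G c) (G c) (comult D x))"
        by (rule linear_comp[OF tmap_linear Dp(2)]) (use GL in auto)
      show "is_linear K D (tens K C C) (\<lambda>x. comult C (G c x))"
        by (rule linear_comp[OF comult_linear[OF Cp(1)] GL])
      fix q assume "q \<in> ?Q"
      then obtain i j where q: "q = (i, j)" and ij: "i < n" "j < n" by auto
      have "tmap K D D C C (G c) (G c) (comult D (d i j)) =
          (\<Oplus>\<^bsub>tens K C C\<^esub>k\<in>{..<n}. tmap K D D C C (G c) (G c) (pure K D D (d i k) (d k j)))"
        unfolding dD(2)[OF ij] by (rule linear_finsum[OF tmap_linear]) (use GL dD(1) ij in auto)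
      also have "\<dots> = (\<Oplus>\<^bsub>tens K C C\<^esub>k\<in>{..<n}. pure K C C (c i k) (c k j))"
        by (rule module_finsum_cong) (use GL Gd dD(1) cD(1) ij in auto)
      also have "\<dots> = comult C (G c (d i j))" using Gd cD(2) ij by simp
      finally show "tmap K D D C C (G c) (G c) (comult D (case q of (i, j) \<Rightarrow> d i j)) =
          comult C (G c (case q of (i, j) \<Rightarrow> d i j))" using q by simp
    qed simp
    have 2: "counit C (G c x) = counit D x" if x: "x \<in> carrier D" for x
    proof (rule basis_linear_eq[where W = "self_module K", OF bas _ _ _ _ x])
      show "is_linear K D (self_module K) (\<lambda>x. counit C (G c x))"
        using functional_comp[OF counit_functional[OF Cp(1)] GL] by (simp add: functional_def)
      show "is_linear K D (self_module K) (counit D)" using Dp(3) by (simp add: functional_def)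
      show "counit C (G c (case q of (i, j) \<Rightarrow> d i j)) = counit D (case q of (i, j) \<Rightarrow> d i j)" if "q \<in> ?Q" for q
        using that Gd cD(3) dD(3) by auto
    qed simp
    show "G c \<in> coalgebra_hom K D C" using Glin 1 2 by (simp add: coalgebra_hom_def)
  qed
  have GL: "is_linear K D C (G c)" "is_linear K D C (G c')" using G[OF c] G[OF c'] by (auto simp: coalgebra_hom_def lin_def)
  have pG: "p (G c' x) = p (G c x)" if x: "x \<in> carrier D" for x
    by (rule basis_linear_eq[OF bas H linear_comp[OF Cp(2) GL(2)] linear_comp[OF Cp(2) GL(1)] _ x])
      (use Gd[OF c] Gd[OF c'] eq in auto)
  have f: "restrict (\<lambda>x. p (G c x)) (carrier D) \<in> lin K D H"
    by (rule linear_restrict[OF linear_comp[OF Cp(2) GL(1)] Dm])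
  have "G c = G c'"
    using Cp(3)[OF D f] G[OF c] G[OF c'] pG by auto
  then show ?thesis using Gd[OF c ij] Gd[OF c' ij] by simp
qed

text \<open>The cofree coalgebra is cogenerated by \<open>p\<close>: on a subspace stable under the slices of \<open>p\<close>,
  the counit detects zero. For a finite-dimensional right coideal containing a given element,
  a basis adapted to the subspace makes the coefficient matrix block triangular after applying \<open>p\<close>;
  lifting the blocks and uniqueness show that it was block triangular already.\<close>

lemma cofree_detect:
  fixes \<iota> :: "'k list \<Rightarrow> 'u"
  assumes \<iota>: "inj_on \<iota> (lists (carrier K))" and C: "is_cofree_coalgebra TYPE('u) K H C p" and H: "module K H"
    and N: "submodule N K C" and \<epsilon>: "\<And>c. c \<in> N \<Longrightarrow> counit C c = \<zero>"
    and stab: "\<And>c \<phi>. c \<in> N \<Longrightarrow> functional H \<phi> \<Longrightarrow> rslice C C (\<lambda>x. \<phi> (p x)) (comult C c) \<in> N"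
    and c: "c \<in> N"
  shows "c = \<zero>\<^bsub>C\<^esub>"
proof -
  note Cp = cofree_props[OF C]
  note Cc = coalgebra_props[OF Cp(1)]
  have Cm: "module K C" by (rule Cc(1))
  interpret C: module K C by (rule Cm)
  note NC = submodule_subset[OF N Cm]
  have "finite {c}" "{c} \<subseteq> carrier C" using c NC by auto
  from coaction_finite[OF Cp(1) Cc(4) this]
  obtain U n0 \<phi> where U: "submodule U K C" "{c} \<subseteq> U"
    and Us: "\<forall>x\<in>U. \<forall>\<psi>. functional C \<psi> \<longrightarrow> rslice C C \<psi> (comult C x) \<in> U"
    and \<phi>: "\<forall>i<n0::nat. functional C (\<phi> i)" "\<forall>x\<in>U. (\<forall>i<n0. \<phi> i x = \<zero>) \<longrightarrow> x = \<zero>\<^bsub>C\<^esub>"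
    by (elim exE conjE)
  have UN: "submodule (U \<inter> N) K C" by (rule submodule_inter[OF Cm U(1) N])
  have "\<exists>m e \<psi>. frame C m e \<psi> \<and> (\<forall>i<m. e i \<in> U \<inter> N) \<and> (\<forall>x\<in>U \<inter> N. fproj C m e \<psi> x = x)"
    by (rule frame_of_separated[OF Cm UN, of n0 \<phi>]) (use \<phi> in auto)
  then obtain m e \<psi> where m: "frame C m e \<psi>" "\<forall>i<m. e i \<in> U \<inter> N" "\<forall>x\<in>U \<inter> N. fproj C m e \<psi> x = x"
    by blast
  have "\<exists>m e \<psi>. frame C m e \<psi> \<and> (\<forall>i<m. e i \<in> U) \<and> (\<forall>x\<in>U. fproj C m e \<psi> x = x)"
    by (rule frame_of_separated[OF Cm U(1), of n0 \<phi>]) (use \<phi> in auto)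
  then obtain l d \<chi> where l: "frame C l d \<chi>" "\<forall>i<l. d i \<in> U" "\<forall>x\<in>U. fproj C l d \<chi> x = x" by blast
  have "\<exists>n e' \<psi>'. m \<le> n \<and> frame C n e' \<psi>' \<and> (\<forall>i<m. e' i = e i \<and> \<psi>' i = \<psi> i) \<and>
    (\<forall>i<n. e' i \<in> U) \<and> (\<forall>s\<in>d ` {..<l}. fproj C n e' \<psi>' s = s)"
    by (rule frame_extend[OF Cm U(1) m(1)]) (use m(2) l(2) in auto)
  then obtain n e' \<psi>' where n: "m \<le> n" "frame C n e' \<psi>'" "\<forall>i<m. e' i = e i \<and> \<psi>' i = \<psi> i"
    "\<forall>i<n. e' i \<in> U" "\<forall>s\<in>d ` {..<l}. fproj C n e' \<psi>' s = s" by blast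
  note p = frame_props[OF n(2)] and pm = frame_props[OF m(1)] and pl = frame_props[OF l(1)]
  have P: "is_linear K C C (fproj C n e' \<psi>')" by (rule fproj_linear[OF Cm p(1,2)])
  \<comment> \<open>The enlarged frame fixes the vectors \<open>d i\<close>, which span
    \<open>U\<close>, while its first \<open>m\<close> vectors still span
    \<open>U \<inter> N\<close>.\<close>
  have fixU: "fproj C n e' \<psi>' x = x" if x: "x \<in> U" for x
  proof -
    have xC: "x \<in> carrier C" using x submodule_subset[OF U(1) Cm] by blast
    have "fproj C n e' \<psi>' (fproj C l d \<chi> x) = (\<Oplus>\<^bsub>C\<^esub>i\<in>{..<l}. fproj C n e' \<psi>' (\<chi> i x \<odot>\<^bsub>C\<^esub> d i))"
      unfolding fproj_def[of C l]
      by (rule linear_finsum[OF P Cm Cm]) (use pl functional_closed[OF pl(2) xC] Cm in auto)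
    also have "\<dots> = fproj C l d \<chi> x"
      unfolding fproj_def[of C l]
      by (rule module_finsum_cong[OF Cm])
        (use pl functional_closed[OF pl(2) xC] Cm n(5) in \<open>auto simp: linear_smult[OF P]\<close>)
    finally show ?thesis using l(3) x by simp
  qed
  have cof: "coframe C C (comult C) n e' \<psi>'"
    by (rule coframeI[OF Cm Cm Cc(2) n(2), of U]) (use n(4) fixU Us in auto)
  let ?c = "\<lambda>i j. lslice C C (\<psi>' i) (comult C (e' j))"
  have mat: "comatrix C n ?c" by (rule comatrix_of_coframe[OF Cp(1) Cc(4) cof])
  note cD = comatrixD[OF mat]
  have \<Delta>c: "comult C (e' j) \<in> carrier (tens K C C)" if "j < n" for j using linear_closed[OF Cc(2) p(1)[OF that]] .
  have pH: "p (?c i j) \<in> carrier H" if "i < n" "j < n" for i j using linear_closed[OF Cp(2) cD(1)[OF that]] .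
  \<comment> \<open>The slices of \<open>e' j\<close> along \<open>\<theta> \<circ> p\<close> stay
    in \<open>U \<inter> N\<close>, the span of the first \<open>m\<close> vectors, so their
    coordinate \<open>i\<close> vanishes; \<open>slice_swap\<close> turns this into a statement
    about the entry.\<close>
  have zero: "p (?c i j) = \<zero>\<^bsub>H\<^esub>" if i: "m \<le> i" "i < n" and j: "j < m" for i j
  proof (rule eqI_functional[OF H pH])
    have jn: "j < n" using j n(1) by simp
    show "i < n" "j < n" by fact+
    fix \<theta> assume \<theta>: "functional H \<theta>"
    have f: "functional C (\<lambda>x. \<theta> (p x))" by (rule functional_comp[OF \<theta> Cp(2)])
    let ?x = "rslice C C (\<lambda>x. \<theta> (p x)) (comult C (e' j))"
    have "e' j \<in> U \<inter> N" using m(2) n(3) j by simp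
    then have xUN: "?x \<in> U \<inter> N" using Us stab[OF _ \<theta>] f by blast
    then have xC: "?x \<in> carrier C" using NC by blast
    have "\<psi>' i ?x = \<psi>' i (fproj C m e \<psi> ?x)" using m(3) xUN by simp
    also have "\<dots> = (\<Oplus>k\<in>{..<m}. \<psi>' i (\<psi> k ?x \<odot>\<^bsub>C\<^esub> e k))"
      unfolding fproj_def
      by (rule functional_finsum[OF p(2)[OF i(2)] Cm]) (use pm functional_closed[OF pm(2) xC] Cm in auto)
    also have "\<dots> = \<zero>"
    proof (rule add.finprod_one_eqI)
      fix k assume "k \<in> {..<m}"
      then have k: "k < m" "k < n" "k \<noteq> i" using n(1) i by auto
      have "\<psi>' i (e k) = \<zero>" using p(3)[OF i(2) k(2)] n(3) k by simp
      then show "\<psi>' i (\<psi> k ?x \<odot>\<^bsub>C\<^esub> e k) = \<zero>"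
        using functional_smult[OF p(2)[OF i(2)] functional_closed[OF pm(2)[OF k(1)] xC] pm(1)[OF k(1)]]
          functional_closed[OF pm(2)[OF k(1)] xC] by simp
    qed
    finally have "\<psi>' i ?x = \<zero>" .
    then have "\<theta> (p (?c i j)) = \<zero>" using slice_swap[OF Cm Cm p(2)[OF i(2)] f \<Delta>c[OF jn]] by simp
    then show "\<theta> (p (?c i j)) = \<theta> \<zero>\<^bsub>H\<^esub>" using functional_zero[OF \<theta> H] by simp
  qed (use H in simp)
  \<comment> \<open>The complement of the lower left block. It is transitive because block
    triangular matrices are closed under products.\<close>
  let ?P = "\<lambda>i j. \<not> (m \<le> i \<and> j < m)"
  have "\<exists>c'. comatrix C n c' \<and> (\<forall>i<n. \<forall>j<n. p (c' i j) = p (?c i j)) \<and> (\<forall>i<n. \<forall>j<n. \<not> ?P i j \<longrightarrow> c' i j = \<zero>\<^bsub>C\<^esub>)"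
    by (rule comatrix_lift[where P = ?P and h = "\<lambda>i j. p (?c i j)", OF \<iota> C H]) (use pH zero in auto)
  then obtain c' where c': "comatrix C n c'" "\<forall>i<n. \<forall>j<n. p (c' i j) = p (?c i j)"
    "\<forall>i<n. \<forall>j<n. \<not> ?P i j \<longrightarrow> c' i j = \<zero>\<^bsub>C\<^esub>" by blast
  have block: "?c i j = \<zero>\<^bsub>C\<^esub>" if "m \<le> i" "i < n" "j < m" for i j
    using comatrix_unique[OF \<iota> C H mat c'(1), of i j] c'(2,3) that n(1) by auto
  \<comment> \<open>In the expansion of \<open>e' j\<close> by the left counit, the terms with
    \<open>i < m\<close> vanish since the counit is zero on \<open>N\<close>, the others by
    \<open>block\<close>.\<close>
  have e0: "e' j = \<zero>\<^bsub>C\<^esub>" if j: "j < m" for j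
  proof -
    have jn: "j < n" using j n(1) by simp
    have "e' j = lslice C C (counit C) (comult C (e' j))" using Cc(5)[OF p(1)[OF jn]] by simp
    also have "\<dots> = lslice C C (counit C) (\<Oplus>\<^bsub>tens K C C\<^esub>i\<in>{..<n}. pure K C C (e' i) (?c i j))"
      by (rule arg_cong[where f = "lslice C C (counit C)"]) (use cof jn in \<open>unfold coframe_def, blast\<close>)
    also have "\<dots> = (\<Oplus>\<^bsub>C\<^esub>i\<in>{..<n}. lslice C C (counit C) (pure K C C (e' i) (?c i j)))"
      by (rule linear_finsum[OF lslice_linear]) (use Cm Cc(3) p(1) cD(1) jn in auto)
    also have "\<dots> = \<zero>\<^bsub>C\<^esub>"
    proof (rule module_finsum_zero[OF Cm])
      fix i assume "i \<in> {..<n}"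
      then have i: "i < n" by simp
      have "lslice C C (counit C) (pure K C C (e' i) (?c i j)) = counit C (e' i) \<odot>\<^bsub>C\<^esub> ?c i j"
        by (rule lslice_pure) (use Cm Cc(3) p(1) cD(1) i jn in auto)
      also have "\<dots> = \<zero>\<^bsub>C\<^esub>"
      proof (cases "i < m")
        case True
        then have "counit C (e' i) = \<zero>" using \<epsilon> m(2) n(3) by simp
        then show ?thesis using cD(1)[OF i jn] by simp
      next
        case False
        then have "?c i j = \<zero>\<^bsub>C\<^esub>" using block i j by simp
        then show ?thesis using functional_closed[OF Cc(3) p(1)[OF i]] by simp
      qed
      finally show "lslice C C (counit C) (pure K C C (e' i) (?c i j)) = \<zero>\<^bsub>C\<^esub>" .
    qed
    finally show ?thesis .
  qed
  \<comment> \<open>The vectors of a frame are nonzero.\<close>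
  have "m = 0"
  proof (rule ccontr)
    assume "m \<noteq> 0"
    then have m0: "0 < m" "0 < n" using n(1) by auto
    have "\<psi>' 0 (e' 0) = \<zero>" using e0[OF m0(1)] functional_zero[OF p(2)[OF m0(2)] Cm] by simp
    then show False using p(3)[OF m0(2) m0(2)] by simp
  qed
  then show ?thesis using m(3) c U(2) by (auto simp: fproj_def)
qed

end

subsection \<open>Subcoalgebras\<close>

context base_field
begin

text \<open>The bilinear maps behind \<open>split_left_S\<close> and \<open>split_right_S\<close>
  contain a \<open>tmap\<close> whose map depends on a parameter; linearity in the parameter follows
  by induction on the tensor.\<close>

lemma tmap_param_right:
  assumes mods: "module K A" "module K B" "module K E" "module K F" "module K Y"
    and f: "is_linear K A E f" and g: "\<And>y. y \<in> carrier Y \<Longrightarrow> is_linear K B F (g y)"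
    and gy: "\<And>b. b \<in> carrier B \<Longrightarrow> is_linear K Y F (\<lambda>y. g y b)"
    and s: "s \<in> carrier (tens K A B)"
  shows "is_linear K Y (tens K E F) (\<lambda>y. tmap K A B E F f (g y) s)"
  using mods(1,2) s
proof (induction rule: tens_induct)
  case (pure a b)
  have "is_linear K Y (tens K E F) (\<lambda>y. pure K E F (f a) (g y b))"
    by (rule linear_comp[OF linear_pure_right gy]) (use mods linear_closed[OF f] pure in auto)
  then show ?case
  proof (rule linear_cong[OF _ mods(5)])
    show "tmap K A B E F f (g y) (pure K A B a b) = pure K E F (f a) (g y b)" if "y \<in> carrier Y" for y
      using mods f g[OF that] pure by simp
  qed
next
  case (add s t)
  have "is_linear K Y (tens K E F) (\<lambda>y. tmap K A B E F f (g y) s \<oplus>\<^bsub>tens K E F\<^esub> tmap K A B E F f (g y) t)"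
    by (rule linear_plus[OF _ add.IH]) (use mods in simp)
  then show ?case
  proof (rule linear_cong[OF _ mods(5)])
    show "tmap K A B E F f (g y) (s \<oplus>\<^bsub>tens K A B\<^esub> t) = tmap K A B E F f (g y) s \<oplus>\<^bsub>tens K E F\<^esub> tmap K A B E F f (g y) t"
      if "y \<in> carrier Y" for y
      by (rule linear_add[OF tmap_linear[OF mods(1-4) f g[OF that]] add.hyps])
  qed
qed

lemma tmap_param_left:
  assumes mods: "module K A" "module K B" "module K E" "module K F" "module K Y"
    and f: "\<And>y. y \<in> carrier Y \<Longrightarrow> is_linear K A E (f y)" and g: "is_linear K B F g"
    and fy: "\<And>a. a \<in> carrier A \<Longrightarrow> is_linear K Y E (\<lambda>y. f y a)"
    and s: "s \<in> carrier (tens K A B)"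
  shows "is_linear K Y (tens K E F) (\<lambda>y. tmap K A B E F (f y) g s)"
  using mods(1,2) s
proof (induction rule: tens_induct)
  case (pure a b)
  have "is_linear K Y (tens K E F) (\<lambda>y. pure K E F (f y a) (g b))"
    by (rule linear_comp[OF linear_pure_left fy]) (use mods linear_closed[OF g] pure in auto)
  then show ?case
  proof (rule linear_cong[OF _ mods(5)])
    show "tmap K A B E F (f y) g (pure K A B a b) = pure K E F (f y a) (g b)" if "y \<in> carrier Y" for y
      using mods f[OF that] g pure by simp
  qed
next
  case (add s t)
  have "is_linear K Y (tens K E F) (\<lambda>y. tmap K A B E F (f y) g s \<oplus>\<^bsub>tens K E F\<^esub> tmap K A B E F (f y) g t)"
    by (rule linear_plus[OF _ add.IH]) (use mods in simp)
  then show ?case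
  proof (rule linear_cong[OF _ mods(5)])
    show "tmap K A B E F (f y) g (s \<oplus>\<^bsub>tens K A B\<^esub> t) = tmap K A B E F (f y) g s \<oplus>\<^bsub>tens K E F\<^esub> tmap K A B E F (f y) g t"
      if "y \<in> carrier Y" for y
      by (rule linear_add[OF tmap_linear[OF mods(1-4) f[OF that] g] add.hyps])
  qed
qed

lemma is_coalgebra_iff:
  "is_coalgebra K D \<longleftrightarrow> module K D \<and> is_linear K D (tens K D D) (comult D) \<and> functional D (counit D) \<and>
    (\<forall>c\<in>carrier D. tassoc K D D D (tmap K D D (tens K D D) D (comult D) (\<lambda>x. x) (comult D c)) =
       tmap K D D D (tens K D D) (\<lambda>x. x) (comult D) (comult D c)) \<and>
    (\<forall>c\<in>carrier D. lslice D D (counit D) (comult D c) = c) \<and>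
    (\<forall>c\<in>carrier D. rslice D D (counit D) (comult D c) = c)"
  unfolding is_coalgebra_def functional_def rslice_def lslice_def by (rule refl)

lemma subcoalgebra_simps [simp]:
  "carrier (subcoalgebra K C X) = X"
  "x \<oplus>\<^bsub>subcoalgebra K C X\<^esub> y = x \<oplus>\<^bsub>C\<^esub> y"
  "\<zero>\<^bsub>subcoalgebra K C X\<^esub> = \<zero>\<^bsub>C\<^esub>"
  "c \<odot>\<^bsub>subcoalgebra K C X\<^esub> x = c \<odot>\<^bsub>C\<^esub> x"
  "counit (subcoalgebra K C X) = counit C"
  by (simp_all add: subcoalgebra_def submod_def)

lemma subcoalgebra_tens:
  "tens K (subcoalgebra K C X) (subcoalgebra K C X) = tens K (submod C X) (submod C X)"
  "pure K (subcoalgebra K C X) (subcoalgebra K C X) = pure K (submod C X) (submod C X)"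
  by (simp_all add: tens_def pure_def[abs_def] tens_coset_def[abs_def] bal_tensor_def bal_coset_def[abs_def]
      bal_kernel_def bal_relations_def Let_def)

lemma subcoalgebra_tmap:
  "tmap K (subcoalgebra K C X) (subcoalgebra K C X) E F = tmap K (submod C X) (submod C X) E F"
  unfolding tmap_def[abs_def] tlift_def[abs_def] subcoalgebra_tens by simp

lemma subcoalgebra_module:
  assumes "submodule X K C" "module K C"
  shows "module K (subcoalgebra K C X)"
proof -
  have "module K (submod C X)" using assms by simp
  then show ?thesis
    unfolding subcoalgebra_def
    by (simp add: module_def module_axioms_def abelian_group_def abelian_group_axioms_def abelian_monoid_def)
qed

lemma subcoalgebra_incl:
  assumes "submodule X K C" "module K C"
  shows "is_linear K (subcoalgebra K C X) C (\<lambda>x. x)"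
  by (rule is_linearI) (use submodule_subset[OF assms] in auto)

lemma subcoalgebra_incl_inj:
  assumes "submodule X K C" "module K C"
  shows "inj_on (tmap K (subcoalgebra K C X) (subcoalgebra K C X) C C (\<lambda>x. x) (\<lambda>x. x))
    (carrier (tens K (subcoalgebra K C X) (subcoalgebra K C X)))"
  by (rule tmap_inj) (use assms subcoalgebra_module subcoalgebra_incl in auto)

text \<open>A preimage exists by the definition of a subcoalgebra and is unique by the injectivity
  of \<open>X \<otimes> X \<rightarrow> C \<otimes> C\<close>, so the description in
  \<open>subcoalgebra\<close> denotes it.\<close>

lemma subcoalgebra_comult:
  assumes C: "is_coalgebra K C" and X: "is_subcoalgebra K C X" and x: "x \<in> X"
  shows "comult (subcoalgebra K C X) x \<in> carrier (tens K (subcoalgebra K C X) (subcoalgebra K C X))"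
    and "tmap K (subcoalgebra K C X) (subcoalgebra K C X) C C (\<lambda>x. x) (\<lambda>x. x) (comult (subcoalgebra K C X) x) = comult C x"
proof -
  let ?D = "subcoalgebra K C X"
  let ?P = "\<lambda>t. t \<in> carrier (tens K ?D ?D) \<and> tmap K ?D ?D C C (\<lambda>x. x) (\<lambda>x. x) t = comult C x"
  have sub: "submodule X K C" using X by (simp add: is_subcoalgebra_def)
  have eq: "comult ?D x = (THE t. ?P t)"
    using x unfolding subcoalgebra_tens subcoalgebra_tmap by (simp add: subcoalgebra_def)
  have "comult C x \<in> tmap K ?D ?D C C (\<lambda>x. x) (\<lambda>x. x) ` carrier (tens K ?D ?D)"
    using X x unfolding is_subcoalgebra_def subcoalgebra_tens subcoalgebra_tmap by blast
  then have "\<exists>!t. ?P t"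
    using subcoalgebra_incl_inj[OF sub coalgebra_module[OF C]] by (auto dest: inj_onD)
  from theI'[OF this]
  show "comult ?D x \<in> carrier (tens K ?D ?D)"
    and "tmap K ?D ?D C C (\<lambda>x. x) (\<lambda>x. x) (comult ?D x) = comult C x"
    unfolding eq by blast+
qed

text \<open>Each axiom is inherited from \<open>C\<close> through the inclusion; for those with
  values in tensor powers, injectivity over a field brings the equation back.\<close>

lemma subcoalgebra_coalgebra:
  assumes C: "is_coalgebra K C" and X: "is_subcoalgebra K C X"
  shows "is_coalgebra K (subcoalgebra K C X)"
proof -
  let ?D = "subcoalgebra K C X" and ?i = "\<lambda>x. x"
  let ?ii = "tmap K ?D ?D C C ?i ?i"
  note Cc = coalgebra_props[OF C]
  note Cm = Cc(1)
  have sub: "submodule X K C" using X by (simp add: is_subcoalgebra_def)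
  have Dm: "module K ?D" by (rule subcoalgebra_module[OF sub Cm])
  have inc: "is_linear K ?D C ?i" by (rule subcoalgebra_incl[OF sub Cm])
  have iiL: "is_linear K (tens K ?D ?D) (tens K C C) ?ii" by (rule tmap_linear[OF Dm Dm Cm Cm inc inc])
  have XC: "x \<in> carrier C" if "x \<in> X" for x using submodule_subset[OF sub Cm] that by blast
  note \<Delta> = subcoalgebra_comult[OF C X]
  note inj = subcoalgebra_incl_inj[OF sub Cm]
  note [simp] = Cm Dm inc
  have \<Delta>lin: "is_linear K ?D (tens K ?D ?D) (comult ?D)"
  proof (rule is_linearI)
    interpret T: module K "tens K ?D ?D" by simp
    show "comult ?D x \<in> carrier (tens K ?D ?D)" if "x \<in> carrier ?D" for x using \<Delta>(1) that by simp
    show "comult ?D (x \<oplus>\<^bsub>?D\<^esub> y) = comult ?D x \<oplus>\<^bsub>tens K ?D ?D\<^esub> comult ?D y"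
      if "x \<in> carrier ?D" "y \<in> carrier ?D" for x y
    proof (rule inj_onD[OF inj])
      have xy: "x \<in> X" "y \<in> X" "x \<oplus>\<^bsub>C\<^esub> y \<in> X" using that submodule_add[OF sub Cm] by auto
      show "?ii (comult ?D (x \<oplus>\<^bsub>?D\<^esub> y)) = ?ii (comult ?D x \<oplus>\<^bsub>tens K ?D ?D\<^esub> comult ?D y)"
        using xy \<Delta> XC by (simp add: linear_add[OF iiL] linear_add[OF Cc(2)])
    qed (use that \<Delta>(1) submodule_add[OF sub Cm] in auto)
    show "comult ?D (a \<odot>\<^bsub>?D\<^esub> x) = a \<odot>\<^bsub>tens K ?D ?D\<^esub> comult ?D x"
      if "a \<in> carrier K" "x \<in> carrier ?D" for a x
    proof (rule inj_onD[OF inj])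
      have xy: "x \<in> X" "a \<odot>\<^bsub>C\<^esub> x \<in> X" using that submodule_smult[OF sub Cm] by auto
      show "?ii (comult ?D (a \<odot>\<^bsub>?D\<^esub> x)) = ?ii (a \<odot>\<^bsub>tens K ?D ?D\<^esub> comult ?D x)"
        using xy \<Delta> XC that by (simp add: linear_smult[OF iiL] linear_smult[OF Cc(2)])
    qed (use that \<Delta>(1) submodule_smult[OF sub Cm] in auto)
  qed
  have \<epsilon>: "functional ?D (counit ?D)"
    using functional_comp[OF Cc(3) inc] by simp
  let ?j = "tmap K ?D (tens K ?D ?D) C (tens K C C) ?i ?ii"
  have jinj: "inj_on ?j (carrier (tens K ?D (tens K ?D ?D)))"
    by (rule tmap_inj) (use iiL inj in auto)
  have coassoc: "tassoc K ?D ?D ?D (tmap K ?D ?D (tens K ?D ?D) ?D (comult ?D) ?i (comult ?D x)) =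
      tmap K ?D ?D ?D (tens K ?D ?D) ?i (comult ?D) (comult ?D x)" if x: "x \<in> X" for x
  proof (rule inj_onD[OF jinj])
    have t: "comult ?D x \<in> carrier (tens K ?D ?D)" by (rule \<Delta>(1)[OF x])
    have "?j (tassoc K ?D ?D ?D (tmap K ?D ?D (tens K ?D ?D) ?D (comult ?D) ?i (comult ?D x))) =
      tassoc K C C C (tmap K (tens K ?D ?D) ?D (tens K C C) C ?ii ?i (tmap K ?D ?D (tens K ?D ?D) ?D (comult ?D) ?i (comult ?D x)))"
      by (rule tassoc_nat[symmetric]) (use t \<Delta>lin in auto)
    also have "tmap K (tens K ?D ?D) ?D (tens K C C) C ?ii ?i (tmap K ?D ?D (tens K ?D ?D) ?D (comult ?D) ?i (comult ?D x)) =
      tmap K ?D ?D (tens K C C) C (\<lambda>x. ?ii (comult ?D x)) ?i (comult ?D x)"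
      by (rule tmap_comp) (use t \<Delta>lin iiL in auto)
    also have "tmap K ?D ?D (tens K C C) C (\<lambda>x. ?ii (comult ?D x)) ?i =
      tmap K ?D ?D (tens K C C) C (\<lambda>x. comult C x) ?i"
      by (rule tmap_cong) (use \<Delta>(2) in auto)
    also have "tmap K ?D ?D (tens K C C) C (\<lambda>x. comult C x) ?i (comult ?D x) =
      tmap K C C (tens K C C) C (comult C) ?i (?ii (comult ?D x))"
      by (rule tmap_comp[symmetric]) (use t Cc(2) in auto)
    also have "?ii (comult ?D x) = comult C x" by (rule \<Delta>(2)[OF x])
    also have "tassoc K C C C (tmap K C C (tens K C C) C (comult C) ?i (comult C x)) =
      tmap K C C C (tens K C C) ?i (comult C) (comult C x)"
      by (rule coaction_props(3)[OF Cc(4) XC[OF x]])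
    also have "comult C x = ?ii (comult ?D x)" by (rule \<Delta>(2)[OF x, symmetric])
    also have "tmap K C C C (tens K C C) ?i (comult C) (?ii (comult ?D x)) =
      tmap K ?D ?D C (tens K C C) ?i (\<lambda>x. comult C x) (comult ?D x)"
      by (rule tmap_comp) (use t Cc(2) in auto)
    also have "tmap K ?D ?D C (tens K C C) ?i (\<lambda>x. comult C x) =
      tmap K ?D ?D C (tens K C C) ?i (\<lambda>x. ?ii (comult ?D x))"
      by (rule tmap_cong) (use \<Delta>(2) in auto)
    also have "tmap K ?D ?D C (tens K C C) ?i (\<lambda>x. ?ii (comult ?D x)) (comult ?D x) =
      ?j (tmap K ?D ?D ?D (tens K ?D ?D) ?i (comult ?D) (comult ?D x))"
      by (rule tmap_comp[symmetric]) (use t \<Delta>lin iiL in auto)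
    finally show "?j (tassoc K ?D ?D ?D (tmap K ?D ?D (tens K ?D ?D) ?D (comult ?D) ?i (comult ?D x))) =
      ?j (tmap K ?D ?D ?D (tens K ?D ?D) ?i (comult ?D) (comult ?D x))" .
  qed (use \<Delta>(1)[OF x] \<Delta>lin in auto)
  have left: "lslice ?D ?D (counit ?D) (comult ?D x) = x" if x: "x \<in> X" for x
    using lslice_tmap[OF Dm Dm Cm Cm inc inc Cc(3) \<Delta>(1)[OF x]] \<Delta>(2)[OF x] Cc(5)[OF XC[OF x]] by simp
  have right: "rslice ?D ?D (counit ?D) (comult ?D x) = x" if x: "x \<in> X" for x
    using rslice_tmap[OF Dm Dm Cm Cm inc inc Cc(3) \<Delta>(1)[OF x]] \<Delta>(2)[OF x]
      coaction_props(4)[OF Cc(4) XC[OF x]] by simp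
  show ?thesis
    unfolding is_coalgebra_iff
    using Dm \<Delta>lin \<epsilon> coassoc left right by auto
qed

text \<open>That \<open>comult C x\<close> comes from the tensor square of the span is a condition
  cutting out a subspace, so it may be checked on generators.\<close>

lemma is_subcoalgebra_span:
  assumes C: "is_coalgebra K C" and X: "\<And>X. X \<in> \<X> \<Longrightarrow> is_subcoalgebra K C X"
  shows "is_subcoalgebra K C (span_of K C (\<Union>\<X>))"
proof -
  note Cc = coalgebra_props[OF C]
  note Cm = Cc(1)
  let ?Y = "span_of K C (\<Union>\<X>)"
  have "\<Union>\<X> \<subseteq> carrier C"
  proof (rule Union_least)
    show "X \<subseteq> carrier C" if "X \<in> \<X>" for X
      using X[OF that] submodule_subset[OF _ Cm] by (simp add: is_subcoalgebra_def)
  qed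
  then have Y: "submodule ?Y K C" by (rule submodule_span_of[OF Cm])
  let ?D = "submod C ?Y"
  let ?f = "tmap K ?D ?D C C (\<lambda>x. x) (\<lambda>x. x)"
  have Dm: "module K ?D" using Y Cm by simp
  have im: "submodule (?f ` carrier (tens K ?D ?D)) K (tens K C C)"
    by (rule submodule_image[OF _ _ _ module.carrier_is_submodule]) (use Dm Cm Y in auto)
  have "\<Union>\<X> \<subseteq> {x \<in> carrier C. comult C x \<in> ?f ` carrier (tens K ?D ?D)}"
  proof
    fix x assume "x \<in> \<Union>\<X>"
    then obtain X where XX: "X \<in> \<X>" "x \<in> X" by blast
    have sX: "submodule X K C" using X[OF XX(1)] by (simp add: is_subcoalgebra_def)
    let ?E = "submod C X"
    have Em: "module K ?E" using sX Cm by simp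
    have XY: "X \<subseteq> ?Y" using span_of_incl[of "\<Union>\<X>" C] XX(1) by blast
    have ED: "is_linear K ?E ?D (\<lambda>x. x)" by (rule is_linearI) (use XY in auto)
    have xC: "x \<in> carrier C" using submodule_subset[OF sX Cm] XX by blast
    have "comult C x \<in> tmap K ?E ?E C C (\<lambda>x. x) (\<lambda>x. x) ` carrier (tens K ?E ?E)"
      using X[OF XX(1)] XX(2) unfolding is_subcoalgebra_def by blast
    then obtain t where t: "t \<in> carrier (tens K ?E ?E)" "comult C x = tmap K ?E ?E C C (\<lambda>x. x) (\<lambda>x. x) t" by blast
    have "?f (tmap K ?E ?E ?D ?D (\<lambda>x. x) (\<lambda>x. x) t) = comult C x"
      unfolding t(2) by (rule tmap_comp) (use Em Dm Cm ED Y t in auto)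
    moreover have "tmap K ?E ?E ?D ?D (\<lambda>x. x) (\<lambda>x. x) t \<in> carrier (tens K ?D ?D)"
      using Em Dm ED t by simp
    ultimately show "x \<in> {x \<in> carrier C. comult C x \<in> ?f ` carrier (tens K ?D ?D)}"
      using xC by (metis (mono_tags, lifting) image_eqI mem_Collect_eq)
  qed
  then have "?Y \<subseteq> {x \<in> carrier C. comult C x \<in> ?f ` carrier (tens K ?D ?D)}"
    by (rule span_of_least[OF submodule_preimage[OF Cm tens_module[OF Cm Cm] Cc(2) im]])
  then show ?thesis using Y unfolding is_subcoalgebra_def by blast
qed

lemma is_subcoalgebra_comatrix:
  assumes C: "is_coalgebra K C" and c: "comatrix C n c"
  shows "is_subcoalgebra K C (span_of K C {c i j | i j. i < n \<and> j < n})"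
proof -
  note Cc = coalgebra_props[OF C] and cD = comatrixD[OF c]
  note Cm = Cc(1)
  let ?G = "{c i j | i j. i < n \<and> j < n}"
  let ?Y = "span_of K C ?G"
  have "?G \<subseteq> carrier C" using cD by auto
  then have Y: "submodule ?Y K C" by (rule submodule_span_of[OF Cm])
  let ?D = "submod C ?Y"
  let ?f = "tmap K ?D ?D C C (\<lambda>x. x) (\<lambda>x. x)"
  have Dm: "module K ?D" using Y Cm by simp
  have fl: "is_linear K (tens K ?D ?D) (tens K C C) ?f" using Dm Cm Y by simp
  have im: "submodule (?f ` carrier (tens K ?D ?D)) K (tens K C C)"
    by (rule submodule_image[OF _ _ _ module.carrier_is_submodule]) (use Dm Cm Y in auto)
  have cY: "c i j \<in> ?Y" if "i < n" "j < n" for i j using span_of_incl[of ?G C] that by blast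
  have "?G \<subseteq> {x \<in> carrier C. comult C x \<in> ?f ` carrier (tens K ?D ?D)}"
  proof safe
    fix i j assume ij: "i < n" "j < n"
    show "c i j \<in> carrier C" using cD ij by simp
    have mem: "pure K C C (c i k) (c k j) \<in> ?f ` carrier (tens K ?D ?D)" if "k < n" for k
    proof (rule image_eqI)
      show "pure K ?D ?D (c i k) (c k j) \<in> carrier (tens K ?D ?D)"
        using cY ij that by simp
      show "pure K C C (c i k) (c k j) = ?f (pure K ?D ?D (c i k) (c k j))"
        using Dm Cm Y cY ij that by simp
    qed
    show "comult C (c i j) \<in> ?f ` carrier (tens K ?D ?D)"
      unfolding cD(2)[OF ij] by (rule submodule_finsum[OF im]) (use Cm mem in auto)
  qed
  then have "?Y \<subseteq> {x \<in> carrier C. comult C x \<in> ?f ` carrier (tens K ?D ?D)}"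
    by (rule span_of_least[OF submodule_preimage[OF Cm tens_module[OF Cm Cm] Cc(2) im]])
  then show ?thesis using Y unfolding is_subcoalgebra_def by blast
qed

end

subsection \<open>The universal coalgebra of partial corepresentations\<close>

locale hopf_cofree = base_field K for K :: "('k, 'z) ring_scheme" (structure) +
  fixes H :: "('k, 'h, 'x) hopf_scheme" and C :: "('k, 'c) coalgebra" and p :: "'c \<Rightarrow> 'h"
    and \<iota> :: "'k list \<Rightarrow> 'u"
  assumes hopf: "is_hopf_algebra K H" and cofree: "is_cofree_coalgebra TYPE('u) K H C p"
    and univ: "inj_on \<iota> (lists (carrier K))"
begin

lemma H_module [simp]: "module K H" and H_comult: "is_linear K H (tens K H H) (comult H)"
  and H_counit: "functional H (counit H)" and S_linear: "is_linear K H H (antipode H)"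
  using hopf coalgebra_props[of H] by (auto simp: is_hopf_algebra_def)

lemma C_coalgebra: "is_coalgebra K C" and p_linear: "is_linear K C H p"
  using cofree_props[OF cofree] by auto

lemma C_module [simp]: "module K C"
  using coalgebra_module[OF C_coalgebra] .

lemma H_mult_left: "x \<in> carrier H \<Longrightarrow> is_linear K H H (\<lambda>y. x \<otimes>\<^bsub>H\<^esub> y)"
  and H_mult_right: "x \<in> carrier H \<Longrightarrow> is_linear K H H (\<lambda>y. y \<otimes>\<^bsub>H\<^esub> x)"
proof -
  have u: "is_unital_algebra K H" using hopf by (simp add: is_hopf_algebra_def)
  then interpret H: ring H by (simp add: is_unital_algebra_def)
  show "x \<in> carrier H \<Longrightarrow> is_linear K H H (\<lambda>y. x \<otimes>\<^bsub>H\<^esub> y)"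
    "x \<in> carrier H \<Longrightarrow> is_linear K H H (\<lambda>y. y \<otimes>\<^bsub>H\<^esub> x)"
    using u by (auto intro!: is_linearI simp: is_unital_algebra_def H.r_distr H.l_distr)
qed

lemma mult_S_linear [simp]: "is_linear K (tens K H H) H (mult_S K H)"
  unfolding mult_S_def
  by (rule tlift_linear)
    (auto intro!: bilinearI linear_comp[OF H_mult_left S_linear] H_mult_right linear_closed[OF S_linear])

lemma split_left_S_linear [simp]: "is_linear K (tens K H H) (tens K H H) (split_left_S K H)"
  unfolding split_left_S_def
proof (rule tlift_linear)
  have m: "is_linear K H H (\<lambda>v. v \<otimes>\<^bsub>H\<^esub> antipode H y)" if "y \<in> carrier H" for y
    by (rule H_mult_right[OF linear_closed[OF S_linear that]])
  show "bilinear K H H (tens K H H) (\<lambda>x y. tmap K H H H H (\<lambda>u. u) (\<lambda>v. v \<otimes>\<^bsub>H\<^esub> antipode H y) (comult H x))"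
  proof (rule bilinearI)
    show "is_linear K H (tens K H H) (\<lambda>y. tmap K H H H H (\<lambda>u. u) (\<lambda>v. v \<otimes>\<^bsub>H\<^esub> antipode H y) (comult H x))"
      if "x \<in> carrier H" for x
      by (rule tmap_param_right) (use m linear_comp[OF H_mult_left S_linear] linear_closed[OF H_comult that] in auto)
    show "is_linear K H (tens K H H) (\<lambda>x. tmap K H H H H (\<lambda>u. u) (\<lambda>v. v \<otimes>\<^bsub>H\<^esub> antipode H y) (comult H x))"
      if "y \<in> carrier H" for y
      by (rule linear_comp[OF tmap_linear H_comult]) (use m that in auto)
  qed
qed auto

lemma split_right_S_linear [simp]: "is_linear K (tens K H H) (tens K H H) (split_right_S K H)"
  unfolding split_right_S_def
proof (rule tlift_linear)
  have m: "is_linear K H H (\<lambda>u. x \<otimes>\<^bsub>H\<^esub> antipode H u)" if "x \<in> carrier H" for x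
    by (rule linear_comp[OF H_mult_left[OF that] S_linear])
  show "bilinear K H H (tens K H H) (\<lambda>x y. tmap K H H H H (\<lambda>u. x \<otimes>\<^bsub>H\<^esub> antipode H u) (\<lambda>v. v) (comult H y))"
  proof (rule bilinearI)
    show "is_linear K H (tens K H H) (\<lambda>y. tmap K H H H H (\<lambda>u. x \<otimes>\<^bsub>H\<^esub> antipode H u) (\<lambda>v. v) (comult H y))"
      if "x \<in> carrier H" for x
      by (rule linear_comp[OF tmap_linear H_comult]) (use m that in auto)
    show "is_linear K H (tens K H H) (\<lambda>x. tmap K H H H H (\<lambda>u. x \<otimes>\<^bsub>H\<^esub> antipode H u) (\<lambda>v. v) (comult H y))"
      if "y \<in> carrier H" for y
      by (rule tmap_param_left)
        (use m H_mult_right[OF linear_closed[OF S_linear]] linear_closed[OF H_comult that] in auto)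
  qed
qed auto

section \<open>The partial corepresentation identities inside \<open>C\<close>\<close>

definition pp :: "'c \<Rightarrow> ('h, 'h) tensor"
  where "pp c = tmap K C C H H p p (comult C c)"

definition pS :: "'c \<Rightarrow> 'h"
  where "pS c = mult_S K H (pp c)"

text \<open>The identities are imposed elementwise and computed with the comultiplication of
  \<open>C\<close>. Being linear in \<open>c\<close> they define a subspace, which is why they
  survive sums of subcoalgebras.\<close>

definition PC :: "'c set"
  where "PC = {c \<in> carrier C. counit H (p c) = counit C c \<and>
    split_left_S K H (pp c) = tmap K C C H H p pS (comult C c) \<and>
    split_right_S K H (pp c) = tmap K C C H H pS p (comult C c)}"

lemma pp_linear: "is_linear K C (tens K H H) pp"
  unfolding pp_def[abs_def]
  by (rule linear_comp[OF tmap_linear comult_linear[OF C_coalgebra]]) (use p_linear in auto)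

lemma pS_linear: "is_linear K C H pS"
  unfolding pS_def[abs_def] by (rule linear_comp[OF mult_S_linear pp_linear])

lemma PC_submodule: "submodule PC K C"
proof -
  note \<Delta> = comult_linear[OF C_coalgebra]
  have 1: "submodule {c \<in> carrier C. counit H (p c) = counit C c} K C"
    by (rule submodule_equalizer[where W = "self_module K"])
      (use functional_comp[OF H_counit p_linear] counit_functional[OF C_coalgebra] in \<open>auto simp: functional_def\<close>)
  have 2: "submodule {c \<in> carrier C. split_left_S K H (pp c) = tmap K C C H H p pS (comult C c)} K C"
    by (rule submodule_equalizer[where W = "tens K H H", OF _ _ linear_comp[OF split_left_S_linear pp_linear]
          linear_comp[OF tmap_linear \<Delta>]]) (use p_linear pS_linear in auto)
  have 3: "submodule {c \<in> carrier C. split_right_S K H (pp c) = tmap K C C H H pS p (comult C c)} K C"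
    by (rule submodule_equalizer[where W = "tens K H H", OF _ _ linear_comp[OF split_right_S_linear pp_linear]
          linear_comp[OF tmap_linear \<Delta>]]) (use p_linear pS_linear in auto)
  have "PC = {c \<in> carrier C. counit H (p c) = counit C c} \<inter>
      ({c \<in> carrier C. split_left_S K H (pp c) = tmap K C C H H p pS (comult C c)} \<inter>
       {c \<in> carrier C. split_right_S K H (pp c) = tmap K C C H H pS p (comult C c)})"
    by (auto simp: PC_def)
  then show ?thesis using submodule_inter[OF C_module 1 submodule_inter[OF C_module 2 3]] by simp
qed

text \<open>The comultiplication of \<open>X\<close> maps to that of \<open>C\<close> under the
  inclusion, so at elements of \<open>X\<close> both readings of the identities agree.\<close>

lemma partial_corep_iff:
  assumes X: "is_subcoalgebra K C X"
  shows "is_partial_corep K (subcoalgebra K C X) H p \<longleftrightarrow> X \<subseteq> PC"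
proof -
  let ?D = "subcoalgebra K C X"
  have sub: "submodule X K C" using X by (simp add: is_subcoalgebra_def)
  have Dm: "module K ?D" by (rule subcoalgebra_module[OF sub C_module])
  have inc: "is_linear K ?D C (\<lambda>x. x)" by (rule subcoalgebra_incl[OF sub C_module])
  have XC: "X \<subseteq> carrier C" by (rule submodule_subset[OF sub C_module])
  note \<Delta> = subcoalgebra_comult[OF C_coalgebra X]
  have lin: "is_linear K ?D H f" if "is_linear K C H f" for f using linear_comp[OF that inc] .
  have tm: "tmap K ?D ?D H H f g (comult ?D x) = tmap K C C H H f g (comult C x)"
    if "is_linear K C H f" "is_linear K C H g" "x \<in> X" for f g x
    using tmap_comp[OF Dm Dm C_module C_module H_module H_module inc inc that(1,2) \<Delta>(1)[OF that(3)]] \<Delta>(2)[OF that(3)]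
    by simp
  have q: "mult_S K H (tmap K ?D ?D H H p p (comult ?D x)) = pS x" if "x \<in> X" for x
    using tm[OF p_linear p_linear that] by (simp add: pS_def pp_def)
  have e1: "tmap K ?D ?D H H p (\<lambda>d. mult_S K H (tmap K ?D ?D H H p p (comult ?D d))) = tmap K ?D ?D H H p pS"
    by (rule tmap_cong) (use q in auto)
  have e2: "tmap K ?D ?D H H (\<lambda>d. mult_S K H (tmap K ?D ?D H H p p (comult ?D d))) p = tmap K ?D ?D H H pS p"
    by (rule tmap_cong) (use q in auto)
  have "c \<in> PC \<longleftrightarrow> counit H (p c) = counit ?D c \<and>
       split_left_S K H (tmap K ?D ?D H H p p (comult ?D c)) =
       tmap K ?D ?D H H p (\<lambda>d. mult_S K H (tmap K ?D ?D H H p p (comult ?D d))) (comult ?D c) \<and>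
       split_right_S K H (tmap K ?D ?D H H p p (comult ?D c)) =
       tmap K ?D ?D H H (\<lambda>d. mult_S K H (tmap K ?D ?D H H p p (comult ?D d))) p (comult ?D c)" if c: "c \<in> X" for c
    unfolding e1 e2 tm[OF p_linear p_linear c] tm[OF p_linear pS_linear c] tm[OF pS_linear p_linear c]
    using c XC by (auto simp: PC_def pp_def)
  then show ?thesis
    unfolding is_partial_corep_def using lin[OF p_linear] by auto
qed

section \<open>The universal coalgebra as the largest subcoalgebra inside \<open>PC\<close>\<close>

definition HX :: "'c set"
  where "HX = span_of K C (\<Union>{X. is_subcoalgebra K C X \<and> is_partial_corep K (subcoalgebra K C X) H p})"

definition D :: "('k, 'c) coalgebra"
  where "D = Hpar K H C p"

lemma D_eq: "D = subcoalgebra K C HX"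
  by (simp add: D_def Hpar_def HX_def)

lemma HX_subcoalgebra: "is_subcoalgebra K C HX"
  unfolding HX_def by (rule is_subcoalgebra_span[OF C_coalgebra]) auto

text \<open>Summing subcoalgebras does not lead out of \<open>PC\<close>, since \<open>PC\<close> is
  a subspace; this is why \<open>p\<close> is again a partial corepresentation on the sum.\<close>

lemma HX_PC: "HX \<subseteq> PC"
  unfolding HX_def by (rule span_of_least[OF PC_submodule]) (use partial_corep_iff in auto)

lemma HX_maximal: "is_subcoalgebra K C X \<Longrightarrow> X \<subseteq> PC \<Longrightarrow> X \<subseteq> HX"
  unfolding HX_def using partial_corep_iff[of X] by (intro order.trans[OF _ span_of_incl]) auto

lemma HX_submodule: "submodule HX K C"
  using HX_subcoalgebra by (simp add: is_subcoalgebra_def)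

lemma D_coalgebra: "is_coalgebra K D"
  unfolding D_eq by (rule subcoalgebra_coalgebra[OF C_coalgebra HX_subcoalgebra])

lemma D_module [simp]: "module K D"
  using coalgebra_module[OF D_coalgebra] .

lemma D_simps: "carrier D = HX" "\<zero>\<^bsub>D\<^esub> = \<zero>\<^bsub>C\<^esub>" "x \<oplus>\<^bsub>D\<^esub> y = x \<oplus>\<^bsub>C\<^esub> y" "a \<odot>\<^bsub>D\<^esub> x = a \<odot>\<^bsub>C\<^esub> x"
  "counit D = counit C"
  by (simp_all add: D_eq)

lemma D_corep: "is_partial_corep K D H p"
  unfolding D_eq using partial_corep_iff[OF HX_subcoalgebra] HX_PC by simp

lemma D_incl: "is_linear K D C (\<lambda>x. x)"
  unfolding D_eq by (rule subcoalgebra_incl[OF HX_submodule C_module])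

lemma pD_linear: "is_linear K D H p"
  using linear_comp[OF p_linear D_incl] .

lemma D_comult:
  assumes "x \<in> carrier D"
  shows "comult D x \<in> carrier (tens K D D)" "tmap K D D C C (\<lambda>x. x) (\<lambda>x. x) (comult D x) = comult C x"
  using subcoalgebra_comult[OF C_coalgebra HX_subcoalgebra, of x] assms by (simp_all add: D_eq)

lemma D_incl_inj: "inj_on (tmap K D D C C (\<lambda>x. x) (\<lambda>x. x)) (carrier (tens K D D))"
  unfolding D_eq by (rule subcoalgebra_incl_inj[OF HX_submodule C_module])

text \<open>Slices of an element of \<open>D\<close> are the same whether computed in
  \<open>D\<close> or in \<open>C\<close>, so detection is inherited from the cofree
  coalgebra.\<close>

lemma D_detect:
  assumes N: "submodule N K D" and \<epsilon>: "\<And>c. c \<in> N \<Longrightarrow> counit D c = \<zero>"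
    and stab: "\<And>c \<phi>. c \<in> N \<Longrightarrow> functional H \<phi> \<Longrightarrow> rslice D D (\<lambda>x. \<phi> (p x)) (comult D c) \<in> N"
    and c: "c \<in> N"
  shows "c = \<zero>\<^bsub>D\<^esub>"
proof -
  have ND: "x \<in> carrier D" if "x \<in> N" for x using submodule_subset[OF N D_module] that by blast
  have NC: "submodule N K C"
    by (rule submoduleI'[OF C_module])
      (use ND linear_closed[OF D_incl] submodule_zero[OF N] submodule_add[OF N] submodule_smult[OF N] in \<open>auto simp: D_simps\<close>)
  have "c = \<zero>\<^bsub>C\<^esub>"
  proof (rule cofree_detect[OF univ cofree H_module NC _ _ c])
    show "counit C c = \<zero>" if "c \<in> N" for c using \<epsilon>[OF that] by (simp add: D_simps)
    show "rslice C C (\<lambda>x. \<phi> (p x)) (comult C c) \<in> N" if "c \<in> N" "functional H \<phi>" for c \<phi>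
      using rslice_tmap[OF D_module D_module C_module C_module D_incl D_incl functional_comp[OF that(2) p_linear] D_comult(1)[OF ND[OF that(1)]]]
        D_comult(2)[OF ND[OF that(1)]] stab[OF that] by simp
  qed
  then show ?thesis by (simp add: D_simps)
qed

text \<open>The entries of a comatrix span a subcoalgebra, so once they lie in \<open>PC\<close>
  maximality puts them into \<open>D\<close>.\<close>

lemma comatrix_D:
  assumes c: "comatrix C n c" and PC: "\<And>i j. i < n \<Longrightarrow> j < n \<Longrightarrow> c i j \<in> PC"
  shows "comatrix D n c"
proof -
  note cD = comatrixD[OF c]
  have "span_of K C {c i j | i j. i < n \<and> j < n} \<subseteq> PC"
    by (rule span_of_least[OF PC_submodule]) (use PC in auto)
  then have "span_of K C {c i j | i j. i < n \<and> j < n} \<subseteq> HX"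
    by (rule HX_maximal[OF is_subcoalgebra_comatrix[OF C_coalgebra c]])
  then have mem: "c i j \<in> carrier D" if "i < n" "j < n" for i j
    using span_of_incl[of "{c i j | i j. i < n \<and> j < n}" C] that by (auto simp: D_simps)
  show ?thesis
    unfolding comatrix_def
  proof (intro allI impI conjI mem)
    fix i j assume ij: "i < n" "j < n"
    show "counit D (c i j) = (if i = j then \<one> else \<zero>)" using cD(3)[OF ij] by (simp add: D_simps)
    show "comult D (c i j) = (\<Oplus>\<^bsub>tens K D D\<^esub>k\<in>{..<n}. pure K D D (c i k) (c k j))"
    proof (rule inj_onD[OF D_incl_inj])
      have "tmap K D D C C (\<lambda>x. x) (\<lambda>x. x) (\<Oplus>\<^bsub>tens K D D\<^esub>k\<in>{..<n}. pure K D D (c i k) (c k j)) =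
          (\<Oplus>\<^bsub>tens K C C\<^esub>k\<in>{..<n}. tmap K D D C C (\<lambda>x. x) (\<lambda>x. x) (pure K D D (c i k) (c k j)))"
        by (rule linear_finsum[OF tmap_linear]) (use D_incl mem ij in auto)
      also have "\<dots> = (\<Oplus>\<^bsub>tens K C C\<^esub>k\<in>{..<n}. pure K C C (c i k) (c k j))"
        by (rule module_finsum_cong) (use D_incl mem cD(1) ij in auto)
      finally show "tmap K D D C C (\<lambda>x. x) (\<lambda>x. x) (comult D (c i j)) =
          tmap K D D C C (\<lambda>x. x) (\<lambda>x. x) (\<Oplus>\<^bsub>tens K D D\<^esub>k\<in>{..<n}. pure K D D (c i k) (c k j))"
        using D_comult(2)[OF mem[OF ij]] cD(2)[OF ij] by simp
      show "(\<Oplus>\<^bsub>tens K D D\<^esub>k\<in>{..<n}. pure K D D (c i k) (c k j)) \<in> carrier (tens K D D)"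
        by (rule module_finsum_closed) (use mem ij in auto)
    qed (use D_comult(1)[OF mem[OF ij]] in simp)
  qed
qed


subsection \<open>Partial comodules from comodules\<close>

text \<open>Coassociativity pushed along two linear maps to \<open>H\<close>. With it the
  expressions in the partial comodule axioms become \<open>I \<otimes> f\<close> applied to
  \<open>\<rho> m\<close>, for suitable maps \<open>f\<close> on \<open>D\<close>.\<close>

lemma coaction_map_map:
  assumes M: "coaction D M \<rho>" and \<omega>: "is_linear K D H \<omega>1" "is_linear K D H \<omega>2" and m: "m \<in> carrier M"
  shows "tassoc K M H H (tmap K M D (tens K M H) H (\<lambda>x. tmap K M D M H (\<lambda>x. x) \<omega>1 (\<rho> x)) \<omega>2 (\<rho> m)) =
    tmap K M D M (tens K H H) (\<lambda>x. x) (\<lambda>d. tmap K D D H H \<omega>1 \<omega>2 (comult D d)) (\<rho> m)"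
proof -
  note Mp = coaction_props[OF M] and Dp = coalgebra_props[OF D_coalgebra]
  note [simp] = Mp(1) Mp(2) \<omega>
  have r: "\<rho> m \<in> carrier (tens K M D)" by (rule Mp(5)[OF m])
  have "tmap K M D (tens K M H) H (\<lambda>x. tmap K M D M H (\<lambda>x. x) \<omega>1 (\<rho> x)) \<omega>2 (\<rho> m) =
      tmap K (tens K M D) D (tens K M H) H (tmap K M D M H (\<lambda>x. x) \<omega>1) \<omega>2 (tmap K M D (tens K M D) D \<rho> (\<lambda>d. d) (\<rho> m))"
    by (rule tmap_comp[symmetric]) (use r in auto)
  then have "tassoc K M H H (tmap K M D (tens K M H) H (\<lambda>x. tmap K M D M H (\<lambda>x. x) \<omega>1 (\<rho> x)) \<omega>2 (\<rho> m)) =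
      tassoc K M H H (tmap K (tens K M D) D (tens K M H) H (tmap K M D M H (\<lambda>x. x) \<omega>1) \<omega>2
        (tmap K M D (tens K M D) D \<rho> (\<lambda>d. d) (\<rho> m)))" by simp
  also have "\<dots> = tmap K M (tens K D D) M (tens K H H) (\<lambda>x. x) (tmap K D D H H \<omega>1 \<omega>2)
      (tassoc K M D D (tmap K M D (tens K M D) D \<rho> (\<lambda>d. d) (\<rho> m)))"
    by (rule tassoc_nat) (use r in auto)
  also have "\<dots> = tmap K M (tens K D D) M (tens K H H) (\<lambda>x. x) (tmap K D D H H \<omega>1 \<omega>2)
      (tmap K M D M (tens K D D) (\<lambda>x. x) (comult D) (\<rho> m))"
    using Mp(3)[OF m] by simp
  also have "\<dots> = tmap K M D M (tens K H H) (\<lambda>x. x) (\<lambda>d. tmap K D D H H \<omega>1 \<omega>2 (comult D d)) (\<rho> m)"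
    by (rule tmap_comp) (use r Dp in auto)
  finally show ?thesis .
qed

text \<open>The coaction part of \<open>Gamma\<close>, restricted to the carrier because the objects
  of the category carry extensional coactions.\<close>

definition ind :: "('k, 'm, 'y) module_scheme \<Rightarrow> ('m \<Rightarrow> ('m, 'c) tensor) \<Rightarrow> 'm \<Rightarrow> ('m, 'h) tensor"
  where "ind M \<rho> = (\<lambda>m\<in>carrier M. tmap K M D M H (\<lambda>m. m) p (\<rho> m))"

lemma ind_linear:
  assumes "coaction D M \<rho>"
  shows "is_linear K M (tens K M H) (ind M \<rho>)" "ind M \<rho> \<in> lin K M (tens K M H)"
proof -
  note Mp = coaction_props[OF assms]
  have "is_linear K M (tens K M H) (\<lambda>m. tmap K M D M H (\<lambda>m. m) p (\<rho> m))"
    by (rule linear_comp[OF tmap_linear Mp(2)]) (use Mp pD_linear in auto)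
  then show "ind M \<rho> \<in> lin K M (tens K M H)" unfolding ind_def by (rule linear_restrict[OF _ Mp(1)])
  then show "is_linear K M (tens K M H) (ind M \<rho>)" by (simp add: lin_def)
qed

text \<open>For the last two axioms both sides have the form \<open>I \<otimes> f\<close> applied to
  \<open>\<rho> m\<close>, and the two maps \<open>f\<close> agree by the corresponding identity for
  \<open>p\<close>; the first is counitality.\<close>

lemma partial_comodule_ind:
  fixes M :: "('k, 'm) module"
  assumes M: "coaction D M \<rho>"
  shows "is_partial_comodule K H (M, ind M \<rho>)"
proof -
  note Mp = coaction_props[OF M] and Dp = coalgebra_props[OF D_coalgebra]
  note [simp] = Mp(1) Mp(2) pD_linear
  let ?I = "\<lambda>x. x"
  let ?r = "ind M \<rho>"
  define pp' where "pp' = (\<lambda>d. tmap K D D H H p p (comult D d))"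
  define q where "q = (\<lambda>d. mult_S K H (pp' d))"
  have pp'L: "is_linear K D (tens K H H) pp'" unfolding pp'_def by (rule linear_comp[OF tmap_linear Dp(2)]) auto
  have qL: "is_linear K D H q" unfolding q_def by (rule linear_comp[OF mult_S_linear pp'L])
  note [simp] = pp'L qL
  have r: "\<rho> m \<in> carrier (tens K M D)" if "m \<in> carrier M" for m by (rule Mp(5)[OF that])
  have rm: "?r m = tmap K M D M H ?I p (\<rho> m)" if "m \<in> carrier M" for m using that by (simp add: ind_def)
  have rL: "is_linear K M (tens K M H) ?r" by (rule ind_linear[OF M])
  \<comment> \<open>Turns an outer \<open>?r\<close> on a tensor of the form
    \<open>(I \<otimes> \<omega>) (\<rho> m)\<close> into the left hand side of
    \<open>coaction_map_map\<close>.\<close>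
  have rt: "tmap K M H (tens K M H) H ?r ?I (tmap K M D M H ?I \<omega> (\<rho> m)) =
      tmap K M D (tens K M H) H (\<lambda>x. tmap K M D M H ?I p (\<rho> x)) \<omega> (\<rho> m)"
    if m: "m \<in> carrier M" and \<omega>: "is_linear K D H \<omega>" for m \<omega>
  proof -
    have "tmap K M H (tens K M H) H ?r ?I (tmap K M D M H ?I \<omega> (\<rho> m)) =
      tmap K M D (tens K M H) H (\<lambda>x. ?r x) (\<lambda>x. \<omega> x) (\<rho> m)"
      by (rule tmap_comp) (use r[OF m] rL \<omega> in auto)
    also have "tmap K M D (tens K M H) H (\<lambda>x. ?r x) (\<lambda>x. \<omega> x) =
        tmap K M D (tens K M H) H (\<lambda>x. tmap K M D M H ?I p (\<rho> x)) \<omega>"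
      by (rule tmap_cong) (use rm in auto)
    finally show ?thesis .
  qed
  have c2: "coact2 K H (M, ?r) m = tmap K M D M (tens K H H) ?I pp' (\<rho> m)" if m: "m \<in> carrier M" for m
    unfolding coact2_def prod.case rm[OF m] rt[OF m pD_linear] pp'_def
    by (rule coaction_map_map[OF M _ _ m]) auto
  have cS: "coact_S K H (M, ?r) m = tmap K M D M H ?I q (\<rho> m)" if m: "m \<in> carrier M" for m
    unfolding coact_S_def prod.case c2[OF m] q_def
    by (rule tmap_comp) (use r[OF m] in auto)
  have cSL: "is_linear K M (tens K M H) (coact_S K H (M, ?r))"
  proof (rule linear_cong[OF _ Mp(1) cS])
    show "is_linear K M (tens K M H) (\<lambda>m. tmap K M D M H ?I q (\<rho> m))"
      by (rule linear_comp[OF tmap_linear Mp(2)]) auto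
  qed
  have PC: "counit H (p d) = counit D d" "split_left_S K H (pp' d) = tmap K D D H H p q (comult D d)"
    "split_right_S K H (pp' d) = tmap K D D H H q p (comult D d)" if "d \<in> carrier D" for d
    using D_corep that unfolding is_partial_corep_def pp'_def q_def by blast+
  have 1: "rslice M H (counit H) (?r m) = m" if m: "m \<in> carrier M" for m
  proof -
    have "rslice M H (counit H) (?r m) = rslice M D (\<lambda>d. counit H (p d)) (\<rho> m)"
      unfolding rm[OF m] by (rule rslice_tmap) (use r[OF m] H_counit in auto)
    also have "rslice M D (\<lambda>d. counit H (p d)) = rslice M D (counit D)"
      unfolding rslice_def by (rule tlift_cong) (use PC(1) in simp)
    finally show ?thesis using Mp(4)[OF m] by simp
  qed
  have 2: "tmap K M (tens K H H) M (tens K H H) ?I (split_left_S K H) (coact2 K H (M, ?r) m) =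
       tassoc K M H H (tmap K M H (tens K M H) H ?r (\<lambda>h. h) (coact_S K H (M, ?r) m))" if m: "m \<in> carrier M" for m
  proof -
    have "tmap K M (tens K H H) M (tens K H H) ?I (split_left_S K H) (coact2 K H (M, ?r) m) =
        tmap K M D M (tens K H H) ?I (\<lambda>d. split_left_S K H (pp' d)) (\<rho> m)"
      unfolding c2[OF m] by (rule tmap_comp) (use r[OF m] in auto)
    also have "tmap K M D M (tens K H H) ?I (\<lambda>d. split_left_S K H (pp' d)) =
        tmap K M D M (tens K H H) ?I (\<lambda>d. tmap K D D H H p q (comult D d))"
      by (rule tmap_cong) (use PC(2) in auto)
    also have "tmap K M D M (tens K H H) ?I (\<lambda>d. tmap K D D H H p q (comult D d)) (\<rho> m) =
        tassoc K M H H (tmap K M D (tens K M H) H (\<lambda>x. tmap K M D M H ?I p (\<rho> x)) q (\<rho> m))"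
      by (rule coaction_map_map[OF M _ _ m, symmetric]) auto
    also have "\<dots> = tassoc K M H H (tmap K M H (tens K M H) H ?r (\<lambda>h. h) (coact_S K H (M, ?r) m))"
      unfolding cS[OF m] rt[OF m qL] ..
    finally show ?thesis .
  qed
  have 3: "tmap K M (tens K H H) M (tens K H H) ?I (split_right_S K H) (coact2 K H (M, ?r) m) =
       tassoc K M H H (tmap K M H (tens K M H) H (coact_S K H (M, ?r)) (\<lambda>h. h) (?r m))" if m: "m \<in> carrier M" for m
  proof -
    have "tmap K M (tens K H H) M (tens K H H) ?I (split_right_S K H) (coact2 K H (M, ?r) m) =
        tmap K M D M (tens K H H) ?I (\<lambda>d. split_right_S K H (pp' d)) (\<rho> m)"
      unfolding c2[OF m] by (rule tmap_comp) (use r[OF m] in auto)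
    also have "tmap K M D M (tens K H H) ?I (\<lambda>d. split_right_S K H (pp' d)) =
        tmap K M D M (tens K H H) ?I (\<lambda>d. tmap K D D H H q p (comult D d))"
      by (rule tmap_cong) (use PC(3) in auto)
    also have "tmap K M D M (tens K H H) ?I (\<lambda>d. tmap K D D H H q p (comult D d)) (\<rho> m) =
        tassoc K M H H (tmap K M D (tens K M H) H (\<lambda>x. tmap K M D M H ?I q (\<rho> x)) p (\<rho> m))"
      by (rule coaction_map_map[OF M _ _ m, symmetric]) auto
    also have "tmap K M D (tens K M H) H (\<lambda>x. tmap K M D M H ?I q (\<rho> x)) p =
        tmap K M D (tens K M H) H (coact_S K H (M, ?r)) p"
      by (rule tmap_cong) (use cS in auto)
    also have "tmap K M D (tens K M H) H (coact_S K H (M, ?r)) p (\<rho> m) =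
        tmap K M H (tens K M H) H (coact_S K H (M, ?r)) (\<lambda>h. h) (?r m)"
      unfolding rm[OF m] by (rule tmap_comp[symmetric]) (use r[OF m] cSL in auto)
    finally show ?thesis .
  qed
  show ?thesis
    unfolding is_partial_comodule_def prod.case
    using Mp(1) ind_linear(2)[OF M] 1 2 3 unfolding rslice_def by blast
qed

end

subsection \<open>Lifting partial coactions\<close>

context base_field
begin

section \<open>Coefficient matrices over a frame\<close>

lemma module_smult_finsum:
  assumes "module K V" "a \<in> carrier K" "finite I" "\<And>i. i \<in> I \<Longrightarrow> f i \<in> carrier V"
  shows "a \<odot>\<^bsub>V\<^esub> (\<Oplus>\<^bsub>V\<^esub>i\<in>I. f i) = (\<Oplus>\<^bsub>V\<^esub>i\<in>I. a \<odot>\<^bsub>V\<^esub> f i)"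
  using assms by (intro module.finsum_smult_ldistr) auto

text \<open>Composition of coactions is a matrix product with tensors in place of products of
  entries. The matrix of \<open>r\<close> and the column \<open>s\<close> are independent, so either
  can be the one belonging to \<open>coact_S\<close>.\<close>

lemma matrix_act:
  fixes n :: nat
  assumes mods: "module K M" "module K A" "module K B" and r: "is_linear K M (tens K M A) r"
    and e: "\<And>i. i < n \<Longrightarrow> e i \<in> carrier M" and h: "\<And>i j. i < n \<Longrightarrow> j < n \<Longrightarrow> h i j \<in> carrier A"
    and re: "\<And>j. j < n \<Longrightarrow> r (e j) = (\<Oplus>\<^bsub>tens K M A\<^esub>i\<in>{..<n}. pure K M A (e i) (h i j))"
    and s: "\<And>k. k < n \<Longrightarrow> s k \<in> carrier B"
  shows "tassoc K M A B (tmap K M B (tens K M A) B r (\<lambda>b. b) (\<Oplus>\<^bsub>tens K M B\<^esub>k\<in>{..<n}. pure K M B (e k) (s k))) =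
    (\<Oplus>\<^bsub>tens K M (tens K A B)\<^esub>i\<in>{..<n}. pure K M (tens K A B) (e i) (\<Oplus>\<^bsub>tens K A B\<^esub>k\<in>{..<n}. pure K A B (h i k) (s k)))"
proof -
  note [simp] = mods
  let ?W = "tens K M (tens K A B)" and ?F = "tmap K M B (tens K M A) B r (\<lambda>d. d)"
  let ?t = "\<lambda>i k. pure K M (tens K A B) (e i) (pure K A B (h i k) (s k))"
  have t: "?t i k \<in> carrier ?W" if "i < n" "k < n" for i k using that e h s by simp
  have L: "is_linear K (tens K M B) ?W (\<lambda>t. tassoc K M A B (?F t))"
    by (rule linear_comp[OF tassoc_linear]) (use r in auto)
  have "tassoc K M A B (?F (\<Oplus>\<^bsub>tens K M B\<^esub>k\<in>{..<n}. pure K M B (e k) (s k))) =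
      (\<Oplus>\<^bsub>?W\<^esub>k\<in>{..<n}. tassoc K M A B (?F (pure K M B (e k) (s k))))"
    by (rule linear_finsum[OF L]) (use e s in auto)
  also have "\<dots> = (\<Oplus>\<^bsub>?W\<^esub>k\<in>{..<n}. \<Oplus>\<^bsub>?W\<^esub>i\<in>{..<n}. ?t i k)"
  proof (rule module_finsum_cong)
    fix k assume "k \<in> {..<n}"
    then have k: "k < n" by simp
    have L': "is_linear K (tens K M A) ?W (\<lambda>u. tassoc K M A B (pure K (tens K M A) B u (s k)))"
      by (rule linear_comp[OF tassoc_linear linear_pure_left]) (use s k in auto)
    have "tassoc K M A B (?F (pure K M B (e k) (s k))) = tassoc K M A B (pure K (tens K M A) B (r (e k)) (s k))"
      using r e s k by simp
    also have "\<dots> = (\<Oplus>\<^bsub>?W\<^esub>i\<in>{..<n}. tassoc K M A B (pure K (tens K M A) B (pure K M A (e i) (h i k)) (s k)))"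
      unfolding re[OF k] by (rule linear_finsum[OF L']) (use e h k in auto)
    also have "\<dots> = (\<Oplus>\<^bsub>?W\<^esub>i\<in>{..<n}. ?t i k)"
      by (rule module_finsum_cong) (use e h s k in auto)
    finally show "tassoc K M A B (?F (pure K M B (e k) (s k))) = (\<Oplus>\<^bsub>?W\<^esub>i\<in>{..<n}. ?t i k)" .
    show "(\<Oplus>\<^bsub>?W\<^esub>i\<in>{..<n}. ?t i k) \<in> carrier ?W"
      by (rule module_finsum_closed) (use t k in auto)
  qed auto
  also have "\<dots> = (\<Oplus>\<^bsub>?W\<^esub>i\<in>{..<n}. \<Oplus>\<^bsub>?W\<^esub>k\<in>{..<n}. ?t i k)"
    by (rule finsum_swap) (use t in auto)
  also have "\<dots> = (\<Oplus>\<^bsub>?W\<^esub>i\<in>{..<n}. pure K M (tens K A B) (e i) (\<Oplus>\<^bsub>tens K A B\<^esub>k\<in>{..<n}. pure K A B (h i k) (s k)))"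
  proof (rule module_finsum_cong)
    fix i assume "i \<in> {..<n}"
    then have i: "i < n" by simp
    show "(\<Oplus>\<^bsub>?W\<^esub>k\<in>{..<n}. ?t i k) = pure K M (tens K A B) (e i) (\<Oplus>\<^bsub>tens K A B\<^esub>k\<in>{..<n}. pure K A B (h i k) (s k))"
      by (rule linear_finsum[OF linear_pure_right, symmetric]) (use e h s i in auto)
    show "pure K M (tens K A B) (e i) (\<Oplus>\<^bsub>tens K A B\<^esub>k\<in>{..<n}. pure K A B (h i k) (s k)) \<in> carrier ?W"
      by (intro pure_closed module_finsum_closed e) (use e h s i in auto)
  qed auto
  finally show ?thesis .
qed

lemma frame_coeff:
  assumes mods: "module K M" "module K A" and fr: "frame M n e \<psi>" and s: "\<And>k. k < n \<Longrightarrow> s k \<in> carrier A" and i: "i < n"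
  shows "lslice M A (\<psi> i) (\<Oplus>\<^bsub>tens K M A\<^esub>k\<in>{..<n}. pure K M A (e k) (s k)) = s i"
proof -
  note p = frame_props[OF fr]
  have "lslice M A (\<psi> i) (\<Oplus>\<^bsub>tens K M A\<^esub>k\<in>{..<n}. pure K M A (e k) (s k)) =
      (\<Oplus>\<^bsub>A\<^esub>k\<in>{..<n}. lslice M A (\<psi> i) (pure K M A (e k) (s k)))"
    by (rule linear_finsum[OF lslice_linear]) (use mods p s i in auto)
  also have "\<dots> = (\<Oplus>\<^bsub>A\<^esub>k\<in>{..<n}. \<psi> i (e k) \<odot>\<^bsub>A\<^esub> s k)"
    by (rule module_finsum_cong)
      (use mods p s i functional_closed[OF p(2)[OF i] p(1)] in auto)
  also have "\<dots> = s i"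
    by (rule finsum_delta) (use mods p s i in auto)
  finally show ?thesis .
qed

lemma tmap_right_sum:
  assumes mods: "module K M" "module K A" "module K B" and g: "is_linear K A B g"
    and e: "\<And>i. i < n \<Longrightarrow> e i \<in> carrier M" and s: "\<And>k. k < n \<Longrightarrow> s k \<in> carrier A"
  shows "tmap K M A M B (\<lambda>x. x) g (\<Oplus>\<^bsub>tens K M A\<^esub>k\<in>{..<(n::nat)}. pure K M A (e k) (s k)) =
    (\<Oplus>\<^bsub>tens K M B\<^esub>k\<in>{..<n}. pure K M B (e k) (g (s k)))"
proof -
  have "tmap K M A M B (\<lambda>x. x) g (\<Oplus>\<^bsub>tens K M A\<^esub>k\<in>{..<n}. pure K M A (e k) (s k)) =
      (\<Oplus>\<^bsub>tens K M B\<^esub>k\<in>{..<n}. tmap K M A M B (\<lambda>x. x) g (pure K M A (e k) (s k)))"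
    by (rule linear_finsum[OF tmap_linear]) (use mods g e s in auto)
  also have "\<dots> = (\<Oplus>\<^bsub>tens K M B\<^esub>k\<in>{..<n}. pure K M B (e k) (g (s k)))"
    by (rule module_finsum_cong) (use mods g e s linear_closed[OF g] in auto)
  finally show ?thesis .
qed

end

context hopf_cofree
begin

lemma partial_comoduleD:
  assumes "is_partial_comodule K H (M, r)"
  shows "module K M" "is_linear K M (tens K M H) r" "r \<in> extensional (carrier M)"
    "\<And>m. m \<in> carrier M \<Longrightarrow> rslice M H (counit H) (r m) = m"
    "\<And>m. m \<in> carrier M \<Longrightarrow>
       tmap K M (tens K H H) M (tens K H H) (\<lambda>m. m) (split_left_S K H) (coact2 K H (M, r) m) =
       tassoc K M H H (tmap K M H (tens K M H) H r (\<lambda>h. h) (coact_S K H (M, r) m))"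
    "\<And>m. m \<in> carrier M \<Longrightarrow>
       tmap K M (tens K H H) M (tens K H H) (\<lambda>m. m) (split_right_S K H) (coact2 K H (M, r) m) =
       tassoc K M H H (tmap K M H (tens K M H) H (coact_S K H (M, r)) (\<lambda>h. h) (r m))"
  using assms unfolding is_partial_comodule_def rslice_def lin_def by auto

text \<open>The coefficients of \<open>e i\<close> in the partial comodule axioms at
  \<open>e j\<close> are the equations that define \<open>PC\<close>, at the entry
  \<open>c i j\<close> of the lifted comatrix.\<close>

lemma lift_coframe:
  assumes M: "is_partial_comodule K H (M, r)" and fr: "coframe H M r n e \<psi>"
  obtains c where "comatrix D n c" "\<forall>i<n. \<forall>j<n. p (c i j) = lslice M H (\<psi> i) (r (e j))"
proof -
  note Mp = partial_comoduleD[OF M]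
  note [simp] = Mp(1) Mp(2)
  have frM: "frame M n e \<psi>" using fr by (simp add: coframe_def)
  note q = frame_props[OF frM]
  define h where "h = (\<lambda>i j. lslice M H (\<psi> i) (r (e j)))"
  have rc: "r (e j) \<in> carrier (tens K M H)" if "j < n" for j using linear_closed[OF Mp(2) q(1)[OF that]] .
  have h: "h i j \<in> carrier H" if "i < n" "j < n" for i j using that q rc by (simp add: h_def)
  have re: "r (e j) = (\<Oplus>\<^bsub>tens K M H\<^esub>i\<in>{..<n}. pure K M H (e i) (h i j))" if "j < n" for j
    using fr that unfolding coframe_def h_def by blast
  \<comment> \<open>With the full relation an arbitrary matrix over \<open>H\<close> lifts to
    \<open>C\<close>; the partial comodule axioms enter when its entries are shown to lie in
    \<open>PC\<close>.\<close>
  have "\<exists>c. comatrix C n c \<and> (\<forall>i<n. \<forall>j<n. p (c i j) = h i j) \<and> (\<forall>i<n. \<forall>j<n. \<not> True \<longrightarrow> c i j = \<zero>\<^bsub>C\<^esub>)"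
    by (rule comatrix_lift[where P = "\<lambda>_ _. True", OF univ cofree H_module]) (use h in auto)
  then obtain c where c: "comatrix C n c" "\<And>i j. i < n \<Longrightarrow> j < n \<Longrightarrow> p (c i j) = h i j" by blast
  note cD = comatrixD[OF c(1)]
  have tc: "tmap K C C H H f g (comult C (c i j)) = (\<Oplus>\<^bsub>tens K H H\<^esub>k\<in>{..<n}. pure K H H (f (c i k)) (g (c k j)))"
    if ij: "i < n" "j < n" and fg: "is_linear K C H f" "is_linear K C H g" for f g i j
  proof -
    have "tmap K C C H H f g (comult C (c i j)) = (\<Oplus>\<^bsub>tens K H H\<^esub>k\<in>{..<n}. tmap K C C H H f g (pure K C C (c i k) (c k j)))"
      unfolding cD(2)[OF ij] by (rule linear_finsum[OF tmap_linear]) (use cD(1) ij fg in auto)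
    also have "\<dots> = (\<Oplus>\<^bsub>tens K H H\<^esub>k\<in>{..<n}. pure K H H (f (c i k)) (g (c k j)))"
      by (rule module_finsum_cong) (use cD(1) ij fg linear_closed[OF fg(1)] linear_closed[OF fg(2)] in auto)
    finally show ?thesis .
  qed
  have ppc: "pp (c i j) = (\<Oplus>\<^bsub>tens K H H\<^esub>k\<in>{..<n}. pure K H H (h i k) (h k j))" if ij: "i < n" "j < n" for i j
  proof -
    have "pp (c i j) = (\<Oplus>\<^bsub>tens K H H\<^esub>k\<in>{..<n}. pure K H H (p (c i k)) (p (c k j)))"
      unfolding pp_def by (rule tc[OF ij p_linear p_linear])
    also have "\<dots> = (\<Oplus>\<^bsub>tens K H H\<^esub>k\<in>{..<n}. pure K H H (h i k) (h k j))"
      by (rule module_finsum_cong) (use c(2) h ij in auto)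
    finally show ?thesis .
  qed
  have ppC: "pp (c i j) \<in> carrier (tens K H H)" "pS (c i j) \<in> carrier H" if "i < n" "j < n" for i j
    using linear_closed[OF pp_linear cD(1)[OF that]] linear_closed[OF pS_linear cD(1)[OF that]] .
  have c2: "coact2 K H (M, r) (e j) = (\<Oplus>\<^bsub>tens K M (tens K H H)\<^esub>i\<in>{..<n}. pure K M (tens K H H) (e i) (pp (c i j)))"
    if j: "j < n" for j
  proof -
    have "coact2 K H (M, r) (e j) = (\<Oplus>\<^bsub>tens K M (tens K H H)\<^esub>i\<in>{..<n}. pure K M (tens K H H) (e i)
        (\<Oplus>\<^bsub>tens K H H\<^esub>k\<in>{..<n}. pure K H H (h i k) (h k j)))"
      unfolding coact2_def prod.case re[OF j] by (rule matrix_act[where e = e and h = h and n = n, OF _ _ _ _ q(1) h re]) (use h j in auto)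
    also have "\<dots> = (\<Oplus>\<^bsub>tens K M (tens K H H)\<^esub>i\<in>{..<n}. pure K M (tens K H H) (e i) (pp (c i j)))"
      by (rule module_finsum_cong) (use ppc ppC q j in auto)
    finally show ?thesis .
  qed
  have cS: "coact_S K H (M, r) (e j) = (\<Oplus>\<^bsub>tens K M H\<^esub>i\<in>{..<n}. pure K M H (e i) (pS (c i j)))" if j: "j < n" for j
    unfolding coact_S_def prod.case c2[OF j] pS_def
    by (rule tmap_right_sum) (use ppC q j in auto)
  have cSL: "is_linear K M (tens K M H) (coact_S K H (M, r))"
    unfolding coact_S_def coact2_def prod.case
    by (intro linear_comp[OF tmap_linear] linear_comp[OF tassoc_linear] linear_comp[OF tmap_linear Mp(2)]) auto
  have PC1: "counit H (p (c i j)) = counit C (c i j)" if ij: "i < n" "j < n" for i j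
    using slice_swap[OF Mp(1) H_module q(2)[OF ij(1)] H_counit rc[OF ij(2)]] Mp(4)[OF q(1)[OF ij(2)]] q(3)[OF ij]
      c(2)[OF ij] cD(3)[OF ij] by (simp add: h_def)
  have PC2: "split_left_S K H (pp (c i j)) = tmap K C C H H p pS (comult C (c i j))" if ij: "i < n" "j < n" for i j
  proof -
    have "split_left_S K H (pp (c i j)) =
        lslice M (tens K H H) (\<psi> i) (\<Oplus>\<^bsub>tens K M (tens K H H)\<^esub>i\<in>{..<n}. pure K M (tens K H H) (e i) (split_left_S K H (pp (c i j))))"
      by (rule frame_coeff[OF _ _ frM _ ij(1), symmetric]) (use ppC ij linear_closed[OF split_left_S_linear] in auto)
    also have "(\<Oplus>\<^bsub>tens K M (tens K H H)\<^esub>i\<in>{..<n}. pure K M (tens K H H) (e i) (split_left_S K H (pp (c i j)))) =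
        tmap K M (tens K H H) M (tens K H H) (\<lambda>m. m) (split_left_S K H) (coact2 K H (M, r) (e j))"
      unfolding c2[OF ij(2)] by (rule tmap_right_sum[symmetric]) (use ppC q ij in auto)
    also have "\<dots> = tassoc K M H H (tmap K M H (tens K M H) H r (\<lambda>h. h) (coact_S K H (M, r) (e j)))"
      by (rule Mp(5)[OF q(1)[OF ij(2)]])
    also have "\<dots> = (\<Oplus>\<^bsub>tens K M (tens K H H)\<^esub>i\<in>{..<n}. pure K M (tens K H H) (e i)
        (\<Oplus>\<^bsub>tens K H H\<^esub>k\<in>{..<n}. pure K H H (h i k) (pS (c k j))))"
      unfolding cS[OF ij(2)] by (rule matrix_act[where e = e and h = h and n = n, OF _ _ _ _ q(1) h re]) (use ppC ij in auto)
    also have "lslice M (tens K H H) (\<psi> i) \<dots> = (\<Oplus>\<^bsub>tens K H H\<^esub>k\<in>{..<n}. pure K H H (h i k) (pS (c k j)))"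
      by (rule frame_coeff[OF _ _ frM _ ij(1)]) (use ppC h ij in \<open>auto intro!: module_finsum_closed\<close>)
    also have "\<dots> = (\<Oplus>\<^bsub>tens K H H\<^esub>k\<in>{..<n}. pure K H H (p (c i k)) (pS (c k j)))"
      by (rule module_finsum_cong) (use c(2) h ppC ij in auto)
    also have "\<dots> = tmap K C C H H p pS (comult C (c i j))"
      by (rule tc[OF ij p_linear pS_linear, symmetric])
    finally show ?thesis .
  qed
  have PC3: "split_right_S K H (pp (c i j)) = tmap K C C H H pS p (comult C (c i j))" if ij: "i < n" "j < n" for i j
  proof -
    have "split_right_S K H (pp (c i j)) =
        lslice M (tens K H H) (\<psi> i) (\<Oplus>\<^bsub>tens K M (tens K H H)\<^esub>i\<in>{..<n}. pure K M (tens K H H) (e i) (split_right_S K H (pp (c i j))))"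
      by (rule frame_coeff[OF _ _ frM _ ij(1), symmetric]) (use ppC ij linear_closed[OF split_right_S_linear] in auto)
    also have "(\<Oplus>\<^bsub>tens K M (tens K H H)\<^esub>i\<in>{..<n}. pure K M (tens K H H) (e i) (split_right_S K H (pp (c i j)))) =
        tmap K M (tens K H H) M (tens K H H) (\<lambda>m. m) (split_right_S K H) (coact2 K H (M, r) (e j))"
      unfolding c2[OF ij(2)] by (rule tmap_right_sum[symmetric]) (use ppC q ij in auto)
    also have "\<dots> = tassoc K M H H (tmap K M H (tens K M H) H (coact_S K H (M, r)) (\<lambda>h. h) (r (e j)))"
      by (rule Mp(6)[OF q(1)[OF ij(2)]])
    also have "\<dots> = (\<Oplus>\<^bsub>tens K M (tens K H H)\<^esub>i\<in>{..<n}. pure K M (tens K H H) (e i)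
        (\<Oplus>\<^bsub>tens K H H\<^esub>k\<in>{..<n}. pure K H H (pS (c i k)) (h k j)))"
      unfolding re[OF ij(2)] by (rule matrix_act[where e = e and h = "\<lambda>i j. pS (c i j)" and n = n, OF _ _ _ cSL q(1) ppC(2) cS]) (use h ij in auto)
    also have "lslice M (tens K H H) (\<psi> i) \<dots> = (\<Oplus>\<^bsub>tens K H H\<^esub>k\<in>{..<n}. pure K H H (pS (c i k)) (h k j))"
      by (rule frame_coeff[OF _ _ frM _ ij(1)]) (use ppC h ij in \<open>auto intro!: module_finsum_closed\<close>)
    also have "\<dots> = (\<Oplus>\<^bsub>tens K H H\<^esub>k\<in>{..<n}. pure K H H (pS (c i k)) (p (c k j)))"
      by (rule module_finsum_cong) (use c(2) h ppC ij in auto)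
    also have "\<dots> = tmap K C C H H pS p (comult C (c i j))"
      by (rule tc[OF ij pS_linear p_linear, symmetric])
    finally show ?thesis .
  qed
  have "comatrix D n c"
    by (rule comatrix_D[OF c(1)]) (use PC1 PC2 PC3 cD(1) in \<open>auto simp: PC_def\<close>)
  then show thesis using that c(2) by (simp add: h_def)
qed

text \<open>Iterated slices, along words of functionals on \<open>H\<close>. Since \<open>p\<close> cogenerates, an element of
  \<open>M \<otimes> H\<^sup>p\<^sup>a\<^sup>r\<close> is determined by the values of the counit on its iterated slices.\<close>

fun word :: "('a \<Rightarrow> ('a, 'h) tensor) \<Rightarrow> ('k, 'a, 'y) module_scheme \<Rightarrow> ('h \<Rightarrow> 'k) list \<Rightarrow> 'a \<Rightarrow> 'a"
  where "word r M [] m = m"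
  | "word r M (\<phi> # \<phi>s) m = word r M \<phi>s (rslice M H \<phi> (r m))"

fun cword :: "('h \<Rightarrow> 'k) list \<Rightarrow> 'c \<Rightarrow> 'c"
  where "cword [] d = d"
  | "cword (\<phi> # \<phi>s) d = cword \<phi>s (rslice D D (\<lambda>x. \<phi> (p x)) (comult D d))"

abbreviation functionals :: "('h \<Rightarrow> 'k) list set"
  where "functionals \<equiv> {\<phi>s. \<forall>\<phi>\<in>set \<phi>s. functional H \<phi>}"

text \<open>Prescribes the value at \<open>m\<close> of a \<open>D\<close>-coaction inducing
  \<open>r\<close> in terms of \<open>r\<close> alone. The relation is linear in the pair
  \<open>(m, t)\<close>, so values can be assembled from generators.\<close>

definition lifts :: "('a \<Rightarrow> ('a, 'h) tensor) \<Rightarrow> ('k, 'a, 'y) module_scheme \<Rightarrow> 'a \<Rightarrow> ('a, 'c) tensor \<Rightarrow> bool"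
  where "lifts r M m t \<longleftrightarrow> m \<in> carrier M \<and> t \<in> carrier (tens K M D) \<and>
    (\<forall>\<phi>s\<in>functionals. rslice M D (\<lambda>d. counit D (cword \<phi>s d)) t = word r M \<phi>s m)"

lemma p_functional: "functional H \<phi> \<Longrightarrow> functional D (\<lambda>x. \<phi> (p x))"
  by (rule functional_comp[OF _ pD_linear])

lemma cword_linear: "\<phi>s \<in> functionals \<Longrightarrow> is_linear K D D (cword \<phi>s)"
proof (induction \<phi>s)
  case Nil
  have "cword [] = (\<lambda>d. d)" by (rule ext) simp
  then show ?case by simp
next
  case (Cons \<phi> \<phi>s)
  have eq: "cword (\<phi> # \<phi>s) = (\<lambda>d. cword \<phi>s (rslice D D (\<lambda>x. \<phi> (p x)) (comult D d)))" by (rule ext) simp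
  from Cons have "is_linear K D D (\<lambda>d. cword \<phi>s (rslice D D (\<lambda>x. \<phi> (p x)) (comult D d)))"
    by (intro linear_comp[OF _ coslice_linear[OF D_coalgebra p_functional]]) auto
  then show ?case unfolding eq .
qed

lemma cword_functional: "\<phi>s \<in> functionals \<Longrightarrow> functional D (\<lambda>d. counit D (cword \<phi>s d))"
  by (rule functional_comp[OF counit_functional[OF D_coalgebra] cword_linear])

lemma word_linear:
  assumes "module K M" "is_linear K M (tens K M H) r"
  shows "\<phi>s \<in> functionals \<Longrightarrow> is_linear K M M (word r M \<phi>s)"
proof (induction \<phi>s)
  case Nil
  have "word r M [] = (\<lambda>d. d)" by (rule ext) simp
  then show ?case by simp
next
  case (Cons \<phi> \<phi>s)
  have eq: "word r M (\<phi> # \<phi>s) = (\<lambda>m. word r M \<phi>s (rslice M H \<phi> (r m)))" by (rule ext) simp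
  from Cons have "is_linear K M M (\<lambda>m. word r M \<phi>s (rslice M H \<phi> (r m)))"
    using assms by (intro linear_comp[OF _ linear_comp[OF rslice_linear assms(2)]]) auto
  then show ?case unfolding eq .
qed

text \<open>The elements on all of whose iterated slices the counit vanishes form a subspace to
  which \<open>D_detect\<close> applies.\<close>

lemma D_eqI_cword:
  assumes d: "d \<in> carrier D" "d' \<in> carrier D"
    and eq: "\<And>\<phi>s. \<phi>s \<in> functionals \<Longrightarrow> counit D (cword \<phi>s d) = counit D (cword \<phi>s d')"
  shows "d = d'"
proof -
  let ?N = "{d \<in> carrier D. \<forall>\<phi>s\<in>functionals. counit D (cword \<phi>s d) = \<zero>}"
  note f = cword_functional
  have "d \<ominus>\<^bsub>D\<^esub> d' = \<zero>\<^bsub>D\<^esub>"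
  proof (rule D_detect)
    show "submodule ?N K D"
      by (rule submoduleI'[OF D_module])
        (auto simp: functional_zero[OF f D_module] functional_add[OF f] functional_smult[OF f])
    show "counit D c = \<zero>" if "c \<in> ?N" for c
      using that bspec[of functionals "\<lambda>\<phi>s. counit D (cword \<phi>s c) = \<zero>" "[]"] by simp
    show "rslice D D (\<lambda>x. \<phi> (p x)) (comult D c) \<in> ?N" if c: "c \<in> ?N" and \<phi>: "functional H \<phi>" for c \<phi>
    proof -
      have "counit D (cword \<phi>s (rslice D D (\<lambda>x. \<phi> (p x)) (comult D c))) = \<zero>" if "\<phi>s \<in> functionals" for \<phi>s
        using c \<phi> that bspec[of functionals "\<lambda>\<phi>s. counit D (cword \<phi>s c) = \<zero>" "\<phi> # \<phi>s"] by simp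
      then show ?thesis using c linear_closed[OF coslice_linear[OF D_coalgebra p_functional[OF \<phi>]]] by simp
    qed
    show "d \<ominus>\<^bsub>D\<^esub> d' \<in> ?N"
      using d eq functional_closed[OF f] by (simp add: functional_diff[OF f D_module] minus_eq r_neg)
  qed
  then show ?thesis using d by (simp add: module_diff_eq_zero)
qed

text \<open>A functional \<open>\<nu>\<close> on \<open>M\<close> reduces the claim to elements of
  \<open>D\<close>, and by \<open>slice_swap\<close> their iterated counit values are prescribed by
  \<open>r\<close>.\<close>

lemma lifts_unique:
  assumes M: "module K M" and s: "lifts r M m s" and t: "lifts r M m t"
  shows "s = t"
proof (rule tens_eqI_lslice[OF M D_module])
  show st: "s \<in> carrier (tens K M D)" "t \<in> carrier (tens K M D)" using s t by (auto simp: lifts_def)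
  fix \<nu> assume \<nu>: "functional M \<nu>"
  show "lslice M D \<nu> s = lslice M D \<nu> t"
  proof (rule D_eqI_cword)
    show "lslice M D \<nu> s \<in> carrier D" "lslice M D \<nu> t \<in> carrier D" using M \<nu> st by auto
    show "counit D (cword \<phi>s (lslice M D \<nu> s)) = counit D (cword \<phi>s (lslice M D \<nu> t))"
      if \<phi>s: "\<phi>s \<in> functionals" for \<phi>s
      using slice_swap[OF M D_module \<nu> cword_functional[OF \<phi>s] st(1)] slice_swap[OF M D_module \<nu> cword_functional[OF \<phi>s] st(2)]
        s t \<phi>s by (simp add: lifts_def)
  qed
qed

lemma lifts_add:
  assumes M: "module K M" and r: "is_linear K M (tens K M H) r" and "lifts r M m s" "lifts r M m' s'"
  shows "lifts r M (m \<oplus>\<^bsub>M\<^esub> m') (s \<oplus>\<^bsub>tens K M D\<^esub> s')"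
  using assms unfolding lifts_def
  by (auto simp: linear_add[OF rslice_linear[OF M D_module cword_functional]] linear_add[OF word_linear[OF M r]])

lemma lifts_smult:
  assumes M: "module K M" and r: "is_linear K M (tens K M H) r" and "lifts r M m s" "a \<in> carrier K"
  shows "lifts r M (a \<odot>\<^bsub>M\<^esub> m) (a \<odot>\<^bsub>tens K M D\<^esub> s)"
  using assms unfolding lifts_def
  by (auto simp: linear_smult[OF rslice_linear[OF M D_module cword_functional]] linear_smult[OF word_linear[OF M r]])

lemma lifts_finsum:
  assumes M: "module K M" and r: "is_linear K M (tens K M H) r"
    and "finite I" "\<And>i. i \<in> I \<Longrightarrow> lifts r M (f i) (s i)"
  shows "lifts r M (\<Oplus>\<^bsub>M\<^esub>i\<in>I. f i) (\<Oplus>\<^bsub>tens K M D\<^esub>i\<in>I. s i)"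
  using assms(3,4)
proof (induction I)
  case empty
  interpret M: module K M by fact
  interpret T: module K "tens K M D" using M by simp
  show ?case
    using M by (auto simp: lifts_def linear_zero[OF rslice_linear[OF M D_module cword_functional] _ M]
        linear_zero[OF word_linear[OF M r] M M])
next
  case (insert i I)
  interpret M: module K M by fact
  interpret T: module K "tens K M D" using M by simp
  have c: "f j \<in> carrier M" "s j \<in> carrier (tens K M D)" if "j \<in> insert i I" for j
    using insert.prems[OF that] by (auto simp: lifts_def)
  have "finsum M f (insert i I) = f i \<oplus>\<^bsub>M\<^esub> finsum M f I" using insert.hyps c by (intro M.finsum_insert) auto
  moreover have "finsum (tens K M D) s (insert i I) = s i \<oplus>\<^bsub>tens K M D\<^esub> finsum (tens K M D) s I"
    using insert.hyps c by (intro T.finsum_insert) auto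
  ultimately show ?case using lifts_add[OF M r insert.prems[of i] insert.IH] insert.prems by simp
qed

lemma ind_slice:
  assumes M: "coaction D M \<rho>" and \<phi>: "functional H \<phi>" and m: "m \<in> carrier M"
  shows "rslice M H \<phi> (ind M \<rho> m) = rslice M D (\<lambda>x. \<phi> (p x)) (\<rho> m)"
  using m rslice_tmap[OF _ D_module _ H_module linear_ident pD_linear \<phi>, of M "\<rho> m"] coaction_props[OF M]
  by (simp add: ind_def)

text \<open>Induction on the word: \<open>coaction_slice\<close> trades the first slice on the
  coefficient side for a slice of \<open>m\<close> itself.\<close>

lemma lifts_coaction:
  assumes M: "coaction D M \<rho>" and m: "m \<in> carrier M"
  shows "lifts (ind M \<rho>) M m (\<rho> m)"
proof -
  note Mp = coaction_props[OF M]
  have "rslice M D (\<lambda>d. counit D (cword \<phi>s d)) (\<rho> m) = word (ind M \<rho>) M \<phi>s m" if "\<phi>s \<in> functionals" for \<phi>s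
    using that m
  proof (induction \<phi>s arbitrary: m)
    case Nil
    then show ?case using Mp(4) by simp
  next
    case (Cons \<phi> \<phi>s)
    have \<phi>: "functional H \<phi>" and \<phi>s: "\<phi>s \<in> functionals" using Cons.prems by auto
    let ?\<psi> = "\<lambda>x. \<phi> (p x)"
    let ?m = "rslice M D ?\<psi> (\<rho> m)"
    have mm: "?m \<in> carrier M" using Mp p_functional[OF \<phi>] Cons.prems by simp
    have "rslice M D (\<lambda>d. counit D (cword (\<phi> # \<phi>s) d)) (\<rho> m) =
        rslice M D (\<lambda>d. counit D (cword \<phi>s d)) (tmap K M D M D (\<lambda>x. x) (\<lambda>d. rslice D D ?\<psi> (comult D d)) (\<rho> m))"
      using rslice_tmap[OF _ _ _ _ linear_ident coslice_linear[OF D_coalgebra p_functional[OF \<phi>]] cword_functional[OF \<phi>s], of M "\<rho> m"]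
        Mp Cons.prems by simp
    also have "\<dots> = rslice M D (\<lambda>d. counit D (cword \<phi>s d)) (\<rho> ?m)"
      using coaction_slice[OF D_coalgebra M p_functional[OF \<phi>]] Cons.prems by simp
    also have "\<dots> = word (ind M \<rho>) M \<phi>s ?m" by (rule Cons.IH[OF \<phi>s mm])
    also have "\<dots> = word (ind M \<rho>) M (\<phi> # \<phi>s) m" using ind_slice[OF M \<phi>] Cons.prems by simp
    finally show ?case .
  qed
  then show ?thesis using m Mp(5) by (simp add: lifts_def)
qed

lemma word_morphism:
  assumes f: "is_linear K M N f" and mods: "module K M" "module K N"
    and r: "is_linear K M (tens K M H) r" and eq: "\<And>m. m \<in> carrier M \<Longrightarrow> s (f m) = tmap K M H N H f (\<lambda>h. h) (r m)"
  shows "\<phi>s \<in> functionals \<Longrightarrow> m \<in> carrier M \<Longrightarrow> word s N \<phi>s (f m) = f (word r M \<phi>s m)"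
proof (induction \<phi>s arbitrary: m)
  case (Cons \<phi> \<phi>s)
  have \<phi>: "functional H \<phi>" using Cons.prems by simp
  have "rslice N H \<phi> (s (f m)) = f (rslice M H \<phi> (r m))"
    unfolding eq[OF Cons.prems(2)]
    by (rule rslice_tmap) (use mods f \<phi> linear_closed[OF r] Cons.prems in auto)
  then show ?case using Cons.IH[of "rslice M H \<phi> (r m)"] Cons.prems mods \<phi> linear_closed[OF r] by simp
qed simp

text \<open>Both sides lift \<open>f m\<close> with respect to \<open>ind N \<sigma>\<close>: the
  left one as a value of \<open>\<sigma>\<close>, the right one because \<open>f\<close> commutes
  with iterated slices.\<close>

lemma morphism_lift:
  assumes M: "coaction D M \<rho>" and N: "coaction D N \<sigma>" and f: "is_linear K M N f"
    and eq: "\<And>m. m \<in> carrier M \<Longrightarrow> ind N \<sigma> (f m) = tmap K M H N H f (\<lambda>h. h) (ind M \<rho> m)"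
    and m: "m \<in> carrier M"
  shows "\<sigma> (f m) = tmap K M D N D f (\<lambda>h. h) (\<rho> m)"
proof (rule lifts_unique)
  note Mp = coaction_props[OF M] and Np = coaction_props[OF N]
  show "module K N" by (rule Np(1))
  show "lifts (ind N \<sigma>) N (f m) (\<sigma> (f m))" by (rule lifts_coaction[OF N linear_closed[OF f m]])
  show "lifts (ind N \<sigma>) N (f m) (tmap K M D N D f (\<lambda>h. h) (\<rho> m))"
    unfolding lifts_def
  proof (intro conjI ballI)
    fix \<phi>s assume \<phi>s: "\<phi>s \<in> functionals"
    have "rslice N D (\<lambda>d. counit D (cword \<phi>s d)) (tmap K M D N D f (\<lambda>h. h) (\<rho> m)) =
        f (rslice M D (\<lambda>d. counit D (cword \<phi>s d)) (\<rho> m))"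
      by (rule rslice_tmap) (use Mp Np f m cword_functional[OF \<phi>s] in auto)
    also have "\<dots> = f (word (ind M \<rho>) M \<phi>s m)"
      using lifts_coaction[OF M m] \<phi>s by (simp add: lifts_def)
    also have "\<dots> = word (ind N \<sigma>) N \<phi>s (f m)"
      using word_morphism[OF f Mp(1) Np(1) ind_linear(1)[OF M] eq \<phi>s m] by simp
    finally show "rslice N D (\<lambda>d. counit D (cword \<phi>s d)) (tmap K M D N D f (\<lambda>h. h) (\<rho> m)) = word (ind N \<sigma>) N \<phi>s (f m)" .
  qed (use Mp Np f m linear_closed[OF f] in auto)
qed

text \<open>Slicing by \<open>\<phi> \<circ> p\<close> sends the candidate for \<open>e j\<close> to
  the combination of the candidates for the \<open>e k\<close> with scalars
  \<open>\<phi> (p (c k j))\<close>, and slicing \<open>r (e j)\<close> gives the same combination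
  of the \<open>e k\<close>. Hence induction on the word.\<close>

lemma lifts_matrix:
  assumes M: "module K M" and r: "is_linear K M (tens K M H) r" and c: "comatrix D n c"
    and e: "\<And>i. i < n \<Longrightarrow> e i \<in> carrier M"
    and re: "\<And>j. j < n \<Longrightarrow> r (e j) = (\<Oplus>\<^bsub>tens K M H\<^esub>i\<in>{..<n}. pure K M H (e i) (p (c i j)))"
    and j: "j < n"
  shows "lifts r M (e j) (\<Oplus>\<^bsub>tens K M D\<^esub>i\<in>{..<n}. pure K M D (e i) (c i j))"
proof -
  note cD = comatrixD[OF c]
  note [simp] = M
  let ?x = "\<lambda>j. \<Oplus>\<^bsub>tens K M D\<^esub>i\<in>{..<n}. pure K M D (e i) (c i j)"
  have pc: "p (c i j) \<in> carrier H" if "i < n" "j < n" for i j using linear_closed[OF pD_linear cD(1)[OF that]] .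
  have x: "?x j \<in> carrier (tens K M D)" if "j < n" for j
    by (rule module_finsum_closed) (use e cD(1) that in auto)
  have main: "rslice M D (\<lambda>d. counit D (cword \<phi>s d)) (?x j) = word r M \<phi>s (e j)" if "\<phi>s \<in> functionals" for \<phi>s
    using that j
  proof (induction \<phi>s arbitrary: j)
    case Nil
    have \<epsilon>: "functional D (counit D)" by (rule counit_functional[OF D_coalgebra])
    have "rslice M D (counit D) (?x j) = (\<Oplus>\<^bsub>M\<^esub>i\<in>{..<n}. rslice M D (counit D) (pure K M D (e i) (c i j)))"
      by (rule linear_finsum[OF rslice_linear]) (use \<epsilon> e cD(1) Nil in auto)
    also have "\<dots> = (\<Oplus>\<^bsub>M\<^esub>i\<in>{..<n}. counit D (c i j) \<odot>\<^bsub>M\<^esub> e i)"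
      by (rule module_finsum_cong) (use \<epsilon> e cD(1) Nil functional_closed[OF \<epsilon>] in auto)
    also have "\<dots> = e j"
      by (rule finsum_delta) (use e cD(3) Nil in auto)
    finally show ?case by simp
  next
    case (Cons \<phi> \<phi>s)
    have \<phi>: "functional H \<phi>" and \<phi>s: "\<phi>s \<in> functionals" and j: "j < n" using Cons.prems by auto
    let ?\<psi> = "\<lambda>x. \<phi> (p x)" and ?R = "\<lambda>d. rslice D D (\<lambda>x. \<phi> (p x)) (comult D d)"
    have \<psi>: "functional D ?\<psi>" by (rule p_functional[OF \<phi>])
    have k: "\<phi> (p (c k j)) \<in> carrier K" if "k < n" for k using functional_closed[OF \<phi> pc[OF that j]] .
    have RL: "is_linear K D D ?R" by (rule coslice_linear[OF D_coalgebra \<psi>])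
    have Rc: "?R (c i j) = (\<Oplus>\<^bsub>D\<^esub>k\<in>{..<n}. \<phi> (p (c k j)) \<odot>\<^bsub>D\<^esub> c i k)" if i: "i < n" for i
    proof -
      have "?R (c i j) = (\<Oplus>\<^bsub>D\<^esub>k\<in>{..<n}. rslice D D ?\<psi> (pure K D D (c i k) (c k j)))"
        unfolding cD(2)[OF i j] by (rule linear_finsum[OF rslice_linear]) (use \<psi> cD(1) i j in auto)
      also have "\<dots> = (\<Oplus>\<^bsub>D\<^esub>k\<in>{..<n}. \<phi> (p (c k j)) \<odot>\<^bsub>D\<^esub> c i k)"
        by (rule module_finsum_cong) (use \<psi> cD(1) i j k in auto)
      finally show ?thesis .
    qed
    let ?y = "\<lambda>i k. \<phi> (p (c k j)) \<odot>\<^bsub>tens K M D\<^esub> pure K M D (e i) (c i k)"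
    have y: "?y i k \<in> carrier (tens K M D)" if "i < n" "k < n" for i k
      using e cD(1) k that by simp
    have "tmap K M D M D (\<lambda>x. x) ?R (?x j) = (\<Oplus>\<^bsub>tens K M D\<^esub>i\<in>{..<n}. pure K M D (e i) (?R (c i j)))"
      by (rule tmap_right_sum) (use RL e cD(1) j in auto)
    also have "\<dots> = (\<Oplus>\<^bsub>tens K M D\<^esub>i\<in>{..<n}. \<Oplus>\<^bsub>tens K M D\<^esub>k\<in>{..<n}. ?y i k)"
    proof (rule module_finsum_cong)
      fix i assume "i \<in> {..<n}"
      then have i: "i < n" by simp
      have "pure K M D (e i) (?R (c i j)) = (\<Oplus>\<^bsub>tens K M D\<^esub>k\<in>{..<n}. pure K M D (e i) (\<phi> (p (c k j)) \<odot>\<^bsub>D\<^esub> c i k))"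
        unfolding Rc[OF i] by (rule linear_finsum[OF linear_pure_right]) (use e cD(1) k i in auto)
      also have "\<dots> = (\<Oplus>\<^bsub>tens K M D\<^esub>k\<in>{..<n}. ?y i k)"
      proof (rule module_finsum_cong)
        fix l assume "l \<in> {..<n}"
        then have l: "l < n" by simp
        show "pure K M D (e i) (\<phi> (p (c l j)) \<odot>\<^bsub>D\<^esub> c i l) = ?y i l"
          by (rule linear_smult[OF linear_pure_right[OF M D_module e[OF i]] k[OF l] cD(1)[OF i l]])
        show "?y i l \<in> carrier (tens K M D)" by (rule y[OF i l])
      qed simp
      finally show "pure K M D (e i) (?R (c i j)) = (\<Oplus>\<^bsub>tens K M D\<^esub>k\<in>{..<n}. ?y i k)" .
      show "(\<Oplus>\<^bsub>tens K M D\<^esub>k\<in>{..<n}. ?y i k) \<in> carrier (tens K M D)"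
        by (rule module_finsum_closed) (use y i in auto)
    qed simp
    also have "\<dots> = (\<Oplus>\<^bsub>tens K M D\<^esub>k\<in>{..<n}. \<Oplus>\<^bsub>tens K M D\<^esub>i\<in>{..<n}. ?y i k)"
      by (rule finsum_swap) (use y in auto)
    also have "\<dots> = (\<Oplus>\<^bsub>tens K M D\<^esub>k\<in>{..<n}. \<phi> (p (c k j)) \<odot>\<^bsub>tens K M D\<^esub> ?x k)"
    proof (rule module_finsum_cong)
      fix l assume "l \<in> {..<n}"
      then have l: "l < n" by simp
      show "(\<Oplus>\<^bsub>tens K M D\<^esub>i\<in>{..<n}. ?y i l) = \<phi> (p (c l j)) \<odot>\<^bsub>tens K M D\<^esub> ?x l"
        by (rule module_smult_finsum[symmetric]) (use e cD(1) k l in auto)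
      show "\<phi> (p (c l j)) \<odot>\<^bsub>tens K M D\<^esub> ?x l \<in> carrier (tens K M D)"
        by (rule module_smult_closed[OF _ k[OF l] x[OF l]]) simp
    qed simp
    finally have Rx: "tmap K M D M D (\<lambda>x. x) ?R (?x j) = (\<Oplus>\<^bsub>tens K M D\<^esub>k\<in>{..<n}. \<phi> (p (c k j)) \<odot>\<^bsub>tens K M D\<^esub> ?x k)" .
    let ?L = "rslice M D (\<lambda>d. counit D (cword \<phi>s d))"
    have L: "is_linear K (tens K M D) M ?L" by (rule rslice_linear[OF M D_module cword_functional[OF \<phi>s]])
    have W: "is_linear K M M (word r M \<phi>s)" by (rule word_linear[OF M r \<phi>s])
    have "rslice M D (\<lambda>d. counit D (cword (\<phi> # \<phi>s) d)) (?x j) = ?L (tmap K M D M D (\<lambda>x. x) ?R (?x j))"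
      using rslice_tmap[OF M D_module M D_module linear_ident RL cword_functional[OF \<phi>s] x[OF j]] by simp
    also have "\<dots> = (\<Oplus>\<^bsub>M\<^esub>k\<in>{..<n}. ?L (\<phi> (p (c k j)) \<odot>\<^bsub>tens K M D\<^esub> ?x k))"
      unfolding Rx by (rule linear_finsum[OF L]) (use x k in \<open>auto intro!: module_smult_closed\<close>)
    also have "\<dots> = (\<Oplus>\<^bsub>M\<^esub>k\<in>{..<n}. word r M \<phi>s (\<phi> (p (c k j)) \<odot>\<^bsub>M\<^esub> e k))"
    proof (rule module_finsum_cong[OF M])
      fix l assume "l \<in> {..<n}"
      then have l: "l < n" by simp
      show "?L (\<phi> (p (c l j)) \<odot>\<^bsub>tens K M D\<^esub> ?x l) = word r M \<phi>s (\<phi> (p (c l j)) \<odot>\<^bsub>M\<^esub> e l)"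
        unfolding linear_smult[OF L k[OF l] x[OF l]] linear_smult[OF W k[OF l] e[OF l]] Cons.IH[OF \<phi>s l] ..
      show "word r M \<phi>s (\<phi> (p (c l j)) \<odot>\<^bsub>M\<^esub> e l) \<in> carrier M"
        using linear_closed[OF W] k[OF l] e[OF l] by simp
    qed
    also have "\<dots> = word r M \<phi>s (\<Oplus>\<^bsub>M\<^esub>k\<in>{..<n}. \<phi> (p (c k j)) \<odot>\<^bsub>M\<^esub> e k)"
      by (rule linear_finsum[OF W M M, symmetric]) (use k e in auto)
    also have "(\<Oplus>\<^bsub>M\<^esub>k\<in>{..<n}. \<phi> (p (c k j)) \<odot>\<^bsub>M\<^esub> e k) = rslice M H \<phi> (r (e j))"
    proof -
      have "rslice M H \<phi> (r (e j)) = (\<Oplus>\<^bsub>M\<^esub>k\<in>{..<n}. rslice M H \<phi> (pure K M H (e k) (p (c k j))))"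
        unfolding re[OF j] by (rule linear_finsum[OF rslice_linear]) (use \<phi> e pc j in auto)
      also have "\<dots> = (\<Oplus>\<^bsub>M\<^esub>k\<in>{..<n}. \<phi> (p (c k j)) \<odot>\<^bsub>M\<^esub> e k)"
        by (rule module_finsum_cong) (use \<phi> e pc j k in auto)
      finally show ?thesis by simp
    qed
    finally show ?case by simp
  qed
  show ?thesis unfolding lifts_def by (intro conjI ballI main e[OF j] x[OF j])
qed

section \<open>Lifting locally finite partial coactions\<close>

text \<open>Finite dimensionality of \<open>U\<close> is expressed by finitely many functionals
  separating its points, the form that \<open>frame_of_separated\<close> turns into a basis.\<close>

definition locally_finite :: "('k, 'a, 'y) module_scheme \<Rightarrow> ('a \<Rightarrow> ('a, 'h) tensor) \<Rightarrow> bool"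
  where "locally_finite M r \<longleftrightarrow> (\<forall>m\<in>carrier M. \<exists>U n \<psi>. submodule U K M \<and> m \<in> U \<and>
    (\<forall>x\<in>U. \<forall>\<phi>. functional H \<phi> \<longrightarrow> rslice M H \<phi> (r x) \<in> U) \<and>
    (\<forall>i<n::nat. functional M (\<psi> i)) \<and> (\<forall>x\<in>U. (\<forall>i<n. \<psi> i x = \<zero>) \<longrightarrow> x = \<zero>\<^bsub>M\<^esub>))"

text \<open>Lifts over different stable finite-dimensional subspaces agree where they overlap
  because lifts are unique, so they glue to a linear map without any compatible choice of
  bases.\<close>

lemma coaction_lift:
  fixes M :: "('k, 'm) module"
  assumes M: "is_partial_comodule K H (M, r)" and fin: "locally_finite M r"
  obtains \<rho> where "coaction D M \<rho>" "\<rho> \<in> extensional (carrier M)" "ind M \<rho> = r"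
proof -
  note Mp = partial_comoduleD[OF M]
  note [simp] = Mp(1) Mp(2)
  interpret T: module K "tens K M D" by simp
  have ex: "\<exists>n e \<psi> c. frame M n e \<psi> \<and> comatrix D n c \<and> fproj M n e \<psi> m = m \<and>
      (\<forall>j<n. lifts r M (e j) (\<Oplus>\<^bsub>tens K M D\<^esub>i\<in>{..<n}. pure K M D (e i) (c i j)))"
    if m: "m \<in> carrier M" for m
  proof -
    from bspec[OF fin[unfolded locally_finite_def] m]
    obtain U k \<chi> where U: "submodule U K M" "m \<in> U" "\<forall>x\<in>U. \<forall>\<phi>. functional H \<phi> \<longrightarrow> rslice M H \<phi> (r x) \<in> U"
      "\<forall>i<k::nat. functional M (\<chi> i)" "\<forall>x\<in>U. (\<forall>i<k. \<chi> i x = \<zero>) \<longrightarrow> x = \<zero>\<^bsub>M\<^esub>"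
      by (elim exE conjE)
    have "\<exists>n e \<psi>. frame M n e \<psi> \<and> (\<forall>i<n. e i \<in> U) \<and> (\<forall>x\<in>U. fproj M n e \<psi> x = x)"
      by (rule frame_of_separated[OF Mp(1) U(1), of k \<chi>]) (use U(4,5) in auto)
    then obtain n e \<psi> where fr: "frame M n e \<psi>" "\<forall>i<n. e i \<in> U" "\<forall>x\<in>U. fproj M n e \<psi> x = x" by blast
    note q = frame_props[OF fr(1)]
    have cof: "coframe H M r n e \<psi>"
      by (rule coframeI[OF Mp(1) H_module Mp(2) fr(1), of U]) (use fr(2,3) U(3) in auto)
    obtain c where c: "comatrix D n c" "\<forall>i<n. \<forall>j<n. p (c i j) = lslice M H (\<psi> i) (r (e j))"
      by (rule lift_coframe[OF M cof])
    have re: "r (e j) = (\<Oplus>\<^bsub>tens K M H\<^esub>i\<in>{..<n}. pure K M H (e i) (p (c i j)))" if j: "j < n" for j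
    proof -
      have "r (e j) = (\<Oplus>\<^bsub>tens K M H\<^esub>i\<in>{..<n}. pure K M H (e i) (lslice M H (\<psi> i) (r (e j))))"
        using cof j unfolding coframe_def by blast
      also have "\<dots> = (\<Oplus>\<^bsub>tens K M H\<^esub>i\<in>{..<n}. pure K M H (e i) (p (c i j)))"
        by (rule module_finsum_cong)
          (use c(2) q j linear_closed[OF pD_linear comatrixD(1)[OF c(1)]] in auto)
      finally show ?thesis .
    qed
    have "lifts r M (e j) (\<Oplus>\<^bsub>tens K M D\<^esub>i\<in>{..<n}. pure K M D (e i) (c i j))" if "j < n" for j
      by (rule lifts_matrix[OF Mp(1,2) c(1) q(1) re that])
    then show ?thesis using fr(1,3) U(2) c(1)
      by (intro exI[of _ n] exI[of _ e] exI[of _ \<psi>] exI[of _ c] conjI allI impI) blast+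
  qed
  have lifts_ex: "\<exists>!t. lifts r M m t" if m: "m \<in> carrier M" for m
  proof (rule ex_ex1I)
    from ex[OF m] obtain n e \<psi> c where fr: "frame M n e \<psi>" "fproj M n e \<psi> m = m"
      and l: "\<forall>j<n. lifts r M (e j) (\<Oplus>\<^bsub>tens K M D\<^esub>i\<in>{..<n}. pure K M D (e i) (c i j))"
      by (elim exE conjE)
    note q = frame_props[OF fr(1)]
    have "lifts r M (fproj M n e \<psi> m)
        (\<Oplus>\<^bsub>tens K M D\<^esub>j\<in>{..<n}. \<psi> j m \<odot>\<^bsub>tens K M D\<^esub> (\<Oplus>\<^bsub>tens K M D\<^esub>i\<in>{..<n}. pure K M D (e i) (c i j)))"
      unfolding fproj_def
      by (rule lifts_finsum) (use l lifts_smult[OF Mp(1,2)] functional_closed[OF q(2) m] in auto)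
    then show "\<exists>t. lifts r M m t" using fr(2) by auto
    show "s = t" if "lifts r M m s" "lifts r M m t" for s t by (rule lifts_unique[OF Mp(1) that])
  qed
  define \<rho> where "\<rho> = (\<lambda>m\<in>carrier M. THE t. lifts r M m t)"
  have \<rho>: "lifts r M m (\<rho> m)" if "m \<in> carrier M" for m
    using theI'[OF lifts_ex[OF that]] that by (simp add: \<rho>_def)
  have \<rho>_eq: "\<rho> m = t" if "lifts r M m t" for m t
    using lifts_unique[OF Mp(1) \<rho> that] that by (simp add: lifts_def)
  have \<rho>L: "is_linear K M (tens K M D) \<rho>"
  proof (rule is_linearI)
    show "\<rho> x \<in> carrier (tens K M D)" if "x \<in> carrier M" for x using \<rho>[OF that] by (simp add: lifts_def)
    show "\<rho> (x \<oplus>\<^bsub>M\<^esub> y) = \<rho> x \<oplus>\<^bsub>tens K M D\<^esub> \<rho> y" if "x \<in> carrier M" "y \<in> carrier M" for x y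
      by (rule \<rho>_eq[OF lifts_add[OF Mp(1,2) \<rho> \<rho>]]) fact+
    show "\<rho> (a \<odot>\<^bsub>M\<^esub> x) = a \<odot>\<^bsub>tens K M D\<^esub> \<rho> x" if "a \<in> carrier K" "x \<in> carrier M" for a x
      by (rule \<rho>_eq[OF lifts_smult[OF Mp(1,2) \<rho>]]) fact+
  qed
  note Dp = coalgebra_props[OF D_coalgebra]
  have co: "coaction D M \<rho>"
    unfolding coaction_def
  proof (intro conjI ballI Mp(1) \<rho>L)
    fix m assume m: "m \<in> carrier M"
    \<comment> \<open>Counitality is the prescription for the empty word.\<close>
    show "rslice M D (counit D) (\<rho> m) = m"
      using \<rho>[OF m] bspec[of functionals "\<lambda>\<phi>s. rslice M D (\<lambda>d. counit D (cword \<phi>s d)) (\<rho> m) = word r M \<phi>s m" "[]"]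
      unfolding lifts_def by simp
    from ex[OF m] obtain n e \<psi> c where fr: "frame M n e \<psi>" "fproj M n e \<psi> m = m" and c: "comatrix D n c"
      and l: "\<forall>j<n. lifts r M (e j) (\<Oplus>\<^bsub>tens K M D\<^esub>i\<in>{..<n}. pure K M D (e i) (c i j))"
      by (elim exE conjE)
    note q = frame_props[OF fr(1)]
    let ?l = "\<lambda>m. tassoc K M D D (tmap K M D (tens K M D) D \<rho> (\<lambda>d. d) (\<rho> m))"
    let ?r = "\<lambda>m. tmap K M D M (tens K D D) (\<lambda>m. m) (comult D) (\<rho> m)"
    have sub: "submodule {m \<in> carrier M. ?l m = ?r m} K M"
    proof (rule submodule_equalizer[where W = "tens K M (tens K D D)"])
      show "is_linear K M (tens K M (tens K D D)) ?l"
        by (intro linear_comp[OF tassoc_linear] linear_comp[OF tmap_linear \<rho>L]) (use \<rho>L in auto)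
      show "is_linear K M (tens K M (tens K D D)) ?r"
        by (intro linear_comp[OF tmap_linear \<rho>L]) (use Dp in auto)
    qed auto
    \<comment> \<open>On a frame vector \<open>\<rho>\<close> is given by a comatrix, which makes
      coassociativity automatic; linearity carries it to \<open>m\<close>.\<close>
    have "e j \<in> {m \<in> carrier M. ?l m = ?r m}" if j: "j < n" for j
    proof -
      have "?l (e j) = ?r (e j)"
        by (rule matrix_coaction(1)[OF Mp(1) D_module \<rho>L Dp(2,3) c q(1) _ j]) (use \<rho>_eq l in auto)
      then show ?thesis using q(1)[OF j] by simp
    qed
    then have "fproj M n e \<psi> m \<in> {m \<in> carrier M. ?l m = ?r m}"
      unfolding fproj_def
      by (intro submodule_finsum[OF sub Mp(1)] submodule_smult[OF sub Mp(1)]) (use functional_closed[OF q(2) m] in auto)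
    then show "?l m = ?r m" using fr(2) by simp
  qed
  have "ind M \<rho> m = r m" for m
  proof (cases "m \<in> carrier M")
    case m: True
    have t: "\<rho> m \<in> carrier (tens K M D)" using linear_closed[OF \<rho>L m] .
    have "tmap K M D M H (\<lambda>x. x) p (\<rho> m) = r m"
    proof (rule tens_eqI_rslice[OF Mp(1) H_module])
      fix \<phi> assume \<phi>: "functional H \<phi>"
      have "rslice M H \<phi> (tmap K M D M H (\<lambda>x. x) p (\<rho> m)) = rslice M D (\<lambda>x. \<phi> (p x)) (\<rho> m)"
        by (rule rslice_tmap) (use \<phi> pD_linear t in auto)
      \<comment> \<open>A slice along \<open>\<phi> \<circ> p\<close> is the counit value of a word
        of length one, so the prescription by words recovers \<open>r\<close>.\<close>
      also have "rslice M D (\<lambda>x. \<phi> (p x)) = rslice M D (\<lambda>d. counit D (cword [\<phi>] d))"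
        unfolding rslice_def
      proof (rule tlift_cong)
        fix a d assume "d \<in> carrier D"
        then show "\<phi> (p d) \<odot>\<^bsub>M\<^esub> a = counit D (cword [\<phi>] d) \<odot>\<^bsub>M\<^esub> a"
          using slice_swap[OF D_module D_module Dp(3) p_functional[OF \<phi>] linear_closed[OF Dp(2)]] Dp(5) by simp
      qed
      also have "rslice M D (\<lambda>d. counit D (cword [\<phi>] d)) (\<rho> m) = word r M [\<phi>] m"
        using \<rho>[OF m] \<phi>
          bspec[of functionals "\<lambda>\<phi>s. rslice M D (\<lambda>d. counit D (cword \<phi>s d)) (\<rho> m) = word r M \<phi>s m" "[\<phi>]"]
        unfolding lifts_def by (simp del: word.simps cword.simps)
      finally show "rslice M H \<phi> (tmap K M D M H (\<lambda>x. x) p (\<rho> m)) = rslice M H \<phi> (r m)" by simp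
    qed (use t pD_linear linear_closed[OF Mp(2) m] in auto)
    then show ?thesis using m by (simp add: ind_def)
  next
    case False
    then show ?thesis using Mp(3) by (simp add: ind_def extensional_def)
  qed
  then have "ind M \<rho> = r" by blast
  then show thesis using that[OF co] by (simp add: \<rho>_def)
qed

lemma coaction_unique:
  assumes "coaction D M \<rho>" "coaction D M \<sigma>" "ind M \<rho> = ind M \<sigma>" "m \<in> carrier M"
  shows "\<rho> m = \<sigma> m"
  using lifts_unique[OF coaction_props(1)[OF assms(1)] lifts_coaction[OF assms(1,4)]] lifts_coaction[OF assms(2,4)]
    assms(3) by simp

end

subsection \<open>Finiteness conditions\<close>

context base_field
begin

lemma dual_carrier: "f \<in> carrier (dual K M) \<longleftrightarrow> f \<in> extensional (carrier M) \<and> functional M f"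
  by (simp add: dual_def lin_def functional_def)

lemma dual_module:
  assumes M: "module K M"
  shows "module K (dual K M)"
proof -
  note [simp] = functional_closed
  have d: "\<zero>\<^bsub>dual K M\<^esub> = (\<lambda>x\<in>carrier M. \<zero>)" "\<And>f g. f \<oplus>\<^bsub>dual K M\<^esub> g = (\<lambda>x\<in>carrier M. f x \<oplus> g x)"
    "\<And>c f. c \<odot>\<^bsub>dual K M\<^esub> f = (\<lambda>x\<in>carrier M. c \<otimes> f x)"
    by (simp_all add: dual_def)
  have res: "functional M (restrict f (carrier M))" if "functional M f" for f
    using linear_restrict[of M "self_module K" f] that M by (simp add: functional_def lin_def)
  have z: "functional M (\<lambda>x. \<zero>)" using linear_zero_map[of "self_module K" M] by (simp add: functional_def)
  have a: "functional M (\<lambda>x. f x \<oplus> g x)" if "functional M f" "functional M g" for f g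
    using linear_plus[of "self_module K" M f g] that by (simp add: functional_def)
  have s: "functional M (\<lambda>x. c \<otimes> f x)" if "functional M f" "c \<in> carrier K" for f c
    using linear_scale[of "self_module K" M f c] that by (simp add: functional_def)
  have c: "f x \<in> carrier K" if "f \<in> carrier (dual K M)" "x \<in> carrier M" for f x
    using that functional_closed[of M f x] by (simp add: dual_carrier)
  have e: "f = g" if "f \<in> extensional (carrier M)" "g \<in> extensional (carrier M)"
    "\<And>x. x \<in> carrier M \<Longrightarrow> f x = g x" for f g
    using that by (rule extensionalityI)
  have ex: "f \<in> extensional (carrier M)" if "f \<in> carrier (dual K M)" for f using that by (simp add: dual_carrier)
  show ?thesis
  proof (rule moduleI)
    show "cring K" by (rule is_cring)
    show "abelian_group (dual K M)"
    proof (rule abelian_groupI)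
      show "f \<oplus>\<^bsub>dual K M\<^esub> g \<in> carrier (dual K M)" if "f \<in> carrier (dual K M)" "g \<in> carrier (dual K M)" for f g
        using that res[OF a, of f g] by (simp add: dual_carrier d)
      show "\<zero>\<^bsub>dual K M\<^esub> \<in> carrier (dual K M)" using res[OF z] by (simp add: dual_carrier d)
      show "f \<oplus>\<^bsub>dual K M\<^esub> g \<oplus>\<^bsub>dual K M\<^esub> h = f \<oplus>\<^bsub>dual K M\<^esub> (g \<oplus>\<^bsub>dual K M\<^esub> h)"
        if "f \<in> carrier (dual K M)" "g \<in> carrier (dual K M)" "h \<in> carrier (dual K M)" for f g h
        unfolding d by (rule restrict_ext) (use c[OF that(1)] c[OF that(2)] c[OF that(3)] in \<open>simp add: a_assoc\<close>)
      show "f \<oplus>\<^bsub>dual K M\<^esub> g = g \<oplus>\<^bsub>dual K M\<^esub> f"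
        if "f \<in> carrier (dual K M)" "g \<in> carrier (dual K M)" for f g
        unfolding d by (rule restrict_ext) (use c[OF that(1)] c[OF that(2)] in \<open>simp add: a_comm\<close>)
      show "\<zero>\<^bsub>dual K M\<^esub> \<oplus>\<^bsub>dual K M\<^esub> f = f" if "f \<in> carrier (dual K M)" for f
        unfolding d by (rule e) (use ex[OF that] c[OF that] in auto)
      show "\<exists>g\<in>carrier (dual K M). g \<oplus>\<^bsub>dual K M\<^esub> f = \<zero>\<^bsub>dual K M\<^esub>" if f: "f \<in> carrier (dual K M)" for f
      proof (rule bexI)
        show "(\<lambda>x\<in>carrier M. (\<ominus> \<one>) \<otimes> f x) \<in> carrier (dual K M)"
          using res[OF s, of f "\<ominus> \<one>"] f by (simp add: dual_carrier)
        show "(\<lambda>x\<in>carrier M. (\<ominus> \<one>) \<otimes> f x) \<oplus>\<^bsub>dual K M\<^esub> f = \<zero>\<^bsub>dual K M\<^esub>"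
          unfolding d by (rule restrict_ext) (use c[OF f] in \<open>simp add: l_minus l_neg\<close>)
      qed
    qed
    show "k \<odot>\<^bsub>dual K M\<^esub> f \<in> carrier (dual K M)" if "k \<in> carrier K" "f \<in> carrier (dual K M)" for k f
      using that res[OF s, of f k] by (simp add: dual_carrier d)
    show "(k \<oplus> l) \<odot>\<^bsub>dual K M\<^esub> f = k \<odot>\<^bsub>dual K M\<^esub> f \<oplus>\<^bsub>dual K M\<^esub> l \<odot>\<^bsub>dual K M\<^esub> f"
      if "k \<in> carrier K" "l \<in> carrier K" "f \<in> carrier (dual K M)" for k l f
      unfolding d by (rule restrict_ext) (use that c[OF that(3)] in \<open>simp add: l_distr\<close>)
    show "k \<odot>\<^bsub>dual K M\<^esub> (f \<oplus>\<^bsub>dual K M\<^esub> g) = k \<odot>\<^bsub>dual K M\<^esub> f \<oplus>\<^bsub>dual K M\<^esub> k \<odot>\<^bsub>dual K M\<^esub> g"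
      if "k \<in> carrier K" "f \<in> carrier (dual K M)" "g \<in> carrier (dual K M)" for k f g
      unfolding d by (rule restrict_ext) (use that c[OF that(2)] c[OF that(3)] in \<open>simp add: r_distr\<close>)
    show "(k \<otimes> l) \<odot>\<^bsub>dual K M\<^esub> f = k \<odot>\<^bsub>dual K M\<^esub> (l \<odot>\<^bsub>dual K M\<^esub> f)"
      if "k \<in> carrier K" "l \<in> carrier K" "f \<in> carrier (dual K M)" for k l f
      unfolding d by (rule restrict_ext) (use that c[OF that(3)] in \<open>simp add: m_assoc\<close>)
    show "\<one> \<odot>\<^bsub>dual K M\<^esub> f = f" if "f \<in> carrier (dual K M)" for f
      unfolding d by (rule e) (use ex[OF that] c[OF that] in auto)
  qed
qed

lemma eval_functional:
  assumes "x \<in> carrier M"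
  shows "functional (dual K M) (\<lambda>f. f x)"
  unfolding functional_def
  by (rule is_linearI) (use assms in \<open>auto simp: dual_def lin_def functional_def[symmetric] functional_closed\<close>)

text \<open>The operator of \<open>t\<close> is the slice of \<open>t\<close> along evaluation at
  \<open>x\<close>, so whatever fixes the finite left support of \<open>t\<close> fixes its
  values.\<close>

lemma finite_rank_elem_act:
  assumes M: "module K M" and t: "t \<in> carrier (tens K M (dual K M))"
  shows "\<exists>S. finite S \<and> S \<subseteq> carrier M \<and>
    (\<forall>P. is_linear K M M P \<longrightarrow> (\<forall>s\<in>S. P s = s) \<longrightarrow> (\<forall>x\<in>carrier M. P (elem_act K M t x) = elem_act K M t x))"
proof -
  note dm = dual_module[OF M]
  from tens_support_left[OF M dm t] obtain S where S: "finite S" "S \<subseteq> carrier M"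
    "\<forall>P. is_linear K M M P \<longrightarrow> (\<forall>s\<in>S. P s = s) \<longrightarrow> tmap K M (dual K M) M (dual K M) P (\<lambda>x. x) t = t"
    by (elim exE conjE)
  have "P (elem_act K M t x) = elem_act K M t x"
    if P: "is_linear K M M P" "\<forall>s\<in>S. P s = s" and x: "x \<in> carrier M" for P x
  proof -
    have e: "elem_act K M t x = rslice M (dual K M) (\<lambda>f. f x) t" by (simp add: elem_act_def rslice_def)
    have T: "tmap K M (dual K M) M (dual K M) P (\<lambda>x. x) t = t" using S(3) P by blast
    show ?thesis
      unfolding e using rslice_tmap[OF M dm M dm P(1) linear_ident eval_functional[OF x] t, unfolded T] by (rule sym)
  qed
  then show ?thesis using S(1,2) by blast
qed

text \<open>Firmness makes the action map from the balanced tensor product onto \<open>M\<close>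
  surjective, and an element of that tensor product involves finitely many elements of
  \<open>R\<close>.\<close>

lemma firm_generated:
  assumes M: "module K M" and R: "is_nonunital_ring R" and firm: "is_firm_module R M act" and m: "m \<in> carrier M"
  shows "\<exists>F. finite F \<and> F \<subseteq> carrier R \<and> m \<in> span_of K M {act r x | r x. r \<in> F \<and> x \<in> carrier M}"
proof -
  let ?T = "bal_tensor (carrier R) R M (monoid.mult R) act"
  let ?G = "\<lambda>F. {act r x | r x. r \<in> F \<and> x \<in> carrier M}"
  have actc: "act r x \<in> carrier M" if "r \<in> carrier R" "x \<in> carrier M" for r x
    using firm that by (auto simp: is_firm_module_def is_left_module_def)
  have ok: "bal_ok (carrier R) R M (monoid.mult R) act"
    using R M actc by (auto simp: bal_ok_def is_nonunital_ring_def abelian_group_def abelian_monoid.a_closed)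
  obtain h where h: "h \<in> iso ?T (add_monoid M)"
    "\<forall>r\<in>carrier R. \<forall>x\<in>carrier M. h (bal_coset (carrier R) R M (monoid.mult R) act (frag_of (r, x))) = act r x"
    using firm by (auto simp: is_firm_module_def)
  interpret M: module K M by fact
  interpret h: group_hom ?T "add_monoid M" h
    using h(1) bal_tensor_comm_group[OF ok] module_comm_group[OF M]
    by (simp add: group_hom_def group_hom_axioms_def iso_def comm_group.axioms)
  have "h ` carrier ?T = carrier M" using h(1) by (auto simp: iso_def bij_betw_def)
  then obtain t where t: "t \<in> carrier ?T" "m = h t" using m by blast
  have sub: "submodule (span_of K M (?G F)) K M" if "F \<subseteq> carrier R" for F
    by (rule submodule_span_of[OF M]) (use that actc in auto)
  have "\<exists>F. finite F \<and> F \<subseteq> carrier R \<and> h t \<in> span_of K M (?G F)"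
  proof (rule bal_tensor_induct[OF ok t(1), where P = "\<lambda>t. \<exists>F. finite F \<and> F \<subseteq> carrier R \<and> h t \<in> span_of K M (?G F)"])
    show "\<exists>F. finite F \<and> F \<subseteq> carrier R \<and> h \<one>\<^bsub>?T\<^esub> \<in> span_of K M (?G F)"
      using submodule_zero[OF sub[of "{}"] M] h.hom_one by (intro exI[of _ "{}"]) auto
    show "\<exists>F. finite F \<and> F \<subseteq> carrier R \<and>
        h (bal_coset (carrier R) R M (monoid.mult R) act (frag_of (r, x))) \<in> span_of K M (?G F)"
      if "r \<in> carrier R" "x \<in> carrier M" for r x
    proof -
      have "act r x \<in> ?G {r}" using that by blast
      then have "act r x \<in> span_of K M (?G {r})" using span_of_incl[of "?G {r}" M] by blast
      then show ?thesis using that h(2) by (intro exI[of _ "{r}"]) simp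
    qed
  next
    fix s t assume st: "s \<in> carrier ?T" "t \<in> carrier ?T"
      and IH: "\<exists>F. finite F \<and> F \<subseteq> carrier R \<and> h s \<in> span_of K M (?G F)"
        "\<exists>F. finite F \<and> F \<subseteq> carrier R \<and> h t \<in> span_of K M (?G F)"
    from IH(1) obtain F where F: "finite F" "F \<subseteq> carrier R" "h s \<in> span_of K M (?G F)" by (elim exE conjE)
    from IH(2) obtain F' where F': "finite F'" "F' \<subseteq> carrier R" "h t \<in> span_of K M (?G F')" by (elim exE conjE)
    let ?F = "F \<union> F'"
    have S: "submodule (span_of K M (?G ?F)) K M" by (rule sub) (use F F' in auto)
    have mono: "span_of K M (?G E) \<subseteq> span_of K M (?G ?F)" if "E \<subseteq> ?F" for E
    proof (rule span_of_least[OF S])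
      have "?G E \<subseteq> ?G ?F" using that by blast
      then show "?G E \<subseteq> span_of K M (?G ?F)" using span_of_incl[of "?G ?F" M] by (rule order.trans)
    qed
    have "h s \<in> span_of K M (?G ?F)" "h t \<in> span_of K M (?G ?F)" using F(3) F'(3) mono[of F] mono[of F'] by auto
    moreover have "h (s \<otimes>\<^bsub>?T\<^esub> inv\<^bsub>?T\<^esub> t) = h s \<oplus>\<^bsub>M\<^esub> \<ominus>\<^bsub>M\<^esub> h t"
      using st by (simp add: a_inv_def)
    ultimately have "h (s \<otimes>\<^bsub>?T\<^esub> inv\<^bsub>?T\<^esub> t) \<in> span_of K M (?G ?F)"
      using submodule_add[OF S M] submodule_minus[OF S M] by simp
    then show "\<exists>F. finite F \<and> F \<subseteq> carrier R \<and> h (s \<otimes>\<^bsub>?T\<^esub> inv\<^bsub>?T\<^esub> t) \<in> span_of K M (?G F)"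
      using F F' by (intro exI[of _ ?F]) simp
  qed
  then show ?thesis using t(2) by simp
qed

end

context hopf_cofree
begin

text \<open>The common core of the two finiteness criteria: a projection fixing \<open>S\<close>
  bounds the dimension of the span of \<open>G\<close>, and stability under slices passes from
  \<open>G\<close> to its span.\<close>

lemma locally_finite_span:
  assumes M: "module K M" and r: "is_linear K M (tens K M H) r" and G: "G \<subseteq> carrier M"
    and S: "finite S" "S \<subseteq> carrier M"
    and fxd: "\<And>P x. is_linear K M M P \<Longrightarrow> (\<forall>s\<in>S. P s = s) \<Longrightarrow> x \<in> G \<Longrightarrow> P x = x"
    and stab: "\<And>x \<phi>. x \<in> G \<Longrightarrow> functional H \<phi> \<Longrightarrow> rslice M H \<phi> (r x) \<in> G"
  shows "\<exists>n \<psi>. (\<forall>x\<in>span_of K M G. \<forall>\<phi>. functional H \<phi> \<longrightarrow> rslice M H \<phi> (r x) \<in> span_of K M G) \<and>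
    (\<forall>i<n::nat. functional M (\<psi> i)) \<and> (\<forall>x\<in>span_of K M G. (\<forall>i<n. \<psi> i x = \<zero>) \<longrightarrow> x = \<zero>\<^bsub>M\<^esub>)"
proof -
  interpret M: module K M by fact
  let ?U = "span_of K M G"
  have U: "submodule ?U K M" by (rule submodule_span_of[OF M G])
  obtain n e \<psi> where fr: "frame M n e \<psi>" "\<forall>i<n. e i \<in> carrier M" "\<forall>s\<in>S. fproj M n e \<psi> s = s"
    by (rule frame_exists[OF M M.carrier_is_submodule S])
  note q = frame_props[OF fr(1)]
  have P: "is_linear K M M (fproj M n e \<psi>)" by (rule fproj_linear[OF M q(1,2)])
  have "?U \<subseteq> {x \<in> carrier M. fproj M n e \<psi> x = x}"
    by (rule span_of_least[OF submodule_equalizer[OF M M P linear_ident]]) (use fxd[OF P fr(3)] G in auto)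
  then have UP: "fproj M n e \<psi> x = x" if "x \<in> ?U" for x using that by blast
  have sep: "x = \<zero>\<^bsub>M\<^esub>" if "x \<in> ?U" "\<forall>i<n. \<psi> i x = \<zero>" for x
  proof -
    have "fproj M n e \<psi> x = \<zero>\<^bsub>M\<^esub>"
      unfolding fproj_def by (rule module_finsum_zero[OF M]) (use that(2) q(1) M in auto)
    then show ?thesis using UP[OF that(1)] by simp
  qed
  have "rslice M H \<phi> (r x) \<in> ?U" if x: "x \<in> ?U" and \<phi>: "functional H \<phi>" for x \<phi>
  proof -
    have lin: "is_linear K M M (\<lambda>x. rslice M H \<phi> (r x))"
      by (rule linear_comp[OF rslice_linear[OF M H_module \<phi>] r])
    have "G \<subseteq> {x \<in> carrier M. rslice M H \<phi> (r x) \<in> ?U}"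
      using stab[OF _ \<phi>] G span_of_incl[of G M] by blast
    then have "?U \<subseteq> {x \<in> carrier M. rslice M H \<phi> (r x) \<in> ?U}"
      by (rule span_of_least[OF submodule_preimage[OF M M lin U]])
    then show ?thesis using x by blast
  qed
  then show ?thesis using q(2) sep by (intro exI[of _ n] exI[of _ \<psi>]) blast
qed

text \<open>The whole space serves as the stable subspace of every element.\<close>

lemma locally_finite_finite_dim:
  assumes M: "module K M" and r: "is_linear K M (tens K M H) r" and fd: "finite_dim K M"
  shows "locally_finite M r"
proof -
  interpret M: module K M by fact
  obtain B where B: "finite B" "B \<subseteq> carrier M" "span_of K M B = carrier M" using fd by (auto simp: finite_dim_def)
  have full: "span_of K M (carrier M) = carrier M"
    using span_of_incl[of "carrier M" M] span_of_least[OF M.carrier_is_submodule order_refl] by blast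
  have "\<exists>n \<psi>. (\<forall>x\<in>span_of K M (carrier M). \<forall>\<phi>. functional H \<phi> \<longrightarrow> rslice M H \<phi> (r x) \<in> span_of K M (carrier M)) \<and>
    (\<forall>i<n::nat. functional M (\<psi> i)) \<and> (\<forall>x\<in>span_of K M (carrier M). (\<forall>i<n. \<psi> i x = \<zero>) \<longrightarrow> x = \<zero>\<^bsub>M\<^esub>)"
  proof (rule locally_finite_span[OF M r order_refl B(1,2)])
    show "P x = x" if P: "is_linear K M M P" "\<forall>s\<in>B. P s = s" and x: "x \<in> carrier M" for P x
    proof -
      have "span_of K M B \<subseteq> {x \<in> carrier M. P x = x}"
        by (rule span_of_least[OF submodule_equalizer[OF M M P(1) linear_ident]]) (use P(2) B(2) in auto)
      then show ?thesis using B(3) x by blast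
    qed
    show "rslice M H \<phi> (r x) \<in> carrier M" if "x \<in> carrier M" "functional H \<phi>" for x \<phi>
      using M that linear_closed[OF r] by simp
  qed
  then obtain n \<psi> where *: "\<forall>i<n::nat. functional M (\<psi> i)" "\<forall>x\<in>carrier M. (\<forall>i<n. \<psi> i x = \<zero>) \<longrightarrow> x = \<zero>\<^bsub>M\<^esub>"
    unfolding full by (elim exE conjE)
  show ?thesis
    unfolding locally_finite_def
  proof (intro ballI)
    fix m assume "m \<in> carrier M"
    then show "\<exists>U n \<psi>. submodule U K M \<and> m \<in> U \<and>
       (\<forall>x\<in>U. \<forall>\<phi>. functional H \<phi> \<longrightarrow> rslice M H \<phi> (r x) \<in> U) \<and>
       (\<forall>i<n::nat. functional M (\<psi> i)) \<and> (\<forall>x\<in>U. (\<forall>i<n. \<psi> i x = \<zero>) \<longrightarrow> x = \<zero>\<^bsub>M\<^esub>)"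
      using * M M.carrier_is_submodule linear_closed[OF r]
      by (intro exI[of _ "carrier M"] exI[of _ n] exI[of _ \<psi>] conjI) simp_all
  qed
qed

lemma comodule_hom_iff:
  "f \<in> comodule_hom K E (M, \<rho>) (N, \<sigma>) \<longleftrightarrow> f \<in> extensional (carrier M) \<and> is_linear K M N f \<and>
    (\<forall>m\<in>carrier M. \<sigma> (f m) = tmap K M E N E f (\<lambda>h. h) (\<rho> m))"
  by (auto simp: comodule_hom_def lin_def)

text \<open>Firmness gives \<open>M = R M\<close>, and the elements of \<open>R\<close> are endomorphisms of finite rank, so that
  \<open>M\<close> is the sum of their finite-dimensional images, which are subcomodules.\<close>

lemma locally_finite_firm:
  assumes M: "module K M" and r: "is_linear K M (tens K M H) r"
    and firm: "is_firmly_projective K M (comodule_hom K H (M, r) (M, r))"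
  shows "locally_finite M r"
proof -
  obtain R \<phi> where R: "R \<subseteq> comodule_hom K H (M, r) (M, r)"
    and via: "is_firmly_projective_via K (endo_ring M R) M \<phi>"
    and act: "\<forall>f\<in>R. \<forall>m\<in>carrier M. elem_act K M (\<phi> f) m = f m"
    using firm[unfolded is_firmly_projective_def] by (elim exE conjE)
  have cR: "carrier (endo_ring M R) = R" by (simp add: endo_ring_def)
  have nr: "is_nonunital_ring (endo_ring M R)" and fm: "is_firm_module (endo_ring M R) M (\<lambda>f. elem_act K M (\<phi> f))"
    and hom: "\<phi> \<in> hom (add_monoid (endo_ring M R)) (add_monoid (tens K M (dual K M)))"
    using via by (auto simp: is_firmly_projective_via_def is_firm_ring_def)
  have \<phi>: "\<phi> f \<in> carrier (tens K M (dual K M))" if "f \<in> R" for f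
    using hom that by (auto simp: hom_def cR)
  have f: "is_linear K M M f" "\<And>m. m \<in> carrier M \<Longrightarrow> r (f m) = tmap K M H M H f (\<lambda>h. h) (r m)" if "f \<in> R" for f
    using R that by (auto simp: comodule_hom_iff)
  have "\<forall>f\<in>R. \<exists>S. finite S \<and> S \<subseteq> carrier M \<and>
    (\<forall>P. is_linear K M M P \<longrightarrow> (\<forall>s\<in>S. P s = s) \<longrightarrow> (\<forall>x\<in>carrier M. P (elem_act K M (\<phi> f) x) = elem_act K M (\<phi> f) x))"
    using finite_rank_elem_act[OF M \<phi>] by blast
  from bchoice[OF this] obtain T where T: "\<forall>f\<in>R. finite (T f) \<and> T f \<subseteq> carrier M \<and>
    (\<forall>P. is_linear K M M P \<longrightarrow> (\<forall>s\<in>T f. P s = s) \<longrightarrow> (\<forall>x\<in>carrier M. P (elem_act K M (\<phi> f) x) = elem_act K M (\<phi> f) x))" ..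
  show ?thesis
    unfolding locally_finite_def
  proof (intro ballI)
    fix m assume m: "m \<in> carrier M"
    from firm_generated[OF M nr fm m, unfolded cR] obtain F where F: "finite F" "F \<subseteq> R"
      "m \<in> span_of K M {elem_act K M (\<phi> f) x | f x. f \<in> F \<and> x \<in> carrier M}" by (elim exE conjE)
    let ?G = "{f x | f x. f \<in> F \<and> x \<in> carrier M}"
    have GG: "{elem_act K M (\<phi> f) x | f x. f \<in> F \<and> x \<in> carrier M} = ?G"
    proof (intro equalityI subsetI; elim CollectE exE conjE)
      fix y f x assume fx: "y = elem_act K M (\<phi> f) x" "f \<in> F" "x \<in> carrier M"
      then have "y = f x" using act F(2) by auto
      then show "y \<in> ?G" using fx(2,3) by (intro CollectI exI[of _ f] exI[of _ x] conjI)
    next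
      fix y f x assume fx: "y = f x" "f \<in> F" "x \<in> carrier M"
      then have "y = elem_act K M (\<phi> f) x" using act F(2) by auto
      then show "y \<in> {elem_act K M (\<phi> f) x | f x. f \<in> F \<and> x \<in> carrier M}"
        using fx(2,3) by (intro CollectI exI[of _ f] exI[of _ x] conjI)
    qed
    have GM: "?G \<subseteq> carrier M"
    proof (intro subsetI; elim CollectE exE conjE)
      fix y f x assume "y = f x" "f \<in> F" "x \<in> carrier M"
      then show "y \<in> carrier M" using linear_closed[OF f(1)] F(2) by auto
    qed
    have fT: "finite (\<Union>f\<in>F. T f)" "(\<Union>f\<in>F. T f) \<subseteq> carrier M" using T F by auto
    have "\<exists>n \<psi>. (\<forall>x\<in>span_of K M ?G. \<forall>\<phi>. functional H \<phi> \<longrightarrow> rslice M H \<phi> (r x) \<in> span_of K M ?G) \<and>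
      (\<forall>i<n::nat. functional M (\<psi> i)) \<and> (\<forall>x\<in>span_of K M ?G. (\<forall>i<n. \<psi> i x = \<zero>) \<longrightarrow> x = \<zero>\<^bsub>M\<^esub>)"
    proof (rule locally_finite_span[OF M r GM fT])
      show "P y = y" if P: "is_linear K M M P" "\<forall>s\<in>\<Union>f\<in>F. T f. P s = s" and y: "y \<in> ?G" for P y
      proof -
        obtain f x where fx: "y = f x" "f \<in> F" "x \<in> carrier M" using y by (elim CollectE exE conjE)
        have fR: "f \<in> R" using fx F(2) by blast
        have "\<forall>s\<in>T f. P s = s" using P(2) fx(2) by simp
        then have "P (elem_act K M (\<phi> f) x) = elem_act K M (\<phi> f) x" using T fR P(1) fx(3) by simp
        then show ?thesis using act fR fx by simp
      qed
      \<comment> \<open>Endomorphisms of the partial comodule commute with slices, so the images of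
        the elements of \<open>F\<close> are stable.\<close>
      show "rslice M H \<theta> (r y) \<in> ?G" if y: "y \<in> ?G" and \<theta>: "functional H \<theta>" for y \<theta>
      proof -
        obtain f x where fx: "y = f x" "f \<in> F" "x \<in> carrier M" using y by (elim CollectE exE conjE)
        have fR: "f \<in> R" using fx F(2) by blast
        have "rslice M H \<theta> (r y) = f (rslice M H \<theta> (r x))"
          unfolding fx(1) f(2)[OF fR fx(3)]
          by (rule rslice_tmap) (use M f(1)[OF fR] \<theta> linear_closed[OF r fx(3)] in auto)
        moreover have "rslice M H \<theta> (r x) \<in> carrier M" using M \<theta> linear_closed[OF r fx(3)] by simp
        ultimately show ?thesis
          using fx(2) by (intro CollectI exI[of _ f] exI[of _ "rslice M H \<theta> (r x)"] conjI)
      qed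
    qed
    then obtain n \<psi> where "\<forall>x\<in>span_of K M ?G. \<forall>\<phi>. functional H \<phi> \<longrightarrow> rslice M H \<phi> (r x) \<in> span_of K M ?G"
      "\<forall>i<n::nat. functional M (\<psi> i)" "\<forall>x\<in>span_of K M ?G. (\<forall>i<n. \<psi> i x = \<zero>) \<longrightarrow> x = \<zero>\<^bsub>M\<^esub>"
      by (elim exE conjE)
    then show "\<exists>U n \<psi>. submodule U K M \<and> m \<in> U \<and>
       (\<forall>x\<in>U. \<forall>\<phi>. functional H \<phi> \<longrightarrow> rslice M H \<phi> (r x) \<in> U) \<and>
       (\<forall>i<n::nat. functional M (\<psi> i)) \<and> (\<forall>x\<in>U. (\<forall>i<n. \<psi> i x = \<zero>) \<longrightarrow> x = \<zero>\<^bsub>M\<^esub>)"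
      using submodule_span_of[OF M GM] F(3)[unfolded GG]
      by (intro exI[of _ "span_of K M ?G"] exI[of _ n] exI[of _ \<psi>] conjI)
  qed
qed


subsection \<open>The functor to partial comodules\<close>

text \<open>Stated for an arbitrary class \<open>Obj\<close> of coactions, to cover comodules and
  partial comodules at once.\<close>

lemma comodule_hom_category:
  assumes E: "module K E" and Obj: "\<And>M \<rho>. (M, \<rho>) \<in> Obj \<Longrightarrow> module K M \<and> is_linear K M (tens K M E) \<rho>"
  shows "is_category \<lparr>Ob = Obj, Hom = comodule_hom K E, Idn = (\<lambda>X. \<lambda>x\<in>carrier (fst X). x),
    Cmp = (\<lambda>X Y Z g f. compose (carrier (fst X)) g f)\<rparr>"
proof -
  have id: "(\<lambda>x\<in>carrier M. x) \<in> comodule_hom K E (M, \<rho>) (M, \<rho>)" if X: "(M, \<rho>) \<in> Obj" for M \<rho>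
  proof -
    have M: "module K M" and \<rho>: "is_linear K M (tens K M E) \<rho>" using Obj[OF X] by auto
    have "tmap K M E M E (\<lambda>x\<in>carrier M. x) (\<lambda>h. h) = tmap K M E M E (\<lambda>x. x) (\<lambda>h. h)"
      by (rule tmap_cong) auto
    then show ?thesis
      using M E linear_restrict[OF linear_ident M] linear_closed[OF \<rho>] by (auto simp: comodule_hom_iff lin_def)
  qed
  have cmp: "compose (carrier M) g f \<in> comodule_hom K E (M, \<rho>) (L, \<tau>)"
    if X: "(M, \<rho>) \<in> Obj" "(N, \<sigma>) \<in> Obj" "(L, \<tau>) \<in> Obj"
      and f: "f \<in> comodule_hom K E (M, \<rho>) (N, \<sigma>)" and g: "g \<in> comodule_hom K E (N, \<sigma>) (L, \<tau>)"
    for M \<rho> N \<sigma> L \<tau> f g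
  proof -
    have mods: "module K M" "module K N" "module K L" and \<rho>: "is_linear K M (tens K M E) \<rho>"
      using Obj[OF X(1)] Obj[OF X(2)] Obj[OF X(3)] by auto
    have fl: "is_linear K M N f" and gl: "is_linear K N L g" using f g by (auto simp: comodule_hom_iff)
    have cl: "is_linear K M L (compose (carrier M) g f)"
      by (rule linear_cong[OF linear_comp[OF gl fl] mods(1)]) (simp add: compose_def)
    have "\<tau> (compose (carrier M) g f m) = tmap K M E L E (compose (carrier M) g f) (\<lambda>h. h) (\<rho> m)"
      if m: "m \<in> carrier M" for m
    proof -
      have "\<tau> (compose (carrier M) g f m) = tmap K N E L E g (\<lambda>h. h) (tmap K M E N E f (\<lambda>h. h) (\<rho> m))"
        using f g m linear_closed[OF fl m] by (simp add: comodule_hom_iff compose_def)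
      also have "\<dots> = tmap K M E L E (\<lambda>x. g (f x)) (\<lambda>h. h) (\<rho> m)"
        by (rule tmap_comp) (use mods E fl gl linear_closed[OF \<rho> m] in auto)
      also have "tmap K M E L E (\<lambda>x. g (f x)) (\<lambda>h. h) = tmap K M E L E (compose (carrier M) g f) (\<lambda>h. h)"
        by (rule tmap_cong) (simp_all add: compose_def)
      finally show ?thesis .
    qed
    then show ?thesis using cl by (simp add: comodule_hom_iff compose_extensional)
  qed
  have fnc: "f \<in> carrier (fst X) \<rightarrow> carrier (fst Y)" "f \<in> extensional (carrier (fst X))" if "f \<in> comodule_hom K E X Y" for f X Y
  proof -
    obtain M \<rho> N \<sigma> where XY: "X = (M, \<rho>)" "Y = (N, \<sigma>)" by (cases X, cases Y)
    have "is_linear K M N f" "f \<in> extensional (carrier M)" using that by (simp_all add: XY comodule_hom_iff)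
    then show "f \<in> carrier (fst X) \<rightarrow> carrier (fst Y)" "f \<in> extensional (carrier (fst X))"
      by (simp_all add: XY linear_closed)
  qed
  show ?thesis
    unfolding is_category_def
  proof (intro conjI ballI; simp only: cat.simps)
    show "(\<lambda>x\<in>carrier (fst X). x) \<in> comodule_hom K E X X" if "X \<in> Obj" for X
      using id that by (cases X) simp
    show "compose (carrier (fst X)) g f \<in> comodule_hom K E X Z"
      if "X \<in> Obj" "Y \<in> Obj" "Z \<in> Obj" "f \<in> comodule_hom K E X Y" "g \<in> comodule_hom K E Y Z" for X Y Z f g
      using cmp that by (cases X; cases Y; cases Z) simp
    show "compose (carrier (fst X)) f (\<lambda>x\<in>carrier (fst X). x) = f"
      "compose (carrier (fst X)) (\<lambda>x\<in>carrier (fst Y). x) f = f"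
      if "f \<in> comodule_hom K E X Y" for X Y f
      using fnc[OF that] by (auto intro: compose_Id Id_compose)
    show "compose (carrier (fst W)) h (compose (carrier (fst W)) g f) =
        compose (carrier (fst W)) (compose (carrier (fst X)) h g) f"
      if "f \<in> comodule_hom K E W X" for W X f g h
      using fnc(1)[OF that] by (rule compose_assoc)
  qed
qed

lemma comod_category: "is_category (comod_cat K D)"
  unfolding comod_cat_def
  by (rule comodule_hom_category) (auto simp: is_comodule_iff coaction_def)

lemma par_comod_category: "is_category (par_comod_cat K H)"
  unfolding par_comod_cat_def
  by (rule comodule_hom_category) (auto dest: partial_comoduleD)

lemma full_subcat_category: "is_category \<C> \<Longrightarrow> is_category (full_subcat \<C> P)"
  unfolding is_category_def full_subcat_def by simp

lemma Gamma_fob: "fob (Gamma K H C p) (M, \<rho>) = (M, ind M \<rho>)"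
  by (simp add: Gamma_def ind_def D_def)

text \<open>As \<open>Gamma\<close> is the identity on arrows, this equality of sets is full
  faithfulness. The inclusion with content is \<open>morphism_lift\<close>.\<close>

lemma Gamma_hom:
  assumes X: "is_comodule K D X" and Y: "is_comodule K D Y"
  shows "comodule_hom K H (fob (Gamma K H C p) X) (fob (Gamma K H C p) Y) = comodule_hom K D X Y"
proof -
  obtain M \<rho> N \<sigma> where XY: "X = (M, \<rho>)" "Y = (N, \<sigma>)" by (cases X, cases Y)
  have M: "coaction D M \<rho>" and N: "coaction D N \<sigma>" using X Y by (auto simp: XY is_comodule_iff)
  note Mp = coaction_props[OF M] and Np = coaction_props[OF N]
  have "f \<in> comodule_hom K H (M, ind M \<rho>) (N, ind N \<sigma>)" if f: "f \<in> comodule_hom K D (M, \<rho>) (N, \<sigma>)" for f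
  proof -
    have fl: "is_linear K M N f" using f by (simp add: comodule_hom_iff)
    have "ind N \<sigma> (f m) = tmap K M H N H f (\<lambda>h. h) (ind M \<rho> m)" if m: "m \<in> carrier M" for m
    proof -
      have "ind N \<sigma> (f m) = tmap K N D N H (\<lambda>x. x) p (tmap K M D N D f (\<lambda>h. h) (\<rho> m))"
        using f m linear_closed[OF fl m] by (simp add: comodule_hom_iff ind_def)
      also have "\<dots> = tmap K M D N H (\<lambda>x. f x) (\<lambda>h. p h) (\<rho> m)"
        by (rule tmap_comp) (use Mp Np fl pD_linear m in auto)
      also have "\<dots> = tmap K M H N H f (\<lambda>h. h) (tmap K M D M H (\<lambda>x. x) p (\<rho> m))"
        by (rule tmap_comp[symmetric]) (use Mp Np fl pD_linear m in auto)
      finally show ?thesis using m by (simp add: ind_def)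
    qed
    then show ?thesis using f by (simp add: comodule_hom_iff)
  qed
  moreover have "f \<in> comodule_hom K D (M, \<rho>) (N, \<sigma>)" if f: "f \<in> comodule_hom K H (M, ind M \<rho>) (N, ind N \<sigma>)" for f
    using f morphism_lift[OF M N] by (simp add: comodule_hom_iff)
  ultimately show ?thesis unfolding XY Gamma_fob by blast
qed

lemma Gamma_partial: "is_comodule K D X \<Longrightarrow> is_partial_comodule K H (fob (Gamma K H C p) X)"
  by (cases X) (auto simp: Gamma_fob is_comodule_iff intro: partial_comodule_ind)

lemma Gamma_farr: "farr (Gamma K H C p) X Y f = f"
  by (simp add: Gamma_def)

lemma Gamma_fst: "fst (fob (Gamma K H C p) X) = fst X"
  by (cases X) (simp add: Gamma_fob)

section \<open>The inverse of \<open>Gamma\<close> on locally finite objects\<close>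

text \<open>A preimage under \<open>Gamma\<close>, by \<open>Gamma_inj\<close> the only one whenever
  one exists. It inverts \<open>Gamma\<close> on objects and later serves as the universal element
  of the reconstruction.\<close>

definition hat :: "('k, 'm, 'h) comod \<Rightarrow> 'm \<Rightarrow> ('m, 'c) tensor"
  where "hat X = (SOME \<rho>. is_comodule K D (fst X, \<rho>) \<and> fob (Gamma K H C p) (fst X, \<rho>) = X)"

lemma hat:
  assumes "is_partial_comodule K H X" "locally_finite (fst X) (snd X)"
  shows "is_comodule K D (fst X, hat X)" "fob (Gamma K H C p) (fst X, hat X) = X"
proof -
  obtain M r where X: "X = (M, r)" by (cases X)
  obtain \<rho> where \<rho>: "coaction D M \<rho>" "\<rho> \<in> extensional (carrier M)" "ind M \<rho> = r"
    by (rule coaction_lift[of M r]) (use assms X in auto)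
  then have "\<exists>\<rho>. is_comodule K D (fst X, \<rho>) \<and> fob (Gamma K H C p) (fst X, \<rho>) = X"
    by (intro exI[of _ \<rho>]) (simp add: X is_comodule_iff Gamma_fob)
  from someI_ex[OF this] show "is_comodule K D (fst X, hat X)" "fob (Gamma K H C p) (fst X, hat X) = X"
    unfolding hat_def by blast+
qed

lemma Gamma_inj:
  assumes X: "is_comodule K D X" and Y: "is_comodule K D Y" and eq: "fob (Gamma K H C p) X = fob (Gamma K H C p) Y"
  shows "X = Y"
proof -
  obtain M \<rho> N \<sigma> where XY: "X = (M, \<rho>)" "Y = (N, \<sigma>)" by (cases X, cases Y)
  have MN: "M = N" and i: "ind M \<rho> = ind M \<sigma>" using eq by (auto simp: XY Gamma_fob)
  have "\<rho> = \<sigma>"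
  proof (rule extensionalityI)
    show "\<rho> \<in> extensional (carrier M)" "\<sigma> \<in> extensional (carrier M)" using X Y MN by (auto simp: XY is_comodule_iff)
    show "\<rho> m = \<sigma> m" if "m \<in> carrier M" for m
      using coaction_unique[OF _ _ i that] X Y MN by (auto simp: XY is_comodule_iff)
  qed
  then show ?thesis using MN XY by simp
qed

lemma Gamma_functor:
  assumes PQ: "\<And>X. is_comodule K D X \<Longrightarrow> P X \<Longrightarrow> Q (fob (Gamma K H C p) X)"
  shows "is_functor (full_subcat (comod_cat K D) P) (full_subcat (par_comod_cat K H) Q) (Gamma K H C p)"
  unfolding is_functor_def
  using full_subcat_category[OF comod_category] full_subcat_category[OF par_comod_category] PQ Gamma_partial
  by (auto simp: full_subcat_def comod_cat_def par_comod_cat_def Gamma_farr Gamma_hom Gamma_fst)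

text \<open>\<open>P\<close> and \<open>Q\<close> stand for the finiteness conditions on the two
  sides. Local finiteness supplies preimages, \<open>Gamma_inj\<close> makes them unique, and the
  equality of hom-sets lets the inverse functor be the identity on arrows.\<close>

lemma Gamma_iso:
  fixes P :: "('k, 'm, 'c) comod \<Rightarrow> bool" and Q :: "('k, 'm, 'h) comod \<Rightarrow> bool"
  assumes PQ: "\<And>X. is_comodule K D X \<Longrightarrow> P X \<longleftrightarrow> Q (fob (Gamma K H C p) X)"
    and lf: "\<And>X. is_partial_comodule K H X \<Longrightarrow> Q X \<Longrightarrow> locally_finite (fst X) (snd X)"
  shows "is_cat_iso (full_subcat (comod_cat K D) P) (full_subcat (par_comod_cat K H) Q) (Gamma K H C p)"
proof -
  let ?A = "full_subcat (comod_cat K D) P" and ?B = "full_subcat (par_comod_cat K H) Q"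
  define G :: "(('k, 'm, 'h) comod, 'm \<Rightarrow> 'm, ('k, 'm, 'c) comod, 'm \<Rightarrow> 'm) funct" where "G = \<lparr>fob = (\<lambda>X. (fst X, hat X)), farr = (\<lambda>X Y f. f)\<rparr>"
  have A: "X \<in> Ob ?A \<longleftrightarrow> is_comodule K D X \<and> P X" for X by (simp add: full_subcat_def comod_cat_def)
  have B: "X \<in> Ob ?B \<longleftrightarrow> is_partial_comodule K H X \<and> Q X" for X by (simp add: full_subcat_def par_comod_cat_def)
  have F: "is_functor ?A ?B (Gamma K H C p)" by (rule Gamma_functor) (use PQ in auto)
  have GX: "is_comodule K D (fob G X)" "fob (Gamma K H C p) (fob G X) = X" if "X \<in> Ob ?B" for X
    using hat[OF _ lf, of X] that unfolding B by (auto simp: G_def)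
  have GA: "fob G X \<in> Ob ?A" if "X \<in> Ob ?B" for X
    using GX[OF that] PQ[OF GX(1)[OF that]] that by (simp add: A B)
  have Hom: "Hom ?A = comodule_hom K D" "Hom ?B = comodule_hom K H"
    by (simp_all add: full_subcat_def comod_cat_def par_comod_cat_def)
  have GH: "Hom ?A (fob G X) (fob G Y) = Hom ?B X Y" if "X \<in> Ob ?B" "Y \<in> Ob ?B" for X Y
    using Gamma_hom[OF GX(1)[OF that(1)] GX(1)[OF that(2)]] GX(2)[OF that(1)] GX(2)[OF that(2)] by (simp add: Hom)
  have "is_functor ?B ?A G"
    unfolding is_functor_def
    using full_subcat_category[OF comod_category, of P] full_subcat_category[OF par_comod_category, of Q] GA GH
    by (auto simp: G_def full_subcat_def comod_cat_def par_comod_cat_def)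
  moreover have "fob G (fob (Gamma K H C p) X) = X" if "X \<in> Ob ?A" for X
  proof (rule Gamma_inj)
    have XB: "fob (Gamma K H C p) X \<in> Ob ?B" using F that unfolding is_functor_def by blast
    show "is_comodule K D (fob G (fob (Gamma K H C p) X))" by (rule GX(1)[OF XB])
    show "fob (Gamma K H C p) (fob G (fob (Gamma K H C p) X)) = fob (Gamma K H C p) X" by (rule GX(2)[OF XB])
    show "is_comodule K D X" using that A by simp
  qed
  ultimately show ?thesis
    unfolding is_cat_iso_def using F GX(2) by (intro conjI exI[of _ G]) (auto simp: G_def Gamma_farr)
qed

text \<open>Firm projectivity depends on the vector space and the endomorphism ring, and
  \<open>Gamma\<close> changes neither.\<close>

lemma Gamma_iso_f: "is_cat_iso (comod_cat_f K D) (par_comod_cat_f K H) (Gamma K H C p)"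
  unfolding comod_cat_f_def par_comod_cat_f_def
proof (rule Gamma_iso)
  show "is_firmly_projective K (fst X) (comodule_hom K D X X) \<longleftrightarrow>
      is_firmly_projective K (fst (fob (Gamma K H C p) X)) (comodule_hom K H (fob (Gamma K H C p) X) (fob (Gamma K H C p) X))"
    if "is_comodule K D X" for X
    using that by (simp add: Gamma_hom Gamma_fst)
  show "locally_finite (fst X) (snd X)"
    if "is_partial_comodule K H X" "is_firmly_projective K (fst X) (comodule_hom K H X X)" for X
    using that locally_finite_firm[of "fst X" "snd X"] partial_comoduleD[of "fst X" "snd X"] by simp
qed

lemma Gamma_iso_fd: "is_cat_iso (comod_cat_fd K D) (par_comod_cat_fd K H) (Gamma K H C p)"
  unfolding comod_cat_fd_def par_comod_cat_fd_def
proof (rule Gamma_iso)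
  show "locally_finite (fst X) (snd X)" if "is_partial_comodule K H X" "finite_dim K (fst X)" for X
    using that locally_finite_finite_dim[of "fst X" "snd X"] partial_comoduleD[of "fst X" "snd X"] by simp
qed (simp add: Gamma_fst)

lemma full_subcat_True: "full_subcat \<C> (\<lambda>_. True) = \<C>"
  by (simp add: full_subcat_def)

lemma Gamma_fully_faithful: "is_fully_faithful (comod_cat K D :: (('k, 'm, 'c) comod, 'm \<Rightarrow> 'm) cat) (par_comod_cat K H) (Gamma K H C p)"
  unfolding is_fully_faithful_def
proof (intro ballI)
  fix X Y :: "('k, 'm, 'c) comod" assume "X \<in> Ob (comod_cat K D)" "Y \<in> Ob (comod_cat K D)"
  then have "comodule_hom K H (fob (Gamma K H C p) X) (fob (Gamma K H C p) Y) = comodule_hom K D X Y"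
    by (intro Gamma_hom) (simp_all add: comod_cat_def)
  moreover have "farr (Gamma K H C p) X Y = id" by (simp add: Gamma_def fun_eq_iff)
  ultimately show "bij_betw (farr (Gamma K H C p) X Y) (Hom (comod_cat K D) X Y)
      (Hom (par_comod_cat K H) (fob (Gamma K H C p) X) (fob (Gamma K H C p) Y))"
    by (simp add: comod_cat_def par_comod_cat_def)
qed

end

subsection \<open>Tannaka reconstruction\<close>

context base_field
begin

lemma coaction_restrict:
  assumes D: "is_coalgebra K D" and M: "coaction D M \<rho>"
  shows "coaction D M (restrict \<rho> (carrier M))"
proof -
  note Mp = coaction_props[OF M]
  have "tmap K M D (tens K M D) D (restrict \<rho> (carrier M)) (\<lambda>d. d) = tmap K M D (tens K M D) D \<rho> (\<lambda>d. d)"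
    by (rule tmap_cong) simp_all
  then show ?thesis
    using M linear_restrict[OF Mp(2,1)] by (simp add: coaction_def lin_def)
qed

lemma finite_dim_basis:
  assumes "basis V {..<n::nat} b \<chi>"
  shows "finite_dim K V"
proof -
  note B = basis_props[OF assms]
  interpret V: module K V by (rule B(1))
  have sub: "b ` {..<n} \<subseteq> carrier V" using B(3) by auto
  note S = submodule_span_of[OF B(1) sub]
  have "x \<in> span_of K V (b ` {..<n})" if x: "x \<in> carrier V" for x
  proof -
    have "b i \<in> span_of K V (b ` {..<n})" if "i < n" for i
      using span_of_incl[of "b ` {..<n}" V] that by blast
    then have "(\<Oplus>\<^bsub>V\<^esub>i\<in>{..<n}. \<chi> i x \<odot>\<^bsub>V\<^esub> b i) \<in> span_of K V (b ` {..<n})"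
      using functional_closed[OF B(4) x] by (intro submodule_finsum[OF S B(1)] submodule_smult[OF S B(1)]) auto
    then show ?thesis using B(6)[OF x] by simp
  qed
  moreover have "span_of K V (b ` {..<n}) \<subseteq> carrier V" by (rule span_of_least[OF V.carrier_is_submodule sub])
  ultimately have "span_of K V (b ` {..<n}) = carrier V" by blast
  then show ?thesis unfolding finite_dim_def using sub by (intro exI[of _ "b ` {..<n}"]) simp
qed

text \<open>Objects of the comodule category are carried by \<open>'u\<close>, whereas
  \<open>D\<close> has its own type. A finite-dimensional right coideal containing \<open>S\<close>
  is therefore copied into \<open>'u\<close>, and \<open>\<beta>\<close> identifies the
  copy.\<close>

lemma regular_subcomodule:
  fixes \<iota> :: "'k list \<Rightarrow> 'u"
  assumes \<iota>: "inj_on \<iota> (lists (carrier K))" and D: "is_coalgebra K D" and S: "finite S" "S \<subseteq> carrier D"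
  obtains V :: "('k, 'u) module" and \<sigma> \<beta>
  where "coaction D V \<sigma>" "\<sigma> \<in> extensional (carrier V)" "finite_dim K V"
    "is_linear K V D \<beta>" "inj_on \<beta> (carrier V)"
    "\<forall>v\<in>carrier V. comult D (\<beta> v) = tmap K V D D D \<beta> (\<lambda>x. x) (\<sigma> v)" "S \<subseteq> \<beta> ` carrier V"
proof -
  note Dp = coalgebra_props[OF D]
  note [simp] = Dp(1)
  from coaction_finite[OF D Dp(4) S] obtain U m \<phi> where U: "submodule U K D" "S \<subseteq> U"
    "\<forall>x\<in>U. \<forall>\<psi>. functional D \<psi> \<longrightarrow> rslice D D \<psi> (comult D x) \<in> U"
    "\<forall>i<m::nat. functional D (\<phi> i)" "\<forall>x\<in>U. (\<forall>i<m. \<phi> i x = \<zero>) \<longrightarrow> x = \<zero>\<^bsub>D\<^esub>"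
    by (elim exE conjE)
  have "\<exists>n e \<psi>. frame D n e \<psi> \<and> (\<forall>i<n. e i \<in> U) \<and> (\<forall>x\<in>U. fproj D n e \<psi> x = x)"
    by (rule frame_of_separated[OF Dp(1) U(1), where n = m and \<phi> = \<phi>]) (use U(4,5) in auto)
  then obtain n e \<psi> where fr: "frame D n e \<psi>" "\<forall>i<n. e i \<in> U" "\<forall>x\<in>U. fproj D n e \<psi> x = x"
    by (elim exE conjE)
  note q = frame_props[OF fr(1)]
  have cf: "coframe D D (comult D) n e \<psi>"
    by (rule coframeI[OF Dp(1,1,2) fr(1), where U = U]) (use fr U(3) in auto)
  define c where "c i j = lslice D D (\<psi> i) (comult D (e j))" for i j
  have cm: "comatrix D n c" unfolding c_def by (rule comatrix_of_coframe[OF D Dp(4) cf])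
  have cc: "c i j \<in> carrier D" if "i < n" "j < n" for i j using comatrixD(1)[OF cm that] .
  have ce: "comult D (e j) = (\<Oplus>\<^bsub>tens K D D\<^esub>i\<in>{..<n}. pure K D D (e i) (c i j))" if "j < n" for j
    using cf that unfolding coframe_def c_def by blast
  define V :: "('k, 'u) module" where "V = umod \<iota> n ()"
  define b where "b i = \<iota> ((replicate n \<zero>)[i := \<one>])" for i
  define \<chi> where "\<chi> i x = inv_into (lists (carrier K)) \<iota> x ! i" for i x
  have bas: "basis V {..<n} b \<chi>" unfolding V_def b_def[abs_def] \<chi>_def[abs_def] by (rule umod_basis[OF \<iota>])
  note B = basis_props[OF bas]
  note [simp] = B(1)
  \<comment> \<open>The coaction on the copy has the coefficient matrix of the comultiplication on
    \<open>U\<close>.\<close>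
  define s where "s j = (\<Oplus>\<^bsub>tens K V D\<^esub>i\<in>{..<n}. pure K V D (b i) (c i j))" for j
  have sc: "s j \<in> carrier (tens K V D)" if "j < n" for j
    unfolding s_def by (rule module_finsum_closed) (use B(3) cc that in auto)
  define \<tau> where "\<tau> = basis_map (tens K V D) {..<n} \<chi> s"
  have \<tau>b: "\<tau> (b j) = s j" if "j < n" for j
    using that basis_map_basis[OF bas, of "tens K V D" s j] sc by (simp add: \<tau>_def)
  have \<tau>l: "is_linear K V (tens K V D) \<tau>"
    using basis_map_linear[OF bas, of "tens K V D" s] sc by (simp add: \<tau>_def)
  note mc = matrix_coaction[OF B(1) Dp(1) \<tau>l Dp(2,3) cm, where e = b, OF B(3) \<tau>b[unfolded s_def]]
  have co: "coaction D V \<tau>"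
    unfolding coaction_def
  proof (intro conjI ballI)
    fix x assume x: "x \<in> carrier V"
    show "tassoc K V D D (tmap K V D (tens K V D) D \<tau> (\<lambda>d. d) (\<tau> x)) = tmap K V D V (tens K D D) (\<lambda>m. m) (comult D) (\<tau> x)"
      by (rule basis_linear_eq[OF bas, where W = "tens K V (tens K D D)" and
            f = "\<lambda>x. tassoc K V D D (tmap K V D (tens K V D) D \<tau> (\<lambda>d. d) (\<tau> x))", OF _ _ _ _ x])
        (use mc(1) Dp(2) \<tau>l in \<open>auto intro!: linear_comp[OF tassoc_linear] linear_comp[OF tmap_linear]\<close>)
    show "rslice V D (counit D) (\<tau> x) = x"
      by (rule basis_linear_eq[OF bas, where W = V and f = "\<lambda>x. rslice V D (counit D) (\<tau> x)" and g = "\<lambda>x. x", OF _ _ _ _ x])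
        (use mc(2) Dp(3) \<tau>l in \<open>auto intro!: linear_comp[OF rslice_linear]\<close>)
  qed (use \<tau>l in auto)
  note co' = coaction_restrict[OF D co]
  define \<beta> where "\<beta> = basis_map D {..<n} \<chi> e"
  have \<beta>: "is_linear K V D \<beta>" "\<And>j. j < n \<Longrightarrow> \<beta> (b j) = e j"
    using basis_map_linear[OF bas Dp(1), of e] basis_map_basis[OF bas Dp(1), of e] q(1) by (simp_all add: \<beta>_def)
  \<comment> \<open>The inverse of \<open>\<beta>\<close> on \<open>U\<close>, read off from the
    dual functionals of the frame.\<close>
  define \<gamma> where "\<gamma> d = (\<Oplus>\<^bsub>V\<^esub>i\<in>{..<n}. \<psi> i d \<odot>\<^bsub>V\<^esub> b i)" for d
  have \<gamma>l: "is_linear K D V \<gamma>"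
    unfolding \<gamma>_def by (rule linear_finsum_map) (use q(2) B(3) in \<open>auto intro!: linear_functional_scale\<close>)
  have \<gamma>\<beta>: "\<gamma> (\<beta> v) = v" if v: "v \<in> carrier V" for v
  proof (rule basis_linear_eq[OF bas, where W = V and f = "\<lambda>v. \<gamma> (\<beta> v)" and g = "\<lambda>v. v", OF _ _ _ _ v])
    show "\<gamma> (\<beta> (b j)) = b j" if "j \<in> {..<n}" for j
      using that \<beta>(2) finsum_delta[of V j n b "\<lambda>i. \<psi> i (e j)"] q(3) B(3) by (simp add: \<gamma>_def)
  qed (auto intro: linear_comp[OF \<gamma>l \<beta>(1)])
  have \<beta>\<gamma>: "\<beta> (\<gamma> d) = d" if d: "d \<in> U" for d
  proof -
    have dD: "d \<in> carrier D" using d submodule_subset[OF U(1) Dp(1)] by blast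
    note fc = functional_closed[OF q(2) dD]
    have "\<beta> (\<gamma> d) = (\<Oplus>\<^bsub>D\<^esub>i\<in>{..<n}. \<beta> (\<psi> i d \<odot>\<^bsub>V\<^esub> b i))"
      unfolding \<gamma>_def by (rule linear_finsum[OF \<beta>(1)]) (use fc B(3) in auto)
    also have "\<dots> = (\<Oplus>\<^bsub>D\<^esub>i\<in>{..<n}. \<psi> i d \<odot>\<^bsub>D\<^esub> e i)"
      by (rule module_finsum_cong) (use fc B(3) q(1) linear_smult[OF \<beta>(1)] \<beta>(2) in auto)
    also have "\<dots> = d" using fr(3) d by (simp add: fproj_def)
    finally show ?thesis .
  qed
  have comp: "comult D (\<beta> v) = tmap K V D D D \<beta> (\<lambda>x. x) (\<tau> v)" if v: "v \<in> carrier V" for v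
  proof (rule basis_linear_eq[OF bas, where W = "tens K D D" and f = "\<lambda>v. comult D (\<beta> v)" and
        g = "\<lambda>v. tmap K V D D D \<beta> (\<lambda>x. x) (\<tau> v)", OF _ _ _ _ v])
    show "comult D (\<beta> (b j)) = tmap K V D D D \<beta> (\<lambda>x. x) (\<tau> (b j))" if "j \<in> {..<n}" for j
    proof -
      have j: "j < n" using that by simp
      have "tmap K V D D D \<beta> (\<lambda>x. x) (\<tau> (b j)) = (\<Oplus>\<^bsub>tens K D D\<^esub>i\<in>{..<n}. tmap K V D D D \<beta> (\<lambda>x. x) (pure K V D (b i) (c i j)))"
        unfolding \<tau>b[OF j] s_def by (rule linear_finsum[OF tmap_linear]) (use \<beta>(1) B(3) cc j in auto)
      also have "\<dots> = comult D (e j)"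
        unfolding ce[OF j] by (rule module_finsum_cong) (use \<beta> B(3) cc j q(1) in auto)
      finally show ?thesis using \<beta>(2)[OF j] by simp
    qed
  qed (use \<beta>(1) \<tau>l Dp(2) in \<open>auto intro!: linear_comp[OF Dp(2)] linear_comp[OF tmap_linear]\<close>)
  show ?thesis
  proof (rule that[of V "restrict \<tau> (carrier V)" \<beta>])
    show "coaction D V (restrict \<tau> (carrier V))" by (rule co')
    show "finite_dim K V" by (rule finite_dim_basis[OF bas])
    show "inj_on \<beta> (carrier V)" by (rule inj_on_inverseI[where g = \<gamma>]) (rule \<gamma>\<beta>)
    show "\<forall>v\<in>carrier V. comult D (\<beta> v) = tmap K V D D D \<beta> (\<lambda>x. x) (restrict \<tau> (carrier V) v)"
      using comp by simp
    show "S \<subseteq> \<beta> ` carrier V"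
    proof
      fix d assume "d \<in> S"
      then have d: "d \<in> U" using U(2) by blast
      then have "\<gamma> d \<in> carrier V" using submodule_subset[OF U(1) Dp(1)] linear_closed[OF \<gamma>l] by blast
      then have "\<beta> (\<gamma> d) \<in> \<beta> ` carrier V" by (rule imageI)
      then show "d \<in> \<beta> ` carrier V" by (simp add: \<beta>\<gamma>[OF d])
    qed
  qed (use \<beta>(1) in auto)
qed

section \<open>Values forced on coefficients by a natural transformation\<close>

lemma comod_cat_fd_simps:
  "(M, \<rho>) \<in> Ob (comod_cat_fd K D) \<longleftrightarrow> coaction D M \<rho> \<and> \<rho> \<in> extensional (carrier M) \<and> finite_dim K M"
  "Hom (comod_cat_fd K D) = comodule_hom K D"
  by (auto simp: comod_cat_fd_def full_subcat_def comod_cat_def is_comodule_iff)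

text \<open>For an object \<open>(M, \<rho>)\<close>, a functional \<open>f\<close> on \<open>M\<close> and \<open>m \<in> M\<close>, the map \<open>g : D \<rightarrow> W\<close>
  inducing \<open>\<alpha>\<close> must send the coefficient \<open>f(m\<^sub>(\<^sub>0\<^sub>)) m\<^sub>(\<^sub>1\<^sub>)\<close> to \<open>(f \<otimes> I)(\<alpha> m)\<close>.\<close>

definition coefficient_value :: "('k, 'd, 'x) coalgebra_scheme \<Rightarrow> ('k, 'w, 'y) module_scheme \<Rightarrow>
   (('k, 'u, 'd) comod \<Rightarrow> 'u \<Rightarrow> ('u, 'w) tensor) \<Rightarrow> 'd \<Rightarrow> 'w \<Rightarrow> bool"
  where "coefficient_value D W \<alpha> d w \<longleftrightarrow> (\<exists>M \<rho> f m. (M, \<rho>) \<in> Ob (comod_cat_fd K D) \<and> functional M f \<and>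
    m \<in> carrier M \<and> d = lslice M D f (\<rho> m) \<and> w = lslice M W f (\<alpha> (M, \<rho>) m))"

lemma nat_tensorD:
  assumes nat: "is_nat_tensor K \<C> forget W \<alpha>" and M: "(M, \<rho>) \<in> Ob \<C>"
  shows "is_linear K M (tens K M W) (\<alpha> (M, \<rho>))"
    and "\<And>N \<sigma> f x. (N, \<sigma>) \<in> Ob \<C> \<Longrightarrow> f \<in> Hom \<C> (M, \<rho>) (N, \<sigma>) \<Longrightarrow> x \<in> carrier M \<Longrightarrow>
      \<alpha> (N, \<sigma>) (f x) = tmap K M W N W f (\<lambda>w. w) (\<alpha> (M, \<rho>) x)"
  using nat M unfolding is_nat_tensor_def forget_def by (force simp: lin_def)+

text \<open>Taking coefficients along \<open>f\<close> is a comodule morphism from \<open>M\<close>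
  into the copy \<open>V\<close> of a subcomodule of \<open>D\<close>. Naturality along it expresses
  the value through \<open>V\<close> and the coefficient alone.\<close>

lemma coefficient_value_transfer:
  fixes \<alpha> :: "('k, 'u, 'd) comod \<Rightarrow> 'u \<Rightarrow> ('u, 'w) tensor"
  assumes D: "is_coalgebra K D" and W: "module K W" and nat: "is_nat_tensor K (comod_cat_fd K D) forget W \<alpha>"
    and M: "(M, \<rho>) \<in> Ob (comod_cat_fd K D)" and f: "functional M f"
    and V: "(V, \<sigma>) \<in> Ob (comod_cat_fd K D)" and \<beta>: "is_linear K V D \<beta>" "inj_on \<beta> (carrier V)"
    and comp: "\<And>v. v \<in> carrier V \<Longrightarrow> comult D (\<beta> v) = tmap K V D D D \<beta> (\<lambda>x. x) (\<sigma> v)"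
    and range: "\<And>x. x \<in> carrier M \<Longrightarrow> lslice M D f (\<rho> x) \<in> \<beta> ` carrier V"
    and m: "m \<in> carrier M"
  shows "lslice M W f (\<alpha> (M, \<rho>) m) =
    lslice V W (\<lambda>v. counit D (\<beta> v)) (\<alpha> (V, \<sigma>) (inv_into (carrier V) \<beta> (lslice M D f (\<rho> m))))"
proof -
  note Dp = coalgebra_props[OF D]
  have Mc: "coaction D M \<rho>" and Vc: "coaction D V \<sigma>" using M V by (auto simp: comod_cat_fd_simps)
  note Mp = coaction_props[OF Mc] and Vp = coaction_props[OF Vc]
  note [simp] = Dp(1) Mp(1) Vp(1) W
  define \<gamma> where "\<gamma> = (\<lambda>x\<in>carrier M. inv_into (carrier V) \<beta> (lslice M D f (\<rho> x)))"
  have \<gamma>: "\<gamma> x \<in> carrier V" "\<beta> (\<gamma> x) = lslice M D f (\<rho> x)" if "x \<in> carrier M" for x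
    using range[OF that] that by (simp_all add: \<gamma>_def inv_into_into f_inv_into_f)
  note cl = coefficient_linear[OF D Mc f]
  have \<gamma>l: "is_linear K M V \<gamma>"
  proof (rule is_linearI)
    show "\<gamma> (x \<oplus>\<^bsub>M\<^esub> y) = \<gamma> x \<oplus>\<^bsub>V\<^esub> \<gamma> y" if "x \<in> carrier M" "y \<in> carrier M" for x y
      by (rule inj_onD[OF \<beta>(2)]) (use that \<gamma> linear_add[OF cl] linear_add[OF \<beta>(1)] in auto)
    show "\<gamma> (a \<odot>\<^bsub>M\<^esub> x) = a \<odot>\<^bsub>V\<^esub> \<gamma> x" if "a \<in> carrier K" "x \<in> carrier M" for a x
      by (rule inj_onD[OF \<beta>(2)]) (use that \<gamma> linear_smult[OF cl] linear_smult[OF \<beta>(1)] in auto)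
  qed (rule \<gamma>(1))
  \<comment> \<open>Colinearity of \<open>\<gamma>\<close>, tested after the injective map
    \<open>\<beta> \<otimes> I\<close>.\<close>
  have "\<sigma> (\<gamma> x) = tmap K M D V D \<gamma> (\<lambda>h. h) (\<rho> x)" if x: "x \<in> carrier M" for x
  proof (rule inj_onD[OF tmap_inj[OF Vp(1) Dp(1) Dp(1) Dp(1) \<beta> linear_ident inj_on_id2]])
    have "tmap K V D D D \<beta> (\<lambda>x. x) (\<sigma> (\<gamma> x)) = tmap K M D D D (\<lambda>x. lslice M D f (\<rho> x)) (\<lambda>x. x) (\<rho> x)"
      using comp[OF \<gamma>(1)[OF x]] comult_coefficient[OF D Mc f x] \<gamma>(2)[OF x] by simp
    also have "tmap K M D D D (\<lambda>x. lslice M D f (\<rho> x)) (\<lambda>x. x) = tmap K M D D D (\<lambda>x. \<beta> (\<gamma> x)) (\<lambda>x. x)"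
      by (rule tmap_cong) (simp_all add: \<gamma>(2))
    also have "\<dots> (\<rho> x) = tmap K V D D D \<beta> (\<lambda>x. x) (tmap K M D V D \<gamma> (\<lambda>h. h) (\<rho> x))"
      by (rule tmap_comp[symmetric]) (use \<gamma>l \<beta>(1) Mp(5)[OF x] in auto)
    finally show "tmap K V D D D \<beta> (\<lambda>x. x) (\<sigma> (\<gamma> x)) = tmap K V D D D \<beta> (\<lambda>x. x) (tmap K M D V D \<gamma> (\<lambda>h. h) (\<rho> x))" .
  qed (use x \<gamma>(1) \<gamma>l Mp(5) Vp(5) in auto)
  then have "\<gamma> \<in> Hom (comod_cat_fd K D) (M, \<rho>) (V, \<sigma>)"
    using \<gamma>l unfolding comod_cat_fd_simps comodule_hom_def lin_def by (simp add: \<gamma>_def)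
  note n = nat_tensorD(2)[OF nat M V this m]
  have \<epsilon>: "functional V (\<lambda>v. counit D (\<beta> v))" by (rule functional_comp[OF Dp(3) \<beta>(1)])
  have \<alpha>: "\<alpha> (M, \<rho>) m \<in> carrier (tens K M W)" by (rule linear_closed[OF nat_tensorD(1)[OF nat M] m])
  have "lslice V W (\<lambda>v. counit D (\<beta> v)) (\<alpha> (V, \<sigma>) (\<gamma> m)) = lslice M W (\<lambda>x. counit D (\<beta> (\<gamma> x))) (\<alpha> (M, \<rho>) m)"
    unfolding n by (rule lslice_tmap) (use \<gamma>l \<epsilon> \<alpha> in auto)
  \<comment> \<open>The counit of a coefficient along \<open>f\<close> is the value of
    \<open>f\<close>, so the counit on \<open>V\<close> pulls back to \<open>f\<close> along
    \<open>\<gamma>\<close>.\<close>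
  also have "lslice M W (\<lambda>x. counit D (\<beta> (\<gamma> x))) = lslice M W f"
    unfolding lslice_def by (rule tlift_cong) (simp add: \<gamma>(2) counit_coefficient[OF D Mc f])
  finally show ?thesis using m by (simp add: \<gamma>_def)
qed

text \<open>Both presentations of \<open>d\<close> are transferred to one \<open>V\<close>
  containing all the coefficients involved, where the value is the same expression in
  \<open>d\<close>.\<close>

lemma coefficient_value_unique:
  fixes \<alpha> :: "('k, 'u, 'd) comod \<Rightarrow> 'u \<Rightarrow> ('u, 'w) tensor" and \<iota> :: "'k list \<Rightarrow> 'u"
  assumes \<iota>: "inj_on \<iota> (lists (carrier K))" and D: "is_coalgebra K D" and W: "module K W"
    and nat: "is_nat_tensor K (comod_cat_fd K D) forget W \<alpha>"
    and w: "coefficient_value D W \<alpha> d w" "coefficient_value D W \<alpha> d w'"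
  shows "w = w'"
proof -
  note Dp = coalgebra_props[OF D]
  obtain M \<rho> f m where 1: "(M, \<rho>) \<in> Ob (comod_cat_fd K D)" "functional M f" "m \<in> carrier M"
    "d = lslice M D f (\<rho> m)" "w = lslice M W f (\<alpha> (M, \<rho>) m)"
    using w(1) unfolding coefficient_value_def by (elim exE conjE)
  obtain N \<tau> h n where 2: "(N, \<tau>) \<in> Ob (comod_cat_fd K D)" "functional N h" "n \<in> carrier N"
    "d = lslice N D h (\<tau> n)" "w' = lslice N W h (\<alpha> (N, \<tau>) n)"
    using w(2) unfolding coefficient_value_def by (elim exE conjE)
  have Mc: "coaction D M \<rho>" "finite_dim K M" and Nc: "coaction D N \<tau>" "finite_dim K N"
    using 1(1) 2(1) by (auto simp: comod_cat_fd_simps)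
  obtain A where A: "finite A" "A \<subseteq> carrier M" "span_of K M A = carrier M" using Mc(2) by (auto simp: finite_dim_def)
  obtain B where B: "finite B" "B \<subseteq> carrier N" "span_of K N B = carrier N" using Nc(2) by (auto simp: finite_dim_def)
  note lM = coefficient_linear[OF D Mc(1) 1(2)] and lN = coefficient_linear[OF D Nc(1) 2(2)]
  obtain V :: "('k, 'u) module" and \<sigma> \<beta> where V: "coaction D V \<sigma>" "\<sigma> \<in> extensional (carrier V)" "finite_dim K V"
    "is_linear K V D \<beta>" "inj_on \<beta> (carrier V)"
    "\<forall>v\<in>carrier V. comult D (\<beta> v) = tmap K V D D D \<beta> (\<lambda>x. x) (\<sigma> v)"
    and sub: "(\<lambda>x. lslice M D f (\<rho> x)) ` A \<union> (\<lambda>x. lslice N D h (\<tau> x)) ` B \<subseteq> \<beta> ` carrier V"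
  proof (rule regular_subcomodule[OF \<iota> D])
    show "finite ((\<lambda>x. lslice M D f (\<rho> x)) ` A \<union> (\<lambda>x. lslice N D h (\<tau> x)) ` B)" using A B by simp
    show "(\<lambda>x. lslice M D f (\<rho> x)) ` A \<union> (\<lambda>x. lslice N D h (\<tau> x)) ` B \<subseteq> carrier D"
      using A(2) B(2) linear_closed[OF lM] linear_closed[OF lN] by blast
  qed
  have VO: "(V, \<sigma>) \<in> Ob (comod_cat_fd K D)" using V by (simp add: comod_cat_fd_simps)
  note Vm = coaction_props(1)[OF V(1)]
  interpret V: module K V by (rule Vm)
  note im = submodule_image[OF Vm Dp(1) V(4) V.carrier_is_submodule]
  \<comment> \<open>The coefficients of a spanning set suffice to put all coefficients into the
    image of \<open>\<beta>\<close>.\<close>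
  have "span_of K M A \<subseteq> {x \<in> carrier M. lslice M D f (\<rho> x) \<in> \<beta> ` carrier V}"
    by (rule span_of_least[OF submodule_preimage[OF coaction_props(1)[OF Mc(1)] Dp(1) lM im]]) (use A(2) sub in auto)
  then have rM: "lslice M D f (\<rho> x) \<in> \<beta> ` carrier V" if "x \<in> carrier M" for x using that unfolding A(3) by blast
  have "span_of K N B \<subseteq> {x \<in> carrier N. lslice N D h (\<tau> x) \<in> \<beta> ` carrier V}"
    by (rule span_of_least[OF submodule_preimage[OF coaction_props(1)[OF Nc(1)] Dp(1) lN im]]) (use B(2) sub in auto)
  then have rN: "lslice N D h (\<tau> x) \<in> \<beta> ` carrier V" if "x \<in> carrier N" for x using that unfolding B(3) by blast
  have cV: "comult D (\<beta> v) = tmap K V D D D \<beta> (\<lambda>x. x) (\<sigma> v)" if "v \<in> carrier V" for v using V(6) that by simp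
  show "w = w'"
    using coefficient_value_transfer[OF D W nat 1(1,2) VO V(4,5) cV rM 1(3)]
      coefficient_value_transfer[OF D W nat 2(1,2) VO V(4,5) cV rN 2(3)] 1(4,5) 2(4,5) by simp
qed

text \<open>Every element of a subcomodule of \<open>D\<close> is its own coefficient along the
  counit, so there a value exists and depends linearly on the element. Totality and linearity of the
  map in \<open>tannaka_universal\<close> come from this.\<close>

lemma coefficient_value_linear:
  fixes \<alpha> :: "('k, 'u, 'd) comod \<Rightarrow> 'u \<Rightarrow> ('u, 'w) tensor" and \<iota> :: "'k list \<Rightarrow> 'u"
  assumes \<iota>: "inj_on \<iota> (lists (carrier K))" and D: "is_coalgebra K D" and W: "module K W"
    and nat: "is_nat_tensor K (comod_cat_fd K D) forget W \<alpha>" and S: "finite S" "S \<subseteq> carrier D"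
  obtains V :: "('k, 'u) module" and \<beta> l
  where "module K V" "is_linear K V D \<beta>" "is_linear K V W l" "S \<subseteq> \<beta> ` carrier V"
    "\<forall>v\<in>carrier V. coefficient_value D W \<alpha> (\<beta> v) (l v)"
proof -
  note Dp = coalgebra_props[OF D]
  obtain V :: "('k, 'u) module" and \<sigma> \<beta> where V: "coaction D V \<sigma>" "\<sigma> \<in> extensional (carrier V)" "finite_dim K V"
    "is_linear K V D \<beta>" "inj_on \<beta> (carrier V)"
    "\<forall>v\<in>carrier V. comult D (\<beta> v) = tmap K V D D D \<beta> (\<lambda>x. x) (\<sigma> v)" "S \<subseteq> \<beta> ` carrier V"
    by (rule regular_subcomodule[OF \<iota> D S])
  note Vp = coaction_props[OF V(1)]
  note [simp] = Dp(1) W Vp(1)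
  have VO: "(V, \<sigma>) \<in> Ob (comod_cat_fd K D)" using V by (simp add: comod_cat_fd_simps)
  have \<epsilon>: "functional V (\<lambda>v. counit D (\<beta> v))" by (rule functional_comp[OF Dp(3) V(4)])
  have c: "\<beta> v = lslice V D (\<lambda>v. counit D (\<beta> v)) (\<sigma> v)" if v: "v \<in> carrier V" for v
  proof -
    have "\<beta> v = lslice D D (counit D) (tmap K V D D D \<beta> (\<lambda>x. x) (\<sigma> v))"
      using Dp(5)[OF linear_closed[OF V(4) v]] V(6) v by simp
    also have "\<dots> = lslice V D (\<lambda>v. counit D (\<beta> v)) (\<sigma> v)"
      by (rule lslice_tmap) (use V(4) Dp(3) Vp(5)[OF v] in auto)
    finally show ?thesis .
  qed
  show ?thesis
  proof (rule that[of V \<beta> "\<lambda>v. lslice V W (\<lambda>v. counit D (\<beta> v)) (\<alpha> (V, \<sigma>) v)"])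
    show "is_linear K V W (\<lambda>v. lslice V W (\<lambda>v. counit D (\<beta> v)) (\<alpha> (V, \<sigma>) v))"
      by (rule linear_comp[OF lslice_linear nat_tensorD(1)[OF nat VO]]) (use \<epsilon> in auto)
    show "\<forall>v\<in>carrier V. coefficient_value D W \<alpha> (\<beta> v) (lslice V W (\<lambda>v. counit D (\<beta> v)) (\<alpha> (V, \<sigma>) v))"
    proof
      fix v assume v: "v \<in> carrier V"
      show "coefficient_value D W \<alpha> (\<beta> v) (lslice V W (\<lambda>v. counit D (\<beta> v)) (\<alpha> (V, \<sigma>) v))"
        unfolding coefficient_value_def
        by (intro exI[of _ V] exI[of _ \<sigma>] exI[of _ "\<lambda>v. counit D (\<beta> v)"] exI[of _ v] conjI VO \<epsilon> v c refl)
    qed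
  qed (use V in auto)
qed

text \<open>Linearity of \<open>g\<close> is checked by placing two elements in one copied
  subcomodule, where the values are given by a linear map; uniqueness holds since every element of
  \<open>D\<close> is a coefficient.\<close>

lemma tannaka_universal:
  fixes \<alpha> :: "('k, 'u, 'd) comod \<Rightarrow> 'u \<Rightarrow> ('u, 'w) tensor" and \<iota> :: "'k list \<Rightarrow> 'u"
  assumes \<iota>: "inj_on \<iota> (lists (carrier K))" and D: "is_coalgebra K D" and W: "module K W"
    and nat: "is_nat_tensor K (comod_cat_fd K D) forget W \<alpha>"
  shows "\<exists>!g. g \<in> lin K D W \<and> (\<forall>X\<in>Ob (comod_cat_fd K D). \<forall>x\<in>carrier (fst X).
    \<alpha> X x = tmap K (fst X) D (fst X) W (\<lambda>x. x) g (snd X x))"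
proof -
  note Dp = coalgebra_props[OF D]
  note uni = coefficient_value_unique[OF \<iota> D W nat]
  \<comment> \<open>The choice is forced: \<open>coefficient_value_unique\<close> leaves one
    possible value.\<close>
  define g where "g = (\<lambda>d\<in>carrier D. SOME w. coefficient_value D W \<alpha> d w)"
  have g: "g d = w" if "d \<in> carrier D" "coefficient_value D W \<alpha> d w" for d w
    using uni[OF someI[of "coefficient_value D W \<alpha> d", OF that(2)] that(2)] that(1) by (simp add: g_def)
  have gl: "is_linear K D W g"
  proof (rule is_linearI)
    fix d e assume de: "d \<in> carrier D" "e \<in> carrier D"
    have S: "finite {d, e}" "{d, e} \<subseteq> carrier D" using de by auto
    obtain V :: "('k, 'u) module" and \<beta> l where V: "module K V" "is_linear K V D \<beta>" "is_linear K V W l"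
      "{d, e} \<subseteq> \<beta> ` carrier V" "\<forall>v\<in>carrier V. coefficient_value D W \<alpha> (\<beta> v) (l v)"
      by (rule coefficient_value_linear[OF \<iota> D W nat S])
    have gb: "g (\<beta> v) = l v" if "v \<in> carrier V" for v using g[of "\<beta> v" "l v"] linear_closed[OF V(2) that] V(5) that by blast
    obtain x y where xy: "x \<in> carrier V" "y \<in> carrier V" "d = \<beta> x" "e = \<beta> y" using V(4) by auto
    show "g d \<in> carrier W" using gb xy linear_closed[OF V(3)] by simp
    have "d \<oplus>\<^bsub>D\<^esub> e = \<beta> (x \<oplus>\<^bsub>V\<^esub> y)" using xy linear_add[OF V(2)] by simp
    then show "g (d \<oplus>\<^bsub>D\<^esub> e) = g d \<oplus>\<^bsub>W\<^esub> g e" using gb xy V(1) linear_add[OF V(3)] by simp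
    fix a assume a: "a \<in> carrier K"
    have "a \<odot>\<^bsub>D\<^esub> d = \<beta> (a \<odot>\<^bsub>V\<^esub> x)" using a xy linear_smult[OF V(2)] by simp
    then show "g (a \<odot>\<^bsub>D\<^esub> d) = a \<odot>\<^bsub>W\<^esub> g d" using a gb xy V(1) linear_smult[OF V(3)] by simp
  qed
  show ?thesis
  proof (rule ex1I[of _ g])
    have "\<alpha> (M, \<rho>) x = tmap K M D M W (\<lambda>x. x) g (\<rho> x)"
      if M: "(M, \<rho>) \<in> Ob (comod_cat_fd K D)" and x: "x \<in> carrier M" for M \<rho> x
    proof -
      have Mc: "coaction D M \<rho>" using M by (auto simp: comod_cat_fd_simps)
      note Mp = coaction_props[OF Mc]
      show ?thesis
      proof (rule tens_eqI_lslice[OF Mp(1) W])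
        show "\<alpha> (M, \<rho>) x \<in> carrier (tens K M W)" by (rule linear_closed[OF nat_tensorD(1)[OF nat M] x])
        show "tmap K M D M W (\<lambda>x. x) g (\<rho> x) \<in> carrier (tens K M W)" using Mp Dp(1) W gl x by auto
        fix f assume f: "functional M f"
        have "coefficient_value D W \<alpha> (lslice M D f (\<rho> x)) (lslice M W f (\<alpha> (M, \<rho>) x))"
          unfolding coefficient_value_def
          by (intro exI[of _ M] exI[of _ \<rho>] exI[of _ f] exI[of _ x] conjI M f x refl)
        then have "lslice M W f (\<alpha> (M, \<rho>) x) = g (lslice M D f (\<rho> x))"
          using g linear_closed[OF coefficient_linear[OF D Mc f] x] by simp
        also have "\<dots> = lslice M W f (tmap K M D M W (\<lambda>x. x) g (\<rho> x))"
          by (rule lslice_tmap[symmetric]) (use Mp Dp(1) W gl x f in auto)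
        finally show "lslice M W f (\<alpha> (M, \<rho>) x) = lslice M W f (tmap K M D M W (\<lambda>x. x) g (\<rho> x))" .
      qed
    qed
    then show "g \<in> lin K D W \<and> (\<forall>X\<in>Ob (comod_cat_fd K D). \<forall>x\<in>carrier (fst X).
        \<alpha> X x = tmap K (fst X) D (fst X) W (\<lambda>x. x) g (snd X x))"
      using gl by (auto simp: lin_def g_def)
  next
    fix g' assume g': "g' \<in> lin K D W \<and> (\<forall>X\<in>Ob (comod_cat_fd K D). \<forall>x\<in>carrier (fst X).
        \<alpha> X x = tmap K (fst X) D (fst X) W (\<lambda>x. x) g' (snd X x))"
    then have gl': "is_linear K D W g'" by (simp add: lin_def)
    show "g' = g"
    proof (rule extensionalityI)
      show "g' \<in> extensional (carrier D)" "g \<in> extensional (carrier D)" using g' by (auto simp: lin_def g_def)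
      fix d assume d: "d \<in> carrier D"
      have S: "finite {d}" "{d} \<subseteq> carrier D" using d by auto
      obtain V :: "('k, 'u) module" and \<beta> l where V: "{d} \<subseteq> \<beta> ` carrier V"
        "\<forall>v\<in>carrier V. coefficient_value D W \<alpha> (\<beta> v) (l v)"
        by (rule coefficient_value_linear[OF \<iota> D W nat S])
      then obtain w where w: "coefficient_value D W \<alpha> d w" by auto
      then obtain M \<rho> f m where M: "(M, \<rho>) \<in> Ob (comod_cat_fd K D)" "functional M f" "m \<in> carrier M"
        "d = lslice M D f (\<rho> m)" "w = lslice M W f (\<alpha> (M, \<rho>) m)"
        unfolding coefficient_value_def by (elim exE conjE)
      have Mc: "coaction D M \<rho>" using M(1) by (auto simp: comod_cat_fd_simps)
      note Mp = coaction_props[OF Mc]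
      have "\<alpha> (M, \<rho>) m = tmap K M D M W (\<lambda>x. x) g' (\<rho> m)" using g' M(1,3) by fastforce
      then have "w = lslice M W f (tmap K M D M W (\<lambda>x. x) g' (\<rho> m))" using M(5) by simp
      also have "\<dots> = g' (lslice M D f (\<rho> m))"
        by (rule lslice_tmap) (use Mp Dp(1) W gl' M(2,3) in auto)
      finally show "g' d = g d" using g[OF d w] M(4) by simp
    qed
  qed
qed

end

context hopf_cofree
begin

section \<open>Transporting the universal property along \<open>Gamma\<close>\<close>

lemma Gamma_fd_ob: "X \<in> Ob (comod_cat_fd K D) \<Longrightarrow> fob (Gamma K H C p) X \<in> Ob (par_comod_cat_fd K H)"
  by (simp add: comod_cat_fd_def par_comod_cat_fd_def full_subcat_def comod_cat_def par_comod_cat_def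
      Gamma_partial Gamma_fst)

lemma hat_fd:
  assumes "X \<in> Ob (par_comod_cat_fd K H)"
  shows "(fst X, hat X) \<in> Ob (comod_cat_fd K D)" "fob (Gamma K H C p) (fst X, hat X) = X"
proof -
  have X: "is_partial_comodule K H X" "finite_dim K (fst X)"
    using assms by (simp_all add: par_comod_cat_fd_def full_subcat_def par_comod_cat_def)
  then have "locally_finite (fst X) (snd X)"
    using locally_finite_finite_dim[of "fst X" "snd X"] partial_comoduleD[of "fst X" "snd X"] by simp
  note h = hat[OF X(1) this]
  show "(fst X, hat X) \<in> Ob (comod_cat_fd K D)" using h(1) X(2)
    by (simp add: comod_cat_fd_def full_subcat_def comod_cat_def)
  show "fob (Gamma K H C p) (fst X, hat X) = X" by (rule h(2))
qed

lemma hat_Gamma: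
  assumes X: "X \<in> Ob (comod_cat_fd K D)"
  shows "hat (fob (Gamma K H C p) X) = snd X"
proof -
  note h = hat_fd[OF Gamma_fd_ob[OF X]]
  have "(fst (fob (Gamma K H C p) X), hat (fob (Gamma K H C p) X)) = X"
    by (rule Gamma_inj) (use h X in \<open>simp_all add: comod_cat_fd_def full_subcat_def comod_cat_def\<close>)
  then show ?thesis by (metis snd_conv)
qed

lemma Gamma_fd_hom:
  assumes "X \<in> Ob (comod_cat_fd K D)" "Y \<in> Ob (comod_cat_fd K D)"
  shows "Hom (par_comod_cat_fd K H) (fob (Gamma K H C p) X) (fob (Gamma K H C p) Y) = Hom (comod_cat_fd K D) X Y"
  using Gamma_hom[of X Y] assms
  by (simp add: comod_cat_fd_def par_comod_cat_fd_def full_subcat_def comod_cat_def par_comod_cat_def)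

lemma forget_functor:
  "is_functor (par_comod_cat_fd K H :: (('k, 'm, 'h) comod, 'm \<Rightarrow> 'm) cat) (vect_cat K) forget"
proof -
  have "is_category (vect_cat K :: (('k, 'm) module, 'm \<Rightarrow> 'm) cat)"
    unfolding is_category_def vect_cat_def
  proof (intro conjI ballI; simp only: cat.simps mem_Collect_eq)
    show "(\<lambda>x\<in>carrier V. x) \<in> lin K V V" if "module K V" for V :: "('k, 'm) module"
      using linear_restrict[OF linear_ident that] .
    show "compose (carrier U) g f \<in> lin K U W" if "module K U" "f \<in> lin K U V" "g \<in> lin K V W"
      for U V W :: "('k, 'm) module" and f g
      using linear_restrict[OF linear_comp[of V W g U f] that(1)] that(2,3) by (simp add: lin_def compose_def)
    show "compose (carrier V) f (\<lambda>x\<in>carrier V. x) = f" "compose (carrier V) (\<lambda>x\<in>carrier W. x) f = f"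
      if "f \<in> lin K V W" for V W :: "('k, 'm) module" and f
      using that linear_closed[of V W f] by (auto simp: lin_def intro!: compose_Id Id_compose)
    show "compose (carrier W) h (compose (carrier W) g f) = compose (carrier W) (compose (carrier X) h g) f"
      if "f \<in> lin K W X" for W X :: "('k, 'm) module" and f g h
      using that linear_closed[of W X f] by (intro compose_assoc) (auto simp: lin_def)
  qed
  moreover have "f \<in> lin K (fst X) (fst Y)" if "f \<in> comodule_hom K H X Y" for f and X Y :: "('k, 'm, 'h) comod"
    using that by (cases X, cases Y) (simp add: comodule_hom_def)
  moreover have "module K (fst X)" if "is_partial_comodule K H X" for X :: "('k, 'm, 'h) comod"
    using partial_comoduleD(1)[of "fst X" "snd X"] that by simp
  moreover have "is_category (par_comod_cat_fd K H :: (('k, 'm, 'h) comod, 'm \<Rightarrow> 'm) cat)"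
    unfolding par_comod_cat_fd_def by (rule full_subcat_category[OF par_comod_category])
  ultimately show ?thesis
    by (simp add: is_functor_def forget_def par_comod_cat_fd_def full_subcat_def par_comod_cat_def vect_cat_def)
qed

text \<open>Composition of a natural transformation with \<open>Gamma\<close>, which changes neither
  the underlying spaces nor the arrows.\<close>

lemma nat_tensor_Gamma:
  fixes \<alpha> :: "('k, 'm, 'h) comod \<Rightarrow> 'm \<Rightarrow> ('m, 'w) tensor"
  assumes nat: "is_nat_tensor K (par_comod_cat_fd K H) forget W \<alpha>"
  shows "is_nat_tensor K (comod_cat_fd K D) forget W (\<lambda>X. \<alpha> (fob (Gamma K H C p) X))"
  unfolding is_nat_tensor_def
proof (intro conjI ballI)
  fix X :: "('k, 'm, 'c) comod" assume X: "X \<in> Ob (comod_cat_fd K D)"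
  note GX = Gamma_fd_ob[OF X]
  show "\<alpha> (fob (Gamma K H C p) X) \<in> lin K (fob forget X) (tens K (fob forget X) W)"
    using nat GX unfolding is_nat_tensor_def by (fastforce simp: forget_def Gamma_fst)
  fix Y :: "('k, 'm, 'c) comod" and f x assume Y: "Y \<in> Ob (comod_cat_fd K D)" and f: "f \<in> Hom (comod_cat_fd K D) X Y"
    and x: "x \<in> carrier (fob forget X)"
  note GY = Gamma_fd_ob[OF Y]
  have "f \<in> Hom (par_comod_cat_fd K H) (fob (Gamma K H C p) X) (fob (Gamma K H C p) Y)"
    using f by (simp add: Gamma_fd_hom[OF X Y])
  moreover have "x \<in> carrier (fob forget (fob (Gamma K H C p) X))" using x by (simp add: forget_def Gamma_fst)
  ultimately have "\<alpha> (fob (Gamma K H C p) Y) (farr forget (fob (Gamma K H C p) X) (fob (Gamma K H C p) Y) f x) =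
      tmap K (fob forget (fob (Gamma K H C p) X)) W (fob forget (fob (Gamma K H C p) Y)) W
       (farr forget (fob (Gamma K H C p) X) (fob (Gamma K H C p) Y) f) (\<lambda>w. w) (\<alpha> (fob (Gamma K H C p) X) x)"
    using nat GX GY unfolding is_nat_tensor_def by blast
  then show "\<alpha> (fob (Gamma K H C p) Y) (farr forget X Y f x) =
      tmap K (fob forget X) W (fob forget Y) W (farr forget X Y f) (\<lambda>w. w) (\<alpha> (fob (Gamma K H C p) X) x)"
    by (simp add: forget_def Gamma_fst)
qed

text \<open>On finite-dimensional objects \<open>Gamma\<close> is an isomorphism compatible with the
  forgetful functors, so the universal property of \<open>D\<close> for its own finite-dimensional
  comodules carries over.\<close>

lemma tannaka_hat:
  "is_tannaka_coalgebra TYPE('w) K (par_comod_cat_fd K H :: (('k, 'u, 'h) comod, 'u \<Rightarrow> 'u) cat) forget D hat"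
  unfolding is_tannaka_coalgebra_def
proof (intro conjI allI impI ballI)
  show "is_functor (par_comod_cat_fd K H :: (('k, 'u, 'h) comod, 'u \<Rightarrow> 'u) cat) (vect_cat K) forget"
    by (rule forget_functor)
  show "is_coalgebra K D" by (rule D_coalgebra)
  have co: "is_comodule K D (fst X, hat X)" if "X \<in> Ob (par_comod_cat_fd K H)" for X :: "('k, 'u, 'h) comod"
    using hat_fd(1)[OF that] by (simp add: comod_cat_fd_def full_subcat_def comod_cat_def)
  then show "is_comodule K D (fob forget X, hat X)" if "X \<in> Ob (par_comod_cat_fd K H)" for X :: "('k, 'u, 'h) comod"
    using that by (simp add: forget_def)
  show "is_nat_tensor K (par_comod_cat_fd K H :: (('k, 'u, 'h) comod, 'u \<Rightarrow> 'u) cat) forget D hat"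
    unfolding is_nat_tensor_def
  proof (intro conjI ballI)
    fix X :: "('k, 'u, 'h) comod" assume X: "X \<in> Ob (par_comod_cat_fd K H)"
    show "hat X \<in> lin K (fob forget X) (tens K (fob forget X) D)"
      using co[OF X] by (simp add: is_comodule_def forget_def)
    fix Y :: "('k, 'u, 'h) comod" and f x assume Y: "Y \<in> Ob (par_comod_cat_fd K H)"
      and f: "f \<in> Hom (par_comod_cat_fd K H) X Y" and x: "x \<in> carrier (fob forget X)"
    have "f \<in> comodule_hom K D (fst X, hat X) (fst Y, hat Y)"
      using f Gamma_fd_hom[OF hat_fd(1)[OF X] hat_fd(1)[OF Y]] hat_fd(2)[OF X] hat_fd(2)[OF Y]
      by (simp add: comod_cat_fd_simps)
    then show "hat Y (farr forget X Y f x) =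
        tmap K (fob forget X) D (fob forget Y) D (farr forget X Y f) (\<lambda>w. w) (hat X x)"
      using x by (simp add: comodule_hom_iff forget_def)
  qed
next
  fix W :: "('k, 'w) module" and \<alpha> :: "('k, 'u, 'h) comod \<Rightarrow> 'u \<Rightarrow> ('u, 'w) tensor"
  assume W: "module K W" and nat: "is_nat_tensor K (par_comod_cat_fd K H) forget W \<alpha>"
  \<comment> \<open>The two ranges of quantification are exchanged by \<open>hat_fd\<close> and
    \<open>hat_Gamma\<close>, so the condition on \<open>g\<close> is the same for both
    categories.\<close>
  have eq: "(\<forall>X\<in>Ob (comod_cat_fd K D). \<forall>x\<in>carrier (fst X).
        \<alpha> (fob (Gamma K H C p) X) x = tmap K (fst X) D (fst X) W (\<lambda>x. x) g (snd X x)) \<longleftrightarrow>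
      (\<forall>X\<in>Ob (par_comod_cat_fd K H). \<forall>x\<in>carrier (fob forget X).
        \<alpha> X x = tmap K (fob forget X) D (fob forget X) W (\<lambda>x. x) g (hat X x))" (is "?L \<longleftrightarrow> ?R") for g
  proof (intro iffI ballI)
    fix X :: "('k, 'u, 'h) comod" and x
    assume l: ?L and X: "X \<in> Ob (par_comod_cat_fd K H)" and x: "x \<in> carrier (fob forget X)"
    then show "\<alpha> X x = tmap K (fob forget X) D (fob forget X) W (\<lambda>x. x) g (hat X x)"
      using l[rule_format, OF hat_fd(1)[OF X], of x] hat_fd(2)[OF X] by (simp add: forget_def)
  next
    fix X :: "('k, 'u, 'c) comod" and x
    assume r: ?R and X: "X \<in> Ob (comod_cat_fd K D)" and x: "x \<in> carrier (fst X)"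
    then show "\<alpha> (fob (Gamma K H C p) X) x = tmap K (fst X) D (fst X) W (\<lambda>x. x) g (snd X x)"
      using r[rule_format, OF Gamma_fd_ob[OF X], of x] hat_Gamma[OF X] by (simp add: forget_def Gamma_fst)
  qed
  show "\<exists>!g. g \<in> lin K D W \<and> (\<forall>X\<in>Ob (par_comod_cat_fd K H). \<forall>x\<in>carrier (fob forget X).
      \<alpha> X x = tmap K (fob forget X) D (fob forget X) W (\<lambda>x. x) g (hat X x))"
    using tannaka_universal[OF univ D_coalgebra W nat_tensor_Gamma[OF nat]] unfolding eq .
qed

end

theorem theorem5p2:
  fixes K :: "('k, 'z) ring_scheme"
    and H :: "('k, 'h, 'x) hopf_scheme"
    and C :: "('k, 'c) coalgebra"
    and p :: "'c \<Rightarrow> 'h"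
    and \<iota> :: "'k list \<Rightarrow> 'u"
  assumes "field K"
    and "is_hopf_algebra K H"
    and "is_cofree_coalgebra TYPE('u) K H C p"
    and universe: "inj_on \<iota> (lists (carrier K))"
  shows "(\<forall>(M :: ('k, 'u) module) \<rho>'. is_comodule K (Hpar K H C p) (M, \<rho>') \<longrightarrow>
            is_partial_comodule K H (fob (Gamma K H C p) (M, \<rho>'))) \<and>
         is_functor (comod_cat K (Hpar K H C p) :: (('k, 'u, 'c) comod, 'u \<Rightarrow> 'u) cat)
           (par_comod_cat K H) (Gamma K H C p) \<and>
         is_fully_faithful (comod_cat K (Hpar K H C p) :: (('k, 'u, 'c) comod, 'u \<Rightarrow> 'u) cat)
           (par_comod_cat K H) (Gamma K H C p) \<and>
         is_cat_iso (comod_cat_f K (Hpar K H C p) :: (('k, 'u, 'c) comod, 'u \<Rightarrow> 'u) cat)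
           (par_comod_cat_f K H) (Gamma K H C p) \<and>
         is_cat_iso (comod_cat_fd K (Hpar K H C p) :: (('k, 'u, 'c) comod, 'u \<Rightarrow> 'u) cat)
           (par_comod_cat_fd K H) (Gamma K H C p) \<and>
         (\<exists>\<delta> :: ('k, 'u, 'h) comod \<Rightarrow> 'u \<Rightarrow> ('u, 'c) tensor.
            (\<forall>M \<rho>. (M, \<rho>) \<in> Ob (par_comod_cat_fd K H) \<longrightarrow>
               (M, \<delta> (M, \<rho>)) \<in> Ob (comod_cat_fd K (Hpar K H C p)) \<and>
               fob (Gamma K H C p) (M, \<delta> (M, \<rho>)) = (M, \<rho>)) \<and>
            is_tannaka_coalgebra TYPE('w) K (par_comod_cat_fd K H) forget (Hpar K H C p) \<delta>)"
proof -
  interpret hopf_cofree K H C p \<iota>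
    using assms by (simp add: hopf_cofree_def hopf_cofree_axioms_def base_field_def)
  show ?thesis
    unfolding D_def[symmetric]
  proof (intro conjI allI impI exI[of _ hat])
    show "is_partial_comodule K H (fob (Gamma K H C p) (M, \<rho>'))" if "is_comodule K D (M, \<rho>')"
      for M :: "('k, 'u) module" and \<rho>'
      by (rule Gamma_partial[OF that])
    show "is_functor (comod_cat K D :: (('k, 'u, 'c) comod, 'u \<Rightarrow> 'u) cat) (par_comod_cat K H) (Gamma K H C p)"
      using Gamma_functor[of "\<lambda>_. True" "\<lambda>_. True"] by (simp add: full_subcat_True)
    show "is_fully_faithful (comod_cat K D :: (('k, 'u, 'c) comod, 'u \<Rightarrow> 'u) cat) (par_comod_cat K H) (Gamma K H C p)"
      by (rule Gamma_fully_faithful)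
    show "is_cat_iso (comod_cat_f K D :: (('k, 'u, 'c) comod, 'u \<Rightarrow> 'u) cat) (par_comod_cat_f K H) (Gamma K H C p)"
      by (rule Gamma_iso_f)
    show "is_cat_iso (comod_cat_fd K D :: (('k, 'u, 'c) comod, 'u \<Rightarrow> 'u) cat) (par_comod_cat_fd K H) (Gamma K H C p)"
      by (rule Gamma_iso_fd)
    show "(M, hat (M, \<rho>)) \<in> Ob (comod_cat_fd K D)" "fob (Gamma K H C p) (M, hat (M, \<rho>)) = (M, \<rho>)"
      if "(M, \<rho>) \<in> Ob (par_comod_cat_fd K H)" for M :: "('k, 'u) module" and \<rho>
      using hat_fd[OF that] by simp_all
    show "is_tannaka_coalgebra TYPE('w) K (par_comod_cat_fd K H :: (('k, 'u, 'h) comod, 'u \<Rightarrow> 'u) cat) forget D hat"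
      by (rule tannaka_hat)
  qed
qed

end
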